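(* Assume $SRP([\omega_2]^\omega)$ and the Tree Property at $\omega_2$. Whenever $\vec I$ is a tower of ideals which concentrates on the class $GIS_{\omega_1}$ of $\omega_1$-guessing, internally stationary sets, then $\vec I$ is not presaturated.
   Context: The base theory is ZFC. $[X]^\omega$ is the set of countable subsets of $X$; a club in $[X]^\omega$ is a $\subseteq$-cofinal subset closed under unions of countable increasing chains, and stationary means meeting every club. For $X \supseteq \omega_1$, a set $P\subset[X]^\omega$ is projective stationary iff for every stationary $T\subset\omega_1$, $\{Y\in P: Y\cap\omega_1\in T\}$ is stationary in $[X]^\omega$. $SRP([\omega_2]^\omega)$, the Strong Reflection Principle at $\omega_2$ (also written $SRP(\omega_2)$): for every projective stationary $P\subset[H_{\omega_2}]^\omega$ there is a continuous elementary chain $\langle N_\xi:\xi<\omega_1\rangle$ of countable elementary submodels of $H_{\omega_2}$ (i.e. $N_\xi\in N_{\xi+1}$, $N_\xi\subset N_{\xi+1}$, and $N_\xi=\bigcup_{\zeta<\xi}N_\zeta$ for limit $\xi$) with $N_\xi\in P$ for every $\xi<\omega_1$. Tree Property at $\omega_2$: every tree of height $\omega_2$ all of whose levels have size $<\omega_2$ has a cofinal branch. $GIS_{\omega_1}$. $ZF^-$ is ZF without Power Set. A transitive $ZF^-$ model $H$ with $\omega_1\in H$ has the $\omega_1$-approximation property iff for every $\eta\in H$ and $A\subseteq\eta$: if $z\cap A\in H$ for every $z\in H$ which is countable in $H$, then $A\in H$. A set $M$ with $\omega_1\subset M\prec H_\theta$ for some regular uncountable $\theta$ is $\omega_1$-guessing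 iff its transitive collapse has the $\omega_1$-approximation property. $G_{\omega_1}$ is the class of $\omega_1$-guessing $M$ with $|M|=\omega_1\subset M$. $IS_{\omega_1}$ (internally stationary sets) is the class of $M$ with $(M,\in)\models ZF^-$, $\omega_1\subseteq M$, $|M|=\omega_1$, such that $M\cap[M]^\omega$ is stationary in $[M]^\omega$. $GIS_{\omega_1}=G_{\omega_1}\cap IS_{\omega_1}$. Ideals. For a set $Z$, an ideal $I\subset\wp(Z)$ is always proper, countably complete, fine (for every $b\in\bigcup Z$, $\{M\in Z: b\notin M\}\in I$) and normal (if $S\notin I$ and $g$ is a function on $S$ with $g(M)\in M$ for all $M\in S$, then $g$ is constant on some $S'\subseteq S$ with $S'\notin I$). $I^+=\wp(Z)\setminus I$. $I$ concentrates on a class $\Gamma$ iff some $A\subseteq\Gamma$ belongs to the dual filter of $I$. If $I\subset\wp(Z)$, $I'\subset\wp(Z')$ and $\bigcup Z\subseteq\bigcup Z'$, then $I$ is the canonical projection of $I'$ to $Z$ iff $I=\{A\subseteq Z:\{M'\in Z': M'\cap\bigcup Z\in A\}\in I'\}$. Towers. A tower of ideals of height $\delta$ is a sequence $\vec I=\langle I_\lambda : \lambda\in U\rangle$, where the index set $U$ is an unbounded subset of $\delta$, each $I_\lambda$ is an ideal on $Z_\lambda=\wp_\kappa(H_\lambda)$ (the set of subsets of $H_\lambda$ of size $<\kappa$) for a fixed regular $\kappa\le\lambda$, all $I_\lambda$ have the same completeness, and for $\lambda\le\lambda'$ in $U$, $I_\lambda$ is the canonical projection of $I_{\lambda'}$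 to $Z_\lambda$. $\vec I$ concentrates on $\Gamma$ iff every $I_\lambda$ does. $\mathbb P_{\vec I}$ is the poset of pairs $(\lambda,S)$ with $\lambda\in U$ and $S\in I_\lambda^+$, ordered by $(\lambda',S')\le(\lambda,S)$ iff $\lambda'\ge\lambda$ and $S'\subseteq\{M'\in Z_{\lambda'}: M'\cap H_\lambda\in S\}$. A tower $\vec I$ of height $\delta$ is presaturated iff $\delta$ always remains a regular cardinal in generic extensions of $V$ by $\mathbb P_{\vec I}$. *)

theory Defs
  imports Main
begin

text \<open>
  The base theory is first-order ZFC, so the mathematics takes place inside an arbitrary structure
  (\<open>'v\<close>, \<open>mem\<close>) satisfying the ZFC axioms (locale \<open>zfc\<close> below). Replacement and separation are
  required only for first-order formulas, given by the datatype \<open>fm\<close>.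

  Consequently every set-theoretic notion is relative to the structure: a function, a sequence, a
  family of sets etc. is an element of \<open>'v\<close>, and all definitions quantify over elements of \<open>'v\<close> only.
  The HOL sets that occur are definable classes.
\<close>

datatype fm = Mem nat nat | Eql nat nat | Neg fm | Conj fm fm | All nat fm

definition Disj :: "fm \<Rightarrow> fm \<Rightarrow> fm" where
  "Disj p q = Neg (Conj (Neg p) (Neg q))"

definition Imp :: "fm \<Rightarrow> fm \<Rightarrow> fm" where
  "Imp p q = Neg (Conj p (Neg q))"

definition Iff :: "fm \<Rightarrow> fm \<Rightarrow> fm" where
  "Iff p q = Conj (Imp p q) (Imp q p)"

definition Ex :: "nat \<Rightarrow> fm \<Rightarrow> fm" where
  "Ex n p = Neg (All n (Neg p))"

definition BAll :: "nat \<Rightarrow> nat \<Rightarrow> fm \<Rightarrow> fm" where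
  "BAll n a p = All n (Imp (Mem n a) p)"

definition BEx :: "nat \<Rightarrow> nat \<Rightarrow> fm \<Rightarrow> fm" where
  "BEx n a p = Ex n (Conj (Mem n a) p)"

text \<open>
  Formulas use named variables, and each formula builder below binds fixed variables. Variables
  from 20 on are bound by the first four, variables 10 to 13 by \<open>Func_fm\<close>, so that no capture
  occurs in \<open>regular_fm\<close>; see lemma \<open>sat_regular\<close>.
\<close>

definition Sub_fm :: "nat \<Rightarrow> nat \<Rightarrow> fm" where
  "Sub_fm a b = BAll 20 a (Mem 20 b)"

definition UPair_fm :: "nat \<Rightarrow> nat \<Rightarrow> nat \<Rightarrow> fm" where
  "UPair_fm w x y = All 20 (Iff (Mem 20 w) (Disj (Eql 20 x) (Eql 20 y)))"

definition Pair_fm :: "nat \<Rightarrow> nat \<Rightarrow> nat \<Rightarrow> fm" where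
  "Pair_fm z x y = Ex 21 (Ex 22 (Conj (UPair_fm 21 x x) (Conj (UPair_fm 22 x y) (UPair_fm z 21 22))))"

definition App_fm :: "nat \<Rightarrow> nat \<Rightarrow> nat \<Rightarrow> fm" where
  "App_fm f x y = BEx 23 f (Pair_fm 23 x y)"

definition Func_fm :: "nat \<Rightarrow> nat \<Rightarrow> nat \<Rightarrow> fm" where
  "Func_fm f a b =
     Conj (BAll 10 f (BEx 11 a (BEx 12 b (Pair_fm 10 11 12))))
          (BAll 11 a (Ex 12 (Conj (App_fm f 11 12) (All 13 (Imp (App_fm f 11 13) (Eql 13 12))))))"

text \<open>Variable 0 is an infinite regular cardinal: a limit ordinal (other than 0) into which no
  smaller ordinal is mapped cofinally.\<close>

definition regular_fm :: fm where
  "regular_fm =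
     Conj (Conj (BAll 1 0 (Sub_fm 1 0)) (BAll 1 0 (BAll 2 1 (Sub_fm 2 1))))
    (Conj (Conj (Ex 1 (Mem 1 0)) (BAll 1 0 (BEx 2 0 (Mem 1 2))))
          (Neg (BEx 1 0 (Ex 2 (Conj (Func_fm 2 1 0)
             (BAll 3 0 (BEx 4 1 (BEx 5 0 (Conj (App_fm 2 4 5) (Sub_fm 3 5))))))))))"


section \<open>Set-theoretic notions in a structure with a membership relation\<close>

locale membership =
  fixes mem :: "'v \<Rightarrow> 'v \<Rightarrow> bool"
begin

definition elts :: "'v \<Rightarrow> 'v set" where
  "elts a = {x. mem x a}"

text \<open>The element of the structure with a given extension (used only for extensions that are
  first-order definable and are sets by the ZFC axioms).\<close>

definition vset :: "'v set \<Rightarrow> 'v" where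
  "vset A = (THE a. elts a = A)"

primrec sat :: "fm \<Rightarrow> (nat \<Rightarrow> 'v) \<Rightarrow> bool" where
  "sat (Mem i j) e \<longleftrightarrow> e i \<in> elts (e j)"
| "sat (Eql i j) e \<longleftrightarrow> e i = e j"
| "sat (Neg p) e \<longleftrightarrow> \<not> sat p e"
| "sat (Conj p q) e \<longleftrightarrow> sat p e \<and> sat q e"
| "sat (All n p) e \<longleftrightarrow> (\<forall>x. sat p (e(n := x)))"


subsection \<open>Single axioms of ZFC, relativized to a class\<close>

definition extensionality_ax :: "'v set \<Rightarrow> bool" where
  "extensionality_ax D \<longleftrightarrow> (\<forall>x\<in>D. \<forall>y\<in>D. elts x \<inter> D = elts y \<inter> D \<longrightarrow> x = y)"

definition foundation_ax :: "'v set \<Rightarrow> bool" where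
  "foundation_ax D \<longleftrightarrow>
     (\<forall>x\<in>D. elts x \<inter> D \<noteq> {} \<longrightarrow> (\<exists>y\<in>elts x \<inter> D. elts y \<inter> elts x \<inter> D = {}))"

definition pairing_ax :: "'v set \<Rightarrow> bool" where
  "pairing_ax D \<longleftrightarrow> (\<forall>x\<in>D. \<forall>y\<in>D. \<exists>z\<in>D. elts z \<inter> D = {x, y})"

definition union_ax :: "'v set \<Rightarrow> bool" where
  "union_ax D \<longleftrightarrow> (\<forall>x\<in>D. \<exists>u\<in>D. elts u \<inter> D = (\<Union>y\<in>elts x \<inter> D. elts y \<inter> D))"

definition infinity_ax :: "'v set \<Rightarrow> bool" where
  "infinity_ax D \<longleftrightarrow>
     (\<exists>w\<in>D. (\<exists>z\<in>elts w \<inter> D. elts z \<inter> D = {}) \<and>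
        (\<forall>x\<in>elts w \<inter> D. \<exists>y\<in>elts w \<inter> D. elts y \<inter> D = insert x (elts x \<inter> D)))"

definition power_set_ax :: "'v set \<Rightarrow> bool" where
  "power_set_ax D \<longleftrightarrow>
     (\<forall>x\<in>D. \<exists>p\<in>D. elts p \<inter> D = {y\<in>D. elts y \<inter> D \<subseteq> elts x})"


subsection \<open>Functions, ordinals, cardinals\<close>

definition pair :: "'v \<Rightarrow> 'v \<Rightarrow> 'v" where
  "pair x y = vset {vset {x}, vset {x, y}}"

definition pow :: "'v \<Rightarrow> 'v" where
  "pow a = vset {b. elts b \<subseteq> elts a}"

definition union :: "'v \<Rightarrow> 'v" where
  "union a = vset (\<Union>x\<in>elts a. elts x)"

definition zero :: 'v where
  "zero = vset {}"

definition succ :: "'v \<Rightarrow> 'v" where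
  "succ a = vset (insert a (elts a))"

definition func :: "'v \<Rightarrow> 'v \<Rightarrow> 'v \<Rightarrow> bool" where
  "func f a b \<longleftrightarrow> (\<forall>z\<in>elts f. \<exists>x\<in>elts a. \<exists>y\<in>elts b. z = pair x y) \<and>
     (\<forall>x\<in>elts a. \<exists>!y. pair x y \<in> elts f)"

definition app :: "'v \<Rightarrow> 'v \<Rightarrow> 'v" where
  "app f x = (THE y. pair x y \<in> elts f)"

definition function_on :: "'v \<Rightarrow> 'v \<Rightarrow> bool" where
  "function_on f a \<longleftrightarrow> (\<exists>b. func f a b)"

definition injection :: "'v \<Rightarrow> 'v \<Rightarrow> 'v \<Rightarrow> bool" where
  "injection f a b \<longleftrightarrow> func f a b \<and> inj_on (app f) (elts a)"

definition bijection :: "'v \<Rightarrow> 'v \<Rightarrow> 'v \<Rightarrow> bool" where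
  "bijection f a b \<longleftrightarrow> func f a b \<and> bij_betw (app f) (elts a) (elts b)"

definition lepoll :: "'v \<Rightarrow> 'v \<Rightarrow> bool" where
  "lepoll a b \<longleftrightarrow> (\<exists>f. injection f a b)"

definition eqpoll :: "'v \<Rightarrow> 'v \<Rightarrow> bool" where
  "eqpoll a b \<longleftrightarrow> (\<exists>f. bijection f a b)"

definition transitive :: "'v \<Rightarrow> bool" where
  "transitive a \<longleftrightarrow> (\<forall>x\<in>elts a. elts x \<subseteq> elts a)"

definition Ord :: "'v \<Rightarrow> bool" where
  "Ord a \<longleftrightarrow> transitive a \<and> (\<forall>x\<in>elts a. transitive x)"

definition Limit :: "'v \<Rightarrow> bool" where
  "Limit a \<longleftrightarrow> Ord a \<and> elts a \<noteq> {} \<and> (\<forall>x\<in>elts a. \<exists>y\<in>elts a. x \<in> elts y)"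

definition Card :: "'v \<Rightarrow> bool" where
  "Card a \<longleftrightarrow> Ord a \<and> (\<forall>b\<in>elts a. \<not> lepoll a b)"

definition regular :: "'v \<Rightarrow> bool" where
  "regular k \<longleftrightarrow> Limit k \<and>
     \<not> (\<exists>a\<in>elts k. \<exists>f. func f a k \<and> (\<forall>b\<in>elts k. \<exists>c\<in>elts a. elts b \<subseteq> elts (app f c)))"

definition omega :: 'v where
  "omega = (THE w. Limit w \<and> (\<forall>v. Limit v \<longrightarrow> elts w \<subseteq> elts v))"

definition card_succ :: "'v \<Rightarrow> 'v" where
  "card_succ k = (THE a. Ord a \<and> \<not> lepoll a k \<and> (\<forall>b\<in>elts a. lepoll b k))"

definition omega1 :: 'v where
  "omega1 = card_succ omega"

definition omega2 :: 'v where
  "omega2 = card_succ omega1"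

definition ctbl :: "'v \<Rightarrow> bool" where
  "ctbl a \<longleftrightarrow> lepoll a omega"

text \<open>\<open>card_less a l\<close>: the cardinality of \<open>a\<close> is smaller than the ordinal \<open>l\<close>,
  which need not be a cardinal.\<close>

definition card_less :: "'v \<Rightarrow> 'v \<Rightarrow> bool" where
  "card_less a l \<longleftrightarrow> (\<exists>b\<in>elts l. lepoll a b)"

definition trans_cl :: "'v \<Rightarrow> 'v" where
  "trans_cl x = (THE t. transitive t \<and> elts x \<subseteq> elts t \<and>
     (\<forall>s. transitive s \<and> elts x \<subseteq> elts s \<longrightarrow> elts t \<subseteq> elts s))"

definition H :: "'v \<Rightarrow> 'v" where
  "H l = vset {x. card_less (trans_cl x) l}"


subsection \<open>Satisfaction in set structures (A, membership)\<close>

text \<open>Since the structure may have nonstandard natural numbers, elementarity inside it refers to its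
  own formulas, which are coded here as elements; assignments are functions on \<open>omega\<close>.\<close>

definition mem_code :: "'v \<Rightarrow> 'v \<Rightarrow> 'v" where
  "mem_code i j = pair zero (pair i j)"

definition eql_code :: "'v \<Rightarrow> 'v \<Rightarrow> 'v" where
  "eql_code i j = pair (succ zero) (pair i j)"

definition neg_code :: "'v \<Rightarrow> 'v" where
  "neg_code p = pair (succ (succ zero)) p"

definition conj_code :: "'v \<Rightarrow> 'v \<Rightarrow> 'v" where
  "conj_code p q = pair (succ (succ (succ zero))) (pair p q)"

definition all_code :: "'v \<Rightarrow> 'v \<Rightarrow> 'v" where
  "all_code i p = pair (succ (succ (succ (succ zero)))) (pair i p)"

definition formula_closed :: "'v \<Rightarrow> bool" where
  "formula_closed F \<longleftrightarrow>
     (\<forall>i\<in>elts omega. \<forall>j\<in>elts omega. mem_code i j \<in> elts F \<and> eql_code i j \<in> elts F) \<and>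
     (\<forall>p\<in>elts F. neg_code p \<in> elts F) \<and>
     (\<forall>p\<in>elts F. \<forall>q\<in>elts F. conj_code p q \<in> elts F) \<and>
     (\<forall>i\<in>elts omega. \<forall>p\<in>elts F. all_code i p \<in> elts F)"

definition formulas :: 'v where
  "formulas = (THE F. formula_closed F \<and> (\<forall>G. formula_closed G \<longrightarrow> elts F \<subseteq> elts G))"

definition assignments :: "'v \<Rightarrow> 'v" where
  "assignments A = vset {s. func s omega A}"

definition upd :: "'v \<Rightarrow> 'v \<Rightarrow> 'v \<Rightarrow> 'v" where
  "upd s i x = vset (insert (pair i x) {z \<in> elts s. \<forall>y. z \<noteq> pair i y})"

definition sat_function :: "'v \<Rightarrow> 'v \<Rightarrow> bool" where
  "sat_function A S \<longleftrightarrow> func S formulas (pow (assignments A)) \<and>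
     (\<forall>i\<in>elts omega. \<forall>j\<in>elts omega.
        elts (app S (mem_code i j)) = {s \<in> elts (assignments A). app s i \<in> elts (app s j)} \<and>
        elts (app S (eql_code i j)) = {s \<in> elts (assignments A). app s i = app s j}) \<and>
     (\<forall>p\<in>elts formulas. elts (app S (neg_code p)) = elts (assignments A) - elts (app S p)) \<and>
     (\<forall>p\<in>elts formulas. \<forall>q\<in>elts formulas.
        elts (app S (conj_code p q)) = elts (app S p) \<inter> elts (app S q)) \<and>
     (\<forall>i\<in>elts omega. \<forall>p\<in>elts formulas.
        elts (app S (all_code i p)) =
          {s \<in> elts (assignments A). \<forall>x\<in>elts A. upd s i x \<in> elts (app S p)})"

definition models :: "'v \<Rightarrow> 'v \<Rightarrow> 'v \<Rightarrow> bool" where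
  "models A p s \<longleftrightarrow> (\<exists>S. sat_function A S \<and> s \<in> elts (app S p))"

definition elementary :: "'v \<Rightarrow> 'v \<Rightarrow> bool" where
  "elementary N M \<longleftrightarrow> elts N \<noteq> {} \<and> elts N \<subseteq> elts M \<and>
     (\<forall>p\<in>elts formulas. \<forall>s\<in>elts (assignments N). models N p s \<longleftrightarrow> models M p s)"

definition zf_minus :: "'v \<Rightarrow> bool" where
  "zf_minus A \<longleftrightarrow>
     extensionality_ax (elts A) \<and> foundation_ax (elts A) \<and> pairing_ax (elts A) \<and>
     union_ax (elts A) \<and> infinity_ax (elts A) \<and>
     (\<forall>p\<in>elts formulas. \<forall>s\<in>elts (assignments A). \<forall>a\<in>elts A. \<exists>b\<in>elts A. \<forall>x\<in>elts A.
        x \<in> elts b \<longleftrightarrow> x \<in> elts a \<and> models A p (upd s zero x)) \<and>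
     (\<forall>p\<in>elts formulas. \<forall>s\<in>elts (assignments A). \<forall>a\<in>elts A.
        (\<forall>x\<in>elts a \<inter> elts A. \<exists>!y. y \<in> elts A \<and>
            models A p (upd (upd s zero x) (succ zero) y)) \<longrightarrow>
        (\<exists>b\<in>elts A. \<forall>y\<in>elts A. y \<in> elts b \<longleftrightarrow>
            (\<exists>x\<in>elts a \<inter> elts A. models A p (upd (upd s zero x) (succ zero) y))))"


subsection \<open>Stationary sets, the Strong Reflection Principle, the Tree Property\<close>

definition ctbl_subsets :: "'v \<Rightarrow> 'v" where
  "ctbl_subsets X = vset {Y. elts Y \<subseteq> elts X \<and> ctbl Y}"

definition club :: "'v \<Rightarrow> 'v \<Rightarrow> bool" where
  "club C X \<longleftrightarrow> elts C \<subseteq> elts (ctbl_subsets X) \<and>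
     (\<forall>Y\<in>elts (ctbl_subsets X). \<exists>Z\<in>elts C. elts Y \<subseteq> elts Z) \<and>
     (\<forall>D. elts D \<subseteq> elts C \<and> elts D \<noteq> {} \<and> ctbl D \<and>
        (\<forall>Y\<in>elts D. \<forall>Z\<in>elts D. elts Y \<subseteq> elts Z \<or> elts Z \<subseteq> elts Y) \<longrightarrow> union D \<in> elts C)"

definition stationary :: "'v \<Rightarrow> 'v \<Rightarrow> bool" where
  "stationary S X \<longleftrightarrow> elts S \<subseteq> elts (ctbl_subsets X) \<and>
     (\<forall>C. club C X \<longrightarrow> elts S \<inter> elts C \<noteq> {})"

definition club_omega1 :: "'v \<Rightarrow> bool" where
  "club_omega1 C \<longleftrightarrow> elts C \<subseteq> elts omega1 \<and>
     (\<forall>a\<in>elts omega1. \<exists>b\<in>elts C. a \<in> elts b) \<and>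
     (\<forall>a\<in>elts omega1. Limit a \<and> (\<forall>b\<in>elts a. \<exists>c\<in>elts C \<inter> elts a. b \<in> elts c) \<longrightarrow> a \<in> elts C)"

definition stationary_omega1 :: "'v \<Rightarrow> bool" where
  "stationary_omega1 T \<longleftrightarrow> elts T \<subseteq> elts omega1 \<and>
     (\<forall>C. club_omega1 C \<longrightarrow> elts T \<inter> elts C \<noteq> {})"

definition projective_stationary :: "'v \<Rightarrow> 'v \<Rightarrow> bool" where
  "projective_stationary P X \<longleftrightarrow>
     elts omega1 \<subseteq> elts X \<and> elts P \<subseteq> elts (ctbl_subsets X) \<and>
     (\<forall>T. stationary_omega1 T \<longrightarrow>
        stationary (vset {Y \<in> elts P. vset (elts Y \<inter> elts omega1) \<in> elts T}) X)"

definition SRP_omega2 :: bool where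
  "SRP_omega2 \<longleftrightarrow> (\<forall>P. projective_stationary P (H omega2) \<longrightarrow>
     (\<exists>N. func N omega1 P \<and>
        (\<forall>a\<in>elts omega1. ctbl (app N a) \<and> elementary (app N a) (H omega2) \<and>
           app N a \<in> elts (app N (succ a)) \<and> elts (app N a) \<subseteq> elts (app N (succ a))) \<and>
        (\<forall>a\<in>elts omega1. Limit a \<longrightarrow> elts (app N a) = (\<Union>b\<in>elts a. elts (app N b)))))"

definition predecessors :: "'v \<Rightarrow> 'v \<Rightarrow> 'v \<Rightarrow> 'v" where
  "predecessors T r t = vset {s \<in> elts T. pair s t \<in> elts r}"

text \<open>\<open>height_eq T r t a\<close>: the predecessors of \<open>t\<close> are well-ordered by \<open>r\<close> in order type \<open>a\<close>.\<close>

definition height_eq :: "'v \<Rightarrow> 'v \<Rightarrow> 'v \<Rightarrow> 'v \<Rightarrow> bool" where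
  "height_eq T r t a \<longleftrightarrow> Ord a \<and> (\<exists>f. bijection f (predecessors T r t) a \<and>
     (\<forall>x\<in>elts (predecessors T r t). \<forall>y\<in>elts (predecessors T r t).
        pair x y \<in> elts r \<longleftrightarrow> app f x \<in> elts (app f y)))"

definition level :: "'v \<Rightarrow> 'v \<Rightarrow> 'v \<Rightarrow> 'v" where
  "level T r a = vset {t \<in> elts T. height_eq T r t a}"

definition tree :: "'v \<Rightarrow> 'v \<Rightarrow> bool" where
  "tree T r \<longleftrightarrow>
     (\<forall>x\<in>elts T. pair x x \<notin> elts r) \<and>
     (\<forall>x\<in>elts T. \<forall>y\<in>elts T. \<forall>z\<in>elts T.
        pair x y \<in> elts r \<and> pair y z \<in> elts r \<longrightarrow> pair x z \<in> elts r) \<and>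
     (\<forall>t\<in>elts T. \<exists>a. height_eq T r t a)"

definition tree_of_height :: "'v \<Rightarrow> 'v \<Rightarrow> 'v \<Rightarrow> bool" where
  "tree_of_height T r k \<longleftrightarrow> tree T r \<and> Ord k \<and>
     (\<forall>a\<in>elts k. elts (level T r a) \<noteq> {}) \<and> elts (level T r k) = {}"

definition cofinal_branch :: "'v \<Rightarrow> 'v \<Rightarrow> 'v \<Rightarrow> 'v \<Rightarrow> bool" where
  "cofinal_branch T r k B \<longleftrightarrow> elts B \<subseteq> elts T \<and>
     (\<forall>x\<in>elts B. \<forall>y\<in>elts B. x = y \<or> pair x y \<in> elts r \<or> pair y x \<in> elts r) \<and>
     (\<forall>a\<in>elts k. elts B \<inter> elts (level T r a) \<noteq> {})"

definition tree_property :: "'v \<Rightarrow> bool" where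
  "tree_property k \<longleftrightarrow> (\<forall>T r. tree_of_height T r k \<and>
     (\<forall>a\<in>elts k. card_less (level T r a) k) \<longrightarrow> (\<exists>B. cofinal_branch T r k B))"


subsection \<open>Guessing and internally stationary sets\<close>

definition omega1_approximation :: "'v \<Rightarrow> bool" where
  "omega1_approximation M \<longleftrightarrow> transitive M \<and> zf_minus M \<and> omega1 \<in> elts M \<and>
     (\<forall>\<eta>\<in>elts M. \<forall>A. elts A \<subseteq> elts \<eta> \<and>
        (\<forall>z\<in>elts M. (\<exists>f\<in>elts M. injection f z omega) \<longrightarrow> vset (elts z \<inter> elts A) \<in> elts M) \<longrightarrow>
        A \<in> elts M)"

definition is_collapse :: "'v \<Rightarrow> 'v \<Rightarrow> bool" where
  "is_collapse M N \<longleftrightarrow> transitive N \<and> (\<exists>\<pi>. bijection \<pi> M N \<and>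
     (\<forall>x\<in>elts M. \<forall>y\<in>elts M. x \<in> elts y \<longleftrightarrow> app \<pi> x \<in> elts (app \<pi> y)))"

definition guessing :: "'v \<Rightarrow> bool" where
  "guessing M \<longleftrightarrow>
     elts omega1 \<subseteq> elts M \<and> (\<exists>\<theta>. regular \<theta> \<and> omega \<in> elts \<theta> \<and> elementary M (H \<theta>)) \<and>
     (\<exists>N. is_collapse M N \<and> omega1_approximation N)"

definition G_omega1 :: "'v \<Rightarrow> bool" where
  "G_omega1 M \<longleftrightarrow> guessing M \<and> eqpoll M omega1 \<and> elts omega1 \<subseteq> elts M"

definition IS_omega1 :: "'v \<Rightarrow> bool" where
  "IS_omega1 M \<longleftrightarrow> zf_minus M \<and> elts omega1 \<subseteq> elts M \<and> eqpoll M omega1 \<and>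
     stationary (vset (elts M \<inter> elts (ctbl_subsets M))) M"

definition GIS_omega1 :: "'v \<Rightarrow> bool" where
  "GIS_omega1 M \<longleftrightarrow> G_omega1 M \<and> IS_omega1 M"


subsection \<open>Ideals and towers\<close>

definition ideal :: "'v \<Rightarrow> 'v \<Rightarrow> bool" where
  "ideal Z I \<longleftrightarrow>
     elts I \<subseteq> elts (pow Z) \<and>
     (\<forall>A\<in>elts I. \<forall>B. elts B \<subseteq> elts A \<longrightarrow> B \<in> elts I) \<and>
     Z \<notin> elts I \<and>
     (\<forall>X. elts X \<subseteq> elts I \<and> ctbl X \<longrightarrow> union X \<in> elts I) \<and>
     (\<forall>b\<in>elts (union Z). vset {M \<in> elts Z. b \<notin> elts M} \<in> elts I) \<and>
     (\<forall>S g. elts S \<subseteq> elts Z \<and> S \<notin> elts I \<and> function_on g S \<and>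
        (\<forall>M\<in>elts S. app g M \<in> elts M) \<longrightarrow>
        (\<exists>S'. elts S' \<subseteq> elts S \<and> S' \<notin> elts I \<and> (\<exists>c. \<forall>M\<in>elts S'. app g M = c)))"

definition positive :: "'v \<Rightarrow> 'v \<Rightarrow> 'v set" where
  "positive Z I = elts (pow Z) - elts I"

definition concentrates :: "'v \<Rightarrow> 'v \<Rightarrow> ('v \<Rightarrow> bool) \<Rightarrow> bool" where
  "concentrates Z I \<Gamma> \<longleftrightarrow>
     (\<exists>A. elts A \<subseteq> elts Z \<and> vset (elts Z - elts A) \<in> elts I \<and> (\<forall>M\<in>elts A. \<Gamma> M))"

definition projection :: "'v \<Rightarrow> 'v \<Rightarrow> 'v \<Rightarrow> 'v \<Rightarrow> bool" where
  "projection Z I Z' I' \<longleftrightarrow> elts (union Z) \<subseteq> elts (union Z') \<and>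
     elts I = {A. elts A \<subseteq> elts Z \<and>
       vset {M' \<in> elts Z'. vset (elts M' \<inter> elts (union Z)) \<in> elts A} \<in> elts I'}"

text \<open>The completeness of an ideal: the least cardinal \<open>\<mu>\<close> such that the ideal is not closed under
  unions of \<open>\<mu>\<close> many sets.\<close>

definition completeness :: "'v \<Rightarrow> 'v \<Rightarrow> bool" where
  "completeness I \<mu> \<longleftrightarrow> Card \<mu> \<and>
     (\<forall>X. elts X \<subseteq> elts I \<and> card_less X \<mu> \<longrightarrow> union X \<in> elts I) \<and>
     (\<exists>X. elts X \<subseteq> elts I \<and> eqpoll X \<mu> \<and> union X \<notin> elts I)"

definition Zset :: "'v \<Rightarrow> 'v \<Rightarrow> 'v" where
  "Zset \<kappa> l = vset {M. elts M \<subseteq> elts (H l) \<and> card_less M \<kappa>}"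

definition tower :: "'v \<Rightarrow> 'v \<Rightarrow> 'v \<Rightarrow> 'v \<Rightarrow> bool" where
  "tower \<delta> \<kappa> U I \<longleftrightarrow>
     Ord \<delta> \<and> elts U \<subseteq> elts \<delta> \<and> (\<forall>a\<in>elts \<delta>. \<exists>l\<in>elts U. elts a \<subseteq> elts l) \<and>
     regular \<kappa> \<and> function_on I U \<and>
     (\<forall>l\<in>elts U. elts \<kappa> \<subseteq> elts l \<and> ideal (Zset \<kappa> l) (app I l)) \<and>
     (\<exists>\<mu>. \<forall>l\<in>elts U. completeness (app I l) \<mu>) \<and>
     (\<forall>l\<in>elts U. \<forall>l'\<in>elts U. elts l \<subseteq> elts l' \<longrightarrow>
        projection (Zset \<kappa> l) (app I l) (Zset \<kappa> l') (app I l'))"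

definition tower_concentrates :: "'v \<Rightarrow> 'v \<Rightarrow> 'v \<Rightarrow> ('v \<Rightarrow> bool) \<Rightarrow> bool" where
  "tower_concentrates \<kappa> U I \<Gamma> \<longleftrightarrow> (\<forall>l\<in>elts U. concentrates (Zset \<kappa> l) (app I l) \<Gamma>)"

definition tower_conditions :: "'v \<Rightarrow> 'v \<Rightarrow> 'v \<Rightarrow> 'v" where
  "tower_conditions \<kappa> U I =
     vset {pair l S | l S. l \<in> elts U \<and> S \<in> positive (Zset \<kappa> l) (app I l)}"

definition tower_order :: "'v \<Rightarrow> 'v \<Rightarrow> 'v \<Rightarrow> 'v" where
  "tower_order \<kappa> U I =
     vset {pair (pair l' S') (pair l S) | l' S' l S.
        pair l' S' \<in> elts (tower_conditions \<kappa> U I) \<and> pair l S \<in> elts (tower_conditions \<kappa> U I) \<and>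
        elts l \<subseteq> elts l' \<and>
        elts S' \<subseteq> {M' \<in> elts (Zset \<kappa> l'). vset (elts M' \<inter> elts (H l)) \<in> elts S}}"


subsection \<open>Forcing\<close>

text \<open>Truth in all generic extensions is expressed by the forcing relation. A set is a name iff it
  belongs to a set of names, each of which consists of pairs (name in that set, condition). The
  recursion defining the forcing relation for atomic formulas takes place inside the structure:
  \<open>forcing_table\<close> says that \<open>E\<close> and \<open>R\<close> are the sets of triples (p, \<open>\<sigma>\<close>, \<open>\<tau>\<close>) such that p forces
  \<open>\<sigma>\<close> and \<open>\<tau>\<close> to be equal, and \<open>\<sigma>\<close> to be an element of \<open>\<tau>\<close>, respectively.\<close>

definition name_closed :: "'v \<Rightarrow> 'v \<Rightarrow> bool" where
  "name_closed P N \<longleftrightarrow>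
     (\<forall>\<tau>\<in>elts N. \<forall>z\<in>elts \<tau>. \<exists>\<sigma>\<in>elts N. \<exists>p\<in>elts P. z = pair \<sigma> p)"

definition is_name :: "'v \<Rightarrow> 'v \<Rightarrow> bool" where
  "is_name P \<tau> \<longleftrightarrow> (\<exists>N. name_closed P N \<and> \<tau> \<in> elts N)"

definition dom :: "'v \<Rightarrow> 'v set" where
  "dom \<tau> = {\<sigma>. \<exists>p. pair \<sigma> p \<in> elts \<tau>}"

definition below :: "'v \<Rightarrow> 'v \<Rightarrow> 'v \<Rightarrow> 'v set" where
  "below P le p = {q \<in> elts P. pair q p \<in> elts le}"

definition triple :: "'v \<Rightarrow> 'v \<Rightarrow> 'v \<Rightarrow> 'v" where
  "triple x y z = pair x (pair y z)"

definition forcing_table :: "'v \<Rightarrow> 'v \<Rightarrow> 'v \<Rightarrow> 'v \<Rightarrow> 'v \<Rightarrow> bool" where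
  "forcing_table P le N E R \<longleftrightarrow> (\<forall>p\<in>elts P. \<forall>\<sigma>\<in>elts N. \<forall>\<tau>\<in>elts N.
     (triple p \<sigma> \<tau> \<in> elts E \<longleftrightarrow>
        (\<forall>\<rho>\<in>dom \<sigma> \<union> dom \<tau>. \<forall>q\<in>below P le p.
           triple q \<rho> \<sigma> \<in> elts R \<longleftrightarrow> triple q \<rho> \<tau> \<in> elts R)) \<and>
     (triple p \<sigma> \<tau> \<in> elts R \<longleftrightarrow>
        (\<forall>q\<in>below P le p. \<exists>r\<in>below P le q. \<exists>\<rho> s.
           pair \<rho> s \<in> elts \<tau> \<and> pair r s \<in> elts le \<and> triple r \<sigma> \<rho> \<in> elts E)))"

definition forces_eql :: "'v \<Rightarrow> 'v \<Rightarrow> 'v \<Rightarrow> 'v \<Rightarrow> 'v \<Rightarrow> bool" where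
  "forces_eql P le p \<sigma> \<tau> \<longleftrightarrow> (\<exists>N E R. name_closed P N \<and> \<sigma> \<in> elts N \<and> \<tau> \<in> elts N \<and>
     forcing_table P le N E R \<and> triple p \<sigma> \<tau> \<in> elts E)"

definition forces_mem :: "'v \<Rightarrow> 'v \<Rightarrow> 'v \<Rightarrow> 'v \<Rightarrow> 'v \<Rightarrow> bool" where
  "forces_mem P le p \<sigma> \<tau> \<longleftrightarrow> (\<exists>N E R. name_closed P N \<and> \<sigma> \<in> elts N \<and> \<tau> \<in> elts N \<and>
     forcing_table P le N E R \<and> triple p \<sigma> \<tau> \<in> elts R)"

primrec forces :: "'v \<Rightarrow> 'v \<Rightarrow> 'v \<Rightarrow> fm \<Rightarrow> (nat \<Rightarrow> 'v) \<Rightarrow> bool" where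
  "forces P le p (Mem i j) e \<longleftrightarrow> forces_mem P le p (e i) (e j)"
| "forces P le p (Eql i j) e \<longleftrightarrow> forces_eql P le p (e i) (e j)"
| "forces P le p (Neg \<phi>) e \<longleftrightarrow> (\<forall>q\<in>below P le p. \<not> forces P le q \<phi> e)"
| "forces P le p (Conj \<phi> \<psi>) e \<longleftrightarrow> forces P le p \<phi> e \<and> forces P le p \<psi> e"
| "forces P le p (All n \<phi>) e \<longleftrightarrow> (\<forall>\<tau>. is_name P \<tau> \<longrightarrow> forces P le p \<phi> (e(n := \<tau>)))"

text \<open>The canonical name of a ground-model set; all conditions are used in place of a largest one,
  which need not exist.\<close>

definition is_check_name :: "'v \<Rightarrow> 'v \<Rightarrow> 'v \<Rightarrow> bool" where
  "is_check_name P x c \<longleftrightarrow> (\<exists>T f. transitive T \<and> x \<in> elts T \<and> function_on f T \<and>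
     (\<forall>y\<in>elts T. elts (app f y) = {pair (app f z) p | z p. z \<in> elts y \<and> p \<in> elts P}) \<and>
     c = app f x)"

definition check_name :: "'v \<Rightarrow> 'v \<Rightarrow> 'v" where
  "check_name P x = (THE c. is_check_name P x c)"

text \<open>The first conjunct follows from the second one if there are conditions at all; it excludes the
  empty tower of height 0.\<close>

definition presaturated :: "'v \<Rightarrow> 'v \<Rightarrow> 'v \<Rightarrow> 'v \<Rightarrow> bool" where
  "presaturated \<delta> \<kappa> U I \<longleftrightarrow> regular \<delta> \<and>
     (\<forall>p\<in>elts (tower_conditions \<kappa> U I).
        forces (tower_conditions \<kappa> U I) (tower_order \<kappa> U I) p regular_fm
          (\<lambda>_. check_name (tower_conditions \<kappa> U I) \<delta>))"

end


section \<open>Models of ZFC\<close>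

locale zfc = membership mem for mem :: "'v \<Rightarrow> 'v \<Rightarrow> bool" +
  assumes extensionality: "extensionality_ax UNIV"
    and foundation: "foundation_ax UNIV"
    and pairing: "pairing_ax UNIV"
    and union: "union_ax UNIV"
    and infinity: "infinity_ax UNIV"
    and power_set: "power_set_ax UNIV"
    and separation: "\<exists>b. \<forall>x. x \<in> elts b \<longleftrightarrow> x \<in> elts a \<and> sat p (e(0 := x))"
    and replacement: "(\<And>x. x \<in> elts a \<Longrightarrow> \<exists>!y. sat p (e(0 := x, 1 := y))) \<Longrightarrow>
      \<exists>b. \<forall>y. y \<in> elts b \<longleftrightarrow> (\<exists>x\<in>elts a. sat p (e(0 := x, 1 := y)))"
    and choice: "(\<And>x. x \<in> elts a \<Longrightarrow> elts x \<noteq> {}) \<Longrightarrow>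
      (\<And>x y. x \<in> elts a \<Longrightarrow> y \<in> elts a \<Longrightarrow> x \<noteq> y \<Longrightarrow> elts x \<inter> elts y = {}) \<Longrightarrow>
      \<exists>c. \<forall>x\<in>elts a. \<exists>!y. y \<in> elts x \<inter> elts c"
begin

lemma elts_inject: "elts x = elts y \<longleftrightarrow> x = y"
  using extensionality by (auto simp: extensionality_ax_def)

lemma vset_eq: "elts a = A \<Longrightarrow> vset A = a"
  by (auto simp: vset_def elts_inject)

lemma eq_upair_iff: "w = vset {x, y} \<longleftrightarrow> elts w = {x, y}"
proof -
  obtain z where "elts z = {x, y}"
    using pairing unfolding pairing_ax_def by (metis Int_UNIV_right UNIV_I)
  then show ?thesis
    by (metis elts_inject vset_eq)
qed

lemma sat_connectives:
  "sat (Disj p q) e \<longleftrightarrow> sat p e \<or> sat q e"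
  "sat (Imp p q) e \<longleftrightarrow> (sat p e \<longrightarrow> sat q e)"
  "sat (Iff p q) e \<longleftrightarrow> (sat p e \<longleftrightarrow> sat q e)"
  "sat (Ex n p) e \<longleftrightarrow> (\<exists>x. sat p (e(n := x)))"
  "sat (BAll n i p) e \<longleftrightarrow> (\<forall>x. x \<in> elts (if i = n then x else e i) \<longrightarrow> sat p (e(n := x)))"
  "sat (BEx n i p) e \<longleftrightarrow> (\<exists>x. x \<in> elts (if i = n then x else e i) \<and> sat p (e(n := x)))"
  by (auto simp: Disj_def Imp_def Iff_def Ex_def BAll_def BEx_def)

lemma sat_UPair:
  assumes "w \<noteq> 20" "x \<noteq> 20" "y \<noteq> 20"
  shows "sat (UPair_fm w x y) e \<longleftrightarrow> e w = vset {e x, e y}"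
  using assms by (auto simp: UPair_fm_def sat_connectives eq_upair_iff)

lemma sat_Pair:
  assumes "z \<notin> {20, 21, 22}" "x \<notin> {20, 21, 22}" "y \<notin> {20, 21, 22}"
  shows "sat (Pair_fm z x y) e \<longleftrightarrow> e z = pair (e x) (e y)"
  using assms by (simp add: Pair_fm_def sat_connectives sat_UPair pair_def)

lemma sat_App:
  assumes "f \<notin> {20, 21, 22, 23}" "x \<notin> {20, 21, 22, 23}" "y \<notin> {20, 21, 22, 23}"
  shows "sat (App_fm f x y) e \<longleftrightarrow> pair (e x) (e y) \<in> elts (e f)"
  using assms by (auto simp: App_fm_def sat_connectives sat_Pair)

lemma func_app:
  assumes "func f a b" "x \<in> elts a"
  shows "pair x y \<in> elts f \<longleftrightarrow> y = app f x"
proof -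
  have ex1: "\<exists>!y. pair x y \<in> elts f"
    using assms by (simp add: func_def)
  then have "pair x (app f x) \<in> elts f"
    unfolding app_def by (rule theI')
  with ex1 show ?thesis by blast
qed

lemma pair_inject: "pair x y = pair x' y' \<longleftrightarrow> x = x' \<and> y = y'"
proof -
  have u: "vset {a, b} = vset {c, d} \<longleftrightarrow> {a, b} = {c, d}" for a b c d
    by (metis eq_upair_iff)
  have "pair x y = pair x' y' \<longleftrightarrow> {vset {x, x}, vset {x, y}} = {vset {x', x'}, vset {x', y'}}"
    unfolding pair_def u by simp
  also have "\<dots> \<longleftrightarrow> x = x' \<and> y = y'"
    unfolding doubleton_eq_iff u by auto
  finally show ?thesis .
qed

lemma func_app_in:
  assumes "func f a b" "x \<in> elts a"
  shows "app f x \<in> elts b"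
proof -
  have "pair x (app f x) \<in> elts f"
    using func_app[OF assms] by simp
  then obtain x' y' where "y' \<in> elts b" and eq: "pair x (app f x) = pair x' y'"
    using assms(1) unfolding func_def by blast
  moreover have "app f x = y'"
    using eq unfolding pair_inject by blast
  ultimately show ?thesis by simp
qed

lemma sat_Func: "sat (Func_fm 2 1 0) e \<longleftrightarrow> func (e 2) (e 1) (e 0)"
proof -
  have "sat (Func_fm 2 1 0) e \<longleftrightarrow>
    (\<forall>z. z \<in> elts (e 2) \<longrightarrow> (\<exists>x. x \<in> elts (e 1) \<and> (\<exists>y. y \<in> elts (e 0) \<and> z = pair x y))) \<and>
    (\<forall>x. x \<in> elts (e 1) \<longrightarrow> (\<exists>y. pair x y \<in> elts (e 2) \<and> (\<forall>y'. pair x y' \<in> elts (e 2) \<longrightarrow> y' = y)))"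
    by (simp add: Func_fm_def sat_connectives sat_Pair sat_App)
  then show ?thesis
    unfolding func_def Ex1_def Ball_def Bex_def by simp
qed

lemma sat_regular: "sat regular_fm e \<longleftrightarrow> regular (e 0)"
proof -
  have "sat regular_fm e \<longleftrightarrow>
     ((\<forall>x\<in>elts (e 0). elts x \<subseteq> elts (e 0)) \<and> (\<forall>x\<in>elts (e 0). \<forall>y\<in>elts x. elts y \<subseteq> elts x)) \<and>
     ((\<exists>x. x \<in> elts (e 0)) \<and> (\<forall>x\<in>elts (e 0). \<exists>y\<in>elts (e 0). x \<in> elts y)) \<and>
     \<not> (\<exists>a\<in>elts (e 0). \<exists>f. func f a (e 0) \<and> (\<forall>b\<in>elts (e 0). \<exists>c\<in>elts a. \<exists>d\<in>elts (e 0).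
           pair c d \<in> elts f \<and> elts b \<subseteq> elts d))"
    by (simp add: regular_fm_def Sub_fm_def sat_connectives sat_App sat_Func[unfolded One_nat_def] Ball_def Bex_def
        subset_iff)
  also have "\<dots> \<longleftrightarrow> regular (e 0)"
  proof -
    have "(\<exists>d\<in>elts k. pair c d \<in> elts f \<and> elts b \<subseteq> elts d) \<longleftrightarrow> elts b \<subseteq> elts (app f c)"
      if "func f a k" "c \<in> elts a" for f a k b c
      using func_app[OF that] func_app_in[OF that] by auto
    then show ?thesis
      unfolding regular_def Limit_def Ord_def transitive_def
      by (auto simp: ex_in_conv cong: conj_cong bex_cong)
  qed
  finally show ?thesis .
qed

end

end

theory Submission
  imports Defs
begin

text \<open>
  No generic ultrapower is used. Call a transitive \<open>N\<close> good over a set \<open>R\<close> of countable subsets of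
  \<open>\<omega>\<^sub>1\<close> if it looks like the transitive collapse of a guessing, internally stationary \<open>M\<close> whose
  countable subsets of \<open>\<omega>\<^sub>1\<close> are those in \<open>R\<close>. For two such \<open>N\<close> the traces on \<open>\<gamma> < \<omega>\<^sub>2\<close> of countable
  sets either coincide or are almost disjoint, so if all ordinals below \<open>\<omega>\<^sub>2\<close> occurred in good sets
  over \<open>R\<close>, then SRP (which makes the nonstationary ideal saturated) would bound the levels of the
  tree of these traces, and the Tree Property would give a coherent branch through it. By SRP
  the branch contains the trace of almost every countable set on some stationary set, while Gitik's
  argument codes an arbitrary real into three such traces; hence \<open>R\<close> contains all reals, contrary to
  guessing and Cantor's theorem. So the ordinals occurring in good sets over \<open>R\<close> have a bound
  \<open>g(R) < \<omega>\<^sub>2\<close>. For \<open>M\<close> from the tower and \<open>\<lambda> \<in> M\<close> the collapse of \<open>\<lambda>\<close> lies below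
  \<open>g(R(M))\<close>, and a fixed injection of \<open>g(R(M))\<close> into \<open>\<omega>\<^sub>1\<close> turns it into a countable ordinal
  depending on \<open>M\<close> only through its trace. By normality these ordinals name a function
  from a part of \<open>\<omega>\<^sub>1\<close> onto \<open>\<delta>\<close>, so the regularity of \<open>\<delta>\<close> is not preserved.
\<close>

text \<open>A normal ideal can press down only values that belong to \<open>M\<close>. The collapse
  of \<lambda> is an ordinal below \<open>omega2\<close> that need not belong to \<open>M\<close>,
  whereas countable ordinals do. Passing to a countable ordinal needs a bound below
  \<open>omega2\<close>, and this bound must be readable from every trace of \<open>M\<close> on an
  \<open>H l\<close>; otherwise the decisions made at different heights of the tower would not
  cohere. This is the role of the parameter \<open>R\<close>: all traces of \<open>M\<close> agree
  on it, and it determines the countable sets of ordinals in the collapse relative to a countable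
  cover \<open>c\<close>, because \<open>c\<close> is isomorphic to a countable ordinal and its
  subsets become subsets of \<open>omega1\<close>. For the same reason two good sets over
  \<open>R\<close> that share unboundedly many pieces of a filtration of an ordinal have the same
  countable subsets of it. The formalization is shaped by separation and replacement for formulas
  only. Every set formed below has to be definable, so least ordinals are preferred to choices,
  values are unions instead of descriptions, and families of functions are chosen inside a fixed
  power set.\<close>

section \<open>Definability by first-order formulas with parameters\<close>

primrec rename :: "(nat \<Rightarrow> nat) \<Rightarrow> fm \<Rightarrow> fm" where
  "rename f (Mem i j) = Mem (f i) (f j)"
| "rename f (Eql i j) = Eql (f i) (f j)"
| "rename f (Neg p) = Neg (rename f p)"
| "rename f (Conj p q) = Conj (rename f p) (rename f q)"
| "rename f (All n p) = All (f n) (rename f p)"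

text \<open>Formulas have no constants, so parameters have to live in variables: the even variables
  carry the assignment and the odd ones the parameters.\<close>

definition merge :: "(nat \<Rightarrow> 'a) \<Rightarrow> (nat \<Rightarrow> 'a) \<Rightarrow> nat \<Rightarrow> 'a" where
  "merge e c n = (if even n then e (n div 2) else c (n div 2))"

fun val :: "nat + 'a \<Rightarrow> (nat \<Rightarrow> 'a) \<Rightarrow> 'a" where
  "val (Inl i) e = e i"
| "val (Inr c) e = c"

named_theorems dfb

context membership begin

notation elts ("$_" [1000] 1000)

lemma sat_rename: "inj f ==> sat (rename f p) e \<longleftrightarrow> sat p (e \<circ> f)"
proof (induction p arbitrary: e)
  case (All n p)
  have "(e(f n := x)) \<circ> f = (e \<circ> f)(n := x)" for x
    using All.prems by (auto simp: fun_eq_iff inj_eq)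
  then have "sat (rename f (All n p)) e \<longleftrightarrow> (\<forall>x. sat p ((e \<circ> f)(n := x)))"
    unfolding rename.simps sat.simps All.IH[OF All.prems] by simp
  then show ?case unfolding sat.simps .
qed auto

text \<open>Definability with parameters of predicates and functions of an assignment whose variables
  are de Bruijn indices. It has to be verified whenever separation, replacement or induction is
  applied, and \<open>intro dfb\<close> does so.\<close>

inductive defb :: "((nat \<Rightarrow> 'v) \<Rightarrow> bool) \<Rightarrow> bool" where
  mem: "defb (%e. val s e : $(val t e))"
| eql: "defb (%e. val s e = val t e)"
| neg: "defb Q ==> defb (%e. \<not> Q e)"
| conj: "defb Q ==> defb Q' ==> defb (%e. Q e & Q' e)"
| all: "defb Q ==> defb (%e. \<forall>x. Q (case_nat x e))"

text \<open>This is the bridge from HOL predicates to the axiom schemes, which speak about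
  \<open>fm\<close>. A formula and one sequence of parameters are built along the derivation, with
  variables renamed so that parameters of different subformulas do not collide.\<close>

lemma defb_sat: "defb Q ==> \<exists>p c. \<forall>e. Q e \<longleftrightarrow> sat p (merge e c)"
proof (induction rule: defb.induct)
  case (mem s t)
  define v where "v = (%(k::nat) (s::nat + 'v). case s of Inl i \<Rightarrow> 2 * i | Inr c \<Rightarrow> 2 * k + 1)"
  define cv where "cv = (%s::nat+'v. case s of Inl i \<Rightarrow> undefined | Inr c \<Rightarrow> c)"
  define c where "c = (%n::nat. if n = 0 then cv s else cv t)"
  have "merge e c (v 0 s) = val s e" "merge e c (v 1 t) = val t e" for e
    by (cases s; cases t; simp add: merge_def v_def c_def cv_def)+
  then have "\<forall>e. val s e : $(val t e) \<longleftrightarrow> sat (Mem (v 0 s) (v 1 t)) (merge e c)"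
    by simp
  then show ?case by blast
next
  case (eql s t)
  define v where "v = (%(k::nat) (s::nat + 'v). case s of Inl i \<Rightarrow> 2 * i | Inr c \<Rightarrow> 2 * k + 1)"
  define cv where "cv = (%s::nat+'v. case s of Inl i \<Rightarrow> undefined | Inr c \<Rightarrow> c)"
  define c where "c = (%n::nat. if n = 0 then cv s else cv t)"
  have "merge e c (v 0 s) = val s e" "merge e c (v 1 t) = val t e" for e
    by (cases s; cases t; simp add: merge_def v_def c_def cv_def)+
  then have "\<forall>e. val s e = val t e \<longleftrightarrow> sat (Eql (v 0 s) (v 1 t)) (merge e c)"
    by simp
  then show ?case by blast
next
  case (neg Q)
  then obtain p c where "\<forall>e. Q e \<longleftrightarrow> sat p (merge e c)" by blast
  then have "\<forall>e. \<not> Q e \<longleftrightarrow> sat (Neg p) (merge e c)" by simp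
  then show ?case by blast
next
  case (conj Q Q')
  then obtain p c p' c' where pc: "\<forall>e. Q e \<longleftrightarrow> sat p (merge e c)" "\<forall>e. Q' e \<longleftrightarrow> sat p' (merge e c')"
    by blast
  \<comment> \<open>The parameter variable 2m+1 moves to 4m+k. With k = 1 and k = 3 the parameters
    of the two conjuncts become disjoint, while the even variables stay shared.\<close>
  define f where "f = (%(k::nat) n::nat. if even n then n else 4 * (n div 2) + k)"
  define d where "d = (%n. if even n then c (n div 2) else c' (n div 2))"
  have inj: "inj (f 1)" "inj (f 3)"
    by (rule inj_on_inverseI[where g = "%m. if even m then m else 2 * (m div 4) + 1"],
        auto simp: f_def elim!: oddE)+
  have d4: "(4 * b + 3) div 2 = 2 * b + 1" for b :: nat by presburger
  have "merge e d \<circ> f 1 = merge e c" "merge e d \<circ> f 3 = merge e c'" for e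
    by (auto simp: fun_eq_iff merge_def f_def d_def d4 elim!: oddE)
  then have "\<forall>e. Q e & Q' e \<longleftrightarrow> sat (Conj (rename (f 1) p) (rename (f 3) p')) (merge e d)"
    using pc by (simp add: sat_rename[OF inj(1)] sat_rename[OF inj(2)] del: One_nat_def)
  then show ?case by blast
next
  case (all Q)
  then obtain p c where pc: "\<forall>e. Q e \<longleftrightarrow> sat p (merge e c)" by blast
  \<comment> \<open>Index 0 of the body becomes the named variable 1. The other even variables move
    down by 2 and the odd ones up by 2, which keeps variable 1 free for the quantifier.\<close>
  define f where "f = (%n::nat. if n = 0 then 1 else if even n then n - 2 else n + 2)"
  define d where "d = case_nat undefined c"
  have inj: "inj f"
    by (rule inj_on_inverseI[where g = "%m. if m = 1 then 0 else if even m then m + 2 else m - 2"])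
      (auto simp: f_def; presburger)
  have "((merge e d)(1 := x)) \<circ> f = merge (case_nat x e) c" for e x
  proof
    fix n show "(((merge e d)(1 := x)) \<circ> f) n = merge (case_nat x e) c n"
    proof (cases "n = 0")
      case False
      show ?thesis
      proof (cases "even n")
        case True
        with False have "n = 2 * Suc (n div 2 - 1)" by presburger
        then obtain k where "n = 2 * Suc k" by blast
        then show ?thesis by (simp add: merge_def f_def)
      next
        case False
        then obtain k where "n = 2 * k + 1" by (elim oddE)
        then show ?thesis by (simp add: merge_def f_def d_def)
      qed
    qed (simp add: merge_def f_def)
  qed
  then have "\<forall>e. (\<forall>x. Q (case_nat x e)) \<longleftrightarrow> sat (All 1 (rename f p)) (merge e d)"
    using pc by (simp add: sat_rename[OF inj] del: One_nat_def)
  then show ?case by blast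
qed

text \<open>The substitution lemma: under a quantifier the substitution is lifted so that it fixes
  index 0 and shifts the other values.\<close>

lemma defb_vals: "defb Q ==> defb (%e. Q (%n. val (\<sigma> n) e))"
proof (induction arbitrary: \<sigma> rule: defb.induct)
  case (mem s t)
  define s' where "s' = (case s of Inl i \<Rightarrow> \<sigma> i | Inr c \<Rightarrow> Inr c)"
  define t' where "t' = (case t of Inl i \<Rightarrow> \<sigma> i | Inr c \<Rightarrow> Inr c)"
  have "val s (%n. val (\<sigma> n) e) = val s' e" "val t (%n. val (\<sigma> n) e) = val t' e" for e
    by (cases s; cases t; simp add: s'_def t'_def)+
  then show ?case by (simp add: defb.mem)
next
  case (eql s t)
  define s' where "s' = (case s of Inl i \<Rightarrow> \<sigma> i | Inr c \<Rightarrow> Inr c)"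
  define t' where "t' = (case t of Inl i \<Rightarrow> \<sigma> i | Inr c \<Rightarrow> Inr c)"
  have "val s (%n. val (\<sigma> n) e) = val s' e" "val t (%n. val (\<sigma> n) e) = val t' e" for e
    by (cases s; cases t; simp add: s'_def t'_def)+
  then show ?case by (simp add: defb.eql)
next
  case (all Q)
  define \<tau> where "\<tau> = case_nat (Inl 0) (%n. map_sum Suc id (\<sigma> n))"
  have "(%n. val (\<tau> n) (case_nat x e)) = case_nat x (%n. val (\<sigma> n) e)" for x e
  proof
    fix n show "val (\<tau> n) (case_nat x e) = case_nat x (%n. val (\<sigma> n) e) n"
      by (cases n; cases "\<sigma> (n - 1)"; simp add: \<tau>_def)
  qed
  with defb.all[OF all.IH[of \<tau>]] show ?case by simp
qed (auto intro: defb.neg defb.conj)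

text \<open>The language has no function symbols, so a term is treated through its graph, with the
  value in index 0 and the assignment shifted by one.\<close>

definition deft :: "((nat \<Rightarrow> 'v) \<Rightarrow> 'v) \<Rightarrow> bool" where
  "deft t \<longleftrightarrow> defb (%e. e 0 = t (%n. e (Suc n)))"

lemma defb_ren: "defb Q ==> defb (%e. Q (%n. e (f n)))"
  using defb_vals[of Q "%n. Inl (f n)"] by simp

lemma deft_ren: "deft t ==> deft (%e. t (%n. e (f n)))"
  unfolding deft_def using defb_ren[of "%e. e 0 = t (%n. e (Suc n))" "case_nat 0 (%n. Suc (f n))"] by simp

lemma defb_not [dfb]: "defb Q ==> defb (%e. \<not> Q e)" by (rule defb.neg)
lemma defb_and [dfb]: "defb Q ==> defb Q' ==> defb (%e. Q e & Q' e)" by (rule defb.conj)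
lemma defb_all [dfb]: "defb (%e. Q (%n. e (Suc n)) (e 0)) ==> defb (%e. \<forall>x. Q e x)"
  using defb.all[of "%e. Q (%n. e (Suc n)) (e 0)"] by simp
lemma defb_or [dfb]: assumes "defb Q" "defb Q'" shows "defb (%e. Q e \<or> Q' e)"
proof -
  have "defb (%e. \<not> (\<not> Q e & \<not> Q' e))"
    by (rule defb_not defb_and assms)+
  then show ?thesis by simp
qed
lemma defb_imp [dfb]: assumes "defb Q" "defb Q'" shows "defb (%e. Q e --> Q' e)"
proof -
  have "defb (%e. \<not> Q e \<or> Q' e)"
    by (rule defb_or defb_not assms)+
  then show ?thesis by (simp only: imp_conv_disj)
qed
lemma defb_iff [dfb]: assumes "defb Q" "defb Q'" shows "defb (%e. Q e = Q' e)"
proof -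
  have "defb (%e. (Q e --> Q' e) & (Q' e --> Q e))"
    by (rule defb_and defb_imp assms)+
  then show ?thesis by (simp only: iff_conv_conj_imp)
qed
lemma defb_ex [dfb]: assumes "defb (%e. Q (%n. e (Suc n)) (e 0))" shows "defb (%e. \<exists>x. Q e x)"
proof -
  have "defb (%e. \<not> (\<forall>x. \<not> Q e x))"
    by (rule defb_not, rule defb_all[of "%e x. \<not> Q e x"], rule defb_not, rule assms)
  then show ?thesis by simp
qed
lemma defb_True [dfb]: "defb (%e. b)"
proof -
  have "defb (%e. e 0 = e 0)" using defb.eql[of "Inl 0" "Inl 0"] by simp
  from this defb_not[OF this] show ?thesis by (cases b) auto
qed

lemma deft_var [dfb]: "deft (%e. e i)"
  unfolding deft_def using defb.eql[of "Inl 0" "Inl (Suc i)"] by simp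
lemma deft_const [dfb]: "deft (%e. c)"
  unfolding deft_def using defb.eql[of "Inl 0" "Inr c"] by simp

text \<open>A defined term is eliminated in favour of an existential quantifier over its
  value.\<close>

lemma defb_let: "defb (%e. Q (e 0) (%n. e (Suc n))) ==> deft t ==> defb (%e. Q (t e) e)"
  unfolding deft_def
  using defb_ex[of "%e x. x = t e & Q x e"]
    defb_and[of "%e. e 0 = t (%n. e (Suc n))" "%e. Q (e 0) (%n. e (Suc n))"] by simp

lemma defb_subst: "defb (%e. Q (e 0)) ==> deft t ==> defb (%e. Q (t e))"
  by (rule defb_let[where Q = "%x e. Q x"])
lemma defb_subst2:
  assumes "defb (%e. Q (e 0) (e 1))" "deft t" "deft s" shows "defb (%e. Q (t e) (s e))"
proof -
  have "defb (%e. Q (t (%n. e (Suc n))) (e 0))"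
    by (rule defb_let[where Q = "%x e. Q x (e 0)" and t = "%e. t (%n. e (Suc n))"])
      (use assms(1) deft_ren[OF assms(2), of Suc] in auto)
  then show ?thesis by (rule defb_let[where Q = "%x e. Q (t e) x"]) fact
qed
lemma defb_subst3:
  assumes "defb (%e. Q (e 0) (e 1) (e 2))" "deft t" "deft s" "deft u" shows "defb (%e. Q (t e) (s e) (u e))"
proof -
  have "defb (%e. Q (e 0) (e 1) (u (%n. e (Suc (Suc n)))))"
    by (rule defb_let[where Q = "%x e. Q (e 0) (e 1) x" and t = "%e. u (%n. e (Suc (Suc n)))"])
      (use defb_ren[OF assms(1), of "%n. if n = 0 then 1 else if n = 1 then 2 else 0"] deft_ren[OF assms(4)] in \<open>auto simp: numeral_2_eq_2\<close>)
  then have "defb (%e. Q (t (%n. e (Suc n))) (e 0) (u (%n. e (Suc n))))"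
    by (intro defb_let[where Q = "%x e. Q x (e 0) (u (%n. e (Suc n)))" and t = "%e. t (%n. e (Suc n))"])
      (use deft_ren[OF assms(2), of Suc] in auto)
  then show ?thesis by (rule defb_let[where Q = "%x e. Q (t e) x (u e)"]) fact
qed

lemma deft_subst: "deft (%e. F (e 0)) ==> deft t ==> deft (%e. F (t e))"
  unfolding deft_def
  by (rule defb_subst2[where Q = "%x y. x = F y" and t = "%e. e 0" and s = "%e. t (%n. e (Suc n))"])
    (use deft_ren[of t Suc] deft_var[of 0] in \<open>auto simp: deft_def\<close>)
lemma deft_subst2: "deft (%e. F (e 0) (e 1)) ==> deft t ==> deft s ==> deft (%e. F (t e) (s e))"
  unfolding deft_def
  by (rule defb_subst3[where Q = "%x y z. x = F y z" and t = "%e. e 0" and s = "%e. t (%n. e (Suc n))" and u = "%e. s (%n. e (Suc n))"])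
    (use deft_ren[of t Suc] deft_ren[of s Suc] deft_var[of 0] in \<open>auto simp: deft_def numeral_2_eq_2\<close>)

lemma defb_mem [dfb]: "deft t ==> deft s ==> defb (%e. t e : $(s e))"
  by (rule defb_subst2[where Q = "%x y. x : $y"])
    (use defb.mem[of "Inl 0" "Inl 1"] in auto)
lemma defb_eq [dfb]: "deft t ==> deft s ==> defb (%e. t e = s e)"
  by (rule defb_subst2[where Q = "%x y. x = y"])
    (use defb.eql[of "Inl 0" "Inl 1"] in auto)
lemma defb_ball [dfb]: "deft a ==> defb (%e. Q (%n. e (Suc n)) (e 0)) ==> defb (%e. \<forall>x\<in>$(a e). Q e x)"
  unfolding Ball_def by (intro dfb) (use deft_ren[of a Suc] in auto)
lemma defb_bex [dfb]: "deft a ==> defb (%e. Q (%n. e (Suc n)) (e 0)) ==> defb (%e. \<exists>x\<in>$(a e). Q e x)"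
  unfolding Bex_def by (intro dfb) (use deft_ren[of a Suc] in auto)
lemma defb_ex1 [dfb]:
  assumes "defb (%e. Q (%n. e (Suc n)) (e 0))" shows "defb (%e. \<exists>!x. Q e x)"
  unfolding Ex1_def
proof (intro dfb assms)
  show "defb (%e. Q (%n. e (Suc (Suc n))) (e 0))"
    using defb_ren[OF assms, of "case_nat 0 (%n. Suc (Suc n))"] by simp
qed
lemma defb_sub [dfb]: "deft a ==> deft b ==> defb (%e. $(a e) <= $(b e))"
  unfolding subset_iff by (intro dfb) (use deft_ren[of a Suc] deft_ren[of b Suc] in auto)

end

context zfc begin

text \<open>On a class that is no set, the description behind \<open>vset\<close> has no solution
  and yields one fixed element \<open>c\<close>. Hence the term is definable whether or not the
  extension exists, and existence can be proved separately.\<close>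

lemma deft_vset [dfb]:
  assumes "defb (%e. Q (%n. e (Suc n)) (e 0))" shows "deft (%e. vset {x. Q e x})"
proof -
  define c where "c = (THE a::'v. False)"
  have eq: "y = vset S \<longleftrightarrow> (\<forall>x. x : $y \<longleftrightarrow> x : S) \<or> (\<not> (\<exists>z. \<forall>x. x : $z \<longleftrightarrow> x : S) & y = c)" for y S
  proof (cases "\<exists>z. $z = S")
    case True
    then obtain z where z: "$z = S" by blast
    have "vset S = z" by (rule vset_eq[OF z])
    then show ?thesis using z elts_inject[of y z] by auto
  next
    case False
    then have "vset S = c" unfolding vset_def c_def by metis
    then show ?thesis using False by blast
  qed
  have 2: "defb (%e. Q (%n. e (Suc (Suc n))) (e 0))" "defb (%e. Q (%n. e (Suc (Suc (Suc n)))) (e 0))"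
    using defb_ren[OF assms, of "case_nat 0 (%n. Suc (Suc n))"]
      defb_ren[OF assms, of "case_nat 0 (%n. Suc (Suc (Suc n)))"] by simp_all
  show ?thesis
    unfolding deft_def eq mem_Collect_eq by (intro dfb 2)
qed

lemma deft_if [dfb]: 
  assumes "defb Q" "deft t" "deft s" shows "deft (%e. if Q e then t e else s e)"
proof -
  have eq: "e 0 = (if Q (%n. e (Suc n)) then t (%n. e (Suc n)) else s (%n. e (Suc n))) \<longleftrightarrow>
    (Q (%n. e (Suc n)) --> e 0 = t (%n. e (Suc n))) & (\<not> Q (%n. e (Suc n)) --> e 0 = s (%n. e (Suc n)))" for e
    by auto
  show ?thesis unfolding deft_def eq
    by (intro dfb) (use defb_ren[OF assms(1), of Suc] deft_ren[OF assms(2), of Suc] deft_ren[OF assms(3), of Suc] in auto)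
qed

lemma separation_defb: 
  assumes "defb (%e. Q (e 0))" shows "\<exists>b. $b = {x \<in> $a. Q x}"
proof -
  obtain p c where "\<forall>e. Q (e 0) \<longleftrightarrow> sat p (merge e c)" using defb_sat[OF assms] by blast
  moreover have "(merge undefined c)(0 := x) = merge (undefined(0 := x)) c" for x
    by (auto simp: fun_eq_iff merge_def)
  ultimately have "Q x \<longleftrightarrow> sat p ((merge undefined c)(0 := x))" for x
    using spec[of _ "undefined(0 := x)"] by (metis fun_upd_same)
  with separation[of a p "merge undefined c"] show ?thesis by auto
qed

lemma replacement_defb:
  assumes "deft (%e. F (e 0))" shows "\<exists>b. $b = F ` $a"
proof -
  have "defb (%e. e 1 = F (e 0))" 
    by (rule defb_eq) (use assms deft_var[of 1] in auto)
  then obtain p c where pc: "\<forall>e. e 1 = F (e 0) \<longleftrightarrow> sat p (merge e c)" using defb_sat by blast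
  \<comment> \<open>The axiom uses variables 0 and 1, whereas \<open>merge\<close> keeps the second
    argument in variable 2. So 2 goes to 1, and the parameters in odd variables are shifted out of
    the way.\<close>
  define f where "f = (%n::nat. if n = 2 then 1 else if odd n then n + 2 else n)"
  have inj: "inj f"
    by (rule inj_on_inverseI[where g = "%m. if m = 1 then 2 else if odd m then m - 2 else m"])
      (auto simp: f_def)
  define d where "d = (merge undefined (case_nat undefined c))"
  have 1: "(d(0 := x, 1 := y)) \<circ> f = merge (undefined(0 := x, 1 := y)) c" for x y
  proof
    fix n show "((d(0 := x, 1 := y)) \<circ> f) n = merge (undefined(0 := x, 1 := y)) c n"
    proof (cases "even n")
      case True
      then obtain k where "n = 2 * k" by blast
      then show ?thesis by (cases "k = 1"; cases "k = 0") (auto simp: f_def d_def merge_def)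
    next
      case False
      then obtain k where "n = 2 * k + 1" by (elim oddE)
      then show ?thesis by (cases "k = 0") (auto simp: f_def d_def merge_def)
    qed
  qed
  have "sat (rename f p) (d(0 := x, 1 := y)) \<longleftrightarrow> y = F x" for x y
    unfolding sat_rename[OF inj] 1 using pc[rule_format, of "undefined(0 := x, 1 := y)"] by simp
  with replacement[of a "rename f p" d] have "\<exists>b. \<forall>y. y : $b \<longleftrightarrow> (\<exists>x\<in>$a. y = F x)" by simp
  then show ?thesis by (auto simp: image_iff set_eq_iff)
qed

section \<open>Classes that are sets, and functions inside the structure\<close>

definition isset :: "'v set \<Rightarrow> bool" where
  "isset S \<longleftrightarrow> (\<exists>a. $a = S)"

lemma elts_vset: "isset S ==> $(vset S) = S"
  unfolding isset_def by (elim exE) (simp add: vset_eq[of _ S])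
lemma vset_elts [simp]: "vset ($a) = a"
  by (rule vset_eq) simp
lemma vsetI: "$a = $b ==> a = b"
  using elts_inject by blast
lemma isset_elts [simp, intro]: "isset ($a)"
  unfolding isset_def by blast
lemma isset_sep: "defb (%e. Q (e 0)) ==> isset {x \<in> $a. Q x}"
  unfolding isset_def by (rule separation_defb)
lemma isset_bounded:
  assumes "defb (%e. Q (e 0))" "!!x. Q x ==> x : $a" shows "isset {x. Q x}"
proof -
  have "{x. Q x} = {x \<in> $a. Q x}" using assms(2) by blast
  then show ?thesis using isset_sep[OF assms(1)] by metis
qed
lemma isset_image: "deft (%e. F (e 0)) ==> isset (F ` $a)"
  unfolding isset_def by (rule replacement_defb)
lemma isset_upair [simp, intro]: "isset {x, y}"
  using pairing unfolding pairing_ax_def isset_def by auto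
lemma isset_single [simp, intro]: "isset {x}"
  using isset_upair[of x x] by simp
lemma isset_Union: "isset (\<Union>x\<in>$a. $x)"
  using union unfolding union_ax_def isset_def by auto
lemma isset_Pow [simp, intro]: "isset {b. $b <= $a}"
  using power_set unfolding power_set_ax_def isset_def by auto
lemma isset_UN: 
  assumes "deft (%e. F (e 0))" shows "isset (\<Union>x\<in>$a. $(F x))"
proof -
  obtain b where "$b = F ` $a" using isset_image[OF assms] unfolding isset_def by blast
  then show ?thesis using isset_Union[of b] by (simp add: image_image)
qed
lemma isset_Un: assumes "isset A" "isset B" shows "isset (A \<union> B)"
proof -
  obtain a b where "$a = A" "$b = B" using assms unfolding isset_def by blast
  moreover obtain p where "$p = {a, b}" using isset_upair unfolding isset_def by blast
  ultimately show ?thesis using isset_Union[of p] by simp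
qed
lemma isset_insert: "isset A ==> isset (insert x A)"
  using isset_Un[OF isset_single] by simp
lemma isset_empty [simp, intro]: "isset {}"
  using isset_sep[of "%x. False"] defb_True by simp
lemma isset_Int: assumes "isset A" shows "isset (A \<inter> $b)"
proof -
  obtain a where a: "$a = A" using assms unfolding isset_def by blast
  have "A \<inter> $b = {x \<in> $a. x : $b}" using a by blast
  then show ?thesis using isset_sep[of "%x. x : $b" a] by (simp add: dfb)
qed
lemma isset_subset:
  assumes "defb (%e. e 0 : B)" "B <= A" "isset A" shows "isset B"
proof -
  obtain a where a: "$a = A" using assms unfolding isset_def by blast
  then have "B = {x \<in> $a. x : B}" using assms(2) by blast
  then show ?thesis using isset_sep[OF assms(1), of a] by simp
qed

lemma elts_sep: "defb (%e. Q (e 0)) ==> $(vset {x \<in> $a. Q x}) = {x \<in> $a. Q x}"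
  by (rule elts_vset[OF isset_sep])
lemma elts_upair [simp]: "$(vset {x, y}) = {x, y}" "$(vset {x}) = {x}"
  by (simp_all add: elts_vset)
lemma elts_zero [simp]: "$zero = {}"
  by (simp add: zero_def elts_vset)
lemma elts_succ [simp]: "$(succ a) = insert a ($a)"
  by (simp add: succ_def elts_vset isset_insert)
lemma elts_pow [simp]: "$(pow a) = {b. $b <= $a}"
  by (simp add: pow_def elts_vset)
lemma elts_union [simp]: "$(union a) = (\<Union>x\<in>$a. $x)"
  unfolding union_def by (rule elts_vset[OF isset_Union])
lemma elts_Int [simp]: "$(vset ($a \<inter> $b)) = $a \<inter> $b"
  by (simp add: elts_vset isset_Int)
lemma elts_Un [simp]: "$(vset ($a \<union> $b)) = $a \<union> $b"
  by (simp add: elts_vset isset_Un)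

lemma deft_upair [dfb]: assumes "deft a" "deft b" shows "deft (%e. vset {a e, b e})"
proof -
  have "{x, y} = {z. z = x \<or> z = y}" for x y :: 'v by auto
  then show ?thesis by (simp, intro dfb assms deft_ren[of _ Suc])
qed
lemma deft_single [dfb]: assumes "deft a" shows "deft (%e. vset {a e})"
  using deft_upair[OF assms assms] by simp
lemma deft_pair [dfb]: "deft a ==> deft b ==> deft (%e. pair (a e) (b e))"
  unfolding pair_def by (intro dfb)
lemma deft_Int [dfb]: assumes "deft a" "deft b" shows "deft (%e. vset ($(a e) \<inter> $(b e)))"
  unfolding Int_def by (intro dfb deft_ren[of a Suc] deft_ren[of b Suc] assms)
lemma deft_Un [dfb]: assumes "deft a" "deft b" shows "deft (%e. vset ($(a e) \<union> $(b e)))"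
  unfolding Un_def by (intro dfb deft_ren[of a Suc] deft_ren[of b Suc] assms)
lemma deft_succ [dfb]: assumes "deft a" shows "deft (%e. succ (a e))"
  unfolding succ_def insert_def Un_def
  by (simp, intro dfb deft_ren[of a Suc] assms)
lemma deft_pow [dfb]: assumes "deft a" shows "deft (%e. pow (a e))"
  unfolding pow_def by (intro dfb deft_ren[of a Suc] assms)
lemma deft_union [dfb]: assumes "deft a" shows "deft (%e. union (a e))"
  unfolding union_def UNION_eq by (intro dfb deft_ren[of a Suc] assms)
lemma deft_image [dfb]:
  assumes "deft a" "deft (%e. F (%n. e (Suc n)) (e 0))" shows "deft (%e. vset (F e ` $(a e)))"
proof -
  have "F e ` $(a e) = {y. \<exists>x\<in>$(a e). y = F e x}" for e by auto
  moreover have "deft (%e. F (%n. e (Suc (Suc n))) (e 0))"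
    using deft_ren[OF assms(2), of "case_nat 0 (%n. Suc (Suc n))"] by simp
  ultimately show ?thesis by (simp, intro dfb deft_ren[of a Suc] assms)
qed
lemma deft_UN [dfb]:
  assumes "deft a" "deft (%e. F (%n. e (Suc n)) (e 0))" shows "deft (%e. vset (\<Union>x\<in>$(a e). $(F e x)))"
proof -
  have "deft (%e. F (%n. e (Suc (Suc n))) (e 0))"
    using deft_ren[OF assms(2), of "case_nat 0 (%n. Suc (Suc n))"] by simp
  then show ?thesis unfolding UNION_eq by (intro dfb deft_ren[of a Suc] assms)
qed
lemma elts_UN: "deft (%e. F (e 0)) ==> $(vset (\<Union>x\<in>$a. $(F x))) = (\<Union>x\<in>$a. $(F x))"
  by (rule elts_vset[OF isset_UN])
lemma elts_image: "deft (%e. F (e 0)) ==> $(vset (F ` $a)) = F ` $a"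
  by (rule elts_vset[OF isset_image])

definition prod :: "'v \<Rightarrow> 'v \<Rightarrow> 'v" where
  "prod a b = vset {z. \<exists>x\<in>$a. \<exists>y\<in>$b. z = pair x y}"

lemma pair_in_pow: "x : $c ==> y : $c ==> pair x y : $(pow (pow c))"
  by (simp add: pair_def)
lemma elts_prod: "$(prod a b) = {z. \<exists>x\<in>$a. \<exists>y\<in>$b. z = pair x y}"
  unfolding prod_def
proof (rule elts_vset[OF isset_bounded])
  show "defb (%e. \<exists>x\<in>$a. \<exists>y\<in>$b. e 0 = pair x y)" by (intro dfb)
next
  fix z assume "\<exists>x\<in>$a. \<exists>y\<in>$b. z = pair x y"
  then show "z : $(pow (pow (vset ($a \<union> $b))))" using pair_in_pow[of _ "vset ($a \<union> $b)"] by auto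
qed
lemma pair_in_prod [simp]: "pair x y : $(prod a b) \<longleftrightarrow> x : $a & y : $b"
  by (auto simp: elts_prod pair_inject)
lemma deft_prod [dfb]: assumes "deft a" "deft b" shows "deft (%e. prod (a e) (b e))"
proof -
  have "deft (%e. b (%n. e (Suc (Suc n))))" using deft_ren[OF assms(2), of "%n. Suc (Suc n)"] by simp
  then show ?thesis
  unfolding prod_def by (intro dfb deft_ren[of a Suc] assms)
qed

text \<open>A total substitute for \<open>app\<close>: the union of all values of \<open>f\<close>
  at \<open>x\<close>. It is definable without a uniqueness condition and agrees with
  \<open>app\<close> on functions.\<close>

definition ap :: "'v \<Rightarrow> 'v \<Rightarrow> 'v" where
  "ap f x = vset {z. \<exists>y. pair x y : $f & z : $y}"

definition lam :: "'v \<Rightarrow> ('v \<Rightarrow> 'v) \<Rightarrow> 'v" where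
  "lam a F = vset ((%x. pair x (F x)) ` $a)"

lemma deft_ap [dfb]: assumes "deft a" "deft b" shows "deft (%e. ap (a e) (b e))"
proof -
  have "deft (%e. a (%n. e (Suc (Suc n))))" "deft (%e. b (%n. e (Suc (Suc n))))"
    using deft_ren[OF assms(1), of "%n. Suc (Suc n)"] deft_ren[OF assms(2), of "%n. Suc (Suc n)"] by auto
  then show ?thesis unfolding ap_def by (intro dfb)
qed
lemma deft_lam [dfb]: 
  assumes "deft a" "deft (%e. F (%n. e (Suc n)) (e 0))" shows "deft (%e. lam (a e) (F e))"
  unfolding lam_def by (intro dfb assms)

lemma ap_eq: assumes "!!y'. pair x y' : $f \<longleftrightarrow> y' = y" shows "ap f x = y"
  unfolding ap_def assms by simp
lemma app_eq: assumes "!!y'. pair x y' : $f \<longleftrightarrow> y' = y" shows "app f x = y"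
  unfolding app_def using assms by simp
lemma func_ap: "func f a b ==> x : $a ==> app f x = ap f x"
  using func_app[of f a b x] ap_eq[of x f "app f x"] by simp
lemma func_ap_in: "func f a b ==> x : $a ==> ap f x : $b"
  using func_app_in[of f a b x] func_ap[of f a b x] by simp
lemma func_pair_iff: "func f a b ==> x : $a ==> pair x y : $f \<longleftrightarrow> y = ap f x"
  using func_app[of f a b x] func_ap[of f a b x] by simp

lemma lam_cong: "(!!x. x : $a ==> F x = G x) ==> lam a F = lam a G"
  unfolding lam_def by (metis (no_types, lifting) image_cong)

context
  fixes F assumes F: "deft (%e. F (e 0))"
begin
lemma elts_lam: "$(lam a F) = (%x. pair x (F x)) ` $a"
proof -
  have "deft (%e. pair (e 0) (F (e 0)))" by (intro dfb F)
  then show ?thesis unfolding lam_def by (rule elts_image)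
qed
lemma pair_lam: "x : $a ==> pair x y : $(lam a F) \<longleftrightarrow> y = F x"
  unfolding elts_lam by (auto simp: pair_inject)
lemma ap_lam: "x : $a ==> ap (lam a F) x = F x"
  by (rule ap_eq) (rule pair_lam)
lemma app_lam: "x : $a ==> app (lam a F) x = F x"
  by (rule app_eq) (rule pair_lam)
lemma func_lam: "(!!x. x : $a ==> F x : $b) ==> func (lam a F) a b"
  unfolding func_def elts_lam by (auto simp: pair_inject)
lemma function_on_lam: "function_on (lam a F) a"
  unfolding function_on_def using func_lam[of a "vset (F ` $a)"] by (auto simp: elts_image[OF F])
end

lemma defb_func [dfb]: 
  assumes "deft f" "deft a" "deft b" shows "defb (%e. func (f e) (a e) (b e))"
proof -
  have "defb (%e. func (e 0) (e 1) (e 2))" unfolding func_def by (intro dfb)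
  then show ?thesis by (rule defb_subst3) fact+
qed
lemma defb_transitive [dfb]: "deft a ==> defb (%e. transitive (a e))"
  by (rule defb_subst[of transitive]) (unfold transitive_def, intro dfb)
lemma defb_Ord [dfb]: "deft a ==> defb (%e. Ord (a e))"
  by (rule defb_subst[of Ord]) (unfold Ord_def, intro dfb)
lemma defb_Limit [dfb]: "deft a ==> defb (%e. Limit (a e))"
  by (rule defb_subst[of Limit]) (unfold Limit_def ex_in_conv[symmetric], intro dfb)

text \<open>The axiom of choice is available only as a selector for disjoint families. It is applied
  to the fibres consisting of all pairs of a given \<open>x\<close> with an admissible
  \<open>y\<close>, which are disjoint; the selected pairs form the function.\<close>

lemma choice_func:
  assumes Q: "defb (%e. Q (e 0) (e 1))" and ex: "!!x. x : $a ==> \<exists>y\<in>$b. Q x y"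
  shows "\<exists>f. func f a b & (\<forall>x\<in>$a. Q x (ap f x))"
proof -
  let ?S = "%x. vset {z. \<exists>y\<in>$b. Q x y & z = pair x y}"
  have Q': "deft s ==> deft t ==> defb (%e. Q (s e) (t e))" for s t
    by (rule defb_subst2[OF Q])
  have S: "$(?S x) = {z. \<exists>y\<in>$b. Q x y & z = pair x y}" for x
    by (rule elts_vset, rule isset_bounded[where a = "prod (vset {x}) b"]) (intro dfb Q', auto)
  have dS: "deft (%e. ?S (e 0))" by (intro dfb Q')
  define A where "A = vset (?S ` $a)"
  have A: "$A = ?S ` $a" unfolding A_def by (rule elts_image[OF dS])
  have "\<exists>c. \<forall>x\<in>$A. \<exists>!y. y : $x \<inter> $c"
  proof (rule choice)
    fix u assume "u : $A"
    then show "$u \<noteq> {}" unfolding A using S ex by fastforce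
  next
    fix u v assume "u : $A" "v : $A" "u \<noteq> v"
    then show "$u \<inter> $v = {}" unfolding A using S by (auto simp: pair_inject)
  qed
  then obtain c where c: "!!x. x : $a ==> \<exists>!z. z : $(?S x) \<inter> $c" unfolding A by blast
  have c': "\<exists>!y. y : $b & Q x y & pair x y : $c" if x: "x : $a" for x
  proof -
    obtain z where z: "z : $(?S x) \<inter> $c" and u: "!!z'. z' : $(?S x) \<inter> $c ==> z' = z"
      using c[OF x] by blast
    from z obtain y where y: "y : $b" "Q x y" "z = pair x y" unfolding S by blast
    show ?thesis
    proof (rule ex1I[of _ y])
      fix y' assume "y' : $b & Q x y' & pair x y' : $c"
      then have "pair x y' = z" by (intro u) (simp add: S, blast)
      then show "y' = y" using y by (simp add: pair_inject)
    qed (use y z in auto)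
  qed
  define f where "f = vset {z. \<exists>x\<in>$a. \<exists>y\<in>$b. z = pair x y & Q x y & z : $c}"
  have f: "$f = {z. \<exists>x\<in>$a. \<exists>y\<in>$b. z = pair x y & Q x y & z : $c}"
    unfolding f_def by (rule elts_vset, rule isset_bounded[where a = c]) (intro dfb Q', auto)
  have p: "pair x y : $f \<longleftrightarrow> x : $a & y : $b & Q x y & pair x y : $c" for x y
    unfolding f by (auto simp: pair_inject)
  have ff: "func f a b"
    unfolding func_def
  proof (intro conjI ballI)
    fix z assume "z : $f" then show "\<exists>x\<in>$a. \<exists>y\<in>$b. z = pair x y" unfolding f by blast
  next
    fix x assume "x : $a" then show "\<exists>!y. pair x y : $f" using c' by (simp add: p)
  qed
  moreover have "Q x (ap f x)" if "x : $a" for x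
    using func_pair_iff[OF ff that, of "ap f x"] p by simp
  ultimately show ?thesis by blast
qed

subsection \<open>Ordinals\<close>

lemma elts_min: "$x \<noteq> {} ==> \<exists>y\<in>$x. $y \<inter> $x = {}"
  using foundation unfolding foundation_ax_def by auto
lemma defb_min: 
  assumes "defb (%e. Q (e 0))" "x : $a" "Q x"
  shows "\<exists>y\<in>$a. Q y & (\<forall>z\<in>$y. z : $a --> \<not> Q z)"
proof -
  have "$(vset {x \<in> $a. Q x}) = {x \<in> $a. Q x}" by (rule elts_sep) fact
  then show ?thesis using elts_min[of "vset {x \<in> $a. Q x}"] assms(2,3) by blast
qed
lemma mem_irrefl [simp]: "x \<notin> $x"
  using elts_min[of "vset {x}"] by auto
lemma mem_asym: "x : $y ==> y \<notin> $x"
  using elts_min[of "vset {x, y}"] by auto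
lemma Ord_mem: "Ord a ==> x : $a ==> Ord x"
  unfolding Ord_def transitive_def by blast
lemma Ord_trans: "Ord a ==> x : $y ==> y : $a ==> x : $a"
  unfolding Ord_def transitive_def by blast
lemma Ord_zero [simp]: "Ord zero" by (simp add: Ord_def transitive_def)
lemma Ord_succ [simp]: "Ord a ==> Ord (succ a)"
  by (auto simp: Ord_def transitive_def)
text \<open>Take a minimal \<open>x\<close> that is incomparable with something, then a minimal
  \<open>y\<close> incomparable with \<open>x\<close>. By minimality the two have the same
  elements.\<close>

lemma Ord_linear:
  assumes "Ord a" "Ord b" shows "a : $b \<or> a = b \<or> b : $a"
proof (rule ccontr)
  let ?I = "%x y. \<not> (x : $y \<or> x = y \<or> y : $x)"
  assume *: "?I a b"
  have "defb (%e. \<exists>y\<in>$(succ b). ?I (e 0) y)" by (intro dfb)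
  from defb_min[OF this, of a "succ a"] * obtain x where x: "x : $(succ a)" "\<exists>y\<in>$(succ b). ?I x y"
    and xm: "!!z. z : $x ==> z : $(succ a) ==> \<not> (\<exists>y\<in>$(succ b). ?I z y)" by auto
  have "defb (%e. ?I x (e 0))" by (intro dfb)
  with x(2) defb_min[of "?I x" _ "succ b"] obtain y where y: "y : $(succ b)" "?I x y"
    and ym: "!!z. z : $y ==> z : $(succ b) ==> \<not> ?I x z" by blast
  have tx: "transitive (succ a)" "transitive (succ b)" "transitive x" "transitive y"
    using assms Ord_succ x(1) y(1) unfolding Ord_def by blast+
  have "$x <= $y"
  proof
    fix z assume z: "z : $x"
    then have "z : $(succ a)" using tx(1) x(1) unfolding transitive_def by blast
    from xm[OF z this] y(1) have "z : $y \<or> z = y \<or> y : $z" by blast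
    then show "z : $y" using y(2) z tx(3) unfolding transitive_def by blast
  qed
  moreover have "$y <= $x"
  proof
    fix z assume z: "z : $y"
    then have "z : $(succ b)" using tx(2) y(1) unfolding transitive_def by blast
    from ym[OF z this] have "x : $z \<or> x = z \<or> z : $x" by blast
    then show "z : $x" using y(2) z tx(4) unfolding transitive_def by blast
  qed
  ultimately show False using y(2) elts_inject by blast
qed
lemma Ord_subset_iff: "Ord a ==> Ord b ==> $a <= $b \<longleftrightarrow> a : $b \<or> a = b"
  using Ord_linear[of a b] mem_irrefl Ord_trans by (metis subset_iff)
lemma Ord_not_mem_iff: "Ord a ==> Ord b ==> a \<notin> $b \<longleftrightarrow> $b <= $a"
  using Ord_linear[of a b] Ord_subset_iff[of b a] mem_irrefl mem_asym by blast
lemma Ord_subset_cases: "Ord a ==> Ord b ==> $a <= $b \<or> $b <= $a"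
  using Ord_linear[of a b] Ord_subset_iff[of a b] Ord_subset_iff[of b a] by blast
lemma Ord_transitiveI: "transitive a ==> (!!x. x : $a ==> Ord x) ==> Ord a"
  unfolding Ord_def by blast
lemma Ord_union: "(!!x. x : $A ==> Ord x) ==> Ord (union A)"
  unfolding Ord_def transitive_def elts_union by blast

lemma Ord_least:
  assumes "defb (%e. Q (e 0))" "Ord a" "Q a"
  shows "\<exists>m. Ord m & Q m & (\<forall>x. Ord x & Q x --> $m <= $x)"
proof -
  obtain m where m: "m : $(succ a)" "Q m" "!!z. z : $m ==> z : $(succ a) ==> \<not> Q z"
    using defb_min[OF assms(1), of a "succ a"] assms(3) by auto
  have om: "Ord m" by (rule Ord_mem[OF _ m(1)]) (simp add: assms)
  have "$m <= $x" if "Ord x" "Q x" for x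
  proof (rule ccontr)
    assume "\<not> $m <= $x"
    then have "x : $m" using Ord_not_mem_iff[of x m] om that by blast
    moreover have "x : $(succ a)" by (rule Ord_trans[OF _ \<open>x : $m\<close> m(1)]) (simp add: assms)
    ultimately show False using m(3) that by blast
  qed
  with om m(2) show ?thesis by blast
qed

text \<open>An intersection of ordinals, hence the least ordinal with the property if there is one.
  It serves as a definable choice of witnesses throughout.\<close>

definition oleast :: "('v \<Rightarrow> bool) \<Rightarrow> 'v" where
  "oleast Q = vset {z. \<forall>x. Ord x & Q x --> z : $x}"

lemma deft_oleast [dfb]:
  assumes "defb (%e. Q (%n. e (Suc n)) (e 0))" shows "deft (%e. oleast (Q e))"
proof -
  have "defb (%e. Q (%n. e (Suc (Suc n))) (e 0))"
    using defb_ren[OF assms, of "case_nat 0 (%n. Suc (Suc n))"] by simp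
  then show ?thesis unfolding oleast_def by (intro dfb)
qed
lemma oleast:
  assumes "defb (%e. Q (e 0))" "Ord a" "Q a"
  shows "Ord (oleast Q)" "Q (oleast Q)" "Ord x ==> Q x ==> $(oleast Q) <= $x"
proof -
  obtain m where m: "Ord m" "Q m" "!!x. Ord x ==> Q x ==> $m <= $x"
    using Ord_least[OF assms] by blast
  have "{z. \<forall>x. Ord x & Q x --> z : $x} = $m" using m by blast
  then have "oleast Q = m" unfolding oleast_def by simp
  then show "Ord (oleast Q)" "Q (oleast Q)" "Ord x ==> Q x ==> $(oleast Q) <= $x" using m by auto
qed
lemma oleast_mem:
  assumes "defb (%e. Q (e 0))" "Ord a" "Q b" "b : $a"
  shows "oleast Q : $a" "Q (oleast Q)" "x : $(oleast Q) ==> \<not> Q x"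
proof -
  have b: "Ord b" using assms Ord_mem by blast
  note o = oleast[OF assms(1) b assms(3)]
  show "oleast Q : $a" using o(3)[OF b assms(3)] Ord_subset_iff[OF o(1) b] Ord_trans[OF assms(2)] assms(4) by blast
  show "Q (oleast Q)" by (rule o)
  show "\<not> Q x" if "x : $(oleast Q)" using o(3)[of x] that o(1) Ord_mem by (metis mem_irrefl subset_iff)
qed

text \<open>The axiom of infinity only gives a set closed under successor. The union of the ordinals
  in it is a limit ordinal.\<close>

lemma Limit_exists: "\<exists>l. Limit l"
proof -
  obtain w z where z: "z : $w" "$z = {}" and w: "!!x. x : $w ==> \<exists>y\<in>$w. $y = insert x ($x)"
    using infinity unfolding infinity_ax_def by auto
  have z0: "z = zero" using z(2) by (intro vsetI) simp
  have ws: "succ x : $w" if x: "x : $w" for x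
  proof -
    obtain y where "y : $w" "$y = $(succ x)" using w[OF x] by auto
    then show ?thesis using vsetI by metis
  qed
  define o' where "o' = vset {x \<in> $w. Ord x}"
  have o': "$o' = {x \<in> $w. Ord x}" unfolding o'_def by (rule elts_sep) (intro dfb)
  have "Ord (union o')" by (rule Ord_union) (simp add: o')
  moreover have "zero : $(union o')"
    using ws[of zero] z z0 o' by (force simp: elts_union)
  moreover have "\<exists>y\<in>$(union o'). x : $y" if x: "x : $(union o')" for x
  proof -
    obtain y where y: "x : $y" "y : $o'" using x by auto
    then have "succ y : $o'" using ws o' by auto
    then have "y : $(union o')" by force
    then show ?thesis using y by blast
  qed
  ultimately show ?thesis unfolding Limit_def by blast
qed
lemma omega_props: "Limit omega" "Limit v ==> $omega <= $v"
proof -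
  obtain l where l: "Limit l" using Limit_exists by blast
  have ol: "Limit x ==> Ord x" for x unfolding Limit_def by blast
  have d: "defb (%e. Limit (e 0))" by (intro dfb)
  from Ord_least[OF d ol[OF l] l] ol obtain m where m: "Limit m" "!!x. Limit x ==> $m <= $x"
    by blast
  have "omega = m" unfolding omega_def
  proof (rule the_equality)
    fix w assume "Limit w & (\<forall>v. Limit v --> $w <= $v)"
    then show "w = m" using m by (intro vsetI equalityI) blast+
  qed (use m in blast)
  then show "Limit omega" "Limit v ==> $omega <= $v" using m by auto
qed
lemma Limit_succ: assumes "Limit l" "x : $l" shows "succ x : $l"
proof -
  have l: "Ord l" using assms unfolding Limit_def by blast
  obtain y where y: "y : $l" "x : $y" using assms unfolding Limit_def by blast
  have oy: "Ord y" "Ord x" using y l Ord_mem assms(2) by blast+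
  have "$(succ x) <= $y" using y oy Ord_trans[of y] by auto
  then have "succ x : $y \<or> succ x = y" using Ord_subset_iff[of "succ x" y] oy by (simp del: elts_succ)
  then show ?thesis using y l Ord_trans by blast
qed
lemma Ord_omega [simp]: "Ord omega" using omega_props unfolding Limit_def by blast
lemma Limit_zero: "Limit l ==> zero : $l"
proof -
  assume l: "Limit l"
  then have "Ord l" "$l \<noteq> {}" unfolding Limit_def by auto
  then show ?thesis using Ord_linear[of zero l] by auto
qed
lemma zero_omega [simp]: "zero : $omega" by (rule Limit_zero[OF omega_props(1)])
lemma succ_omega [simp]: "n : $omega ==> succ n : $omega" by (rule Limit_succ[OF omega_props(1)])
lemma Ord_cases: assumes "Ord a" obtains "a = zero" | b where "Ord b" "a = succ b" | "Limit a"
proof (cases "$a = {}")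
  case True then have "a = zero" by (intro vsetI) simp
  then show ?thesis using that by blast
next
  case False
  show ?thesis
  proof (cases "Limit a")
    case False
    then obtain x where x: "x : $a" "\<forall>y\<in>$a. x \<notin> $y"
      using \<open>$a \<noteq> {}\<close> assms unfolding Limit_def by blast
    have ox: "Ord x" using x assms Ord_mem by blast
    have "$a <= $(succ x)"
      using x(2) Ord_linear[OF ox] Ord_mem[OF assms] by auto
    moreover have "$(succ x) <= $a" using x(1) assms Ord_trans by auto
    ultimately have "a = succ x" by (intro vsetI) blast
    then show ?thesis using that ox by blast
  qed (use that in blast)
qed
lemma omega_induct [consumes 1, case_names def zero succ]:
  assumes "n : $omega" "defb (%e. Q (e 0))" "Q zero" "!!n. n : $omega ==> Q n ==> Q (succ n)"
  shows "Q n"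
proof (rule ccontr)
  assume "\<not> Q n"
  then obtain m where m: "m : $omega" "\<not> Q m" "!!z. z : $m ==> z : $omega ==> Q z"
    using defb_min[OF defb_not[OF assms(2)] assms(1)] by blast
  have "Ord m" using Ord_mem m(1) Ord_omega by blast
  then show False
  proof (cases rule: Ord_cases)
    case 1 then show False using m assms by blast
  next
    case (2 b)
    then have "b : $omega" using m(1) Ord_trans[OF Ord_omega, of b m] by simp
    then show False using 2 m assms(4)[of b] by auto
  next
    case 3 then show False using omega_props(2)[of m] m(1) by auto
  qed
qed

subsection \<open>Recursion\<close>

definition sol :: "('v \<Rightarrow> 'v \<Rightarrow> 'v) \<Rightarrow> 'v \<Rightarrow> 'v \<Rightarrow> bool" where
  "sol F s g \<longleftrightarrow> transitive s & (\<forall>y\<in>$s. ap g y = F y (lam y (ap g)))"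

text \<open>\<open>sol\<close> describes attempts, that is, partial solutions on transitive sets.
  All attempts agree, so the union of their values at \<open>x\<close> is the common value.\<close>

definition rec :: "('v \<Rightarrow> 'v \<Rightarrow> 'v) \<Rightarrow> 'v \<Rightarrow> 'v" where
  "rec F x = vset {w. \<exists>s g. sol F s g & x : $s & w : $(ap g x)}"

lemma deft_let: 
  assumes "deft (%e. F (e 0) (%n. e (Suc n)))" "deft t" shows "deft (%e. F (t e) e)"
  unfolding deft_def
proof (rule defb_let[where Q = "%x e. e 0 = F x (%n. e (Suc n))" and t = "%e. t (%n. e (Suc n))"])
  show "defb (%e. e (Suc 0) = F (e 0) (%n. e (Suc (Suc n))))"
    using defb_ren[OF assms(1)[unfolded deft_def], of "case_nat 1 (case_nat 0 (%n. Suc (Suc n)))"] by simp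
qed (rule deft_ren[OF assms(2)])
lemma deft_let2: 
  assumes "deft (%e. F (%n. e (Suc (Suc n))) (e (Suc 0)) (e 0))" "deft t" "deft u"
  shows "deft (%e. F e (t e) (u e))"
proof (rule deft_let[where F = "%x e. F e (t e) x", OF _ assms(3)])
  show "deft (%e. F (%n. e (Suc n)) (t (%n. e (Suc n))) (e 0))"
    by (rule deft_let[where F = "%x e. F (%n. e (Suc n)) x (e 0)", OF _ deft_ren[OF assms(2)]])
      (use deft_ren[OF assms(1), of "case_nat 1 (case_nat 0 (%n. Suc (Suc n)))"] in simp)
qed
lemma deft_subst2': "deft (%e. F (e (Suc 0)) (e 0)) ==> deft t ==> deft u ==> deft (%e. F (t e) (u e))"
  by (rule deft_let2[where F = "%e. F"])

lemma defb_sol: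
  assumes "deft (%e. F (%n. e (Suc (Suc n))) (e (Suc 0)) (e 0))" "deft s" "deft g"
  shows "defb (%e. sol (F e) (s e) (g e))"
proof -
  have F: "deft (%e. F (%n. e (Suc n)) (t e) (u e))" if "deft t" "deft u" for t u
    by (rule deft_let2[where F = "%e. F (%n. e (Suc n))", OF _ that])
      (use deft_ren[OF assms(1), of "case_nat 0 (case_nat 1 (%n. Suc (Suc (Suc n))))"] in simp)
  show ?thesis unfolding sol_def
    by (intro dfb F assms deft_ren[OF assms(2), of Suc] deft_ren[OF assms(3), of Suc]
       deft_ren[OF assms(3), of "%n. Suc (Suc n)"])
qed

lemma deft_rec [dfb]:
  assumes "deft (%e. F (%n. e (Suc (Suc n))) (e (Suc 0)) (e 0))" "deft t"
  shows "deft (%e. rec (F e) (t e))"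
  unfolding rec_def
  by (intro dfb defb_sol[where F = "%e. F (%n. e (Suc (Suc (Suc n))))"] deft_ren[OF assms(2), of "%n. Suc (Suc (Suc n))"])
   (use deft_ren[OF assms(1), of "case_nat 0 (case_nat 1 (%n. Suc (Suc (Suc (Suc (Suc n))))))"] in simp)

context
  fixes F assumes F: "deft (%e. F (e (Suc 0)) (e 0))"
begin
lemma deft_rec' [dfb]: "deft t ==> deft (%e. rec F (t e))"
  by (rule deft_rec) (rule F)
lemma deft_F: "deft t ==> deft u ==> deft (%e. F (t e) (u e))"
  by (rule deft_subst2'[OF F])

lemma sol_unique:
  assumes "sol F s g" "sol F s' g'" "x : $s" "x : $s'" shows "ap g x = ap g' x"
proof (rule ccontr)
  assume "ap g x \<noteq> ap g' x"
  have "defb (%e. e 0 : $s' & ap g (e 0) \<noteq> ap g' (e 0))" by (intro dfb)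
  then obtain y where y: "y : $s" "y : $s'" "ap g y \<noteq> ap g' y"
    and m: "!!z. z : $y ==> z : $s ==> z : $s' ==> ap g z = ap g' z"
    using defb_min[of "%x. x : $s' & ap g x \<noteq> ap g' x" x s] assms(3,4) \<open>ap g x \<noteq> ap g' x\<close> by auto
  have "lam y (ap g) = lam y (ap g')"
    using assms(1,2) y unfolding sol_def transitive_def by (intro lam_cong m) auto
  then show False using assms(1,2) y unfolding sol_def by metis
qed
lemma rec_sol: assumes "sol F s g" "x : $s" shows "rec F x = ap g x"
proof -
  have u: "ap g' x = ap g x" if "sol F s' g'" "x : $s'" for s' g'
    by (rule sol_unique[OF that(1) assms(1) that(2) assms(2)])
  have "{w. \<exists>s g. sol F s g & x : $s & w : $(ap g x)} = $(ap g x)"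
  proof (intro equalityI subsetI)
    fix w assume "w : {w. \<exists>s g. sol F s g & x : $s & w : $(ap g x)}"
    then obtain s' g' where "sol F s' g'" "x : $s'" "w : $(ap g' x)" by blast
    then show "w : $(ap g x)" using u[of s' g'] by simp
  next
    fix w assume "w : $(ap g x)"
    then show "w : {w. \<exists>s g. sol F s g & x : $s & w : $(ap g x)}" using assms by blast
  qed
  then show ?thesis unfolding rec_def by simp
qed
lemma rec_on:
  assumes T: "transitive T" "y : $T" shows "rec F y = F y (lam y (rec F))"
proof -
  let ?ok = "%y. \<exists>s g. sol F s g & y : $s"
  have dok: "defb (%e. ?ok (e 0))" by (intro dfb defb_sol F)
  have oks: "?ok z" if "?ok x" "z : $x" for x z
    using that unfolding sol_def transitive_def by blast
  have eq: "rec F x = F x (lam x (rec F))" if ok: "?ok x" for x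
  proof -
    obtain s g where s: "sol F s g" "x : $s" using ok by blast
    have "ap g x = F x (lam x (ap g))" using s unfolding sol_def by blast
    moreover have "lam x (ap g) = lam x (rec F)"
    proof (rule lam_cong)
      fix z assume "z : $x"
      then have "z : $s" using s unfolding sol_def transitive_def by blast
      then show "ap g z = rec F z" using rec_sol s by metis
    qed
    ultimately show ?thesis using rec_sol[OF s] by simp
  qed
  have "?ok y"
  proof (rule ccontr)
    assume "\<not> ?ok y"
    then obtain m where m: "m : $T" "\<not> ?ok m" "!!z. z : $m ==> z : $T ==> ?ok z"
      using defb_min[OF defb_not[OF dok] T(2)] by blast
    \<comment> \<open>If \<open>m\<close> is a minimal element of \<open>T\<close> without attempt,
      then the elements of \<open>T\<close> that have one, together with \<open>m\<close>, again
      form a transitive set, and \<open>rec F\<close> itself yields an attempt on it.\<close>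
    define s0 where "s0 = vset {w \<in> $T. ?ok w}"
    have s0: "$s0 = {w \<in> $T. ?ok w}" unfolding s0_def by (rule elts_sep[OF dok])
    define s1 where "s1 = vset (insert m ($s0))"
    have s1: "$s1 = insert m ($s0)" unfolding s1_def by (simp add: elts_vset isset_insert)
    have sub: "z : $s0" if "x : $s1" "z : $x" for x z
      using that m oks T(1) unfolding s1 s0 transitive_def by blast
    define g where "g = lam s1 (%x. F x (lam x (rec F)))"
    have g: "ap g x = F x (lam x (rec F))" if "x : $s1" for x
      unfolding g_def by (rule ap_lam[OF _ that]) (intro dfb deft_F)
    have "sol F s1 g"
      unfolding sol_def
    proof (intro conjI ballI)
      show "transitive s1" using sub s1 unfolding transitive_def by blast
    next
      fix x assume x: "x : $s1"
      have "lam x (ap g) = lam x (rec F)"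
      proof (rule lam_cong)
        fix z assume z: "z : $x"
        have "?ok z" using sub[OF x z] s0 by blast
        moreover have "z : $s1" using sub[OF x z] s1 by blast
        ultimately show "ap g z = rec F z" using g eq by simp
      qed
      then show "ap g x = F x (lam x (ap g))" using g[OF x] by simp
    qed
    then show False using m(2) s1 by blast
  qed
  then show ?thesis by (rule eq)
qed
end

section \<open>Transitive closures, induction on membership\<close>

text \<open>The iterated unions of \<open>x\<close> are defined by recursion on
  \<open>omega\<close>. As \<open>omega\<close> is transitive, \<open>rec_on\<close> applies before
  any transitive closures are known to exist.\<close>

lemma transitive_superset: "\<exists>t. transitive t & $x <= $t"
proof -
  define F where "F = (%n g. if n = zero then x else union (ap g (union n)))"
  have F: "deft (%e. F (e (Suc 0)) (e 0))" unfolding F_def by (intro dfb)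
  have w: "transitive omega" using Ord_omega unfolding Ord_def by blast
  have r0: "rec F zero = x" using rec_on[OF F w zero_omega] by (simp add: F_def)
  have rs: "rec F (succ n) = union (rec F n)" if n: "n : $omega" for n
  proof -
    have on: "Ord n" using n Ord_mem Ord_omega by blast
    have "union (succ n) = n" using on by (intro vsetI) (auto simp: Ord_def transitive_def)
    moreover have "succ n \<noteq> zero" using elts_succ elts_zero by (metis insert_not_empty)
    moreover have "ap (lam (succ n) (rec F)) n = rec F n" 
      by (rule ap_lam) (auto intro: dfb deft_rec' F)
    ultimately show ?thesis using rec_on[OF F w succ_omega[OF n]] by (simp add: F_def)
  qed
  define t where "t = vset (\<Union>n\<in>$omega. $(rec F n))"
  have t: "$t = (\<Union>n\<in>$omega. $(rec F n))"
    unfolding t_def by (rule elts_UN) (intro dfb deft_rec' F)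
  have "transitive t"
    unfolding transitive_def
  proof (intro ballI subsetI)
    fix y z assume "y : $t" "z : $y"
    then obtain n where "n : $omega" "z : $(rec F (succ n))" unfolding t using rs by force
    then show "z : $t" unfolding t using succ_omega by blast
  qed
  moreover have "$x <= $t" unfolding t using r0 zero_omega by blast
  ultimately show ?thesis by blast
qed

lemma mem_induct:
  assumes "defb (%e. Q (e 0))" "!!x. (!!y. y : $x ==> Q y) ==> Q x" shows "Q x"
proof (rule ccontr)
  assume n: "\<not> Q x"
  obtain t where t: "transitive t" "$(vset {x}) <= $t" using transitive_superset by blast
  then obtain m where "m : $t" "\<not> Q m" "!!z. z : $m ==> z : $t ==> Q z"
    using defb_min[OF defb_not[OF assms(1)], of x t] n by auto
  then show False using assms(2) t(1) unfolding transitive_def by blast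
qed

lemma rec_eq: "deft (%e. F (e (Suc 0)) (e 0)) ==> rec F x = F x (lam x (rec F))"
  using transitive_superset[of "vset {x}"] rec_on[of F] by auto

lemma Ord_induct [consumes 1, case_names def less]:
  assumes "Ord a" "defb (%e. Q (e 0))" "!!x. Ord x ==> (!!y. y : $x ==> Q y) ==> Q x" shows "Q a"
proof -
  have "defb (%e. Ord (e 0) --> Q (e 0))" by (intro dfb assms)
  then have "Ord a --> Q a"
  proof (rule mem_induct[where Q = "%a. Ord a --> Q a"])
    fix x assume *: "!!y. y : $x ==> Ord y --> Q y"
    show "Ord x --> Q x" using assms(3)[of x] * Ord_mem by blast
  qed
  then show ?thesis using assms(1) by blast
qed

lemma trans_cl_props: 
  "transitive (trans_cl x)" "$x <= $(trans_cl x)" "transitive s ==> $x <= $s ==> $(trans_cl x) <= $s"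
proof -
  obtain t where t: "transitive t" "$x <= $t" using transitive_superset by blast
  define u where "u = vset {z \<in> $t. \<forall>s. transitive s & $x <= $s --> z : $s}"
  have u: "$u = {z \<in> $t. \<forall>s. transitive s & $x <= $s --> z : $s}"
    unfolding u_def by (rule elts_sep) (intro dfb)
  have 1: "transitive u" "$x <= $u"
    using t unfolding u transitive_def by blast+
  have 2: "$u <= $s" if "transitive s" "$x <= $s" for s using that u by blast
  have "trans_cl x = u"
    unfolding trans_cl_def
  proof (rule the_equality)
    fix w assume "transitive w & $x <= $w & (\<forall>s. transitive s & $x <= $s --> $w <= $s)"
    then show "w = u" using 1 2 by (intro vsetI equalityI) blast+
  qed (use 1 2 in blast)
  then show "transitive (trans_cl x)" "$x <= $(trans_cl x)" "transitive s ==> $x <= $s ==> $(trans_cl x) <= $s"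
    using 1 2 by auto
qed
lemma deft_trans_cl [dfb]: assumes "deft a" shows "deft (%e. trans_cl (a e))"
proof (rule deft_subst[OF _ assms])
  have "trans_cl x = vset {z. \<forall>s. transitive s & $x <= $s --> z : $s}" for x
  proof -
    have "{z. \<forall>s. transitive s & $x <= $s --> z : $s} = $(trans_cl x)"
      using trans_cl_props(1,2)[where x = x] trans_cl_props(3)[where x = x] by blast
    then show ?thesis by simp
  qed
  then show "deft (%e. trans_cl (e 0))" by (simp, intro dfb)
qed

section \<open>Comparing cardinalities\<close>

lemma defb_inj_on [dfb]:
  assumes "deft a" "deft (%e. F (%n. e (Suc n)) (e 0))" shows "defb (%e. inj_on (F e) ($(a e)))"
proof -
  have "deft (%e. F (%n. e (Suc (Suc n))) (e 0))" "deft (%e. F (%n. e (Suc (Suc n))) (e (Suc 0)))"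
    using deft_ren[OF assms(2), of "case_nat 0 (%n. Suc (Suc n))"] 
      deft_ren[OF assms(2), of "case_nat 1 (%n. Suc (Suc n))"] by simp_all
  then show ?thesis unfolding inj_on_def by (intro dfb assms deft_ren[OF assms(1), of Suc])
qed

lemma lepoll_iff: "lepoll a b \<longleftrightarrow> (\<exists>f. (\<forall>x\<in>$a. ap f x : $b) & inj_on (ap f) ($a))"
proof
  assume "lepoll a b"
  then obtain f where f: "func f a b" "inj_on (app f) ($a)" unfolding lepoll_def injection_def by blast
  have "inj_on (ap f) ($a)" using f(2) func_ap[OF f(1)] by (simp cong: inj_on_cong)
  then show "\<exists>f. (\<forall>x\<in>$a. ap f x : $b) & inj_on (ap f) ($a)" using func_ap_in[OF f(1)] by blast
next
  assume "\<exists>f. (\<forall>x\<in>$a. ap f x : $b) & inj_on (ap f) ($a)"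
  then obtain f where f: "\<forall>x\<in>$a. ap f x : $b" "inj_on (ap f) ($a)" by blast
  have d: "deft (%e. ap f (e 0))" by (intro dfb)
  have "func (lam a (ap f)) a b" by (rule func_lam[OF d]) (use f in blast)
  moreover have "inj_on (app (lam a (ap f))) ($a)" using f(2) app_lam[OF d] by (simp cong: inj_on_cong)
  ultimately show "lepoll a b" unfolding lepoll_def injection_def by blast
qed
lemma lepollI:
  assumes F: "deft (%e. F (e 0))" and "!!x. x : $a ==> F x : $b"
    and "!!x y. x : $a ==> y : $a ==> F x = F y ==> x = y"
  shows "lepoll a b"
  unfolding lepoll_iff
  by (rule exI[of _ "lam a F"]) (use assms ap_lam[OF F] in \<open>auto simp: inj_on_def\<close>)
lemma lepollE:
  assumes "lepoll a b"
  obtains f where "!!x. x : $a ==> ap f x : $b" "!!x y. x : $a ==> y : $a ==> ap f x = ap f y ==> x = y"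
  using assms unfolding lepoll_iff inj_on_def by blast
text \<open>Locates an injection in a fixed power set, so that \<open>choice_func\<close> can choose
  such injections for a whole family.\<close>

lemma lepollE_pow:
  assumes "lepoll a k" "$a <= $u"
  shows "\<exists>g\<in>$(pow (prod u k)). (\<forall>x\<in>$a. ap g x : $k) & inj_on (ap g) ($a)"
proof -
  obtain f where f: "!!x. x : $a ==> ap f x : $k" "!!x y. x : $a ==> y : $a ==> ap f x = ap f y ==> x = y"
    using lepollE[OF assms(1)] by metis
  have d: "deft (%e. ap f (e 0))" by (intro dfb)
  show ?thesis
    by (rule bexI[of _ "lam a (ap f)"]) (use f assms(2) ap_lam[OF d] in \<open>auto simp: inj_on_def elts_lam[OF d]\<close>)
qed
lemma defb_lepoll [dfb]: assumes "deft a" "deft b" shows "defb (%e. lepoll (a e) (b e))"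
proof -
  have "defb (%e. lepoll (e 0) (e 1))" unfolding lepoll_iff by (intro dfb)
  then show ?thesis by (rule defb_subst2) fact+
qed
lemma defb_ctbl [dfb]: "deft a ==> defb (%e. ctbl (a e))"
  unfolding ctbl_def by (intro dfb)
lemma defb_card_less [dfb]: assumes "deft a" "deft b" shows "defb (%e. card_less (a e) (b e))"
  unfolding card_less_def by (intro dfb assms deft_ren[OF assms(1), of Suc])

lemma lepoll_subset: "$a <= $b ==> lepoll a b"
  by (rule lepollI[where F = "%x. x"]) (auto intro: deft_var)
lemma lepoll_refl [simp]: "lepoll a a" by (rule lepoll_subset) simp
lemma lepoll_trans: assumes "lepoll a b" "lepoll b c" shows "lepoll a c"
proof -
  obtain f where f: "!!x. x : $a ==> ap f x : $b" "!!x y. x : $a ==> y : $a ==> ap f x = ap f y ==> x = y"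
    using lepollE[OF assms(1)] by metis
  obtain g where g: "!!x. x : $b ==> ap g x : $c" "!!x y. x : $b ==> y : $b ==> ap g x = ap g y ==> x = y"
    using lepollE[OF assms(2)] by metis
  show ?thesis by (rule lepollI[where F = "%x. ap g (ap f x)"]) (intro dfb, use f g in blast, use f g in blast)
qed
text \<open>Each element of the image is sent to the least number of a preimage, so no choice is
  involved.\<close>

lemma lepoll_image:
  assumes F: "deft (%e. F (e 0))" and s: "!!y. y : $b ==> \<exists>x\<in>$a. y = F x" and "lepoll a k" "Ord k"
  shows "lepoll b k"
proof -
  obtain f where f: "!!x. x : $a ==> ap f x : $k" "!!x y. x : $a ==> y : $a ==> ap f x = ap f y ==> x = y"
    using lepollE[OF assms(3)] by metis
  let ?Q = "%y z. \<exists>x\<in>$a. y = F x & z = ap f x"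
  have dQ: "defb (%e. ?Q y (e 0))" for y by (intro dfb deft_subst[OF F])
  have o: "oleast (?Q y) : $k" "?Q y (oleast (?Q y))" if y: "y : $b" for y
  proof -
    obtain x where x: "x : $a" "y = F x" using s[OF y] by blast
    then have "?Q y (ap f x)" "ap f x : $k" using f by auto
    from oleast_mem[OF dQ assms(4) this] show "oleast (?Q y) : $k" "?Q y (oleast (?Q y))" by auto
  qed
  show ?thesis
  proof (rule lepollI[where F = "%y. oleast (?Q y)"])
    show "deft (%e. oleast (?Q (e 0)))" by (intro dfb deft_subst[OF F])
    show "x = y" if "x : $b" "y : $b" "oleast (?Q x) = oleast (?Q y)" for x y
      using o(2)[OF that(1)] o(2)[OF that(2)] that(3) f(2) by metis
  qed (rule o)
qed
lemma lepoll_prod: assumes "lepoll a a'" "lepoll b b'" shows "lepoll (prod a b) (prod a' b')"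
proof -
  obtain f where f: "!!x. x : $a ==> ap f x : $a'" "!!x y. x : $a ==> y : $a ==> ap f x = ap f y ==> x = y"
    using lepollE[OF assms(1)] by metis
  obtain g where g: "!!x. x : $b ==> ap g x : $b'" "!!x y. x : $b ==> y : $b ==> ap g x = ap g y ==> x = y"
    using lepollE[OF assms(2)] by metis
  let ?F = "%z. vset {w. \<exists>x\<in>$a. \<exists>y\<in>$b. z = pair x y & w : $(pair (ap f x) (ap g y))}"
  have F: "?F (pair x y) = pair (ap f x) (ap g y)" if "x : $a" "y : $b" for x y
  proof -
    have "{w. \<exists>x'\<in>$a. \<exists>y'\<in>$b. pair x y = pair x' y' & w : $(pair (ap f x') (ap g y'))} = $(pair (ap f x) (ap g y))"
      using that by (auto simp: pair_inject)
    then show ?thesis by simp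
  qed
  show ?thesis
  proof (rule lepollI[where F = ?F])
    show "deft (%e. ?F (e 0))" by (intro dfb)
    show "?F z : $(prod a' b')" if zz: "z : $(prod a b)" for z
    proof -
      obtain x y where z: "x : $a" "y : $b" "z = pair x y" using zz unfolding elts_prod by blast
      show ?thesis unfolding z(3) F[OF z(1,2)] using f g z by simp
    qed
    show "z = z'" if zz: "z : $(prod a b)" "z' : $(prod a b)" "?F z = ?F z'" for z z'
    proof -
      obtain x y where z: "x : $a" "y : $b" "z = pair x y" using zz(1) unfolding elts_prod by blast
      obtain x' y' where z': "x' : $a" "y' : $b" "z' = pair x' y'" using zz(2) unfolding elts_prod by blast
      have "pair (ap f x) (ap g y) = pair (ap f x') (ap g y')" using zz(3) unfolding z(3) z'(3) F[OF z(1,2)] F[OF z'(1,2)] .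
      then have "ap f x = ap f x'" "ap g y = ap g y'" unfolding pair_inject by simp_all
      then show ?thesis using f(2)[OF z(1) z'(1)] g(2)[OF z(2) z'(2)] z(3) z'(3) by simp
    qed
  qed
qed

section \<open>Codes of transitive sets, Hartogs numbers and hereditary sets\<close>

text \<open>The copy of the membership structure of \<open>t\<close> that \<open>f\<close>
  transports to a set of ordinals, given by its domain and its relation. By Mostowski uniqueness the
  copy determines a transitive \<open>t\<close>.\<close>

definition pcode :: "'v \<Rightarrow> 'v \<Rightarrow> 'v" where
  "pcode t f = pair (vset (ap f ` $t)) (vset {z. \<exists>u\<in>$t. \<exists>v\<in>$t. u : $v & z = pair (ap f u) (ap f v)})"
lemma deft_pcode [dfb]: "deft t ==> deft f ==> deft (%e. pcode (t e) (f e))"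
  by (rule deft_subst2[where F = pcode]) (unfold pcode_def, intro dfb)

lemma pcode_subset:
  assumes t: "transitive t" "inj_on (ap f) ($t)" and t': "transitive t'" "inj_on (ap f') ($t')"
    and eq: "pcode t f = pcode t' f'"
  shows "$t <= $t'"
proof
  let ?E = "%t f. {z. \<exists>u\<in>$t. \<exists>v\<in>$t. u : $v & z = pair (ap f u) (ap f v)}"
  have E: "$(vset (?E t f)) = ?E t f" for t f
  proof (rule elts_vset, rule isset_bounded[where a = "prod (vset (ap f ` $t)) (vset (ap f ` $t))"])
    show "defb (%e. \<exists>u\<in>$t. \<exists>v\<in>$t. u : $v & e 0 = pair (ap f u) (ap f v))" by (intro dfb)
    have d: "deft (%e. ap f (e 0))" by (intro dfb)
    show "x : $(prod (vset (ap f ` $t)) (vset (ap f ` $t)))" if "\<exists>u\<in>$t. \<exists>v\<in>$t. u : $v & x = pair (ap f u) (ap f v)" for x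
      using that by (auto simp: elts_image[OF d])
  qed
  have "vset (ap f ` $t) = vset (ap f' ` $t')" using eq unfolding pcode_def pair_inject by blast
  moreover have "deft (%e. ap g (e 0))" for g by (intro dfb)
  ultimately have B: "ap f ` $t = ap f' ` $t'" by (metis elts_image)
  have "vset (?E t f) = vset (?E t' f')" using eq unfolding pcode_def pair_inject by blast
  then have "$(vset (?E t f)) = $(vset (?E t' f'))" by (rule arg_cong)
  then have EE: "?E t f = ?E t' f'" unfolding E .
  have p: "u : $v \<longleftrightarrow> pair (ap f u) (ap f v) : ?E t f" if "u : $t" "v : $t" for u v
    using that t(2) by (auto simp: pair_inject inj_on_def)
  have p': "u : $v \<longleftrightarrow> pair (ap f' u) (ap f' v) : ?E t' f'" if "u : $t'" "v : $t'" for u v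
    using that t'(2) by (auto simp: pair_inject inj_on_def)
  have main: "u : $t --> (\<forall>u'\<in>$t'. ap f u = ap f' u' --> u = u')" for u
  proof (rule mem_induct[where Q = "%u. u : $t --> (\<forall>u'\<in>$t'. ap f u = ap f' u' --> u = u')"])
    show "defb (%e. e 0 : $t --> (\<forall>u'\<in>$t'. ap f (e 0) = ap f' u' --> e 0 = u'))" by (intro dfb)
    fix u assume IH: "!!v. v : $u ==> v : $t --> (\<forall>u'\<in>$t'. ap f v = ap f' u' --> v = u')"
    show "u : $t --> (\<forall>u'\<in>$t'. ap f u = ap f' u' --> u = u')"
    proof (intro impI ballI vsetI)
      fix u' assume u: "u : $t" "u' : $t'" "ap f u = ap f' u'"
      have 1: "v : $t" if "v : $u" for v using that u t(1) unfolding transitive_def by blast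
      have 2: "v : $t'" if "v : $u'" for v using that u t'(1) unfolding transitive_def by blast
      show "$u = $u'"
      proof (intro equalityI subsetI)
        fix v assume v: "v : $u"
        have "ap f v : ap f' ` $t'" using B 1[OF v] by blast
        then obtain v' where v': "v' : $t'" "ap f v = ap f' v'" by blast
        have "v = v'" using IH[OF v] 1[OF v] v' by blast
        moreover have "v' : $u'" using p[OF 1[OF v] u(1)] v p'[OF v'(1) u(2)] v'(2) u(3) EE by simp
        ultimately show "v : $u'" by simp
      next
        fix v' assume v': "v' : $u'"
        have "ap f' v' : ap f ` $t" using B 2[OF v'] by blast
        then obtain v where v: "v : $t" "ap f' v' = ap f v" by blast
        have vu: "v : $u" using p[OF v(1) u(1)] v' p'[OF 2[OF v'] u(2)] v(2) u(3) EE by simp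
        have "v = v'" using IH[OF vu] v 2[OF v'] by auto
        then show "v' : $u" using vu by simp
      qed
    qed
  qed
  fix u assume u: "u : $t"
  have "ap f u : ap f' ` $t'" using B u by blast
  then show "u : $t'" using main u by blast
qed

text \<open>All codes lie in one set, and a transitive set is recovered from its code, so
  replacement applies. Both \<open>card_succ\<close> and \<open>H\<close> owe their existence to
  this.\<close>

lemma isset_transitive_lepoll: "isset {t. transitive t & lepoll t k}"
proof -
  let ?I = "%t f. transitive t & (\<forall>x\<in>$t. ap f x : $k) & inj_on (ap f) ($t)"
  define C where "C = prod (pow k) (pow (prod k k))"
  define G where "G = (%c. vset {w. \<exists>t f. ?I t f & c = pcode t f & w : $t})"
  have dG: "deft (%e. G (e 0))" unfolding G_def by (intro dfb)
  have G: "G (pcode t f) = t" if "?I t f" for t f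
  proof -
    have "t' = t" if "?I t' f'" "pcode t f = pcode t' f'" for t' f'
      using pcode_subset[of t f t' f'] pcode_subset[of t' f' t f] that \<open>?I t f\<close> by (intro vsetI) auto
    then have "{w. \<exists>t' f'. ?I t' f' & pcode t f = pcode t' f' & w : $t'} = $t" using that by blast
    then show ?thesis unfolding G_def by simp
  qed
  have pc: "pcode t f : $C" if "?I t f" for t f
  proof -
    have d: "deft (%e. ap f (e 0))" by (intro dfb)
    have "$(vset {z. \<exists>u\<in>$t. \<exists>v\<in>$t. u : $v & z = pair (ap f u) (ap f v)}) = {z. \<exists>u\<in>$t. \<exists>v\<in>$t. u : $v & z = pair (ap f u) (ap f v)}"
      by (rule elts_vset, rule isset_bounded[where a = "prod k k"]) (intro dfb, use that in auto)
    then show ?thesis using that unfolding C_def pcode_def by (auto simp: elts_image[OF d])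
  qed
  show ?thesis
  proof (rule isset_subset[OF _ _ isset_image[OF dG, of C]])
    show "defb (%e. e 0 : {t. transitive t & lepoll t k})" unfolding mem_Collect_eq by (intro dfb)
    show "{t. transitive t & lepoll t k} <= G ` $C"
    proof
      fix t assume "t : {t. transitive t & lepoll t k}"
      then obtain f where "?I t f" unfolding lepoll_iff by blast
      then show "t : G ` $C" using G pc by (metis image_eqI)
    qed
  qed
qed

text \<open>Hartogs: the ordinals injecting into \<open>k\<close> form an initial segment, which
  cannot inject into \<open>k\<close> because it would then be an element of itself.\<close>

lemma card_succ_props:
  assumes "Ord k"
  shows elts_card_succ: "$(card_succ k) = {a. Ord a & lepoll a k}" and Ord_card_succ: "Ord (card_succ k)"
proof -
  define h where "h = vset {a. Ord a & lepoll a k}"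
  have "isset {a. Ord a & lepoll a k}"
    by (rule isset_subset[OF _ _ isset_transitive_lepoll[of k]]) 
      (unfold mem_Collect_eq, intro dfb, auto simp: Ord_def)
  then have h: "$h = {a. Ord a & lepoll a k}" unfolding h_def by (rule elts_vset)
  have oh: "Ord h"
  proof (rule Ord_transitiveI)
    show "transitive h"
      unfolding transitive_def h
    proof (intro ballI subsetI)
      fix x y assume "x : {a. Ord a & lepoll a k}" "y : $x"
      moreover have "$y <= $x" using calculation Ord_trans by blast
      ultimately show "y : {a. Ord a & lepoll a k}" using Ord_mem lepoll_trans[OF lepoll_subset] by blast
    qed
  qed (simp add: h)
  have nh: "\<not> lepoll h k" using h oh mem_irrefl[of h] by blast
  have "card_succ k = h"
    unfolding card_succ_def
  proof (rule the_equality)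
    show "Ord h & \<not> lepoll h k & (\<forall>b\<in>$h. lepoll b k)" using oh nh h by blast
    fix a assume a: "Ord a & \<not> lepoll a k & (\<forall>b\<in>$a. lepoll b k)"
    have "a \<notin> $h" using a h by blast
    moreover have "h \<notin> $a" using a nh by blast
    ultimately show "a = h" using Ord_linear a oh by blast
  qed
  then show "$(card_succ k) = {a. Ord a & lepoll a k}" "Ord (card_succ k)" using h oh by auto
qed

text \<open>A member of \<open>H l\<close> is a subset of its transitive closure, which is among the
  set of transitive sets injecting into \<open>l\<close>.\<close>

lemma elts_H: assumes "Ord l" shows "$(H l) = {x. card_less (trans_cl x) l}"
  unfolding H_def
proof (rule elts_vset)
  define ts where "ts = vset {t. transitive t & lepoll t l}"
  have ts: "$ts = {t. transitive t & lepoll t l}" unfolding ts_def by (rule elts_vset[OF isset_transitive_lepoll])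
  have d: "deft (%e. pow (e 0))" by (intro dfb)
  show "isset {x. card_less (trans_cl x) l}"
  proof (rule isset_subset[OF _ _ isset_UN[OF d, of ts]])
    show "defb (%e. e 0 : {x. card_less (trans_cl x) l})" unfolding mem_Collect_eq by (intro dfb)
    show "{x. card_less (trans_cl x) l} <= (\<Union>x\<in>$ts. $(pow x))"
    proof
      fix x assume "x : {x. card_less (trans_cl x) l}"
      then obtain b where b: "b : $l" "lepoll (trans_cl x) b" unfolding card_less_def by blast
      have "$b <= $l" using b(1) assms Ord_trans by blast
      then have "trans_cl x : $ts" unfolding ts using lepoll_trans[OF b(2) lepoll_subset] trans_cl_props(1) by blast
      moreover have "x : $(pow (trans_cl x))" using trans_cl_props(2) by simp
      ultimately show "x : (\<Union>x\<in>$ts. $(pow x))" by blast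
    qed
  qed
qed

subsection \<open>Ordinal addition and products of cardinals\<close>

definition add :: "'v \<Rightarrow> 'v \<Rightarrow> 'v" where
  "add x = rec (%j g. vset ($x \<union> $(vset (ap g ` $j))))"
lemma deft_add [dfb]: assumes "deft x" "deft j" shows "deft (%e. add (x e) (j e))"
  unfolding add_def by (intro dfb assms deft_ren[OF assms(1), of "%n. Suc (Suc n)"])
lemma elts_add: "$(add x j) = $x \<union> add x ` $j"
proof -
  have d: "deft (%e. vset ($x \<union> $(vset (ap (e 0) ` $(e (Suc 0))))))" by (intro dfb)
  have da: "deft (%e. ap g (e 0))" for g by (intro dfb)
  have d2: "deft (%e. add x (e 0))" by (intro dfb)
  have 1: "add x j = vset ($x \<union> $(vset (ap (lam j (add x)) ` $j)))"
    using rec_eq[OF d, of j] unfolding add_def by simp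
  have 2: "ap (lam j (add x)) ` $j = add x ` $j" using ap_lam[OF d2] by (intro image_cong) auto
  have "$(add x j) = $x \<union> $(vset (add x ` $j))"
    using 1 unfolding 2 by (metis elts_Un)
  then show ?thesis unfolding elts_image[OF d2] .
qed
lemma add_mono: "i : $j ==> add x i : $(add x j)" by (simp add: elts_add)
lemma add_ge: "$x <= $(add x j)" by (simp add: elts_add)
lemma add_inj: "Ord i ==> Ord j ==> add x i = add x j ==> i = j"
  using Ord_linear[of i j] add_mono[of i j x] add_mono[of j i x] by (metis mem_irrefl)
lemma add_zero [simp]: "add x zero = x" by (rule vsetI) (simp add: elts_add)
lemma add_succ: "add x (succ j) = succ (add x j)" by (rule vsetI) (auto simp: elts_add)
lemma Ord_add: assumes "Ord x" "Ord j" shows "Ord (add x j)"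
  using assms(2)
proof (induction rule: Ord_induct)
  case def show ?case by (intro dfb)
next
  case (less j)
  have "transitive (add x j)"
    unfolding transitive_def
  proof (intro ballI subsetI)
    fix y z assume y: "y : $(add x j)" "z : $y"
    show "z : $(add x j)"
    proof (cases "y : $x")
      case True then show ?thesis using y(2) Ord_trans[OF assms(1)] by (auto simp: elts_add)
    next
      case False
      then obtain i where i: "i : $j" "y = add x i" using y by (auto simp: elts_add)
      have "$i <= $j" using i(1) less(1) Ord_trans by blast
      then show ?thesis using y(2) unfolding i(2) elts_add by blast
    qed
  qed
  then show ?case
  proof (rule Ord_transitiveI)
    fix y assume "y : $(add x j)"
    then consider "y : $x" | i where "i : $j" "y = add x i" by (auto simp: elts_add)
    then show "Ord y" using less(2) Ord_mem[OF assms(1)] by cases auto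
  qed
qed
lemma add_omega: assumes "m : $omega" "n : $omega" shows "add m n : $omega"
  using assms(2)
proof (induction rule: omega_induct)
  case def show ?case by (intro dfb)
qed (simp_all add: add_succ assms(1))

text \<open>The transfinite ordinal sum of the \<open>f b\<close> for \<open>b\<close> below
  \<open>a\<close>. The blocks that start at \<open>stack f b\<close> and have length
  \<open>f b\<close> are disjoint, so addition inside blocks gives injections into ordinals.\<close>

definition stack :: "('v \<Rightarrow> 'v) \<Rightarrow> 'v \<Rightarrow> 'v" where
  "stack f = rec (%a g. vset (\<Union>b\<in>$a. $(add (ap g b) (f b))))"

context
  fixes f assumes f: "deft (%e. f (e 0))" and Of: "!!b. Ord b ==> Ord (f b)"
begin
lemma deft_stack: "deft t ==> deft (%e. stack f (t e))"
  unfolding stack_def by (intro dfb deft_subst[OF f])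
lemma elts_stack: "$(stack f a) = (\<Union>b\<in>$a. $(add (stack f b) (f b)))"
proof -
  have d: "deft (%e. vset (\<Union>b\<in>$(e (Suc 0)). $(add (ap (e 0) b) (f b))))" by (intro dfb deft_subst[OF f])
  have d2: "deft (%e. stack f (e 0))" by (intro deft_stack dfb)
  have d3: "deft (%e. add (stack f (e 0)) (f (e 0)))" by (intro dfb deft_subst[OF f] deft_stack)
  have "stack f a = vset (\<Union>b\<in>$a. $(add (ap (lam a (stack f)) b) (f b)))"
    using rec_eq[OF d, of a] unfolding stack_def by simp
  also have "\<dots> = vset (\<Union>b\<in>$a. $(add (stack f b) (f b)))" using ap_lam[OF d2] by simp
  finally show ?thesis by (simp add: elts_UN[OF d3])
qed
lemma Ord_stack: assumes "Ord a" shows "Ord (stack f a)"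
  using assms
proof (induction rule: Ord_induct)
  case def show ?case by (intro dfb deft_stack)
next
  case (less a)
  then have *: "Ord (add (stack f b) (f b))" if "b : $a" for b using that Ord_add Of Ord_mem by blast
  have "transitive (stack f a)" unfolding transitive_def elts_stack using * Ord_trans by blast
  then show ?case
  proof (rule Ord_transitiveI)
    fix y assume "y : $(stack f a)"
    then obtain b where "b : $a" "y : $(add (stack f b) (f b))" by (auto simp: elts_stack)
    then show "Ord y" using Ord_mem[OF *] by blast
  qed
qed
lemma stack_inj:
  assumes "Ord b" "Ord b'" "j : $(f b)" "j' : $(f b')" "add (stack f b) j = add (stack f b') j'"
  shows "b = b' & j = j'"
proof -
  have lt: "add (stack f b) j : $(add (stack f b') j')" if "b : $b'" "j : $(f b)" for b b' j j'
  proof -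
    have "add (stack f b) j : $(stack f b')" unfolding elts_stack using that add_mono by blast
    then show ?thesis using add_ge by blast
  qed
  have "b = b'" using Ord_linear[OF assms(1,2)] lt[of b b' j j'] lt[of b' b j' j] assms(3-5) by (metis mem_irrefl)
  moreover have "Ord j" "Ord j'" using assms Of Ord_mem by blast+
  ultimately show ?thesis using add_inj assms(5) by blast
qed
end

definition fstp :: "'v \<Rightarrow> 'v" where "fstp z = vset {w. \<exists>x y. z = pair x y & w : $x}"
definition sndp :: "'v \<Rightarrow> 'v" where "sndp z = vset {w. \<exists>x y. z = pair x y & w : $y}"
lemma fstp [simp]: "fstp (pair x y) = x" by (simp add: fstp_def pair_inject)
lemma sndp [simp]: "sndp (pair x y) = y" by (simp add: sndp_def pair_inject)
lemma deft_fstp [dfb]: "deft t ==> deft (%e. fstp (t e))"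
  by (rule deft_subst[where F = fstp]) (unfold fstp_def, intro dfb)
lemma deft_sndp [dfb]: "deft t ==> deft (%e. sndp (t e))"
  by (rule deft_subst[where F = sndp]) (unfold sndp_def, intro dfb)

lemma lepoll_prodI:
  assumes F: "deft (%e. F (e 0) (e 1))" and "!!x y. x : $a ==> y : $b ==> F x y : $c"
    and "!!x y x' y'. x : $a ==> y : $b ==> x' : $a ==> y' : $b ==> F x y = F x' y' ==> x = x' & y = y'"
  shows "lepoll (prod a b) c"
proof (rule lepollI[where F = "%z. F (fstp z) (sndp z)"])
  show "deft (%e. F (fstp (e 0)) (sndp (e 0)))" by (rule deft_subst2[OF F]) (intro dfb)+
qed (use assms(2,3) in \<open>auto simp: elts_prod pair_inject\<close>)

text \<open>Only the square of \<open>omega\<close>, \<open>omega1\<close> and \<open>omega2\<close>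
  is ever needed, so idempotence is taken as the working notion of an infinite cardinality and
  carried from \<open>omega\<close> upwards by \<open>idem_card_succ\<close>.\<close>

definition idem :: "'v \<Rightarrow> bool" where
  "idem k \<longleftrightarrow> Ord k & $omega <= $k & lepoll (prod k k) k"

text \<open>The Cantor pairing function: the diagonal on which \<open>add m n\<close> is constant
  gets a block with one more place than that sum, and \<open>m\<close> is the position in the
  block.\<close>

lemma idem_omega: "idem omega"
proof -
  have f: "deft (%e. succ (e 0))" by (intro dfb)
  have nat: "n : $omega ==> Ord n" for n using Ord_mem Ord_omega by blast
  have st: "stack succ n : $omega" if "n : $omega" for n
    using that
  proof (induction rule: omega_induct)
    case def show ?case by (intro dfb deft_stack f Ord_succ)
  next
    case zero
    have "stack succ zero = zero" by (rule vsetI) (simp add: elts_stack[OF f Ord_succ])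
    then show ?case by simp
  next
    case (succ n)
    have "stack succ (succ n) = add (stack succ n) (succ n)"
    proof (rule vsetI)
      have "(\<Union>b\<in>$n. $(add (stack succ b) (succ b))) <= $(add (stack succ n) (succ n))"
        using add_ge[of "stack succ n" "succ n"] elts_stack[OF f Ord_succ, of n] by simp
      moreover have "$(stack succ (succ n)) = (\<Union>b\<in>insert n ($n). $(add (stack succ b) (succ b)))"
        using elts_stack[OF f Ord_succ, of "succ n"] by (simp only: elts_succ)
      ultimately show "$(stack succ (succ n)) = $(add (stack succ n) (succ n))" by auto
    qed
    then show ?case using add_omega succ by simp
  qed
  have "lepoll (prod omega omega) omega"
  proof (rule lepoll_prodI[where F = "%m n. add (stack succ (add m n)) m"])
    show "deft (%e. add (stack succ (add (e 0) (e 1))) (e 0))" by (intro dfb deft_stack f Ord_succ)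
    show "add (stack succ (add m n)) m : $omega" if "m : $omega" "n : $omega" for m n
      by (intro add_omega st that)
    show "m = m' & n = n'" if "m : $omega" "n : $omega" "m' : $omega" "n' : $omega"
      "add (stack succ (add m n)) m = add (stack succ (add m' n')) m'" for m n m' n'
    proof -
      have *: "m : $(succ (add m n))" if "m : $omega" "n : $omega" for m n
        using add_ge[of m n] Ord_subset_iff[of m "add m n"] nat[OF that(1)] nat[OF add_omega[OF that]] by auto
      have "add m n = add m' n' & m = m'"
        by (rule stack_inj[OF f Ord_succ]) (use that * nat add_omega in auto)
      then show ?thesis using add_inj that nat by blast
    qed
  qed
  then show ?thesis unfolding idem_def by simp
qed

text \<open>Injections are chosen for the indices, which are numbered in \<open>k\<close>. An
  element is coded by the least number of an index whose set contains it, followed by its value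
  under the injection of that index.\<close>

lemma lepoll_UN:
  assumes k: "idem k" and F: "deft (%e. F (e 0))" and I: "lepoll I k" and "!!i. i : $I ==> lepoll (F i) k"
  shows "lepoll (vset (\<Union>i\<in>$I. $(F i))) k"
proof -
  define U where "U = vset (\<Union>i\<in>$I. $(F i))"
  have U: "$U = (\<Union>i\<in>$I. $(F i))" unfolding U_def by (rule elts_UN[OF F])
  obtain f where f: "!!x. x : $I ==> ap f x : $k" "!!x y. x : $I ==> y : $I ==> ap f x = ap f y ==> x = y"
    using lepollE[OF I] by metis
  have "\<exists>G. func G k (pow (prod U k)) & (\<forall>z\<in>$k. \<forall>i\<in>$I. ap f i = z --> (\<forall>x\<in>$(F i). ap (ap G z) x : $k) & inj_on (ap (ap G z)) ($(F i)))"
  proof (rule choice_func[where Q = "%z g. \<forall>i\<in>$I. ap f i = z --> (\<forall>x\<in>$(F i). ap g x : $k) & inj_on (ap g) ($(F i))"])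
    show "defb (%e. \<forall>i\<in>$I. ap f i = e 0 --> (\<forall>x\<in>$(F i). ap (e 1) x : $k) & inj_on (ap (e 1)) ($(F i)))"
      by (intro dfb deft_subst[OF F])
    fix z assume z: "z : $k"
    show "\<exists>g\<in>$(pow (prod U k)). \<forall>i\<in>$I. ap f i = z --> (\<forall>x\<in>$(F i). ap g x : $k) & inj_on (ap g) ($(F i))"
    proof (cases "\<exists>i\<in>$I. ap f i = z")
      case True
      then obtain i where i: "i : $I" "ap f i = z" by blast
      have "$(F i) <= $U" using i U by blast
      from lepollE_pow[OF assms(4)[OF i(1)] this] obtain g where 
        g: "g : $(pow (prod U k))" "\<forall>x\<in>$(F i). ap g x : $k" "inj_on (ap g) ($(F i))" by blast
      have "i' = i" if "i' : $I" "ap f i' = z" for i' using f(2) i that by blast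
      then show ?thesis using g by (intro bexI[of _ g]) blast+
    next
      case False
      then show ?thesis by (intro bexI[of _ zero]) auto
    qed
  qed
  then obtain G where G0: "func G k (pow (prod U k)) & (\<forall>z\<in>$k. \<forall>i\<in>$I. ap f i = z --> (\<forall>x\<in>$(F i). ap (ap G z) x : $k) & inj_on (ap (ap G z)) ($(F i)))"
    by (rule exE)
  have G: "(\<forall>x\<in>$(F i). ap (ap G (ap f i)) x : $k) & inj_on (ap (ap G (ap f i))) ($(F i))" if "i : $I" for i
    by (rule conjunct2[OF G0, rule_format]) (use f that in auto)
  let ?Q = "%x z. \<exists>i\<in>$I. ap f i = z & x : $(F i)"
  have Ok: "Ord k" using k unfolding idem_def by blast
  have dQ: "defb (%e. ?Q x (e 0))" for x by (intro dfb deft_subst[OF F])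
  have o: "\<exists>i\<in>$I. ap f i = oleast (?Q x) & x : $(F i)" if x: "x : $U" for x
  proof -
    obtain i where "i : $I" "x : $(F i)" using x U by blast
    then have "?Q x (ap f i)" "ap f i : $k" using f by auto
    from oleast_mem(2)[OF dQ Ok this] show ?thesis .
  qed
  have "lepoll U (prod k k)"
  proof (rule lepollI[where F = "%x. pair (oleast (?Q x)) (ap (ap G (oleast (?Q x))) x)"])
    show "deft (%e. pair (oleast (?Q (e 0))) (ap (ap G (oleast (?Q (e 0)))) (e 0)))" by (intro dfb deft_subst[OF F])
    fix x assume "x : $U"
    then obtain i where i: "i : $I" "ap f i = oleast (?Q x)" "x : $(F i)" using o[of x] by auto
    then show "pair (oleast (?Q x)) (ap (ap G (oleast (?Q x))) x) : $(prod k k)"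
      using conjunct1[OF G[OF i(1)]] f(1)[OF i(1)] unfolding i(2) pair_in_prod by blast
  next
    fix x y assume x: "x : $U" and y: "y : $U" 
      and eq: "pair (oleast (?Q x)) (ap (ap G (oleast (?Q x))) x) = pair (oleast (?Q y)) (ap (ap G (oleast (?Q y))) y)"
    obtain i where i: "i : $I" "ap f i = oleast (?Q x)" "x : $(F i)" using o[OF x] by blast
    obtain j where j: "j : $I" "ap f j = oleast (?Q y)" "y : $(F j)" using o[OF y] by blast
    have e: "oleast (?Q x) = oleast (?Q y)" "ap (ap G (oleast (?Q x))) x = ap (ap G (oleast (?Q y))) y"
      using eq unfolding pair_inject by blast+
    have "i = j" using f(2)[OF i(1) j(1)] i(2) j(2) e(1) by simp
    then show "x = y" using conjunct2[OF G[OF i(1)]] e(2) i(2,3) j(2,3) e(1) unfolding inj_on_def by simp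
  qed
  then show ?thesis using lepoll_trans k unfolding U_def idem_def by blast
qed

lemma idem_Ord: "idem k ==> Ord k" unfolding idem_def by blast
lemma idem_upair: assumes "idem k" shows "lepoll (vset {x, y}) k"
proof (rule lepollI[where F = "%z. if z = x then zero else succ zero"])
  show "deft (%e. if e 0 = x then zero else succ zero)" by (intro dfb)
  show "(if z = x then zero else succ zero) : $k" for z
    using assms zero_omega succ_omega[OF zero_omega] unfolding idem_def by auto
  show "z = w" if "z : $(vset {x, y})" "w : $(vset {x, y})" "(if z = x then zero else succ zero) = (if w = x then zero else succ zero)" for z w
  proof -
    have "zero \<noteq> succ zero" using elts_succ[of zero] elts_zero by (metis insert_not_empty)
    then show ?thesis using that by (auto split: if_splits)
  qed
qed
lemma lepoll_Un: assumes "idem k" "lepoll a k" "lepoll b k" shows "lepoll (vset ($a \<union> $b)) k"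
proof -
  have "lepoll (vset (\<Union>i\<in>$(vset {a, b}). $i)) k"
    by (rule lepoll_UN[OF assms(1) deft_var[of 0] idem_upair[OF assms(1)]]) (use assms in auto)
  then show ?thesis by simp
qed
lemma lepoll_succ: assumes "idem k" "lepoll a k" shows "lepoll (succ a) k"
  using lepoll_Un[OF assms(1) idem_upair[OF assms(1), of a a] assms(2)] by (simp add: succ_def)
lemma idem_lepoll_omega: "idem k ==> lepoll omega k" unfolding idem_def by (blast intro: lepoll_subset)

text \<open>Ordinal multiplication by \<open>m\<close>, realized by \<open>stack\<close> with
  constant blocks, embeds the product of \<open>card_succ m\<close> and \<open>m\<close> into
  \<open>card_succ m\<close>. A pair of ordinals is then coded by its maximum and by the two places
  in \<open>m\<close> under a chosen injection of the successor of that maximum.\<close>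

lemma idem_card_succ: assumes m: "idem m" shows "idem (card_succ m)"
proof -
  let ?k = "card_succ m"
  have Om: "Ord m" using m idem_Ord by blast
  have k: "$?k = {a. Ord a & lepoll a m}" by (rule elts_card_succ[OF Om])
  have f: "deft (%e::nat \<Rightarrow> 'v. m)" by (rule deft_const)
  have df: "deft (%e. stack (%b. m) (e 0))" by (rule deft_stack[OF f Om deft_var])
  have ad: "lepoll (add x j) m" if "lepoll x m" "lepoll j m" for x j
  proof -
    have d: "deft (%e. add x (e 0))" by (intro dfb)
    have "lepoll (vset (add x ` $j)) m"
      by (rule lepoll_image[OF d _ that(2) Om]) (auto simp: elts_image[OF d])
    moreover have "add x j = vset ($x \<union> $(vset (add x ` $j)))"
      by (rule vsetI) (metis elts_add elts_Un elts_image[OF d])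
    ultimately show ?thesis using lepoll_Un[OF m that(1)] by simp
  qed
  have st: "a : $?k --> lepoll (stack (%b. m) a) m" for a
  proof (rule mem_induct[where Q = "%a. a : $?k --> lepoll (stack (%b. m) a) m"])
    show "defb (%e. e 0 : $?k --> lepoll (stack (%b. m) (e 0)) m)" by (intro dfb df)
    fix a assume IH: "!!b. b : $a ==> b : $?k --> lepoll (stack (%b. m) b) m"
    show "a : $?k --> lepoll (stack (%b. m) a) m"
    proof
      assume a: "a : $?k"
      have d: "deft (%e. add (stack (%b. m) (e 0)) m)" by (intro dfb df)
      have "lepoll (vset (\<Union>b\<in>$a. $(add (stack (%b. m) b) m))) m"
      proof (rule lepoll_UN[OF m d])
        show "lepoll a m" using a k by blast
        fix b assume b: "b : $a"
        then have "b : $?k" using a Ord_card_succ[OF Om] Ord_trans by blast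
        then show "lepoll (add (stack (%b. m) b) m) m" using IH[OF b] by (intro ad) auto
      qed
      moreover have "stack (%b. m) a = vset (\<Union>b\<in>$a. $(add (stack (%b. m) b) m))"
        by (rule vsetI) (simp add: elts_UN[OF d] elts_stack[OF f Om])
      ultimately show "lepoll (stack (%b. m) a) m" by simp
    qed
  qed
  have km: "lepoll (prod ?k m) ?k"
  proof (rule lepoll_prodI[where F = "%a j. add (stack (%b. m) a) j"])
    show "deft (%e. add (stack (%b. m) (e 0)) (e 1))" by (intro dfb df)
    show "add (stack (%b. m) a) j : $?k" if "a : $?k" "j : $m" for a j
    proof -
      have "Ord j" "$j <= $m" using that(2) Om Ord_mem Ord_trans by blast+
      then show ?thesis using that st ad[of "stack (%b. m) a" j] lepoll_subset[of j m] Ord_add Ord_stack[OF f Om] unfolding k by blast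
    qed
    show "a = a' & j = j'" if "a : $?k" "j : $m" "a' : $?k" "j' : $m"
      "add (stack (%b. m) a) j = add (stack (%b. m) a') j'" for a j a' j'
      by (rule stack_inj[OF f Om]) (use that k in auto)
  qed
  have Ok: "Ord ?k" by (rule Ord_card_succ[OF Om])
  have "\<exists>G. func G ?k (pow (prod ?k m)) & (\<forall>a\<in>$?k. (\<forall>x\<in>$(succ a). ap (ap G a) x : $m) & inj_on (ap (ap G a)) ($(succ a)))"
  proof (rule choice_func[where Q = "%a g. (\<forall>x\<in>$(succ a). ap g x : $m) & inj_on (ap g) ($(succ a))"])
    show "defb (%e. (\<forall>x\<in>$(succ (e 0)). ap (e 1) x : $m) & inj_on (ap (e 1)) ($(succ (e 0))))" by (intro dfb)
    fix a assume a: "a : $?k"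
    have "$(succ a) <= $?k" using a Ok Ord_trans by auto
    then show "\<exists>g\<in>$(pow (prod ?k m)). (\<forall>x\<in>$(succ a). ap g x : $m) & inj_on (ap g) ($(succ a))"
      using lepollE_pow[OF lepoll_succ[OF m]] a k by blast
  qed
  then obtain G where G0: "func G ?k (pow (prod ?k m)) & (\<forall>a\<in>$?k. (\<forall>x\<in>$(succ a). ap (ap G a) x : $m) & inj_on (ap (ap G a)) ($(succ a)))"
    by (rule exE)
  have G: "!!a x. a : $?k ==> x : $(succ a) ==> ap (ap G a) x : $m"
    "!!a. a : $?k ==> inj_on (ap (ap G a)) ($(succ a))" using conjunct2[OF G0] by blast+
  let ?mx = "%a b. vset ($a \<union> $b)"
  have mx: "?mx a b : $?k" "a : $(succ (?mx a b))" "b : $(succ (?mx a b))" if ab: "a : $?k" "b : $?k" for a b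
  proof -
    have o: "Ord a" "Ord b" using ab k by auto
    have "?mx a b = a & (b = a \<or> b : $a) \<or> ?mx a b = b & (a = b \<or> a : $b)"
      using Ord_subset_cases[OF o] Ord_subset_iff[OF o] Ord_subset_iff[OF o(2,1)]
      by (metis sup.absorb1 sup.absorb2 vset_elts)
    then show "?mx a b : $?k" "a : $(succ (?mx a b))" "b : $(succ (?mx a b))" using ab by auto
  qed
  have "lepoll (prod ?k ?k) (prod ?k (prod m m))"
  proof (rule lepoll_prodI[where F = "%a b. pair (?mx a b) (pair (ap (ap G (?mx a b)) a) (ap (ap G (?mx a b)) b))"])
    show "deft (%e. pair (?mx (e 0) (e 1)) (pair (ap (ap G (?mx (e 0) (e 1))) (e 0)) (ap (ap G (?mx (e 0) (e 1))) (e 1))))"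
      by (intro dfb)
    show "pair (?mx a b) (pair (ap (ap G (?mx a b)) a) (ap (ap G (?mx a b)) b)) : $(prod ?k (prod m m))"
      if "a : $?k" "b : $?k" for a b
      unfolding pair_in_prod using mx[OF that] G(1)[of "?mx a b"] by blast
    show "a = a' & b = b'" if "a : $?k" "b : $?k" "a' : $?k" "b' : $?k"
      "pair (?mx a b) (pair (ap (ap G (?mx a b)) a) (ap (ap G (?mx a b)) b)) = pair (?mx a' b') (pair (ap (ap G (?mx a' b')) a') (ap (ap G (?mx a' b')) b'))" for a b a' b'
    proof -
      have e: "?mx a b = ?mx a' b'" "ap (ap G (?mx a b)) a = ap (ap G (?mx a b)) a'" "ap (ap G (?mx a b)) b = ap (ap G (?mx a b)) b'"
        using that(5) unfolding pair_inject by auto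
      note i = G(2)[OF mx(1)[OF that(1,2)], unfolded inj_on_def]
      show ?thesis using i e mx[OF that(1,2)] mx[OF that(3,4), folded e(1)] by blast
    qed
  qed
  moreover have "lepoll (prod ?k (prod m m)) (prod ?k m)"
    by (rule lepoll_prod) (use m in \<open>auto simp: idem_def\<close>)
  ultimately have "lepoll (prod ?k ?k) ?k" using km lepoll_trans by blast
  moreover have "$omega <= $?k"
  proof
    fix n assume n: "n : $omega"
    then have "n : $m" using m unfolding idem_def by blast
    then have "Ord n" "$n <= $m" using Om Ord_mem Ord_trans by blast+
    then show "n : $?k" using k lepoll_subset by blast
  qed
  ultimately show ?thesis unfolding idem_def using Ok by blast
qed

section \<open>The first two uncountable cardinals\<close>

declare elts_vset [simp] isset_insert [simp] isset_Un [simp]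

lemma elts_omega1: "$omega1 = {a. Ord a & ctbl a}"
  unfolding omega1_def ctbl_def by (rule elts_card_succ[OF Ord_omega])
lemma Ord_omega1 [simp]: "Ord omega1" unfolding omega1_def by (rule Ord_card_succ[OF Ord_omega])
lemma elts_omega2: "$omega2 = {a. Ord a & lepoll a omega1}"
  unfolding omega2_def by (rule elts_card_succ[OF Ord_omega1])
lemma Ord_omega2 [simp]: "Ord omega2" unfolding omega2_def by (rule Ord_card_succ[OF Ord_omega1])
lemma idem_omega1: "idem omega1" unfolding omega1_def by (rule idem_card_succ[OF idem_omega])
lemma idem_omega2: "idem omega2" unfolding omega2_def by (rule idem_card_succ[OF idem_omega1])
lemma omega_omega1 [simp]: "omega : $omega1" unfolding elts_omega1 ctbl_def by simp
lemma omega1_omega2 [simp]: "omega1 : $omega2" unfolding elts_omega2 by simp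
lemma omega_omega2 [simp]: "omega : $omega2" using Ord_trans[OF Ord_omega2 omega_omega1 omega1_omega2] .
lemma omega_sub_omega1: "$omega <= $omega1" using Ord_trans[OF Ord_omega1 _ omega_omega1] by blast
lemma omega1_sub_omega2: "$omega1 <= $omega2" using Ord_trans[OF Ord_omega2 _ omega1_omega2] by blast
lemma omega1_lepoll_omega2: "lepoll omega1 omega2" by (rule lepoll_subset[OF omega1_sub_omega2])
lemma ctbl_lepoll_omega1: "ctbl x ==> lepoll x omega1"
  unfolding ctbl_def using lepoll_trans lepoll_subset[OF omega_sub_omega1] by blast
lemma ctbl_subset: "ctbl x ==> $y <= $x ==> ctbl y"
  unfolding ctbl_def using lepoll_trans lepoll_subset by blast
lemma not_ctbl_omega1: "\<not> ctbl omega1"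
  using elts_omega1 mem_irrefl[of omega1] by auto
lemma ctbl_image: "deft (%e. F (e 0)) ==> ctbl x ==> ctbl (vset (F ` $x))"
  unfolding ctbl_def using lepoll_image[of F "vset (F ` $x)" x omega] by (auto simp: elts_image)
lemma ctbl_UN: "deft (%e. F (e 0)) ==> ctbl x ==> (!!i. i : $x ==> ctbl (F i)) ==> ctbl (vset (\<Union>i\<in>$x. $(F i)))"
  unfolding ctbl_def by (rule lepoll_UN[OF idem_omega])
lemma ctbl_Un: "ctbl x ==> ctbl y ==> ctbl (vset ($x \<union> $y))"
  unfolding ctbl_def by (rule lepoll_Un[OF idem_omega])
lemma ctbl_upair: "ctbl (vset {x, y})"
  unfolding ctbl_def by (rule idem_upair[OF idem_omega])

text \<open>Uncountable regularity in its covering form. The arguments about stationary sets use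
  \<open>omega1\<close> and \<open>omega2\<close> through this property, so they are carried out
  once for both.\<close>

definition bnd :: "'v \<Rightarrow> bool" where
  "bnd k \<longleftrightarrow> Limit k & omega : $k &
     (\<forall>A. $A <= $k & (\<exists>a\<in>$k. lepoll A a) --> (\<exists>b\<in>$k. $A <= $b))"

lemma bnd_Ord: "bnd k ==> Ord k" unfolding bnd_def Limit_def by blast
lemma bnd_succ: "bnd k ==> a : $k ==> succ a : $k" unfolding bnd_def using Limit_succ by blast
lemma bnd_zero: "bnd k ==> zero : $k" unfolding bnd_def using Limit_zero by blast
lemma bndD: "bnd k ==> $A <= $k ==> a : $k ==> lepoll A a ==> \<exists>b\<in>$k. $A <= $b"
  unfolding bnd_def by blast
lemma bnd_image:
  assumes k: "bnd k" and F: "deft (%e. F (e 0))" and "lepoll I a" "a : $k" "!!i. i : $I ==> F i : $k"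
  shows "\<exists>b\<in>$k. \<forall>i\<in>$I. F i : $b"
proof -
  have "lepoll (vset (F ` $I)) a"
    by (rule lepoll_image[OF F _ assms(3) Ord_mem[OF bnd_Ord[OF k] assms(4)]]) (auto simp: elts_image[OF F])
  from bndD[OF k _ assms(4) this] show ?thesis using assms(5) unfolding elts_image[OF F] by (simp add: image_subset_iff)
qed
lemma bnd_card_succ: assumes m: "idem m" shows "bnd (card_succ m)"
proof -
  let ?k = "card_succ m"
  have Om: "Ord m" using m idem_Ord by blast
  have k: "$?k = {a. Ord a & lepoll a m}" by (rule elts_card_succ[OF Om])
  have Ok: "Ord ?k" by (rule Ord_card_succ[OF Om])
  have "succ x : $?k" if "x : $?k" for x using that lepoll_succ[OF m] k by simp
  moreover have "omega : $?k" using idem_lepoll_omega[OF m] k by simp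
  moreover have "\<exists>b\<in>$?k. $A <= $b" if A: "$A <= $?k" "a : $?k" "lepoll A a" for A a
  proof -
    have Am: "lepoll A m" using A lepoll_trans k by blast
    have "lepoll (vset (\<Union>i\<in>$A. $i)) m"
      by (rule lepoll_UN[OF m deft_var[of 0] Am]) (use A(1) k in blast)
    moreover have "vset (\<Union>i\<in>$A. $i) = union A" by (rule vsetI) (metis elts_union vset_elts)
    moreover have "Ord (union A)" using Ord_union A(1) k by blast
    ultimately have "succ (union A) : $?k" using lepoll_succ[OF m] k by simp
    moreover have "$A <= $(succ (union A))"
    proof
      fix x assume x: "x : $A"
      then have "$x <= $(union A)" by auto
      moreover have "Ord x" using x A(1) k by blast
      ultimately show "x : $(succ (union A))" using Ord_subset_iff[of x "union A"] \<open>Ord (union A)\<close> unfolding elts_succ by blast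
    qed
    ultimately show ?thesis by blast
  qed
  ultimately show ?thesis unfolding bnd_def Limit_def using Ok elts_succ by (metis empty_iff insertI1)
qed
lemma bnd_omega1: "bnd omega1" unfolding omega1_def by (rule bnd_card_succ[OF idem_omega])
lemma bnd_omega2: "bnd omega2" unfolding omega2_def by (rule bnd_card_succ[OF idem_omega1])

lemma ctbl_bounded_omega1: "$c <= $omega1 ==> ctbl c ==> \<exists>b\<in>$omega1. $c <= $b"
  using bndD[OF bnd_omega1 _ omega_omega1] unfolding ctbl_def by blast
lemma bounded_omega2: "$c <= $omega2 ==> lepoll c omega1 ==> \<exists>b\<in>$omega2. $c <= $b"
  using bndD[OF bnd_omega2 _ omega1_omega2] by blast

lemma Un_Ord: assumes "Ord a" "Ord b" shows "vset ($a \<union> $b) = a \<or> vset ($a \<union> $b) = b"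
  using Ord_subset_cases[OF assms] by (metis sup.absorb1 sup.absorb2 vset_elts)

subsection \<open>Closing off under set-valued functions\<close>

text \<open>A Skolem hull with \<open>omega\<close> many stages. The functions are set-valued, so
  that one function can collect a countable set of values at a time.\<close>

lemma closure_exists:
  assumes k: "idem k" and g: "deft (%e. g (e 0) (e 1))" and X: "lepoll X k" "$X <= $A"
    and gk: "!!x y. x : $A ==> y : $A ==> lepoll (g x y) k & $(g x y) <= $A"
  shows "\<exists>Q. $X <= $Q & $Q <= $A & lepoll Q k & (\<forall>x\<in>$Q. \<forall>y\<in>$Q. $(g x y) <= $Q)"
proof -
  define step where "step Q = vset ($Q \<union> $(vset (\<Union>x\<in>$Q. $(vset (\<Union>y\<in>$Q. $(g x y))))))" for Q
  have g1: "deft (%e. g x (e 0))" for x by (rule deft_subst2[OF g]) (intro dfb)+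
  have g2: "deft (%e. vset (\<Union>y\<in>$Q. $(g (e 0) y)))" for Q by (intro dfb deft_subst2[OF g])
  have ds: "deft (%e. step (e 0))" unfolding step_def by (intro dfb deft_subst2[OF g])
  have step: "$(step Q) = $Q \<union> (\<Union>x\<in>$Q. \<Union>y\<in>$Q. $(g x y))" for Q
  proof -
    have "$(vset (\<Union>x\<in>$Q. $(vset (\<Union>y\<in>$Q. $(g x y))))) = (\<Union>x\<in>$Q. $(vset (\<Union>y\<in>$Q. $(g x y))))"
      by (rule elts_UN[OF g2])
    also have "\<dots> = (\<Union>x\<in>$Q. \<Union>y\<in>$Q. $(g x y))" unfolding elts_UN[OF g1] ..
    finally show ?thesis unfolding step_def elts_Un by simp
  qed
  have stepk: "lepoll (step Q) k" if "lepoll Q k" "$Q <= $A" for Q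
    unfolding step_def
    by (intro lepoll_Un[OF k] lepoll_UN[OF k g2] lepoll_UN[OF k g1]) (use that gk in blast)+
  have stepA: "$(step Q) <= $A" if "$Q <= $A" for Q
    unfolding step using that gk by blast
  \<comment> \<open>Each stage closes off all earlier stages at once. This makes the stages
    increasing and the recursion uniform, with no distinction between zero and successors.\<close>
  define F where "F n s = vset ($X \<union> $(vset (\<Union>m\<in>$n. $(step (ap s m)))))" for n s
  have F: "deft (%e. F (e (Suc 0)) (e 0))" unfolding F_def by (intro dfb deft_subst[OF ds])
  have dr: "deft (%e. step (rec F (e 0)))" by (intro deft_subst[OF ds] deft_rec'[OF F] dfb)
  have dr0: "deft (%e. rec F (e 0))" by (intro deft_rec'[OF F] dfb)
  have r: "rec F n = vset ($X \<union> $(vset (\<Union>m\<in>$n. $(step (rec F m)))))" for n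
  proof -
    have Fa: "F n s = vset ($X \<union> $(vset (\<Union>m\<in>$n. $(step (ap s m)))))" for n s by (simp only: F_def)
    have "rec F n = F n (lam n (rec F))" by (rule rec_eq[OF F])
    also have "\<dots> = vset ($X \<union> $(vset (\<Union>m\<in>$n. $(step (ap (lam n (rec F)) m)))))" by (rule Fa)
    also have "(\<Union>m\<in>$n. $(step (ap (lam n (rec F)) m))) = (\<Union>m\<in>$n. $(step (rec F m)))"
      by (rule SUP_cong[OF refl]) (simp only: ap_lam[OF dr0])
    finally show ?thesis .
  qed
  have re: "$(rec F n) = $X \<union> (\<Union>m\<in>$n. $(step (rec F m)))" for n
    using arg_cong[OF r[of n], of elts] by (simp add: isset_UN[OF dr])
  have P: "n : $omega --> lepoll (rec F n) k & $(rec F n) <= $A" for n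
  proof (rule mem_induct[where Q = "%n. n : $omega --> lepoll (rec F n) k & $(rec F n) <= $A"])
    show "defb (%e. e 0 : $omega --> lepoll (rec F (e 0)) k & $(rec F (e 0)) <= $A)"
      by (intro dfb deft_rec'[OF F])
    fix n assume IH: "!!m. m : $n ==> m : $omega --> lepoll (rec F m) k & $(rec F m) <= $A"
    show "n : $omega --> lepoll (rec F n) k & $(rec F n) <= $A"
    proof (intro impI conjI)
      assume n: "n : $omega"
      have mo: "m : $omega" if "m : $n" for m using that n Ord_trans[OF Ord_omega] by blast
      have "lepoll n k" using mo lepoll_trans[OF lepoll_subset idem_lepoll_omega[OF k]] by blast
      then have "lepoll (vset (\<Union>m\<in>$n. $(step (rec F m)))) k"
        by (rule lepoll_UN[OF k dr]) (use IH mo stepk in blast)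
      then show "lepoll (rec F n) k" unfolding r[of n] by (rule lepoll_Un[OF k X(1)])
      show "$(rec F n) <= $A" unfolding re[of n] using X(2) IH mo stepA by blast
    qed
  qed
  define Q where "Q = vset (\<Union>n\<in>$omega. $(rec F n))"
  have Q: "$Q = (\<Union>n\<in>$omega. $(rec F n))" unfolding Q_def by (rule elts_UN[OF dr0])
  have mono: "$(rec F m) <= $(rec F n)" if "$m <= $n" for m n using that re[of m] re[of n] by auto
  show ?thesis
  proof (intro exI[of _ Q] conjI ballI)
    show "$X <= $Q" unfolding Q using re zero_omega by blast
    show "$Q <= $A" unfolding Q using P by blast
    show "lepoll Q k" unfolding Q_def using P by (intro lepoll_UN[OF k dr0] idem_lepoll_omega[OF k]) blast
    fix x y assume x: "x : $Q" and y: "y : $Q"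
    obtain m where m: "m : $omega" "x : $(rec F m)" using x Q by blast
    obtain n where n: "n : $omega" "y : $(rec F n)" using y Q by blast
    obtain p where p: "p : $omega" "$m <= $p" "$n <= $p"
      using m(1) n(1) Ord_subset_cases[of m n] Ord_mem[OF Ord_omega] by blast
    have "x : $(rec F p)" "y : $(rec F p)" using mono p m n by blast+
    then have "$(g x y) <= $(step (rec F p))" unfolding step by blast
    also have "\<dots> <= $(rec F (succ p))" unfolding re[of "succ p"] elts_succ by blast
    also have "\<dots> <= $Q" unfolding Q using succ_omega[OF p(1)] by blast
    finally show "$(g x y) <= $Q" .
  qed
qed

subsection \<open>Stationary sets\<close>

text \<open>Stationarity is phrased with functions instead of clubs: the closure points of functions
  generate the club filter, and diagonal intersections become trivial.\<close>

definition closed_pt :: "('v \<Rightarrow> 'v \<Rightarrow> 'v) \<Rightarrow> 'v \<Rightarrow> bool" where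
  "closed_pt F x \<longleftrightarrow> zero : $x & (\<forall>u\<in>$x. \<forall>v\<in>$x. F u v : $x)"

definition stat :: "'v \<Rightarrow> 'v \<Rightarrow> bool" where
  "stat k S \<longleftrightarrow> (\<forall>h. (\<forall>x\<in>$k. ap h x : $k) -->
     (\<exists>x\<in>$S. x : $k & closed_pt (%u v. ap h u) x))"

lemma defb_closed_pt [dfb]:
  assumes "deft (%e. F (%n. e (Suc (Suc n))) (e (Suc 0)) (e 0))" "deft x"
  shows "defb (%e. closed_pt (F e) (x e))"
  unfolding closed_pt_def by (intro dfb assms deft_ren[OF assms(2), of Suc] deft_ren[OF assms(2), of "%n. Suc (Suc n)"])
lemma defb_stat [dfb]: assumes "deft k" "deft S" shows "defb (%e. stat (k e) (S e))"
proof -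
  have "defb (%e. stat (e 0) (e 1))" unfolding stat_def by (intro dfb)
  then show ?thesis by (rule defb_subst2) fact+
qed

text \<open>\<open>stat\<close> mentions unary functions that are sets. A binary class function is
  dominated by the unary one that sends \<open>z\<close> to the least ordinal above all values at
  arguments up to \<open>z\<close>.\<close>

lemma stat_closed_pt:
  assumes k: "bnd k" and S: "stat k S" and F: "deft (%e. F (e 0) (e 1))"
    and Fk: "!!x y. x : $k ==> y : $k ==> F x y : $k"
  shows "\<exists>x\<in>$S. x : $k & closed_pt F x"
proof -
  let ?Q = "%z b. b : $k & (\<forall>x\<in>$(succ z). \<forall>y\<in>$(succ z). F x y : $b)"
  have Ok: "Ord k" by (rule bnd_Ord[OF k])
  have F': "deft t ==> deft s ==> deft (%e. F (t e) (s e))" for t s by (rule deft_subst2[OF F])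
  have dQ: "defb (%e. ?Q z (e 0))" for z by (intro dfb F')
  have ex: "\<exists>b\<in>$k. ?Q z b" if z: "z : $k" for z
  proof -
    have sz: "succ z : $k" by (rule bnd_succ[OF k z])
    have sub: "x : $k" if "x : $(succ z)" for x using Ord_trans[OF Ok that sz] .
    let ?R = "%x b. \<forall>y\<in>$(succ z). F x y : $b"
    have dR: "defb (%e. ?R x (e 0))" for x by (intro dfb F')
    have R: "oleast (?R x) : $k" "?R x (oleast (?R x))" if x: "x : $(succ z)" for x
    proof -
      have dd: "deft (%e. F x (e 0))" by (intro F' dfb)
      have "\<exists>b\<in>$k. ?R x b"
        by (rule bnd_image[OF k dd lepoll_refl sz]) (use sub Fk x in blast)
      then obtain b where b: "?R x b" "b : $k" by blast
      from oleast_mem[OF dR Ok b] show "oleast (?R x) : $k" "?R x (oleast (?R x))" by auto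
    qed
    have dl: "deft (%e. oleast (?R (e 0)))" by (intro dfb F')
    obtain b where b: "b : $k" "\<forall>x\<in>$(succ z). oleast (?R x) : $b"
      using bnd_image[OF k dl lepoll_refl sz R(1)] by blast
    then have "?Q z b" using R(2) Ord_trans[OF Ord_mem[OF Ok b(1)]] by blast
    then show ?thesis using b(1) by blast
  qed
  define h where "h = lam k (%z. oleast (?Q z))"
  have dl: "deft (%e. oleast (?Q (e 0)))" by (intro dfb F')
  have h: "ap h z : $k" "?Q z (ap h z)" if z: "z : $k" for z
  proof -
    obtain b where "?Q z b" "b : $k" using ex[OF z] by blast
    from oleast_mem[OF dQ Ok this] show "ap h z : $k" "?Q z (ap h z)" unfolding h_def ap_lam[OF dl z] by auto
  qed
  obtain x where x: "x : $S" "x : $k" "closed_pt (%u v. ap h u) x"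
    using S h unfolding stat_def by blast
  have Ox: "Ord x" using Ord_mem[OF Ok x(2)] .
  have "F u v : $x" if u: "u : $x" and v: "v : $x" for u v
  proof -
    have o: "Ord u" "Ord v" using Ord_mem[OF Ox] u v by auto
    define w where "w = vset ($u \<union> $v)"
    have w: "w : $x" "u : $(succ w)" "v : $(succ w)"
      using Un_Ord[OF o] Ord_subset_iff[OF o] Ord_subset_iff[OF o(2,1)] u v Ord_subset_cases[OF o] unfolding w_def
      by (metis elts_Un sup_ge1 sup_ge2 Ord_subset_iff elts_succ insert_iff o)+
    have "F u v : $(ap h w)" using h(2)[of w] w Ord_trans[OF Ok _ x(2)] by blast
    moreover have "ap h w : $x" using x(3) w(1) unfolding closed_pt_def by blast
    ultimately show ?thesis using Ord_trans[OF Ox] by blast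
  qed
  then show ?thesis using x unfolding closed_pt_def by blast
qed

lemma stat_mono: "stat k S ==> $S <= $S' ==> stat k S'"
  unfolding stat_def by blast

text \<open>A closure point of the pointwise maximum of two ordinal functions is a closure point of
  both, since it is transitive.\<close>

lemma stat_inter:
  assumes k: "bnd k" and S: "stat k S" and F: "deft (%e. F (e 0) (e 1))"
    and Fk: "!!x y. x : $k ==> y : $k ==> F x y : $k"
  shows "stat k (vset {x \<in> $S. x : $k & closed_pt F x})"
  unfolding stat_def
proof (intro allI impI)
  fix h assume h: "\<forall>x\<in>$k. ap h x : $k"
  let ?G = "%x y. vset ($(ap h x) \<union> $(F x y))"
  have F': "deft t ==> deft s ==> deft (%e. F (t e) (s e))" for t s by (rule deft_subst2[OF F])
  have G: "deft (%e. ?G (e 0) (e 1))" by (intro dfb F')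
  have Ok: "Ord k" by (rule bnd_Ord[OF k])
  have GO: "?G x y = ap h x \<or> ?G x y = F x y" if "x : $k" "y : $k" for x y
    by (rule Un_Ord) (use Ord_mem[OF Ok] Fk h that in blast)+
  have "\<exists>x\<in>$S. x : $k & closed_pt ?G x"
  proof (rule stat_closed_pt[OF k S G])
    show "?G x y : $k" if "x : $k" "y : $k" for x y using GO[OF that] Fk[OF that] h that by metis
  qed
  then obtain x where x: "x : $S" "x : $k" "closed_pt ?G x" by blast
  have Ox: "Ord x" using Ord_mem[OF Ok x(2)] .
  have cl: "ap h u : $x & F u v : $x" if u: "u : $x" "v : $x" for u v
  proof -
    have uk: "u : $k" "v : $k" using u Ord_trans[OF Ok _ x(2)] by blast+
    have "?G u v : $x" using x(3) u unfolding closed_pt_def by blast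
    moreover have "$(ap h u) <= $(?G u v)" "$(F u v) <= $(?G u v)" by auto
    moreover have "Ord (ap h u)" "Ord (F u v)" "Ord (?G u v)" using Fk uk h Ord_mem[OF Ok] Ord_mem[OF Ox] \<open>?G u v : $x\<close> by blast+
    ultimately show ?thesis using Ord_subset_iff[of "ap h u" "?G u v"] Ord_subset_iff[of "F u v" "?G u v"] Ord_trans[OF Ox] by metis
  qed
  have "zero : $x" using x(3) unfolding closed_pt_def by blast
  then have "closed_pt F x" "closed_pt (%u v. ap h u) x" unfolding closed_pt_def using cl by blast+
  moreover have "$(vset {x \<in> $S. x : $k & closed_pt F x}) = {x \<in> $S. x : $k & closed_pt F x}"
    by (rule elts_sep) (intro dfb F')
  ultimately show "\<exists>x\<in>$(vset {x \<in> $S. x : $k & closed_pt F x}). x : $k & closed_pt (%u v. ap h u) x"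
    using x(1,2) by blast
qed

text \<open>A closure point of the constant function with value \<open>a\<close> has
  \<open>a\<close> as an element.\<close>

lemma stat_unbounded: assumes k: "bnd k" and S: "stat k S" and a: "a : $k" shows "\<exists>x\<in>$S. x : $k & a : $x"
proof -
  have d: "deft (%e::nat\<Rightarrow>'v. a)" by (rule deft_const)
  show ?thesis using stat_closed_pt[OF k S d a] unfolding closed_pt_def by blast
qed

text \<open>If no fibre were stationary, one could choose for each \<open>b\<close> a function
  \<open>ap G b\<close> without closure points in the fibre of \<open>b\<close>. A closure point of
  the binary function given by \<open>G\<close> is a diagonal intersection point and contradicts the
  choice at its own value \<open>f x\<close>.\<close>

lemma Fodor:
  assumes k: "bnd k" and S: "stat k S" and f: "deft (%e. f (e 0))"
    and reg: "!!x. x : $S ==> x : $k ==> zero : $x ==> f x : $x"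
  shows "\<exists>b\<in>$k. stat k (vset {x \<in> $S. f x = b})"
proof (rule ccontr)
  assume neg: "\<not> (\<exists>b\<in>$k. stat k (vset {x \<in> $S. f x = b}))"
  have sp: "$(vset {x \<in> $S. f x = b}) = {x \<in> $S. f x = b}" for b
    by (rule elts_sep) (intro dfb deft_subst[OF f])
  let ?Q = "%b h. (\<forall>x\<in>$k. ap h x : $k) & (\<forall>x\<in>$S. x : $k & f x = b --> \<not> closed_pt (%u v. ap h u) x)"
  have "\<exists>G. func G k (pow (prod k k)) & (\<forall>b\<in>$k. ?Q b (ap G b))"
  proof (rule choice_func)
    show "defb (%e. ?Q (e 0) (e 1))" by (intro dfb deft_subst[OF f])
    fix b assume "b : $k"
    then have "\<not> stat k (vset {x \<in> $S. f x = b})" using neg by blast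
    then obtain h where h: "\<forall>x\<in>$k. ap h x : $k" "\<forall>x\<in>$S. f x = b --> x : $k --> \<not> closed_pt (%u v. ap h u) x"
      unfolding stat_def sp by blast
    have d: "deft (%e. ap h (e 0))" by (intro dfb)
    \<comment> \<open>Restricting \<open>h\<close> to \<open>k\<close> puts it into the power set
      from which \<open>choice_func\<close> chooses.\<close>
    define h' where "h' = lam k (ap h)"
    have h': "ap h' x = ap h x" if "x : $k" for x unfolding h'_def by (rule ap_lam[OF d that])
    have "closed_pt (%u v. ap h' u) x = closed_pt (%u v. ap h u) x" if "x : $k" for x
      unfolding closed_pt_def using h' Ord_trans[OF bnd_Ord[OF k] _ that] by auto
    then have "?Q b h'" using h h' by auto
    moreover have "h' : $(pow (prod k k))" unfolding h'_def using h(1) by (auto simp: elts_lam[OF d])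
    ultimately show "\<exists>h\<in>$(pow (prod k k)). ?Q b h" by blast
  qed
  then obtain G where "func G k (pow (prod k k)) & (\<forall>b\<in>$k. ?Q b (ap G b))" by (rule exE)
  then have G: "!!b. b : $k ==> ?Q b (ap G b)" by blast
  have d: "deft (%e. ap (ap G (e 0)) (e 1))" by (intro dfb)
  obtain x where x: "x : $S" "x : $k" "closed_pt (%u v. ap (ap G u) v) x"
    using stat_closed_pt[OF k S d] G by blast
  have fx: "f x : $x" using reg x unfolding closed_pt_def by blast
  then have "closed_pt (%u v. ap (ap G (f x)) u) x" using x(3) unfolding closed_pt_def by blast
  moreover have "f x : $k" using Ord_trans[OF bnd_Ord[OF k] fx x(2)] .
  ultimately show False using G x by blast
qed

text \<open>The closure point is the supremum of an increasing sequence of length \<open>t\<close>,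
  coded by \<open>b\<close>. Taking \<open>t\<close> to be \<open>omega\<close> or
  \<open>omega1\<close> produces closure points of either cofinality.\<close>

lemma closed_pt_approach:
  assumes k: "bnd k" and t: "Limit t" "t : $k" and F: "deft (%e. F (e 0) (e 1))"
    and Fk: "!!x y. x : $k ==> y : $k ==> F x y : $k" and a: "a : $k"
  shows "\<exists>x\<in>$k. a : $x & closed_pt F x & (\<exists>b. (\<forall>i\<in>$t. ap b i : $x) &
      (\<forall>y\<in>$x. \<exists>i\<in>$t. y : $(ap b i)) & (\<forall>i\<in>$t. \<forall>j\<in>$i. ap b j : $(ap b i)))"
proof -
  have Ok: "Ord k" by (rule bnd_Ord[OF k])
  have Ot: "Ord t" using t unfolding Limit_def by blast
  have F': "deft t ==> deft s ==> deft (%e. F (t e) (s e))" for t s by (rule deft_subst2[OF F])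
  let ?Q = "%X b. b : $k & a : $b & $X <= $b & (\<forall>u\<in>$X. \<forall>v\<in>$X. F u v : $b)"
  have dQ: "defb (%e. ?Q X (e 0))" for X by (intro dfb F')
  have ex: "\<exists>b\<in>$k. ?Q X b" if c: "c : $k" "$X <= $c" for X c
  proof -
    have Xk: "x : $k" if "x : $X" for x using c that Ord_trans[OF Ok] by blast
    let ?R = "%x b. \<forall>y\<in>$X. F x y : $b"
    have dR: "defb (%e. ?R x (e 0))" for x by (intro dfb F')
    have R: "oleast (?R x) : $k" "?R x (oleast (?R x))" if x: "x : $X" for x
    proof -
      have dd: "deft (%e. F x (e 0))" by (intro F' dfb)
      have "\<exists>b\<in>$k. ?R x b"
        by (rule bnd_image[OF k dd lepoll_subset[OF c(2)] c(1)]) (use Xk Fk x in blast)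
      then obtain b where b: "?R x b" "b : $k" by blast
      from oleast_mem[OF dR Ok b] show "oleast (?R x) : $k" "?R x (oleast (?R x))" by auto
    qed
    have dl: "deft (%e. oleast (?R (e 0)))" by (intro dfb F')
    obtain b where b: "b : $k" "\<forall>x\<in>$X. oleast (?R x) : $b"
      using bnd_image[OF k dl lepoll_subset[OF c(2)] c(1) R(1)] by blast
    define d where "d = vset ($(vset ($b \<union> $c)) \<union> $(succ a))"
    have O: "Ord b" "Ord c" "Ord (succ a)" using Ord_mem[OF Ok] b c a by auto
    have "vset ($b \<union> $c) : $k" using Un_Ord[OF O(1,2)] b c by metis
    then have "d : $k" using Un_Ord[OF Ord_mem[OF Ok] O(3), of "vset ($b \<union> $c)"] bnd_succ[OF k a] unfolding d_def by metis
    moreover have "$b <= $d" "$c <= $d" "a : $d" unfolding d_def by auto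
    ultimately have "?Q X d" using R(2) Ord_trans[OF O(1)] b c by blast
    then show ?thesis using \<open>d : $k\<close> by blast
  qed
  have Q: "oleast (?Q X) : $k" "?Q X (oleast (?Q X))" if c: "c : $k" "$X <= $c" for X c
  proof -
    obtain b where "?Q X b" "b : $k" using ex[OF c] by blast
    from oleast_mem[OF dQ Ok this] show "oleast (?Q X) : $k" "?Q X (oleast (?Q X))" by auto
  qed
  \<comment> \<open>The next ordinal is the least one above \<open>a\<close> and above all previous
    ordinals and their \<open>F\<close>-values; the same clause serves zero, successors and
    limits.\<close>
  define G where "G i s = oleast (?Q (vset (\<Union>j\<in>$i. $(succ (ap s j)))))" for i s
  have G: "deft (%e. G (e (Suc 0)) (e 0))" unfolding G_def by (intro dfb F')
  define b where "b = rec G"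
  have db: "deft (%e. b (e 0))" unfolding b_def by (intro deft_rec'[OF G] dfb)
  have dsb: "deft (%e. succ (b (e 0)))" by (intro dfb db)
  define X where "X i = vset (\<Union>j\<in>$i. $(succ (b j)))" for i
  have X: "$(X i) = (\<Union>j\<in>$i. $(succ (b j)))" for i unfolding X_def by (rule elts_UN[OF dsb])
  have bG: "b i = oleast (?Q (X i))" for i
  proof -
    have "b i = G i (lam i b)" unfolding b_def by (rule rec_eq[OF G])
    then show ?thesis unfolding G_def X_def using ap_lam[OF db] by simp
  qed
  have Xb: "\<exists>c\<in>$k. $(X i) <= $c" if i: "i : $k" "!!j. j : $i ==> b j : $k" for i
  proof -
    obtain c where c: "c : $k" "\<forall>j\<in>$i. succ (b j) : $c"
      using bnd_image[OF k dsb lepoll_refl i(1)] i(2) bnd_succ[OF k] by blast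
    then have "$(X i) <= $c" unfolding X using Ord_trans[OF Ord_mem[OF Ok c(1)]] by blast
    then show ?thesis using c by blast
  qed
  have bk: "i : $k --> b i : $k" for i
  proof (rule mem_induct[where Q = "%i. i : $k --> b i : $k"])
    show "defb (%e. e 0 : $k --> b (e 0) : $k)" by (intro dfb db)
    fix i assume IH: "!!j. j : $i ==> j : $k --> b j : $k"
    show "i : $k --> b i : $k"
    proof
      assume i: "i : $k"
      then have "b j : $k" if "j : $i" for j using IH[OF that] Ord_trans[OF Ok that] by blast
      then obtain c where "c : $k" "$(X i) <= $c" using Xb[OF i] by blast
      then show "b i : $k" unfolding bG by (rule Q)
    qed
  qed
  have tk: "i : $k" if "i : $t" for i using Ord_trans[OF Ok that t(2)] .
  have bQ: "?Q (X i) (b i)" if i: "i : $t" for i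
  proof -
    have "b j : $k" if "j : $i" for j using bk Ord_trans[OF Ok that tk[OF i]] by blast
    then obtain c where "c : $k" "$(X i) <= $c" using Xb[OF tk[OF i]] by blast
    then show ?thesis unfolding bG by (rule Q)
  qed
  define x where "x = vset (\<Union>i\<in>$t. $(b i))"
  have x: "$x = (\<Union>i\<in>$t. $(b i))" unfolding x_def by (rule elts_UN[OF db])
  have Ox: "Ord x"
  proof (rule Ord_transitiveI)
    have Ob: "Ord (b i)" if "i : $t" for i using Ord_mem[OF Ok, of "b i"] bk tk[OF that] by blast
    show "transitive x"
      unfolding transitive_def
    proof (intro ballI subsetI)
      fix y z assume "y : $x" "z : $y"
      then obtain i where i: "i : $t" "y : $(b i)" unfolding x by blast
      then have "z : $(b i)" using Ord_trans[OF Ob[OF i(1)] \<open>z : $y\<close>] by blast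
      then show "z : $x" unfolding x using i by blast
    qed
    fix y assume "y : $x"
    then obtain i where i: "i : $t" "y : $(b i)" unfolding x by blast
    then show "Ord y" using Ord_mem[OF Ob] by blast
  qed
  obtain c where c: "c : $k" "\<forall>i\<in>$t. b i : $c"
    using bnd_image[OF k db lepoll_refl t(2)] bk tk by blast
  have Oc: "Ord c" using Ord_mem[OF Ok c(1)] .
  have "$x <= $c" unfolding x using c(2) Ord_trans[OF Oc] by blast
  then have xk: "x : $k" using Ord_subset_iff[OF Ox Oc] c(1) Ord_trans[OF Ok] by blast
  have inc: "b j : $(b i)" if "i : $t" "j : $i" for i j
    using bQ[OF that(1)] that(2) unfolding X elts_succ by blast
  have bx: "b i : $x" if "i : $t" for i
  proof -
    have "b i : $(b (succ i))" by (rule inc[OF Limit_succ[OF t(1) that]]) simp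
    then show ?thesis unfolding x using Limit_succ[OF t(1) that] by blast
  qed
  have "F u v : $x" if u: "u : $x" "v : $x" for u v
  proof -
    obtain i j where ij: "i : $t" "u : $(b i)" "j : $t" "v : $(b j)" using u unfolding x by blast
    have o: "Ord i" "Ord j" using Ord_mem[OF Ot] ij by auto
    define m where "m = vset ($i \<union> $j)"
    have m: "m : $t" "Ord m" using Un_Ord[OF o] ij o unfolding m_def by metis+
    have "i : $(succ m)" "j : $(succ m)"
      using Ord_subset_iff[OF o(1) m(2)] Ord_subset_iff[OF o(2) m(2)] unfolding m_def elts_Un elts_succ by auto
    moreover have "u : $(succ (b i))" "v : $(succ (b j))" using ij by simp_all
    ultimately have "u : $(X (succ m))" "v : $(X (succ m))" unfolding X by (blast intro: UN_I)+
    then have "F u v : $(b (succ m))" using bQ[OF Limit_succ[OF t(1) m(1)]] by blast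
    then show ?thesis unfolding x using Limit_succ[OF t(1) m(1)] by blast
  qed
  moreover have "a : $x" unfolding x using bQ Limit_zero[OF t(1)] by blast
  moreover have "zero : $x" using Ord_linear[OF Ord_zero Ox] \<open>a : $x\<close> by auto
  moreover have "ap (lam t b) i = b i" if "i : $t" for i by (rule ap_lam[OF db that])
  moreover have "j : $t" if "i : $t" "j : $i" for i j using Ord_trans[OF Ot] that by blast
  ultimately show ?thesis
    using xk bx inc unfolding closed_pt_def
    by (intro bexI[of _ x] conjI exI[of _ "lam t b"]) (auto simp: x)
qed

subsection \<open>Collapsing maps\<close>

text \<open>The Mostowski collapse of \<open>c\<close>, extended to arbitrary arguments. For an
  ordinal \<open>x\<close> and a set \<open>c\<close> of ordinals it is the order type of the part
  of \<open>c\<close> below \<open>x\<close>.\<close>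

definition col :: "'v \<Rightarrow> 'v \<Rightarrow> 'v" where
  "col c = rec (%x g. vset (ap g ` $(vset ($x \<inter> $c))))"
lemma deft_col [dfb]: assumes "deft c" "deft x" shows "deft (%e. col (c e) (x e))"
  unfolding col_def by (intro dfb assms deft_ren[OF assms(1), of "%n. Suc (Suc n)"])
lemma elts_col: "$(col c x) = col c ` ($x \<inter> $c)"
proof -
  have d: "deft (%e. vset (ap (e 0) ` $(vset ($(e (Suc 0)) \<inter> $c))))" by (intro dfb)
  have d2: "deft (%e. col c (e 0))" by (intro dfb)
  have "col c x = vset (ap (lam x (col c)) ` $(vset ($x \<inter> $c)))"
    using rec_eq[OF d, of x] unfolding col_def .
  also have "ap (lam x (col c)) ` $(vset ($x \<inter> $c)) = col c ` $(vset ($x \<inter> $c))"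
    by (rule image_cong) (simp_all add: ap_lam[OF d2])
  finally show ?thesis using elts_image[OF d2, of "vset ($x \<inter> $c)"] by simp
qed
lemma col_mem: "x : $y ==> x : $c ==> col c x : $(col c y)"
  by (simp add: elts_col)
text \<open>The collapse on a transitive set only sees the part of \<open>c\<close> inside it. This
  is why collapsed ordinals can be computed from traces.\<close>

lemma col_cong:
  assumes t: "transitive t" and eq: "$t \<inter> $c = $t \<inter> $c'" and x: "x : $t \<or> x = t"
  shows "col c x = col c' x"
proof -
  have main: "x : $t --> col c x = col c' x" for x
  proof (rule mem_induct[where Q = "%x. x : $t --> col c x = col c' x"])
    show "defb (%e. e 0 : $t --> col c (e 0) = col c' (e 0))" by (intro dfb)
    fix x assume IH: "!!y. y : $x ==> y : $t --> col c y = col c' y"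
    show "x : $t --> col c x = col c' x"
    proof (intro impI vsetI)
      assume "x : $t"
      then have "y : $t" if "y : $x" for y using t that unfolding transitive_def by blast
      then show "$(col c x) = $(col c' x)" unfolding elts_col using IH eq by (intro image_cong) auto
    qed
  qed
  show ?thesis
  proof (cases "x = t")
    case True
    have "$(col c t) = $(col c' t)" unfolding elts_col using main eq by (intro image_cong) auto
    then show ?thesis using True vsetI by blast
  qed (use main x in blast)
qed
lemma Ord_col: 
  assumes "Ord x" shows "Ord (col c x)"
  using assms
proof (induction rule: Ord_induct)
  case def show ?case by (intro dfb)
next
  case (less x)
  show ?case
  proof (rule Ord_transitiveI)
    show "transitive (col c x)"
      unfolding transitive_def
    proof (intro ballI subsetI)
      fix y z assume "y : $(col c x)" "z : $y"
      then obtain u where u: "u : $x" "u : $c" "z : $(col c u)" unfolding elts_col[of c x] by blast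
      then show "z : $(col c x)" unfolding elts_col using Ord_trans[OF less(1) _ u(1)] by blast
    qed
    fix y assume "y : $(col c x)"
    then show "Ord y" unfolding elts_col using less(2) by blast
  qed
qed
lemma col_inj: "Ord x ==> Ord y ==> x : $c ==> y : $c ==> col c x = col c y ==> x = y"
  using Ord_linear[of x y] col_mem[of x y c] col_mem[of y x c] mem_irrefl by metis
lemma col_mem_iff: "Ord x ==> Ord y ==> x : $c ==> y : $c ==> col c x : $(col c y) \<longleftrightarrow> x : $y"
  using Ord_linear[of x y] col_mem[of x y c] col_mem[of y x c] mem_irrefl mem_asym by metis
lemma col_omega1: assumes "ctbl c" "Ord x" shows "col c x : $omega1"
proof -
  have d: "deft (%e. col c (e 0))" by (intro dfb)
  have "ctbl (vset (col c ` $(vset ($x \<inter> $c))))"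
    by (rule ctbl_image[OF d]) (rule ctbl_subset[OF assms(1)], simp)
  moreover have "vset (col c ` $(vset ($x \<inter> $c))) = col c x"
    by (rule vsetI) (simp add: elts_col isset_image[OF d, of "vset ($x \<inter> $c)", simplified])
  ultimately show ?thesis using Ord_col[OF assms(2)] elts_omega1 by simp
qed

subsection \<open>Filtrations of ordinals below \<open>\<omega>\<^sub>2\<close>\<close>

lemma Jinj_ex: "\<exists>J. \<forall>a\<in>$omega2. (\<forall>x\<in>$a. ap (ap J a) x : $omega1) & inj_on (ap (ap J a)) ($a)"
proof -
  have "\<exists>J. func J omega2 (pow (prod omega2 omega1)) & 
    (\<forall>a\<in>$omega2. (\<forall>x\<in>$a. ap (ap J a) x : $omega1) & inj_on (ap (ap J a)) ($a))"
  proof (rule choice_func[where Q = "%a g. (\<forall>x\<in>$a. ap g x : $omega1) & inj_on (ap g) ($a)"])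
    show "defb (%e. (\<forall>x\<in>$(e 0). ap (e 1) x : $omega1) & inj_on (ap (e 1)) ($(e 0)))" by (intro dfb)
    fix a assume a: "a : $omega2"
    then have "lepoll a omega1" "$a <= $omega2" using elts_omega2 Ord_trans[OF Ord_omega2] by auto
    then show "\<exists>g\<in>$(pow (prod omega2 omega1)). (\<forall>x\<in>$a. ap g x : $omega1) & inj_on (ap g) ($a)"
      by (rule lepollE_pow)
  qed
  then show ?thesis by blast
qed

text \<open>The choice is made once, by HOL, of a single element of the structure; for definability
  it is therefore just a parameter. \<open>J a\<close> injects each \<open>a\<close> below
  \<open>omega2\<close> into \<open>omega1\<close>.\<close>

definition J :: "'v \<Rightarrow> 'v \<Rightarrow> 'v" where
  "J a x = ap (ap (SOME J. \<forall>a\<in>$omega2. (\<forall>x\<in>$a. ap (ap J a) x : $omega1) & inj_on (ap (ap J a)) ($a)) a) x"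
lemma deft_J [dfb]: "deft a ==> deft x ==> deft (%e. J (a e) (x e))"
  unfolding J_def by (intro dfb)
lemma J: "a : $omega2 ==> x : $a ==> J a x : $omega1"
  "a : $omega2 ==> inj_on (J a) ($a)"
  using someI_ex[OF Jinj_ex] unfolding J_def[abs_def] by blast+

text \<open>The canonical filtration of \<open>a\<close> by countable sets, indexed by
  \<open>z\<close> below \<open>omega1\<close>. Any other filtration of \<open>a\<close> agrees with
  it at almost all \<open>z\<close>, see \<open>filtration_agree\<close>.\<close>

definition B :: "'v \<Rightarrow> 'v \<Rightarrow> 'v" where
  "B a z = vset {x \<in> $a. J a x : $z}"
lemma deft_B [dfb]: "deft a ==> deft z ==> deft (%e. B (a e) (z e))"
  unfolding B_def by (intro dfb deft_ren[of a Suc] deft_ren[of z Suc])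
lemma elts_B [simp]: "$(B a z) = {x \<in> $a. J a x : $z}"
  unfolding B_def by (rule elts_sep) (intro dfb)
lemma ctbl_omega1_mem: "z : $omega1 ==> ctbl z" using elts_omega1 by simp
lemma ctbl_fibre:
  assumes f: "deft (%e. f (e 0))" and i: "inj_on f ($a)" and z: "ctbl z"
  shows "ctbl (vset {x \<in> $a. f x : $z})"
proof -
  have e: "$(vset {x \<in> $a. f x : $z}) = {x \<in> $a. f x : $z}" by (rule elts_sep) (intro dfb f)
  have "lepoll (vset {x \<in> $a. f x : $z}) z"
    by (rule lepollI[OF f]) (use i in \<open>auto simp: e inj_on_def\<close>)
  then show ?thesis using z lepoll_trans unfolding ctbl_def by blast
qed
lemma ctbl_B: "a : $omega2 ==> z : $omega1 ==> ctbl (B a z)"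
  unfolding B_def by (rule ctbl_fibre) (auto intro: dfb J ctbl_omega1_mem)

text \<open>It suffices that \<open>z\<close> is closed under the passage from \<open>f x\<close> to
  \<open>g x\<close>, a function on \<open>omega1\<close> since \<open>f\<close> is
  injective.\<close>

lemma filtration_half:
  assumes S: "stat omega1 S" and f: "deft (%e. f (e 0))" "inj_on f ($a)"
    and g: "deft (%e. g (e 0))" "!!x. x : $a ==> g x : $omega1"
  shows "stat omega1 (vset {z \<in> $S. \<forall>x\<in>$a. f x : $z --> g x : $z})"
proof -
  have e: "$(vset {z \<in> $S. \<forall>x\<in>$a. f x : $z --> g x : $z}) = {z \<in> $S. \<forall>x\<in>$a. f x : $z --> g x : $z}"
    by (rule elts_sep) (intro dfb deft_subst[OF f(1)] deft_subst[OF g(1)])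
  \<comment> \<open>The value \<open>g x\<close> at the preimage \<open>x\<close> of
    \<open>u\<close>, written as a union, hence \<open>zero\<close> if there is no preimage. The
    second argument is a dummy.\<close>
  define F where "F u v = vset {w. \<exists>x\<in>$a. f x = u & w : $(g x)}" for u v :: 'v
  have F: "deft (%e. F (e 0) (e 1))" unfolding F_def by (intro dfb deft_subst[OF f(1)] deft_subst[OF g(1)])
  have Fx: "F (f x) v = g x" if "x : $a" for x v
  proof -
    have "{w. \<exists>x'\<in>$a. f x' = f x & w : $(g x')} = $(g x)" using that f(2) unfolding inj_on_def by blast
    then show ?thesis unfolding F_def by simp
  qed
  have Fk: "F u v : $omega1" for u v
  proof (cases "\<exists>x\<in>$a. f x = u")
    case True
    then obtain x where x: "x : $a" "u = f x" by blast
    then show ?thesis using Fx[OF x(1)] g(2)[OF x(1)] by simp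
  next
    case False
    then have "{w. \<exists>x\<in>$a. f x = u & w : $(g x)} = {}" by blast
    then have "F u v = zero" unfolding F_def zero_def by (simp only:)
    then show ?thesis using bnd_zero[OF bnd_omega1] by simp
  qed
  have e2: "$(vset {z \<in> $S. z : $omega1 & closed_pt F z}) = {z \<in> $S. z : $omega1 & closed_pt F z}"
    by (rule elts_sep) (intro dfb deft_subst2[OF F])
  have "stat omega1 (vset {z \<in> $S. z : $omega1 & closed_pt F z})"
    by (rule stat_inter[OF bnd_omega1 S F Fk])
  then show ?thesis
  proof (rule stat_mono)
    have "g x : $z" if "closed_pt F z" "x : $a" "f x : $z" for x z
      using that Fx[OF that(2), of "f x"] unfolding closed_pt_def by metis
    then show "$(vset {z \<in> $S. z : $omega1 & closed_pt F z}) <= $(vset {z \<in> $S. \<forall>x\<in>$a. f x : $z --> g x : $z})"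
      unfolding e e2 by blast
  qed
qed
lemma filtration_agree:
  assumes S: "stat omega1 S" and f: "deft (%e. f (e 0))" "inj_on f ($a)" "!!x. x : $a ==> f x : $omega1"
    and g: "deft (%e. g (e 0))" "inj_on g ($a)" "!!x. x : $a ==> g x : $omega1"
  shows "stat omega1 (vset {z \<in> $S. \<forall>x\<in>$a. f x : $z \<longleftrightarrow> g x : $z})"
proof -
  have 1: "stat omega1 (vset {z \<in> $S. \<forall>x\<in>$a. f x : $z --> g x : $z})"
    by (rule filtration_half) fact+
  have 2: "stat omega1 (vset {z \<in> $(vset {z \<in> $S. \<forall>x\<in>$a. f x : $z --> g x : $z}). \<forall>x\<in>$a. g x : $z --> f x : $z})"
    by (rule filtration_half[OF 1]) fact+
  have e: "$(vset {z \<in> $S. \<forall>x\<in>$a. f x : $z --> g x : $z}) = {z \<in> $S. \<forall>x\<in>$a. f x : $z --> g x : $z}"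
    by (rule elts_sep) (intro dfb deft_subst[OF f(1)] deft_subst[OF g(1)])
  have e2: "$(vset {z \<in> $T. \<forall>x\<in>$a. g x : $z --> f x : $z}) = {z \<in> $T. \<forall>x\<in>$a. g x : $z --> f x : $z}" for T
    by (rule elts_sep) (intro dfb deft_subst[OF f(1)] deft_subst[OF g(1)])
  have e3: "$(vset {z \<in> $S. \<forall>x\<in>$a. f x : $z \<longleftrightarrow> g x : $z}) = {z \<in> $S. \<forall>x\<in>$a. f x : $z \<longleftrightarrow> g x : $z}"
    by (rule elts_sep) (intro dfb deft_subst[OF f(1)] deft_subst[OF g(1)])
  show ?thesis by (rule stat_mono[OF 2], unfold e2, unfold e e3, blast)
qed

lemma stationary_omega1_stat: assumes T: "stationary_omega1 T" shows "stat omega1 T"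
  unfolding stat_def
proof (intro allI impI)
  fix h assume h: "\<forall>x\<in>$omega1. ap h x : $omega1"
  let ?c = "closed_pt (%u v. ap h u)"
  define C where "C = vset {x \<in> $omega1. ?c x}"
  have C: "$C = {x \<in> $omega1. ?c x}" unfolding C_def by (rule elts_sep) (intro dfb)
  have "club_omega1 C"
    unfolding club_omega1_def
  proof (intro conjI ballI impI)
    show "$C <= $omega1" using C by blast
    fix a assume a: "a : $omega1"
    show "\<exists>b\<in>$C. a : $b"
    proof -
      have d: "deft (%e. ap h (e 0))" by (intro dfb)
      have "\<exists>x\<in>$omega1. a : $x & ?c x & (\<exists>b. (\<forall>i\<in>$omega. ap b i : $x) &
      (\<forall>y\<in>$x. \<exists>i\<in>$omega. y : $(ap b i)) & (\<forall>i\<in>$omega. \<forall>j\<in>$i. ap b j : $(ap b i)))"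
        by (rule closed_pt_approach[OF bnd_omega1 omega_props(1) omega_omega1 d _ a]) (use h in blast)
      then show ?thesis using C by blast
    qed
    assume l: "Limit a & (\<forall>b\<in>$a. \<exists>c\<in>$C \<inter> $a. b : $c)"
    then have Oa: "Ord a" unfolding Limit_def by blast
    have "ap h u : $a" if u: "u : $a" for u
    proof -
      obtain c where "c : $C" "c : $a" "u : $c" using l u by blast
      then show ?thesis using C Ord_trans[OF Oa] unfolding closed_pt_def by blast
    qed
    moreover have "zero : $a" using l Limit_zero by blast
    ultimately show "a : $C" using a C unfolding closed_pt_def by blast
  qed
  then have "$T \<inter> $C \<noteq> {}" using T unfolding stationary_omega1_def by blast
  then show "\<exists>x\<in>$T. x : $omega1 & ?c x" using C by blast
qed

text \<open>A hull \<open>Q\<close> of size \<open>omega1\<close> around \<open>omega1\<close> and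
  \<open>c\<close> is transported to \<open>omega1\<close> by an injection \<open>f\<close>. For a
  closure point \<open>z\<close> the set of those \<open>x\<close> in \<open>Q\<close> with
  \<open>ap f x\<close> below \<open>z\<close> is closed, and its trace is \<open>z\<close> because
  \<open>f\<close> and the identity induce the same filtration of \<open>omega1\<close> at the
  chosen points.\<close>

lemma lift_stationary:
  assumes A: "$omega1 <= $A" and g: "deft (%e. g (e 0) (e 1))"
    and gA: "!!x y. x : $A ==> y : $A ==> ctbl (g x y) & $(g x y) <= $A"
    and U: "stat omega1 U" and c: "ctbl c" "$c <= $A"
  shows "\<exists>Y. $Y <= $A & ctbl Y & $c <= $Y & (\<forall>x\<in>$Y. \<forall>y\<in>$Y. $(g x y) <= $Y) &
    vset ($Y \<inter> $omega1) : $U & vset ($Y \<inter> $omega1) : $omega1"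
proof -
  have g': "deft t ==> deft s ==> deft (%e. g (t e) (s e))" for t s by (rule deft_subst2[OF g])
  define X where "X = vset ($omega1 \<union> $c)"
  have X: "$X = $omega1 \<union> $c" unfolding X_def by simp
  have "lepoll X omega1" unfolding X_def by (rule lepoll_Un[OF idem_omega1 lepoll_refl ctbl_lepoll_omega1[OF c(1)]])
  moreover have "$X <= $A" using X A c by blast
  ultimately obtain Q where Q: "$X <= $Q" "$Q <= $A" "lepoll Q omega1" "\<forall>x\<in>$Q. \<forall>y\<in>$Q. $(g x y) <= $Q"
    using closure_exists[OF idem_omega1 g, of X A] gA ctbl_lepoll_omega1 by blast
  obtain f where f: "!!x. x : $Q ==> ap f x : $omega1" "inj_on (ap f) ($Q)"
    using Q(3) unfolding lepoll_iff by blast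
  have df: "deft (%e. ap f (e 0))" by (intro dfb)
  have w1Q: "$omega1 <= $Q" "$c <= $Q" using Q(1) X by auto
  define U1 where "U1 = vset {z \<in> $U. \<forall>x\<in>$omega1. ap f x : $z \<longleftrightarrow> x : $z}"
  have U1: "$U1 = {z \<in> $U. \<forall>x\<in>$omega1. ap f x : $z \<longleftrightarrow> x : $z}"
    unfolding U1_def by (rule elts_sep) (intro dfb)
  have sU1: "stat omega1 U1"
    unfolding U1_def by (rule filtration_agree[OF U df]) (use f w1Q inj_on_subset in \<open>auto intro: deft_var\<close>)
  have bd: "\<exists>b\<in>$omega1. \<forall>x\<in>$s. ap f x : $b" if "ctbl s" "$s <= $Q" for s
    by (rule bnd_image[OF bnd_omega1 df that(1)[unfolded ctbl_def] omega_omega1]) (use f that in blast)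
  obtain b0 where b0: "b0 : $omega1" "\<forall>x\<in>$c. ap f x : $b0" using bd[OF c(1) w1Q(2)] by blast
  \<comment> \<open>Bounds the \<open>f\<close>-images of the values of \<open>g\<close> at the
    preimages of \<open>u\<close> and \<open>v\<close>. Placing \<open>b0\<close> below the bound
    makes the resulting set contain \<open>c\<close>.\<close>
  let ?R = "%u v b. b0 : $b & (\<forall>x\<in>$Q. \<forall>y\<in>$Q. ap f x = u & ap f y = v --> (\<forall>w\<in>$(g x y). ap f w : $b))"
  have dR: "defb (%e. ?R u v (e 0))" for u v by (intro dfb g')
  have dl: "deft (%e. oleast (?R (e 0) (e 1)))" by (intro dfb g')
  have R: "oleast (?R u v) : $omega1" "?R u v (oleast (?R u v))" for u v
  proof -
    have "\<exists>b\<in>$omega1. ?R u v b"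
    proof (cases "\<exists>x\<in>$Q. \<exists>y\<in>$Q. ap f x = u & ap f y = v")
      case True
      then obtain x y where xy: "x : $Q" "y : $Q" "ap f x = u" "ap f y = v" by blast
      obtain b where b: "b : $omega1" "\<forall>w\<in>$(g x y). ap f w : $b"
        using bd[of "g x y"] gA Q(2,4) xy(1,2) by blast
      have O: "Ord b" "Ord (succ b0)" using b b0 Ord_mem[OF Ord_omega1] by auto
      define d where "d = vset ($b \<union> $(succ b0))"
      have d: "d : $omega1" using Un_Ord[OF O] b(1) bnd_succ[OF bnd_omega1 b0(1)] unfolding d_def by metis
      have "x' = x & y' = y" if "x' : $Q" "y' : $Q" "ap f x' = u" "ap f y' = v" for x' y'
        using f(2) that xy unfolding inj_on_def by blast
      then have "?R u v d" using b unfolding d_def by auto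
      then show ?thesis using d by blast
    next
      case False
      then have "?R u v (succ b0)" by auto
      then show ?thesis using bnd_succ[OF bnd_omega1 b0(1)] by blast
    qed
    then obtain b where b: "?R u v b" "b : $omega1" by blast
    from oleast_mem[OF dR Ord_omega1 b] show "oleast (?R u v) : $omega1" "?R u v (oleast (?R u v))" by auto
  qed
  obtain z where z: "z : $U1" "z : $omega1" "closed_pt (%u v. oleast (?R u v)) z"
    using stat_closed_pt[OF bnd_omega1 sU1 dl R(1)] by blast
  have Oz: "Ord z" using Ord_mem[OF Ord_omega1 z(2)] .
  define Y where "Y = vset {x \<in> $Q. ap f x : $z}"
  have Y: "$Y = {x \<in> $Q. ap f x : $z}" unfolding Y_def by (rule elts_sep) (intro dfb)
  have zz: "oleast (?R u v) : $z" if "u : $z" "v : $z" for u v using z(3) that unfolding closed_pt_def by blast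
  have z0: "zero : $z" using z(3) unfolding closed_pt_def by blast
  have "vset ($Y \<inter> $omega1) = z"
  proof -
    have "$Y \<inter> $omega1 = {x \<in> $omega1. ap f x : $z}" unfolding Y using w1Q(1) by blast
    also have "\<dots> = {x \<in> $omega1. x : $z}" using z(1) unfolding U1 by blast
    also have "\<dots> = $z" using Ord_trans[OF Ord_omega1 _ z(2)] by blast
    finally show ?thesis by simp
  qed
  moreover have "$c <= $Y"
  proof
    fix x assume x: "x : $c"
    have "b0 : $z" using R(2)[of zero zero] zz[OF z0 z0] Ord_trans[OF Oz] by blast
    then show "x : $Y" unfolding Y using x w1Q(2) b0(2) Ord_trans[OF Oz] by blast
  qed
  moreover have "$(g x y) <= $Y" if xy: "x : $Y" "y : $Y" for x y
  proof
    fix w assume w: "w : $(g x y)"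
    have q: "x : $Q" "y : $Q" "ap f x : $z" "ap f y : $z" using xy Y by auto
    have "ap f w : $(oleast (?R (ap f x) (ap f y)))" using R(2)[of "ap f x" "ap f y"] q w by blast
    then have "ap f w : $z" using zz[OF q(3,4)] Ord_trans[OF Oz] by blast
    then show "w : $Y" unfolding Y using Q(4) q w by blast
  qed
  moreover have "ctbl Y" unfolding Y_def by (rule ctbl_fibre[OF df f(2) ctbl_omega1_mem[OF z(2)]])
  moreover have "$Y <= $A" using Y Q(2) by blast
  moreover have "z : $U" using z(1) U1 by blast
  ultimately show ?thesis using z(2) by metis
qed

lemma elts_ctbl_subsets: "$(ctbl_subsets X) = {Y. $Y <= $X & ctbl Y}"
  unfolding ctbl_subsets_def by (rule elts_vset, rule isset_bounded[where a = "pow X"]) (intro dfb, simp)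

text \<open>Kueker's theorem, with finite subsets coded by iterated unordered pairs.\<close>

lemma club_contains_closed:
  assumes C: "club C X" and X: "transitive X"
  shows "\<exists>F. (\<forall>z\<in>$X. ctbl (ap F z) & $(ap F z) <= $X) &
    (\<forall>Y. $Y <= $X & ctbl Y & $Y \<noteq> {} & (\<forall>z\<in>$Y. $(ap F z) <= $Y) &
      (\<forall>x\<in>$Y. \<forall>y\<in>$Y. vset {x, y} : $Y) --> Y : $C)"
proof -
  have C1: "$C <= $(ctbl_subsets X)" "\<forall>Y\<in>$(ctbl_subsets X). \<exists>Z\<in>$C. $Y <= $Z"
    and C2: "!!D. $D <= $C ==> $D \<noteq> {} ==> ctbl D ==>
        (\<forall>Y\<in>$D. \<forall>Z\<in>$D. $Y <= $Z \<or> $Z <= $Y) ==> union D : $C"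
    using C unfolding club_def by blast+
  have "\<exists>ch. func ch (ctbl_subsets X) C & (\<forall>Y\<in>$(ctbl_subsets X). $Y <= $(ap ch Y))"
    by (rule choice_func) (intro dfb, use C1 in blast)
  then obtain ch where chf: "func ch (ctbl_subsets X) C" and ch2: "\<forall>Y\<in>$(ctbl_subsets X). $Y <= $(ap ch Y)"
    by blast
  have ch: "ap ch Y : $C" "$Y <= $(ap ch Y)" if "$Y <= $X" "ctbl Y" for Y
    using func_ap_in[OF chf, of Y] ch2 that by (auto simp: elts_ctbl_subsets)
  \<comment> \<open>\<open>K z\<close> will be a member of the club that has \<open>z\<close> as an
    element and, for countable \<open>z\<close>, includes all \<open>K w\<close> with
    \<open>w\<close> in \<open>z\<close>. Uncountable \<open>z\<close> contribute only themselves,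
    which keeps the set to be covered countable.\<close>
  define u where "u z g = vset (insert z ($(if ctbl z then vset (\<Union>w\<in>$z. $(ap g w)) else zero)))" for z g
  define G where "G z g = ap ch (u z g)" for z g
  have ins: "insert z ($a) = $(vset {z}) \<union> $a" for z a by simp
  have G: "deft (%e. G (e (Suc 0)) (e 0))" unfolding G_def u_def ins by (intro dfb)
  define K where "K = rec G"
  have dK: "deft (%e. K (e 0))" unfolding K_def by (intro deft_rec'[OF G] dfb)
  have uK: "$(u z (lam z K)) = insert z (if ctbl z then (\<Union>w\<in>$z. $(K w)) else {})" for z
  proof -
    have "(\<Union>w\<in>$z. $(ap (lam z K) w)) = (\<Union>w\<in>$z. $(K w))" using ap_lam[OF dK] by simp
    then have 1: "u z (lam z K) = vset (insert z ($(if ctbl z then vset (\<Union>w\<in>$z. $(K w)) else zero)))"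
      by (simp only: u_def)
    have 2: "$(u z (lam z K)) = insert z ($(if ctbl z then vset (\<Union>w\<in>$z. $(K w)) else zero))"
      by (subst 1) (rule elts_vset[OF isset_insert[OF isset_elts]])
    show ?thesis
    proof (cases "ctbl z")
      case True
      show ?thesis unfolding 2 if_P[OF True] elts_UN[OF dK] ..
    qed (simp add: 2)
  qed
  have KG: "K z = ap ch (u z (lam z K))" for z
  proof -
    have "K z = G z (lam z K)" unfolding K_def by (rule rec_eq[OF G])
    then show ?thesis by (simp only: G_def)
  qed
  have C1': "$Y <= $X" "ctbl Y" if "Y : $C" for Y using that C1(1) elts_ctbl_subsets by auto
  have K: "z : $X --> K z : $C & $(u z (lam z K)) <= $(K z)" for z
  proof (rule mem_induct[where Q = "%z. z : $X --> K z : $C & $(u z (lam z K)) <= $(K z)"])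
    show "defb (%e. e 0 : $X --> K (e 0) : $C & $(u (e 0) (lam (e 0) K)) <= $(K (e 0)))"
      unfolding u_def ins by (intro dfb deft_subst[OF dK])
    fix z assume IH: "!!w. w : $z ==> w : $X --> K w : $C & $(u w (lam w K)) <= $(K w)"
    show "z : $X --> K z : $C & $(u z (lam z K)) <= $(K z)"
    proof
      assume z: "z : $X"
      have zX: "w : $X" if "w : $z" for w using X z that unfolding transitive_def by blast
      then have Kw: "$(K w) <= $X" "ctbl (K w)" if "w : $z" for w using IH[OF that] that C1' by blast+
      have "$(u z (lam z K)) <= $X" unfolding uK using z Kw(1) by (auto split: if_splits)
      moreover have "ctbl (u z (lam z K))"
      proof -
        have s: "ctbl (vset {z})" using ctbl_upair[of z z] by simp
        show ?thesis
        proof (cases "ctbl z")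
          case True
          have "ctbl (vset ($(vset {z}) \<union> $(vset (\<Union>w\<in>$z. $(K w)))))"
            by (rule ctbl_Un[OF s ctbl_UN[OF dK True Kw(2)]])
          moreover have "vset ($(vset {z}) \<union> $(vset (\<Union>w\<in>$z. $(K w)))) = u z (lam z K)"
            by (rule vsetI, subst elts_Un) (simp add: uK True elts_UN[OF dK])
          ultimately show ?thesis by simp
        next
          case False
          then have "u z (lam z K) = vset {z}" by (intro vsetI) (simp add: uK)
          then show ?thesis using s by simp
        qed
      qed
      ultimately show "K z : $C & $(u z (lam z K)) <= $(K z)" unfolding KG[of z] using ch by blast
    qed
  qed
  define F where "F = lam X K"
  have F: "ap F z = K z" if "z : $X" for z unfolding F_def by (rule ap_lam[OF dK that])
  have main: "Y : $C" if Y: "$Y <= $X" "ctbl Y" "$Y \<noteq> {}" "\<forall>z\<in>$Y. $(ap F z) <= $Y"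
    "\<forall>x\<in>$Y. \<forall>y\<in>$Y. vset {x, y} : $Y" for Y
  proof -
    obtain y0 where y0: "y0 : $Y" using Y(3) by blast
    obtain f where f: "!!x. x : $Y ==> ap f x : $omega" "inj_on (ap f) ($Y)"
      using Y(2) unfolding ctbl_def lepoll_iff by blast
    define y where "y n = (if \<exists>x\<in>$Y. ap f x = n then vset {w. \<exists>x\<in>$Y. ap f x = n & w : $x} else y0)" for n
    have dy: "deft (%e. y (e 0))" unfolding y_def by (intro dfb)
    have yf: "y (ap f x) = x" if x: "x : $Y" for x
    proof -
      have "{w. \<exists>x'\<in>$Y. ap f x' = ap f x & w : $x'} = $x" using x f(2) unfolding inj_on_def by blast
      then show ?thesis unfolding y_def using x by auto
    qed
    have yY: "y n : $Y" for n
    proof (cases "\<exists>x\<in>$Y. ap f x = n")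
      case True then show ?thesis using yf by metis
    next
      case False then show ?thesis unfolding y_def using y0 by (simp only: if_False)
    qed
    \<comment> \<open>The sequence starts with \<open>y0\<close> and continues with the pair of the
      last term and the n-th element of an enumeration of \<open>Y\<close>. The sets
      \<open>K (s n)\<close> then increase in the club and exhaust \<open>Y\<close>, so
      \<open>Y\<close> is the union of a chain in it.\<close>
    define S where "S n s = (if n = zero then y0 else vset {ap s (union n), y (union n)})" for n s
    have S: "deft (%e. S (e (Suc 0)) (e 0))" unfolding S_def by (intro dfb deft_subst[OF dy])
    define s where "s = rec S"
    have ds: "deft (%e. s (e 0))" unfolding s_def by (intro deft_rec'[OF S] dfb)
    have sS: "s n = S n (lam n s)" for n unfolding s_def by (rule rec_eq[OF S])
    have s0: "s zero = y0" using sS[of zero] by (simp add: S_def)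
    have ss: "s (succ n) = vset {s n, y n}" if n: "n : $omega" for n
    proof -
      have on: "Ord n" using n Ord_mem Ord_omega by blast
      have 1: "union (succ n) = n" using on by (intro vsetI) (auto simp: Ord_def transitive_def)
      have 2: "succ n \<noteq> zero" using elts_succ elts_zero by (metis insert_not_empty)
      have 3: "ap (lam (succ n) s) n = s n" by (rule ap_lam[OF ds]) simp
      show ?thesis using sS[of "succ n"] unfolding S_def 1 3 using 2 by simp
    qed
    have sY: "s n : $Y" if "n : $omega" for n
      using that
    proof (induction rule: omega_induct)
      case def show ?case by (intro dfb ds)
    next
      case zero show ?case using s0 y0 by simp
    next
      case (succ n) then show ?case using ss yY Y(5) by simp
    qed
    have sX: "s n : $X" if "n : $omega" for n using sY[OF that] Y(1) by blast
    have KY: "$(K (s n)) <= $Y" if "n : $omega" for n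
      using bspec[OF Y(4) sY[OF that]] F[OF sX[OF that]] by simp
    have ysucc: "$(K (s n)) \<union> $(K (y n)) <= $(K (s (succ n)))" if n: "n : $omega" for n
    proof -
      have "ctbl (s (succ n))" unfolding ss[OF n] by (rule ctbl_upair)
      then show ?thesis using conjunct2[OF K[rule_format, OF sX[OF succ_omega[OF n]]]] unfolding uK using ss[OF n] by auto
    qed
    have mono: "m : $n --> $(K (s m)) <= $(K (s n))" if n: "n : $omega" for m n
      using n
    proof (induction rule: omega_induct)
      case def show ?case by (intro dfb deft_subst[OF dK] deft_subst[OF ds])
    next
      case zero then show ?case by simp
    next
      case (succ n) then show ?case using ysucc[OF succ(1)] by auto
    qed
    have dKs: "deft (%e. K (s (e 0)))" by (intro deft_subst[OF dK] ds)
    define D where "D = vset ((%n. K (s n)) ` $omega)"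
    have D: "$D = (%n. K (s n)) ` $omega" unfolding D_def by (rule elts_image[OF dKs])
    have "union D : $C"
    proof (rule C2)
      show "$D <= $C" unfolding D using K sX by blast
      show "$D \<noteq> {}" unfolding D using zero_omega by blast
      show "ctbl D" unfolding D_def by (rule ctbl_image[OF dKs]) (simp add: ctbl_def)
      have "$(K (s m)) <= $(K (s n)) \<or> $(K (s n)) <= $(K (s m))" if "m : $omega" "n : $omega" for m n
        using mono[OF that(1), of n] mono[OF that(2), of m] Ord_linear[of m n] Ord_mem[OF Ord_omega] that by blast
      then show "\<forall>Y\<in>$D. \<forall>Z\<in>$D. $Y <= $Z \<or> $Z <= $Y" unfolding D by blast
    qed
    moreover have "union D = Y"
    proof (intro vsetI equalityI subsetI)
      fix x assume "x : $(union D)" then show "x : $Y" using D KY by auto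
    next
      fix x assume x: "x : $Y"
      then have n: "ap f x : $omega" using f by blast
      have "x : $(K x)" using K[rule_format, of x] x Y(1) uK[of x] by blast
      then have "x : $(K (s (succ (ap f x))))" using ysucc[OF n] yf[OF x] by auto
      then show "x : $(union D)" using D succ_omega[OF n] by auto
    qed
    ultimately show ?thesis by simp
  qed
  show ?thesis
  proof (intro exI[of _ F] conjI ballI allI impI)
    fix z assume z: "z : $X"
    then have "ap F z : $C" using F[OF z] K by simp
    then show "ctbl (ap F z)" "$(ap F z) <= $X" using C1' by blast+
  next
    fix Y assume "$Y <= $X & ctbl Y & $Y \<noteq> {} & (\<forall>z\<in>$Y. $(ap F z) <= $Y) &
      (\<forall>x\<in>$Y. \<forall>y\<in>$Y. vset {x, y} : $Y)"
    then show "Y : $C" by (elim conjE) (rule main)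
  qed
qed

subsection \<open>Hereditary sets\<close>

lemma H_subset: assumes "Ord l" "x : $(H l)" "$y <= $(trans_cl x)" shows "y : $(H l)"
proof -
  have "$(trans_cl y) <= $(trans_cl x)" by (rule trans_cl_props(3)[OF trans_cl_props(1) assms(3)])
  then show ?thesis using assms(2) lepoll_trans[OF lepoll_subset] unfolding elts_H[OF assms(1)] card_less_def by blast
qed
lemma H_subset': "Ord l ==> x : $(H l) ==> $y <= $x ==> y : $(H l)"
  by (rule H_subset[where x = x]) (use trans_cl_props(2)[where x = x] in auto)
lemma transitive_H: assumes "Ord l" shows "transitive (H l)"
  unfolding transitive_def
proof (intro ballI subsetI)
  fix x y assume x: "x : $(H l)" and y: "y : $x"
  have "y : $(trans_cl x)" using y trans_cl_props(2)[where x = x] by blast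
  then have "$y <= $(trans_cl x)" using trans_cl_props(1)[where x = x] unfolding transitive_def by blast
  then show "y : $(H l)" by (rule H_subset[OF assms x])
qed
lemma Ord_in_H: assumes "Ord l" "a : $l" shows "a : $(H l)"
proof -
  have "transitive a" using Ord_mem[OF assms] unfolding Ord_def by blast
  then have "$(trans_cl a) <= $a" by (rule trans_cl_props(3)) simp
  then have "lepoll (trans_cl a) a" by (rule lepoll_subset)
  then show ?thesis unfolding elts_H[OF assms(1)] card_less_def using assms(2) by blast
qed
lemma mem_H2: "x : $(H omega2) \<longleftrightarrow> lepoll (trans_cl x) omega1"
proof -
  have "card_less (trans_cl x) omega2 \<longleftrightarrow> lepoll (trans_cl x) omega1"
    unfolding card_less_def using elts_omega2 lepoll_trans omega1_omega2 by blast
  then show ?thesis using elts_H[OF Ord_omega2] by simp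
qed
lemma omega2_sub_H2: "$omega2 <= $(H omega2)" using Ord_in_H[OF Ord_omega2] by blast
lemma H2_upair: assumes "x : $(H omega2)" "y : $(H omega2)" shows "vset {x, y} : $(H omega2)"
proof -
  define u where "u = vset ($(vset {x, y}) \<union> $(vset ($(trans_cl x) \<union> $(trans_cl y))))"
  have u: "$u = {x, y} \<union> ($(trans_cl x) \<union> $(trans_cl y))" unfolding u_def by simp
  have "$(trans_cl (vset {x, y})) <= $u"
  proof (rule trans_cl_props(3))
    show "transitive u" using trans_cl_props(1,2)[where x = x] trans_cl_props(1,2)[where x = y]
      unfolding transitive_def u by blast
  qed (simp add: u)
  moreover have "lepoll u omega1"
    unfolding u_def by (intro lepoll_Un[OF idem_omega1] idem_upair[OF idem_omega1]) (use assms mem_H2 in blast)+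
  ultimately show ?thesis unfolding mem_H2 using lepoll_trans[OF lepoll_subset] by blast
qed
lemma sub_omega1_H2: "$x <= $omega1 ==> x : $(H omega2)"
  by (rule H_subset'[OF Ord_omega2, of omega1]) (use omega2_sub_H2 omega1_omega2 in auto)

subsection \<open>Nice sets and continuous chains\<close>

text \<open>Three consequences of elementarity in \<open>H omega2\<close>, phrased without formulas:
  the trace on \<open>omega1\<close> is an ordinal, traces of elements are again elements, and below
  an element \<open>a\<close> of \<open>omega2\<close> the set is a piece of the canonical
  filtration.\<close>

definition nice :: "'v \<Rightarrow> bool" where
  "nice Y \<longleftrightarrow> vset ($Y \<inter> $omega1) : $omega1 &
     (\<forall>y\<in>$Y. vset ($y \<inter> $omega1) : $omega1 --> vset ($y \<inter> $omega1) : $Y) &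
     (\<forall>a\<in>$Y. a : $omega2 --> $Y \<inter> $a = $(B a (vset ($Y \<inter> $omega1))))"
lemma defb_nice [dfb]: "deft Y ==> defb (%e. nice (Y e))"
  by (rule defb_subst[of nice]) (unfold nice_def Int_def set_eq_iff mem_Collect_eq, intro dfb)

text \<open>A set-valued Skolem function whose closed sets are nice: it supplies pairs, traces on
  \<open>omega1\<close>, values and preimages under \<open>J\<close>, and the elements of countable
  ordinals.\<close>

definition g0 :: "'v \<Rightarrow> 'v \<Rightarrow> 'v" where
  "g0 x y = vset {w. w = vset {x, y} \<or> w = vset ($x \<inter> $omega1) & w : $omega1 \<or>
     x : $omega2 & y : $x & w = J x y \<or> x : $omega2 & w : $x & J x w = y \<or> x : $omega1 & w : $x}"
lemma deft_g0 [dfb]: "deft x ==> deft y ==> deft (%e. g0 (x e) (y e))"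
  by (rule deft_subst2[where F = g0]) (unfold g0_def, intro dfb)
lemma g0_props:
  shows elts_g0: "$(g0 x y) = {w. w = vset {x, y} \<or> w = vset ($x \<inter> $omega1) & w : $omega1 \<or>
     x : $omega2 & y : $x & w = J x y \<or> x : $omega2 & w : $x & J x w = y \<or> x : $omega1 & w : $x}"
    and ctbl_g0: "ctbl (g0 x y)"
proof -
  define p1 where "p1 = vset {vset {x, y}, vset ($x \<inter> $omega1)}"
  define p2 where "p2 = vset {J x y}"
  define p3 where "p3 = (if x : $omega2 then vset {w \<in> $x. J x w : $(vset {y})} else zero)"
  define p4 where "p4 = (if x : $omega1 then x else zero)"
  define p where "p = vset ($(vset ($p1 \<union> $p2)) \<union> $(vset ($p3 \<union> $p4)))"
  let ?S = "{w. w = vset {x, y} \<or> w = vset ($x \<inter> $omega1) & w : $omega1 \<or>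
     x : $omega2 & y : $x & w = J x y \<or> x : $omega2 & w : $x & J x w = y \<or> x : $omega1 & w : $x}"
  have p3e: "$(vset {w \<in> $x. J x w : $(vset {y})}) = {w \<in> $x. J x w : $(vset {y})}"
    by (rule elts_sep) (intro dfb)
  have p3e': "$(vset {w \<in> $x. J x w = y}) = {w \<in> $x. J x w = y}"
    by (rule elts_sep) (intro dfb)
  have pe: "$p = ($p1 \<union> $p2) \<union> ($p3 \<union> $p4)" unfolding p_def by simp
  have sub: "?S <= $p" unfolding pe p1_def p2_def p3_def p4_def by (auto simp: p3e')
  have z: "ctbl zero" unfolding ctbl_def by (rule lepoll_subset) simp
  have s: "ctbl (vset {u})" for u using ctbl_upair[of u u] by simp
  have "ctbl p3" unfolding p3_def
  proof (split if_split, intro conjI impI)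
    assume "x : $omega2"
    then show "ctbl (vset {w \<in> $x. J x w : $(vset {y})})"
      by (intro ctbl_fibre J s) (intro dfb)
  qed (rule z)
  moreover have "ctbl p4" unfolding p4_def using z ctbl_omega1_mem by simp
  ultimately have cp: "ctbl p" unfolding p_def p1_def p2_def by (intro ctbl_Un ctbl_upair s)
  have "isset ?S" by (rule isset_subset[OF _ sub isset_elts]) (unfold mem_Collect_eq, intro dfb)
  then show e: "$(g0 x y) = ?S" unfolding g0_def by (rule elts_vset)
  show "ctbl (g0 x y)" by (rule ctbl_subset[OF cp]) (use e sub in simp)
qed
lemma g0_H2: assumes "x : $(H omega2)" "y : $(H omega2)" shows "$(g0 x y) <= $(H omega2)"
proof
  fix w assume "w : $(g0 x y)"
  then consider "w = vset {x, y}" | "w : $omega1" | "x : $omega2" "y : $x" "w = J x y" | "x : $omega2" "w : $x" | "x : $omega1" "w : $x"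
    unfolding elts_g0 by blast
  then show "w : $(H omega2)"
  proof cases
    case 1 then show ?thesis using H2_upair assms by simp
  next
    case 2 then show ?thesis using omega1_sub_omega2 omega2_sub_H2 by blast
  next
    case 3 then show ?thesis using J(1)[of x y] omega1_sub_omega2 omega2_sub_H2 by blast
  next
    case 4 then show ?thesis using Ord_trans[OF Ord_omega2] omega2_sub_H2 by blast
  next
    case 5 then show ?thesis using Ord_trans[OF Ord_omega1] omega1_sub_omega2 omega2_sub_H2 by blast
  qed
qed
lemma nice_closed:
  assumes "ctbl Y" "\<forall>x\<in>$Y. \<forall>y\<in>$Y. $(g0 x y) <= $Y"
  shows "nice Y" "\<forall>x\<in>$Y. \<forall>y\<in>$Y. vset {x, y} : $Y"
proof -
  show "\<forall>x\<in>$Y. \<forall>y\<in>$Y. vset {x, y} : $Y" using assms(2) unfolding elts_g0 by blast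
  define e where "e = vset ($Y \<inter> $omega1)"
  have e: "$e = $Y \<inter> $omega1" unfolding e_def by simp
  have "Ord e"
  proof (rule Ord_transitiveI)
    show "transitive e"
      unfolding transitive_def
    proof (intro ballI subsetI)
      fix x w assume x: "x : $e" and w: "w : $x"
      have "w : $(g0 x x)" using x w unfolding elts_g0 e by blast
      then show "w : $e" using assms(2) x w Ord_trans[OF Ord_omega1] unfolding e by blast
    qed
  qed (use e Ord_mem[OF Ord_omega1] in blast)
  moreover have "ctbl e" by (rule ctbl_subset[OF assms(1)]) (simp add: e)
  ultimately have e1: "e : $omega1" unfolding elts_omega1 by blast
  have "$Y \<inter> $a = $(B a e)" if a: "a : $Y" "a : $omega2" for a
  proof (intro equalityI subsetI)
    fix x assume x: "x : $Y \<inter> $a"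
    have "J a x : $(g0 a x)" using a x unfolding elts_g0 by blast
    then show "x : $(B a e)" using assms(2) a x J(1)[of a x] unfolding elts_B e by blast
  next
    fix x assume x: "x : $(B a e)"
    then have "x : $(g0 a (J a x))" using a unfolding elts_g0 by auto
    then show "x : $Y \<inter> $a" using assms(2) a x unfolding elts_B e by blast
  qed
  moreover have "vset ($y \<inter> $omega1) : $Y" if y: "y : $Y" "vset ($y \<inter> $omega1) : $omega1" for y
  proof -
    have "vset ($y \<inter> $omega1) : $(g0 y y)" using y unfolding elts_g0 by blast
    then show ?thesis using assms(2) y by blast
  qed
  ultimately show "nice Y" unfolding nice_def e_def[symmetric] using e1 by blast
qed

text \<open>A club in the countable subsets of \<open>H omega2\<close> contains the sets closed
  under a function \<open>F\<close>, and closing off under \<open>g0\<close> and \<open>F\<close>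
  together can be combined with a prescribed stationary set of traces.\<close>

lemma club_lift:
  assumes C: "club C (H omega2)" and U: "stat omega1 U" and c: "ctbl c" "$c <= $(H omega2)" "$c \<noteq> {}"
  shows "\<exists>Y\<in>$C. ctbl Y & $Y <= $(H omega2) & nice Y & $c <= $Y & vset ($Y \<inter> $omega1) : $U"
proof -
  let ?X = "H omega2"
  obtain F where F: "\<forall>z\<in>$?X. ctbl (ap F z) & $(ap F z) <= $?X" and
    FC: "\<forall>Y. $Y <= $?X & ctbl Y & $Y \<noteq> {} & (\<forall>z\<in>$Y. $(ap F z) <= $Y) &
      (\<forall>x\<in>$Y. \<forall>y\<in>$Y. vset {x, y} : $Y) --> Y : $C"
    using club_contains_closed[OF C transitive_H[OF Ord_omega2]] by blast
  let ?g = "%x y. vset ($(g0 x y) \<union> $(ap F x))"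
  have g: "deft (%e. ?g (e 0) (e 1))" by (intro dfb)
  have A: "$omega1 <= $?X" using omega1_sub_omega2 omega2_sub_H2 by blast
  have gA: "ctbl (?g x y) & $(?g x y) <= $?X" if "x : $?X" "y : $?X" for x y
    using ctbl_Un[OF ctbl_g0] F g0_H2 that by simp
  from lift_stationary[OF A g gA U c(1,2)] obtain Y where Y: "$Y <= $?X" "ctbl Y" "$c <= $Y"
    "\<forall>x\<in>$Y. \<forall>y\<in>$Y. $(?g x y) <= $Y" "vset ($Y \<inter> $omega1) : $U" by blast
  have Y1: "\<forall>x\<in>$Y. \<forall>y\<in>$Y. $(g0 x y) <= $Y" "\<forall>z\<in>$Y. $(ap F z) <= $Y"
    using Y(4) unfolding elts_Un by blast+
  note n = nice_closed[OF Y(2) Y1(1)]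
  have "Y : $C" using FC Y Y1 n(2) c(3) by blast
  then show ?thesis using Y n(1) by blast
qed

definition chain :: "'v \<Rightarrow> 'v \<Rightarrow> bool" where
  "chain N P \<longleftrightarrow> (\<forall>a\<in>$omega1. ap N a : $P) &
     (\<forall>b\<in>$omega1. \<forall>a\<in>$b. $(ap N a) <= $(ap N b) & vset ($(ap N a) \<inter> $omega1) : $(ap N b)) &
     (\<forall>a\<in>$omega1. Limit a --> $(ap N a) = (\<Union>b\<in>$a. $(ap N b)))"

text \<open>SRP relates successive models only; induction extends inclusion to all pairs. Niceness
  turns membership of one model in the next into membership of its trace, so the traces increase
  strictly.\<close>

lemma SRP_chain:
  assumes SRP_omega2 "projective_stationary P (H omega2)" and nice: "!!Y. Y : $P ==> nice Y"
  shows "\<exists>N. chain N P"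
proof -
  from assms(1)[unfolded SRP_omega2_def, rule_format, OF assms(2)]
  obtain N where N0: "func N omega1 P &
        (\<forall>a\<in>$omega1. ctbl (app N a) & elementary (app N a) (H omega2) &
           app N a : $(app N (succ a)) & $(app N a) <= $(app N (succ a))) &
        (\<forall>a\<in>$omega1. Limit a --> $(app N a) = (\<Union>b\<in>$a. $(app N b)))" by (rule exE)
  have N: "func N omega1 P" using N0 by (rule conjunct1)
  have N2: "app N a : $(app N (succ a)) & $(app N a) <= $(app N (succ a))" if "a : $omega1" for a
    using bspec[OF conjunct1[OF conjunct2[OF N0]] that] by simp
  have N3: "$(app N a) = (\<Union>b\<in>$a. $(app N b))" if "a : $omega1" "Limit a" for a
    using bspec[OF conjunct2[OF conjunct2[OF N0]] that(1)] that(2) by simp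
  have s: "succ a : $omega1" if "a : $omega1" for a by (rule bnd_succ[OF bnd_omega1 that])
  have P: "ap N a : $P" if "a : $omega1" for a by (rule func_ap_in[OF N that])
  have S: "ap N a : $(ap N (succ a))" "$(ap N a) <= $(ap N (succ a))" if "a : $omega1" for a
    using N2[OF that] func_ap[OF N that] func_ap[OF N s[OF that]] by simp_all
  have L: "$(ap N a) = (\<Union>b\<in>$a. $(ap N b))" if a: "a : $omega1" "Limit a" for a
  proof -
    have "(\<Union>b\<in>$a. $(app N b)) = (\<Union>b\<in>$a. $(ap N b))"
      using func_ap[OF N Ord_trans[OF Ord_omega1 _ a(1)]] by simp
    then show ?thesis using N3[OF a] func_ap[OF N a(1)] by simp
  qed
  have mono: "b : $omega1 --> (\<forall>a\<in>$b. $(ap N a) <= $(ap N b))" for b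
  proof (rule mem_induct[where Q = "%b. b : $omega1 --> (\<forall>a\<in>$b. $(ap N a) <= $(ap N b))"])
    show "defb (%e. e 0 : $omega1 --> (\<forall>a\<in>$(e 0). $(ap N a) <= $(ap N (e 0))))" by (intro dfb)
    fix b assume IH: "!!c. c : $b ==> c : $omega1 --> (\<forall>a\<in>$c. $(ap N a) <= $(ap N c))"
    show "b : $omega1 --> (\<forall>a\<in>$b. $(ap N a) <= $(ap N b))"
    proof (intro impI ballI)
      fix a assume b: "b : $omega1" and a: "a : $b"
      have "Ord b" using Ord_mem[OF Ord_omega1 b] .
      then show "$(ap N a) <= $(ap N b)"
      proof (cases rule: Ord_cases)
        case 1 then show ?thesis using a by simp
      next
        case (2 c)
        have c: "c : $omega1" using Ord_trans[OF Ord_omega1 _ b, of c] 2 by simp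
        have "$(ap N a) <= $(ap N c)"
        proof (cases "a = c")
          case False
          then have "a : $c" using a 2(2) by simp
          moreover have "c : $b" using 2(2) by simp
          ultimately show ?thesis using IH[of c] c by blast
        qed simp
        then show ?thesis using S(2)[OF c] 2(2) by blast
      next
        case 3 then show ?thesis using L[OF b] a by blast
      qed
    qed
  qed
  have tr: "vset ($(ap N a) \<inter> $omega1) : $(ap N b)" if b: "b : $omega1" "a : $b" for a b
  proof -
    have a: "a : $omega1" using Ord_trans[OF Ord_omega1 b(2,1)] .
    have "vset ($(ap N a) \<inter> $omega1) : $omega1"
      using nice[OF P[OF a]] unfolding nice_def by (rule conjunct1)
    then have "vset ($(ap N a) \<inter> $omega1) : $(ap N (succ a))"
      using bspec[OF conjunct1[OF conjunct2[OF nice[OF P[OF s[OF a]], unfolded nice_def]]] S(1)[OF a]] by (rule mp[rotated])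
    moreover have "succ a = b \<or> succ a : $b"
    proof -
      have "Ord a" "Ord b" using a b Ord_mem[OF Ord_omega1] by auto
      moreover have "$(succ a) <= $b" using b Ord_trans[OF \<open>Ord b\<close>] by auto
      ultimately show ?thesis using Ord_subset_iff[of "succ a" b] Ord_succ[of a] by metis
    qed
    ultimately show ?thesis using mono[of b] b(1) by auto
  qed
  show ?thesis
    unfolding chain_def
  proof (intro exI[of _ N] conjI ballI impI)
    fix a b assume "b : $omega1" "a : $b"
    then show "$(ap N a) <= $(ap N b)" using mono[of b] by simp
  qed (fact P tr L)+
qed

context
  fixes N P assumes N: "chain N P" and nice: "!!Y. Y : $P ==> nice Y"
begin
lemma chain_P: "a : $omega1 ==> ap N a : $P" using N unfolding chain_def by blast
lemma chain_mono: "b : $omega1 ==> a : $b ==> $(ap N a) <= $(ap N b)"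
  using N unfolding chain_def by blast
lemma chain_lim: "a : $omega1 ==> Limit a ==> $(ap N a) = (\<Union>b\<in>$a. $(ap N b))"
  using N unfolding chain_def by blast
lemma chain_trace: "a : $omega1 ==> vset ($(ap N a) \<inter> $omega1) : $omega1"
  using nice chain_P unfolding nice_def by blast
lemma chain_trace_less: "b : $omega1 ==> a : $b ==> vset ($(ap N a) \<inter> $omega1) : $(vset ($(ap N b) \<inter> $omega1))"
  using N chain_trace[OF Ord_trans[OF Ord_omega1]] unfolding chain_def by simp
lemma chain_trace_ge: "a : $omega1 ==> $a <= $(ap N a)"
proof -
  have "a : $omega1 --> $a <= $(vset ($(ap N a) \<inter> $omega1))"
  proof (rule mem_induct[where Q = "%a. a : $omega1 --> $a <= $(vset ($(ap N a) \<inter> $omega1))"])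
    show "defb (%e. e 0 : $omega1 --> $(e 0) <= $(vset ($(ap N (e 0)) \<inter> $omega1)))" by (intro dfb)
    fix a assume IH: "!!b. b : $a ==> b : $omega1 --> $b <= $(vset ($(ap N b) \<inter> $omega1))"
    show "a : $omega1 --> $a <= $(vset ($(ap N a) \<inter> $omega1))"
    proof (intro impI subsetI)
      fix b assume a: "a : $omega1" and b: "b : $a"
      have b1: "b : $omega1" using Ord_trans[OF Ord_omega1 b a] .
      let ?b = "vset ($(ap N b) \<inter> $omega1)" and ?a = "vset ($(ap N a) \<inter> $omega1)"
      have O: "Ord b" "Ord ?b" "Ord ?a" using Ord_mem[OF Ord_omega1] b1 chain_trace[OF b1] chain_trace[OF a] by auto
      have "$b <= $?b" using IH[OF b] b1 by blast
      then have "b : $?b \<or> b = ?b" using Ord_subset_iff[OF O(1,2)] by blast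
      then show "b : $?a"
      proof
        assume "b : $?b"
        then show ?thesis by (rule Ord_trans[OF O(3) _ chain_trace_less[OF a b]])
      next
        assume "b = ?b"
        then show ?thesis using chain_trace_less[OF a b] by metis
      qed
    qed
  qed
  then show "a : $omega1 ==> $a <= $(ap N a)" by simp
qed
text \<open>The trace of the model with index \<open>z\<close> is an increasing continuous function
  of \<open>z\<close>, hence equal to \<open>z\<close> on a club. Closure under the successor of the
  trace captures these points.\<close>

lemma chain_points:
  assumes S: "stat omega1 S"
  shows "stat omega1 (vset {z \<in> $S. z : $omega1 & Limit z & vset ($(ap N z) \<inter> $omega1) = z})"
proof -
  let ?F = "%u v. succ (vset ($(ap N u) \<inter> $omega1))"
  have F: "deft (%e. ?F (e 0) (e 1))" by (intro dfb)
  have "stat omega1 (vset {x \<in> $S. x : $omega1 & closed_pt ?F x})"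
    by (rule stat_inter[OF bnd_omega1 S F]) (rule bnd_succ[OF bnd_omega1 chain_trace])
  then show ?thesis
  proof (rule stat_mono)
    have e1: "$(vset {x \<in> $S. x : $omega1 & closed_pt ?F x}) = {x \<in> $S. x : $omega1 & closed_pt ?F x}"
      by (rule elts_sep) (intro dfb)
    have e2: "$(vset {z \<in> $S. z : $omega1 & Limit z & vset ($(ap N z) \<inter> $omega1) = z}) = {z \<in> $S. z : $omega1 & Limit z & vset ($(ap N z) \<inter> $omega1) = z}"
      by (rule elts_sep) (intro dfb)
    have "Limit x & vset ($(ap N x) \<inter> $omega1) = x" if x: "x : $omega1" and c: "closed_pt ?F x" for x
    proof -
      have Ox: "Ord x" using Ord_mem[OF Ord_omega1 x] .
      have xF: "?F u u : $x" "u : $(?F u u)" if u: "u : $x" for u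
      proof -
        show "?F u u : $x" using c u unfolding closed_pt_def by blast
        have u1: "u : $omega1" using Ord_trans[OF Ord_omega1 u x] .
        let ?u = "vset ($(ap N u) \<inter> $omega1)"
        have O: "Ord u" "Ord ?u" using Ord_mem[OF Ord_omega1] u1 chain_trace[OF u1] by auto
        have "$u <= $?u" using chain_trace_ge[OF u1] Ord_trans[OF Ord_omega1 _ u1] by auto
        then have "u : $?u \<or> u = ?u" by (rule Ord_subset_iff[OF O, THEN iffD1])
        then show "u : $(?F u u)" unfolding elts_succ by blast
      qed
      have L: "Limit x" unfolding Limit_def using Ox xF c unfolding closed_pt_def by blast
      moreover have "$(ap N x) \<inter> $omega1 = $x"
      proof (intro equalityI subsetI)
        fix y assume y: "y : $(ap N x) \<inter> $omega1"
        then obtain u where u: "u : $x" "y : $(ap N u)" using chain_lim[OF x L] by blast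
        then have "y : $(?F u u)" using y by simp
        then show "y : $x" using xF(1)[OF u(1)] Ord_trans[OF Ox] by blast
      next
        fix y assume "y : $x"
        then show "y : $(ap N x) \<inter> $omega1" using chain_trace_ge[OF x] Ord_trans[OF Ord_omega1 _ x] by blast
      qed
      ultimately show ?thesis by simp
    qed
    then show "$(vset {x \<in> $S. x : $omega1 & closed_pt ?F x}) <= $(vset {z \<in> $S. z : $omega1 & Limit z & vset ($(ap N z) \<inter> $omega1) = z})"
      unfolding e1 e2 by blast
  qed
qed
end

subsection \<open>Good sets\<close>

text \<open>This describes the transitive collapse \<open>N\<close> of a guessing and internally stationary set, where
  \<open>R\<close> is the set of bounded subsets of \<open>\<omega>\<^sub>1\<close> in \<open>N\<close>. The last clause makes the countable sets of
  ordinals in \<open>N\<close> that are covered by \<open>c\<close> depend on \<open>R\<close> only.\<close>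

definition good :: "'v \<Rightarrow> 'v \<Rightarrow> bool" where
  "good N R \<longleftrightarrow> transitive N &
     (\<exists>f. (\<forall>x\<in>$N. ap f x : $omega1) & inj_on (ap f) ($N) &
        stat omega1 (vset {z \<in> $omega1. vset {x \<in> $N. ap f x : $z} : $N})) &
     (\<forall>x\<in>$N. \<forall>y\<in>$N. vset ($x \<inter> $y) : $N) &
     (\<forall>c\<in>$N. ctbl c & (\<forall>y\<in>$c. Ord y) -->
        (\<forall>A. $A <= $c --> (A : $N \<longleftrightarrow> vset (col c ` $A) : $R)))"
lemma defb_good [dfb]: assumes "deft N" "deft R" shows "defb (%e. good (N e) (R e))"
proof -
  have "defb (%e. good (e 0) (e 1))" unfolding good_def by (intro dfb)
  then show ?thesis by (rule defb_subst2) fact+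
qed

definition traces :: "'v \<Rightarrow> 'v \<Rightarrow> 'v" where
  "traces N a = vset {x \<in> $N. $x <= $a & ctbl x}"
lemma deft_traces [dfb]: "deft N ==> deft a ==> deft (%e. traces (N e) (a e))"
  by (rule deft_subst2[where F = traces]) (unfold traces_def, intro dfb)
lemma elts_traces: "$(traces N a) = {x \<in> $N. $x <= $a & ctbl x}"
  unfolding traces_def by (rule elts_sep) (intro dfb)
definition SS :: "'v \<Rightarrow> 'v \<Rightarrow> 'v" where
  "SS a X = vset {z \<in> $omega1. B a z : $X}"
lemma deft_SS [dfb]: "deft a ==> deft X ==> deft (%e. SS (a e) (X e))"
  by (rule deft_subst2[where F = SS]) (unfold SS_def, intro dfb)
lemma elts_SS: "$(SS a X) = {z \<in> $omega1. B a z : $X}"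
  unfolding SS_def by (rule elts_sep) (intro dfb)

text \<open>Stationarily many pieces of the filtration of \<open>N\<close> belong to
  \<open>N\<close>. Intersecting them with \<open>a\<close> gives elements of \<open>N\<close>, and
  the filtration of \<open>a\<close> so obtained agrees with the canonical one at almost all
  points.\<close>

lemma good_stat:
  assumes g: "good N R" and a: "a : $N" "a : $omega2" shows "stat omega1 (SS a (traces N a))"
proof -
  have tr: "$a <= $N" using g a unfolding good_def transitive_def by blast
  obtain f where f: "\<forall>x\<in>$N. ap f x : $omega1" "inj_on (ap f) ($N)"
    "stat omega1 (vset {z \<in> $omega1. vset {x \<in> $N. ap f x : $z} : $N})" 
    using g unfolding good_def by blast
  define S where "S = vset {z \<in> $omega1. vset {x \<in> $N. ap f x : $z} : $N}"
  have S: "$S = {z \<in> $omega1. vset {x \<in> $N. ap f x : $z} : $N}"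
    unfolding S_def by (rule elts_sep) (intro dfb)
  have "stat omega1 (vset {z \<in> $S. \<forall>x\<in>$a. ap f x : $z \<longleftrightarrow> J a x : $z})"
  proof (rule filtration_agree)
    show "stat omega1 S" unfolding S_def by (rule f(3))
    show "inj_on (ap f) ($a)" using f(2) tr inj_on_subset by blast
  qed (use f(1) tr J a(2) in \<open>auto intro: dfb\<close>)
  then show ?thesis
  proof (rule stat_mono)
    have e: "$(vset {z \<in> $S. \<forall>x\<in>$a. ap f x : $z \<longleftrightarrow> J a x : $z}) = {z \<in> $S. \<forall>x\<in>$a. ap f x : $z \<longleftrightarrow> J a x : $z}"
      by (rule elts_sep) (intro dfb)
    have "z : $(SS a (traces N a))" if z: "z : $S" "\<forall>x\<in>$a. ap f x : $z \<longleftrightarrow> J a x : $z" for z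
    proof -
      have z1: "z : $omega1" using z S by blast
      let ?E = "vset {x \<in> $N. ap f x : $z}"
      have E: "$?E = {x \<in> $N. ap f x : $z}" by (rule elts_sep) (intro dfb)
      have "vset ($?E \<inter> $a) = B a z" by (rule vsetI, unfold elts_Int, unfold E elts_B) (use z(2) tr in blast)
      moreover have "?E : $N" using z(1) S by blast
      ultimately have "B a z : $N" using g a(1) unfolding good_def by metis
      then have "B a z : $(traces N a)" unfolding elts_traces using ctbl_B[OF a(2) z1] by auto
      then show ?thesis unfolding elts_SS using z1 by blast
    qed
    then show "$(vset {z \<in> $S. \<forall>x\<in>$a. ap f x : $z \<longleftrightarrow> J a x : $z}) <= $(SS a (traces N a))"
      unfolding e by blast
  qed
qed

lemma ctbl_sub_B:
  assumes "a : $omega2" "ctbl x" "$x <= $a"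
  shows "\<exists>b\<in>$omega1. \<forall>z. Ord z & b : $z --> $x <= $(B a z)"
proof -
  have d: "deft (%e. J a (e 0))" by (intro dfb)
  obtain b where b: "b : $omega1" "\<forall>y\<in>$x. J a y : $b"
    using bnd_image[OF bnd_omega1 d assms(2)[unfolded ctbl_def] omega_omega1] J(1) assms by blast
  have "$x <= $(B a z)" if "Ord z" "b : $z" for z
    using b(2) assms(3) Ord_trans[OF that(1) _ that(2)] by auto
  then show ?thesis using b(1) by blast
qed

text \<open>A countable subset of \<open>a\<close> in one good set is covered by a piece
  \<open>B a z\<close> common to both. Relative to this cover its membership in either set means
  that its collapse lies in \<open>R\<close>, the same condition for both.\<close>

lemma good_traces_unique:
  assumes g: "good N R" "good N' R" and a: "a : $omega2"
    and u: "!!b. b : $omega1 ==> \<exists>z\<in>$(SS a (traces N a)) \<inter> $(SS a (traces N' a)). b : $z"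
  shows "traces N a = traces N' a"
proof -
  have half: "$(traces N a) <= $(traces N' a)" if g: "good N R" "good N' R" and
    u: "!!b. b : $omega1 ==> \<exists>z\<in>$(SS a (traces N a)) \<inter> $(SS a (traces N' a)). b : $z" for N N'
  proof
    fix x assume "x : $(traces N a)"
    then have x: "x : $N" "$x <= $a" "ctbl x" unfolding elts_traces by auto
    obtain b where b: "b : $omega1" "\<forall>z. Ord z & b : $z --> $x <= $(B a z)"
      using ctbl_sub_B[OF a x(3,2)] by blast
    obtain z where z: "z : $(SS a (traces N a))" "z : $(SS a (traces N' a))" "b : $z" using u[OF b(1)] by blast
    have c: "z : $omega1" "B a z : $N" "B a z : $N'" using z unfolding elts_SS elts_traces by auto
    have xc: "$x <= $(B a z)" using b(2) z(3) Ord_mem[OF Ord_omega1 c(1)] by blast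
    have cc: "ctbl (B a z)" "\<forall>y\<in>$(B a z). Ord y" using ctbl_B[OF a c(1)] Ord_mem[OF Ord_mem[OF Ord_omega2 a]] by auto
    have "vset (col (B a z) ` $x) : $R" using g(1) c(2) cc xc x(1) unfolding good_def by blast
    then have "x : $N'" using g(2) c(3) cc xc unfolding good_def by blast
    then show "x : $(traces N' a)" unfolding elts_traces using x by blast
  qed
  show ?thesis by (intro vsetI equalityI half[OF g] half[OF g(2,1)]) (use u in blast)+
qed

lemma projective_stationaryI:
  assumes P: "!!Y. Y : $P \<longleftrightarrow> ctbl Y & $Y <= $(H omega2) & nice Y & Q Y"
    and m: "!!T C. stat omega1 T ==> $T <= $omega1 ==> club C (H omega2) ==>
      \<exists>Y\<in>$C. ctbl Y & $Y <= $(H omega2) & nice Y & Q Y & vset ($Y \<inter> $omega1) : $T"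
  shows "projective_stationary P (H omega2)"
  unfolding projective_stationary_def
proof (intro conjI allI impI)
  show "$omega1 <= $(H omega2)" using omega1_sub_omega2 omega2_sub_H2 by blast
  show "$P <= $(ctbl_subsets (H omega2))" unfolding elts_ctbl_subsets using P by blast
  fix T assume T: "stationary_omega1 T"
  have e: "$(vset {Y \<in> $P. vset ($Y \<inter> $omega1) : $T}) = {Y \<in> $P. vset ($Y \<inter> $omega1) : $T}"
    by (rule elts_sep) (intro dfb)
  show "stationary (vset {Y \<in> $P. vset ($Y \<inter> $omega1) : $T}) (H omega2)"
    unfolding stationary_def e
  proof (intro conjI allI impI)
    show "{Y \<in> $P. vset ($Y \<inter> $omega1) : $T} <= $(ctbl_subsets (H omega2))"
      unfolding elts_ctbl_subsets using P by blast
    fix C assume C: "club C (H omega2)"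
    have "$T <= $omega1" using T unfolding stationary_omega1_def by blast
    from m[OF stationary_omega1_stat[OF T] this C] show "{Y \<in> $P. vset ($Y \<inter> $omega1) : $T} \<inter> $C \<noteq> {}"
      using P by blast
  qed
qed

section \<open>The tree of traces and a coherent branch\<close>

definition Lv :: "'v \<Rightarrow> 'v \<Rightarrow> 'v" where
  "Lv R a = vset {X \<in> $(pow (pow a)). \<exists>N. good N R & a : $N & X = traces N a}"
lemma deft_Lv [dfb]: "deft R ==> deft a ==> deft (%e. Lv (R e) (a e))"
  by (rule deft_subst2[where F = Lv]) (unfold Lv_def, intro dfb)
lemma elts_Lv: "$(Lv R a) = {X. \<exists>N. good N R & a : $N & X = traces N a}"
proof -
  have "$(Lv R a) = {X \<in> $(pow (pow a)). \<exists>N. good N R & a : $N & X = traces N a}"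
    unfolding Lv_def by (rule elts_sep) (intro dfb)
  then show ?thesis by (auto simp: elts_traces)
qed

lemma Lv_unique:
  assumes a: "a : $omega2" and X: "X : $(Lv R a)" "X' : $(Lv R a)"
    and S: "stat omega1 S" "$S <= $(SS a X) \<inter> $(SS a X')"
  shows "X = X'"
proof -
  obtain N where N: "good N R" "X = traces N a" using X unfolding elts_Lv by blast
  obtain N' where N': "good N' R" "X' = traces N' a" using X unfolding elts_Lv by blast
  have "\<exists>z\<in>$(SS a X) \<inter> $(SS a X'). b : $z" if "b : $omega1" for b
    using stat_unbounded[OF bnd_omega1 S(1) that] S(2) by blast
  then show ?thesis unfolding N(2) N'(2) by (rule good_traces_unique[OF N(1) N'(1) a])
qed

text \<open>The reason is that under SRP the nonstationary ideal on \<open>\<omega>\<^sub>1\<close> is saturated, and distinct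
  elements of \<open>Lv R a\<close> have almost disjoint stationary sets attached.\<close>

lemma Lv_small:
  assumes SRP: SRP_omega2 and a: "a : $omega2" shows "lepoll (Lv R a) omega1"
proof -
  define A where "A = vset (SS a ` $(Lv R a))"
  have dS: "deft (%e. SS a (e 0))" by (intro dfb)
  have A: "$A = SS a ` $(Lv R a)" unfolding A_def by (rule elts_image[OF dS])
  have As: "stat omega1 S & $S <= $omega1" if S: "S : $A" for S
  proof -
    obtain N where "good N R" "a : $N" "S = SS a (traces N a)" using S unfolding A elts_Lv by blast
    then show ?thesis using good_stat[of N R a] a elts_SS by auto
  qed
  \<comment> \<open>Adding to \<open>A\<close> all stationary sets that are almost disjoint from its
    members makes \<open>E\<close> predense: every stationary set has stationary intersection with a
    member of \<open>E\<close>. This yields the projective stationarity of \<open>P\<close>.\<close>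
  define E where "E = vset {S \<in> $(pow omega1). S : $A \<or> stat omega1 S & (\<forall>S'\<in>$A. \<not> stat omega1 (vset ($S \<inter> $S')))}"
  have E: "$E = {S \<in> $(pow omega1). S : $A \<or> stat omega1 S & (\<forall>S'\<in>$A. \<not> stat omega1 (vset ($S \<inter> $S')))}"
    unfolding E_def by (rule elts_sep) (intro dfb)
  let ?Q = "%Y. \<exists>S\<in>$Y. S : $E & vset ($Y \<inter> $omega1) : $S"
  define P where "P = vset {Y \<in> $(ctbl_subsets (H omega2)). nice Y & ?Q Y}"
  have "$P = {Y \<in> $(ctbl_subsets (H omega2)). nice Y & ?Q Y}"
    unfolding P_def by (rule elts_sep) (intro dfb)
  then have P: "Y : $P \<longleftrightarrow> ctbl Y & $Y <= $(H omega2) & nice Y & ?Q Y" for Y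
    unfolding elts_ctbl_subsets by blast
  have "projective_stationary P (H omega2)"
  proof (rule projective_stationaryI[OF P])
    fix T C assume T: "stat omega1 T" "$T <= $omega1" and C: "club C (H omega2)"
    have "\<exists>S\<in>$E. stat omega1 (vset ($S \<inter> $T))"
    proof (cases "\<exists>S'\<in>$A. stat omega1 (vset ($T \<inter> $S'))")
      case True
      then show ?thesis using As unfolding E by (metis (no_types, lifting) Int_commute elts_pow mem_Collect_eq)
    next
      case False
      then have "T : $E" unfolding E using T by simp
      then show ?thesis using T(1) by (intro bexI[of _ T]) simp_all
    qed
    then obtain S where S: "S : $E" "stat omega1 (vset ($S \<inter> $T))" by blast
    have SH: "S : $(H omega2)" using S(1) sub_omega1_H2 unfolding E by auto
    have cS: "ctbl (vset {S})" using ctbl_upair[of S S] by simp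
    obtain Y where Y: "Y : $C" "ctbl Y" "$Y <= $(H omega2)" "nice Y" "$(vset {S}) <= $Y"
      "vset ($Y \<inter> $omega1) : $(vset ($S \<inter> $T))"
      using club_lift[OF C S(2) cS] SH by auto
    then have "?Q Y" "vset ($Y \<inter> $omega1) : $T" using S(1) by auto
    then show "\<exists>Y\<in>$C. ctbl Y & $Y <= $(H omega2) & nice Y & ?Q Y & vset ($Y \<inter> $omega1) : $T"
      using Y(1-4) by blast
  qed
  moreover have nice: "nice Y" if "Y : $P" for Y using that P by blast
  ultimately obtain N where N: "chain N P" using SRP_chain[OF SRP] by blast
  have dN: "deft (%e. ap N (e 0))" by (intro dfb)
  define Q where "Q = vset (\<Union>z\<in>$omega1. $(ap N z))"
  have Q: "$Q = (\<Union>z\<in>$omega1. $(ap N z))" unfolding Q_def by (rule elts_UN[OF dN])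
  have cN: "ctbl (ap N z)" if "z : $omega1" for z using chain_P[OF N nice that] P by blast
  have Qk: "lepoll Q omega1"
    unfolding Q_def by (rule lepoll_UN[OF idem_omega1 dN lepoll_refl]) (rule ctbl_lepoll_omega1[OF cN])
  have AQ: "$A <= $Q"
  proof
    fix S assume S: "S : $A"
    define S1 where "S1 = vset {z \<in> $S. z : $omega1 & Limit z & vset ($(ap N z) \<inter> $omega1) = z}"
    have S1: "$S1 = {z \<in> $S. z : $omega1 & Limit z & vset ($(ap N z) \<inter> $omega1) = z}"
      unfolding S1_def by (rule elts_sep) (intro dfb)
    have s1: "stat omega1 S1" unfolding S1_def by (rule chain_points[OF N nice]) (use As[OF S] in auto)
    \<comment> \<open>At a continuity point the witness in the model with index \<open>z\<close>
      already occurs in an earlier model. The least such index \<open>u\<close> is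
      regressive.\<close>
    let ?R = "%z u. \<exists>S'\<in>$(ap N u). S' : $E & z : $S'"
    have dR: "defb (%e. ?R z (e 0))" for z by (intro dfb)
    have R: "oleast (?R z) : $z" "?R z (oleast (?R z))" if z: "z : $S1" for z
    proof -
      have z1: "z : $omega1" "Limit z" "vset ($(ap N z) \<inter> $omega1) = z" using z S1 by auto
      obtain S' where S': "S' : $(ap N z)" "S' : $E" "z : $S'"
        using chain_P[OF N nice z1(1)] P z1(3) by metis
      obtain u where "u : $z" "S' : $(ap N u)" using chain_lim[OF N nice z1(1,2)] S'(1) by blast
      then have u: "?R z u" "u : $z" using S' by blast+
      from oleast_mem[OF dR Ord_mem[OF Ord_omega1 z1(1)] u] show "oleast (?R z) : $z" "?R z (oleast (?R z))" by auto
    qed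
    have "deft (%e. oleast (?R (e 0)))" by (intro dfb)
    from Fodor[OF bnd_omega1 s1 this] R obtain u where u: "u : $omega1"
      "stat omega1 (vset {z \<in> $S1. oleast (?R z) = u})" by blast
    define S2 where "S2 = vset {z \<in> $S1. oleast (?R z) = u}"
    have S2: "$S2 = {z \<in> $S1. oleast (?R z) = u}" unfolding S2_def by (rule elts_sep) (intro dfb)
    obtain k where k: "!!x. x : $(ap N u) ==> ap k x : $omega" "inj_on (ap k) ($(ap N u))"
      using cN[OF u(1)] unfolding ctbl_def lepoll_iff by blast
    \<comment> \<open>With the model fixed, its countably many elements are numbered by
      \<open>k\<close>. The number of a witness is below \<open>omega\<close>, hence below
      \<open>z\<close>, and pressing down a second time fixes the witness itself.\<close>
    let ?M = "%z n. \<exists>S'\<in>$(ap N u). S' : $E & z : $S' & ap k S' = n"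
    have dM: "defb (%e. ?M z (e 0))" for z by (intro dfb)
    have M: "oleast (?M z) : $z" "?M z (oleast (?M z))" if z: "z : $S2" for z
    proof -
      have "z : $S1" "oleast (?R z) = u" using z S2 by auto
      then obtain S' where S': "S' : $(ap N u)" "S' : $E" "z : $S'" using R(2)[of z] by blast
      then have n: "?M z (ap k S')" "ap k S' : $omega" using k by blast+
      from oleast_mem[OF dM Ord_omega n] have "oleast (?M z) : $omega" "?M z (oleast (?M z))" by auto
      moreover have "$omega <= $z" using omega_props(2) \<open>z : $S1\<close> S1 by blast
      ultimately show "oleast (?M z) : $z" "?M z (oleast (?M z))" by auto
    qed
    have dl: "deft (%e. oleast (?M (e 0)))" by (intro dfb)
    have s2: "stat omega1 S2" unfolding S2_def by (rule u(2))
    from Fodor[OF bnd_omega1 s2 dl] M obtain n where n: "stat omega1 (vset {z \<in> $S2. oleast (?M z) = n})" by blast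
    have S3: "$(vset {z \<in> $S2. oleast (?M z) = n}) = {z \<in> $S2. oleast (?M z) = n}"
      by (rule elts_sep) (intro dfb)
    obtain z0 where z0: "z0 : $S2" "oleast (?M z0) = n"
      using stat_unbounded[OF bnd_omega1 n bnd_zero[OF bnd_omega1]] unfolding S3 by blast
    then obtain S' where S': "S' : $(ap N u)" "S' : $E" "ap k S' = n" using M(2)[of z0] by blast
    have sub: "z : $S & z : $S'" if zz: "z : $S2" "oleast (?M z) = n" for z
    proof -
      obtain S'' where "S'' : $(ap N u)" "z : $S''" "ap k S'' = n" using M(2)[OF zz(1)] zz(2) by blast
      then have "z : $S'" using S' k(2) unfolding inj_on_def by metis
      then show ?thesis using zz(1) S2 S1 by blast
    qed
    then have "stat omega1 (vset ($S' \<inter> $S))"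
      by (intro stat_mono[OF n]) (simp add: S3 del: elts_vset, blast)
    \<comment> \<open>A member of \<open>E\<close> outside \<open>A\<close> is almost disjoint from
      every member of \<open>A\<close>, whereas \<open>S'\<close> meets \<open>S\<close> in a
      stationary set.\<close>
    then have "S' : $A" using S'(2) S unfolding E by blast
    then obtain X X' where X: "X : $(Lv R a)" "S = SS a X" "X' : $(Lv R a)" "S' = SS a X'" using S A by blast
    have "X = X'" by (rule Lv_unique[OF a X(1,3) n]) (use sub X S3 in blast)
    then have "S = S'" using X by simp
    then show "S : $Q" unfolding Q using S'(1) u(1) by blast
  qed
  have "lepoll (Lv R a) A"
  proof (rule lepollI[OF dS])
    show "SS a X : $A" if "X : $(Lv R a)" for X using that A by blast
    show "X = X'" if X: "X : $(Lv R a)" "X' : $(Lv R a)" "SS a X = SS a X'" for X X'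
    proof -
      have "stat omega1 (SS a X)" using As X(1) A by blast
      then show ?thesis by (rule Lv_unique[OF a X(1,2)]) (use X(3) in simp)
    qed
  qed
  then show ?thesis using lepoll_trans lepoll_subset[OF AQ] Qk by blast
qed

lemma ordinal_iso_eq:
  assumes a: "Ord a" "Ord b" and h: "!!x. x : $a ==> h x : $b" and s: "!!y. y : $b ==> \<exists>x\<in>$a. y = h x"
    and o: "!!x y. x : $a ==> y : $a ==> x : $y \<longleftrightarrow> h x : $(h y)" and d: "deft (%e. h (e 0))"
  shows "a = b"
proof -
  have "x : $a --> h x = x" for x
  proof (rule mem_induct[where Q = "%x. x : $a --> h x = x"])
    show "defb (%e. e 0 : $a --> h (e 0) = e 0)" by (intro dfb d)
    fix x assume IH: "!!y. y : $x ==> y : $a --> h y = y"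
    show "x : $a --> h x = x"
    proof (intro impI vsetI equalityI subsetI)
      fix z assume x: "x : $a" and z: "z : $(h x)"
      have "z : $b" using Ord_trans[OF a(2) z h[OF x]] .
      then obtain y where y: "y : $a" "z = h y" using s by blast
      then have "y : $x" using o[OF y(1) x] z by simp
      then show "z : $x" using IH y by simp
    next
      fix z assume x: "x : $a" and z: "z : $x"
      have za: "z : $a" using Ord_trans[OF a(1) z x] .
      then show "z : $(h x)" using o[OF za x] z IH[OF z] by simp
    qed
  qed
  then show ?thesis using h s by (intro vsetI) fastforce
qed

lemma traces_restrict:
  assumes "$a <= $b" shows "traces N a = vset {x \<in> $(traces N b). $x <= $a}"
proof -
  have "$(vset {x \<in> $(traces N b). $x <= $a}) = {x \<in> $(traces N b). $x <= $a}"
    by (rule elts_sep) (intro dfb)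
  then show ?thesis using assms by (intro vsetI) (auto simp: elts_traces simp del: elts_vset)
qed

text \<open>The nodes of height \<open>a\<close> are the traces in \<open>Lv R a\<close>, ordered by
  restriction; \<open>Lv_small\<close> bounds the levels. The predecessors of a node of height
  \<open>b\<close> are its restrictions to smaller ordinals, so heights in the sense of the tree are
  the first components.\<close>

lemma coherent_branch:
  assumes SRP: SRP_omega2 and TP: "tree_property omega2"
    and ex: "!!a. a : $omega2 ==> \<exists>N. good N R & a : $N"
  shows "\<exists>X. \<forall>a\<in>$omega2. \<exists>N. good N R & a : $N & (\<forall>x. $x <= $a & ctbl x --> (x : $X \<longleftrightarrow> x : $N))"
proof -
  define T where "T = vset {z \<in> $(prod omega2 (pow (pow omega2))). \<exists>a X. z = pair a X & X : $(Lv R a)}"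
  have eT: "$T = {z \<in> $(prod omega2 (pow (pow omega2))). \<exists>a X. z = pair a X & X : $(Lv R a)}"
    unfolding T_def by (rule elts_sep) (intro dfb)
  have sub2: "$a <= $omega2" if "a : $omega2" for a using Ord_trans[OF Ord_omega2 _ that] by blast
  have LvT: "X : $(pow (pow omega2))" if XL: "X : $(Lv R a)" "a : $omega2" for a X
  proof -
    obtain N where N: "X = traces N a" using XL(1) unfolding elts_Lv by blast
    have "$x <= $omega2" if "x : $X" for x
      using that sub2[OF XL(2)] unfolding N elts_traces by blast
    then show ?thesis by auto
  qed
  have T: "pair a X : $T \<longleftrightarrow> a : $omega2 & X : $(Lv R a)" for a X
    unfolding eT using LvT by (auto simp: pair_inject)
  have Tp: "\<exists>a X. t = pair a X & a : $omega2 & X : $(Lv R a)" if "t : $T" for t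
    using that unfolding eT by (auto simp: pair_inject)
  let ?rs = "%X a. vset {x \<in> $X. $x <= $a}"
  define r where "r = vset {z \<in> $(prod T T). \<exists>a X b Y. z = pair (pair a X) (pair b Y) & a : $b & X = ?rs Y a}"
  have "$r = {z \<in> $(prod T T). \<exists>a X b Y. z = pair (pair a X) (pair b Y) & a : $b & X = ?rs Y a}"
    unfolding r_def by (rule elts_sep) (intro dfb)
  then have r: "pair (pair a X) (pair b Y) : $r \<longleftrightarrow> pair a X : $T & pair b Y : $T & a : $b & X = ?rs Y a" for a X b Y
    by (auto simp: pair_inject)
  have rs: "$(?rs Y a) = {x \<in> $Y. $x <= $a}" for Y a by (rule elts_sep) (intro dfb)
  have rs3: "?rs (?rs Y c) a = ?rs Y a" if "$a <= $c" for Y a c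
  proof (rule vsetI)
    have "$(?rs (?rs Y c) a) = {x \<in> $(?rs Y c). $x <= $a}" by (rule rs)
    also have "\<dots> = {x \<in> $Y. $x <= $a}" using rs[of Y c] that by auto
    also have "\<dots> = $(?rs Y a)" by (rule rs[symmetric])
    finally show "$(?rs (?rs Y c) a) = $(?rs Y a)" .
  qed
  have restr: "pair a (?rs Y a) : $T" if ab: "pair b Y : $T" "a : $b" for a b Y
  proof -
    have b: "b : $omega2" using ab(1) T by blast
    obtain N where N: "good N R" "b : $N" "Y = traces N b" using ab(1) unfolding T elts_Lv by blast
    have "a : $N" using N ab(2) unfolding good_def transitive_def by blast
    moreover have "$a <= $b" using Ord_trans[OF Ord_mem[OF Ord_omega2 b] _ ab(2)] by blast
    then have "?rs Y a = traces N a" using traces_restrict N(3) by simp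
    ultimately show ?thesis unfolding T elts_Lv using N(1) Ord_trans[OF Ord_omega2 ab(2) b] by blast
  qed
  have preds: "$(predecessors T r (pair b Y)) = {s. \<exists>a\<in>$b. s = pair a (?rs Y a)}" if t: "pair b Y : $T" for b Y
  proof -
    have "$(predecessors T r (pair b Y)) = {s \<in> $T. pair s (pair b Y) : $r}"
      unfolding predecessors_def by (rule elts_sep) (intro dfb)
    also have "\<dots> = {s. \<exists>a\<in>$b. s = pair a (?rs Y a)}"
    proof (intro set_eqI iffI)
      fix s assume s: "s : {s \<in> $T. pair s (pair b Y) : $r}"
      then obtain a X where aX: "s = pair a X" using Tp by blast
      then have "pair (pair a X) (pair b Y) : $r" using s by simp
      then have "a : $b" "X = ?rs Y a" unfolding r by simp_all
      then show "s : {s. \<exists>a\<in>$b. s = pair a (?rs Y a)}" unfolding aX by blast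
    next
      fix s assume "s : {s. \<exists>a\<in>$b. s = pair a (?rs Y a)}"
      then obtain a where a: "a : $b" "s = pair a (?rs Y a)" by blast
      then have "pair (pair a (?rs Y a)) (pair b Y) : $r" unfolding r using restr[OF t a(1)] t by simp
      then show "s : {s \<in> $T. pair s (pair b Y) : $r}" unfolding a(2) using restr[OF t a(1)] by simp
    qed
    finally show ?thesis .
  qed
  have dfst: "deft (%e. fstp (e 0))" by (intro dfb)
  have rr: "pair x y : $r \<longleftrightarrow> fstp x : $(fstp y)"
    if t: "pair b Y : $T" and x: "x : $(predecessors T r (pair b Y))" and y: "y : $(predecessors T r (pair b Y))" for x y b Y
  proof -
    obtain a where a: "a : $b" "x = pair a (?rs Y a)" using x preds[OF t] by blast
    obtain c where c: "c : $b" "y = pair c (?rs Y c)" using y preds[OF t] by blast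
    have b: "b : $omega2" using t T by blast
    have "?rs Y a = ?rs (?rs Y c) a" if "a : $c"
      by (rule rs3[symmetric]) (use Ord_trans[OF Ord_mem[OF Ord_mem[OF Ord_omega2 b] c(1)] _ that] in blast)
    moreover have "pair a (?rs Y a) : $T" "pair c (?rs Y c) : $T" using restr[OF t] a(1) c(1) by blast+
    ultimately show ?thesis unfolding a(2) c(2) r fstp by metis
  qed
  have fb: "height_eq T r (pair b Y) b" if t: "pair b Y : $T" for b Y
    unfolding height_eq_def
  proof (intro conjI exI[of _ "lam (predecessors T r (pair b Y)) fstp"] ballI)
    let ?p = "predecessors T r (pair b Y)"
    show "Ord b" using t T Ord_mem[OF Ord_omega2] by blast
    have ap: "app (lam ?p fstp) x = fstp x" if "x : $?p" for x by (rule app_lam[OF dfst that])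
    have 1: "func (lam ?p fstp) ?p b" by (rule func_lam[OF dfst]) (auto simp: preds[OF t])
    have "bij_betw fstp ($?p) ($b)"
      unfolding bij_betw_def inj_on_def preds[OF t] by force
    then have "bij_betw (app (lam ?p fstp)) ($?p) ($b)" using ap by (simp cong: bij_betw_cong)
    then show "bijection (lam ?p fstp) ?p b" using 1 unfolding bijection_def by blast
    fix x y assume xy: "x : $?p" "y : $?p"
    show "pair x y : $r \<longleftrightarrow> app (lam ?p fstp) x : $(app (lam ?p fstp) y)"
      unfolding ap[OF xy(1)] ap[OF xy(2)] by (rule rr[OF t xy])
  qed
  have hu: "a = b" if t: "pair b Y : $T" and h: "height_eq T r (pair b Y) a" for a b Y
  proof -
    let ?p = "predecessors T r (pair b Y)"
    obtain f where f: "bijection f ?p a" "\<forall>x\<in>$?p. \<forall>y\<in>$?p. pair x y : $r \<longleftrightarrow> app f x : $(app f y)"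
      using h unfolding height_eq_def by blast
    have Oa: "Ord a" using h unfolding height_eq_def by blast
    have Ob: "Ord b" using t T Ord_mem[OF Ord_omega2] by blast
    have fn: "func f ?p a" and fbij: "bij_betw (app f) ($?p) ($a)" using f(1) unfolding bijection_def by auto
    have ap: "app f x = ap f x" if "x : $?p" for x by (rule func_ap[OF fn that])
    have p: "pair c (?rs Y c) : $?p" if "c : $b" for c using that preds[OF t] by blast
    have "b = a"
    proof (rule ordinal_iso_eq[OF Ob Oa, where h = "%c. ap f (pair c (?rs Y c))"])
      show "deft (%e. ap f (pair (e 0) (?rs Y (e 0))))" by (intro dfb)
      show "ap f (pair c (?rs Y c)) : $a" if "c : $b" for c by (rule func_ap_in[OF fn p[OF that]])
      show "\<exists>x\<in>$b. y = ap f (pair x (?rs Y x))" if y: "y : $a" for y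
      proof -
        obtain s where s: "s : $?p" "y = app f s" using fbij y unfolding bij_betw_def by blast
        then obtain x where "x : $b" "s = pair x (?rs Y x)" using preds[OF t] by blast
        then show ?thesis using s ap[OF s(1)] by blast
      qed
      show "x : $y \<longleftrightarrow> ap f (pair x (?rs Y x)) : $(ap f (pair y (?rs Y y)))" if xy: "x : $b" "y : $b" for x y
        using rr[OF t p[OF xy(1)] p[OF xy(2)]] f(2) p[OF xy(1)] p[OF xy(2)] ap[OF p[OF xy(1)]] ap[OF p[OF xy(2)]] by simp
    qed
    then show ?thesis ..
  qed
  have defh: "defb (%e. height_eq T r (e 0) a)" for a
  proof -
    have "height_eq T r t a \<longleftrightarrow> Ord a & (\<exists>f. func f (predecessors T r t) a & inj_on (ap f) ($(predecessors T r t)) & (\<forall>y\<in>$a. \<exists>x\<in>$(predecessors T r t). y = ap f x) &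
     (\<forall>x\<in>$(predecessors T r t). \<forall>y\<in>$(predecessors T r t).
        pair x y : $r \<longleftrightarrow> ap f x : $(ap f y)))" for t
    proof -
      let ?p = "predecessors T r t"
      have "bijection f ?p a & (\<forall>x\<in>$?p. \<forall>y\<in>$?p. pair x y : $r \<longleftrightarrow> app f x : $(app f y)) \<longleftrightarrow>
        func f ?p a & inj_on (ap f) ($?p) & (\<forall>y\<in>$a. \<exists>x\<in>$?p. y = ap f x) & (\<forall>x\<in>$?p. \<forall>y\<in>$?p. pair x y : $r \<longleftrightarrow> ap f x : $(ap f y))" for f
      proof (cases "func f ?p a")
        case True
        have ap: "app f x = ap f x" if "x : $?p" for x by (rule func_ap[OF True that])
        have "bij_betw (app f) ($?p) ($a) \<longleftrightarrow> bij_betw (ap f) ($?p) ($a)" using ap by (rule bij_betw_cong)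
        also have "\<dots> \<longleftrightarrow> inj_on (ap f) ($?p) & (\<forall>y\<in>$a. \<exists>x\<in>$?p. y = ap f x)"
          unfolding bij_betw_def using func_ap_in[OF True] by blast
        finally show ?thesis unfolding bijection_def using ap by (simp cong: conj_cong)
      qed (simp add: bijection_def)
      then show ?thesis unfolding height_eq_def by simp
    qed
    then show ?thesis unfolding predecessors_def by (simp only:) (intro dfb)
  qed
  have lev: "$(level T r a) = {t. \<exists>X. t = pair a X & a : $omega2 & X : $(Lv R a)}" for a
  proof -
    have "$(level T r a) = {t \<in> $T. height_eq T r t a}"
      unfolding level_def by (rule elts_sep) (rule defh)
    also have "\<dots> = {t. \<exists>X. t = pair a X & a : $omega2 & X : $(Lv R a)}"
      using hu fb Tp T by blast
    finally show ?thesis .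
  qed
  have "tree_of_height T r omega2"
    unfolding tree_of_height_def tree_def
  proof (intro conjI ballI impI)
    fix x assume "x : $T"
    then show "pair x x \<notin> $r" using Tp r mem_irrefl by metis
  next
    fix x y z assume "x : $T" "y : $T" "z : $T" and p: "pair x y : $r & pair y z : $r"
    then obtain a X b Y c Z where e: "x = pair a X" "y = pair b Y" "z = pair c Z" using Tp by metis
    have p': "pair (pair a X) (pair b Y) : $r" "pair (pair b Y) (pair c Z) : $r" using p e by auto
    have c: "c : $omega2" "b : $c" "a : $b" using p' unfolding r T by blast+
    have Ob: "Ord b" using Ord_mem[OF Ord_mem[OF Ord_omega2 c(1)] c(2)] .
    have "?rs (?rs Z b) a = ?rs Z a"
      by (rule rs3) (use Ord_trans[OF Ob _ c(3)] in blast)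
    moreover have "a : $c" using Ord_trans[OF Ord_mem[OF Ord_omega2 c(1)] c(3,2)] .
    ultimately show "pair x z : $r" using p' unfolding e r by metis
  next
    fix t assume "t : $T" then show "\<exists>a. height_eq T r t a" using fb Tp by blast
  next
    fix a assume a: "a : $omega2"
    then show "$(level T r a) \<noteq> {}" using ex[OF a] unfolding lev elts_Lv by blast
  next
    show "$(level T r omega2) = {}" unfolding lev using mem_irrefl by blast
  qed simp
  moreover have "card_less (level T r a) omega2" if a: "a : $omega2" for a
  proof -
    have d: "deft (%e. sndp (e 0))" by (intro dfb)
    have "lepoll (level T r a) (Lv R a)" by (rule lepollI[OF d]) (auto simp: lev)
    then show ?thesis unfolding card_less_def using lepoll_trans Lv_small[OF SRP a] omega1_omega2 by blast
  qed
  ultimately obtain Br where "cofinal_branch T r omega2 Br" using TP unfolding tree_property_def by blast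
  then have Br: "$Br <= $T" "!!x y. x : $Br ==> y : $Br ==> x = y \<or> pair x y : $r \<or> pair y x : $r"
    "!!a. a : $omega2 ==> $Br \<inter> $(level T r a) \<noteq> {}"
    unfolding cofinal_branch_def by blast+
  \<comment> \<open>The union of the traces along the branch. Comparability of nodes makes it agree
    with each single trace on the countable subsets of the corresponding ordinal.\<close>
  define X where "X = vset {x \<in> $(pow omega2). \<exists>a Y. pair a Y : $Br & x : $Y}"
  have X: "$X = {x \<in> $(pow omega2). \<exists>a Y. pair a Y : $Br & x : $Y}"
    unfolding X_def by (rule elts_sep) (intro dfb)
  show ?thesis
  proof (rule exI[of _ X], rule ballI)
    fix a assume a: "a : $omega2"
    obtain Y where Y: "pair a Y : $Br" "Y : $(Lv R a)" using Br(3)[OF a] unfolding lev by blast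
    obtain N where N: "good N R" "a : $N" "Y = traces N a" using Y(2) unfolding elts_Lv by blast
    have "x : $X \<longleftrightarrow> x : $N" if x: "$x <= $a & ctbl x" for x
    proof
      assume "x : $X"
      then obtain b Z where Z: "pair b Z : $Br" "x : $Z" unfolding X by blast
      have "x : $Y"
        using Br(2)[OF Y(1) Z(1)]
      proof (elim disjE)
        assume "pair a Y = pair b Z" then show "x : $Y" using Z(2) unfolding pair_inject by simp
      next
        assume "pair (pair a Y) (pair b Z) : $r" then show "x : $Y" using rs Z(2) x unfolding r by blast
      next
        assume "pair (pair b Z) (pair a Y) : $r" then show "x : $Y" using rs Z(2) x unfolding r by blast
      qed
      then show "x : $N" unfolding N(3) elts_traces by blast
    next
      assume "x : $N"
      then have "x : $Y" unfolding N(3) elts_traces using x by blast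
      then show "x : $X" unfolding X using Y(1) x sub2[OF a] by auto
    qed
    then show "\<exists>N. good N R & a : $N & (\<forall>x. $x <= $a & ctbl x --> (x : $X \<longleftrightarrow> x : $N))"
      using N by blast
  qed
qed

text \<open>Otherwise the nice sets whose trace on \<open>omega2\<close> avoids \<open>X\<close> are
  projective stationary. The union of an SRP chain of such sets meets \<open>omega2\<close> in an
  ordinal \<open>l\<close>; the filtration of \<open>l\<close> by the chain agrees with the
  canonical one almost everywhere, and stationarily many canonical pieces belong to
  \<open>X\<close>.\<close>

lemma branch_contradiction:
  assumes SRP: SRP_omega2
    and X: "!!a. a : $omega2 ==> \<exists>N. good N R & a : $N & (\<forall>x. $x <= $a & ctbl x --> (x : $X \<longleftrightarrow> x : $N))"
  shows "\<exists>T C. stat omega1 T & club C (H omega2) & (\<forall>Y\<in>$C. ctbl Y & $Y <= $(H omega2) & nice Y &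
    vset ($Y \<inter> $omega1) : $T --> vset ($Y \<inter> $omega2) : $X)"
proof (rule ccontr)
  assume neg: "\<not> ?thesis"
  let ?Q = "%Y. vset ($Y \<inter> $omega2) \<notin> $X"
  define P where "P = vset {Y \<in> $(ctbl_subsets (H omega2)). nice Y & ?Q Y}"
  have "$P = {Y \<in> $(ctbl_subsets (H omega2)). nice Y & ?Q Y}"
    unfolding P_def by (rule elts_sep) (intro dfb)
  then have P: "Y : $P \<longleftrightarrow> ctbl Y & $Y <= $(H omega2) & nice Y & ?Q Y" for Y
    unfolding elts_ctbl_subsets by blast
  have "projective_stationary P (H omega2)"
    by (rule projective_stationaryI[OF P]) (use neg in blast)
  moreover have nice: "nice Y" if "Y : $P" for Y using that P by blast
  ultimately obtain N where N: "chain N P" using SRP_chain[OF SRP] by blast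
  have dN: "deft (%e. ap N (e 0))" by (intro dfb)
  define Q where "Q = vset (\<Union>z\<in>$omega1. $(ap N z))"
  have Q: "$Q = (\<Union>z\<in>$omega1. $(ap N z))" unfolding Q_def by (rule elts_UN[OF dN])
  have cN: "ctbl (ap N z)" if "z : $omega1" for z using chain_P[OF N nice that] P by blast
  have Qk: "lepoll Q omega1"
    unfolding Q_def by (rule lepoll_UN[OF idem_omega1 dN lepoll_refl]) (rule ctbl_lepoll_omega1[OF cN])
  define l where "l = vset ($Q \<inter> $omega2)"
  have l: "$l = $Q \<inter> $omega2" unfolding l_def by simp
  have Ol: "Ord l"
  proof (rule Ord_transitiveI)
    show "transitive l"
      unfolding transitive_def
    proof (intro ballI subsetI)
      fix a b assume a: "a : $l" and b: "b : $a"
      obtain z where z: "z : $omega1" "a : $(ap N z)" "a : $omega2" using a unfolding l Q by blast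
      have jb: "J a b : $omega1" by (rule J(1)[OF z(3) b])
      \<comment> \<open>The index \<open>c\<close> is chosen beyond both \<open>z\<close> and
        \<open>J a b\<close>: the model with index \<open>c\<close> then contains \<open>a\<close>
        and has \<open>J a b\<close> in its trace, so niceness puts \<open>b\<close> into
        it.\<close>
      define w where "w = vset ($z \<union> $(succ (J a b)))"
      define c where "c = succ w"
      have O: "Ord z" "Ord (succ (J a b))" using z jb Ord_mem[OF Ord_omega1] by auto
      have w: "$w = $z \<union> $(succ (J a b))" unfolding w_def by (rule elts_Un)
      have m1: "w : $omega1"
        using Un_Ord[OF O] z(1) bnd_succ[OF bnd_omega1 jb] unfolding w_def by metis
      then have c1: "c : $omega1" unfolding c_def by (rule bnd_succ[OF bnd_omega1])
      have "z : $w \<or> z = w" using Ord_subset_iff[OF O(1) Ord_mem[OF Ord_omega1 m1]] w by blast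
      then have zc: "z : $c" unfolding c_def elts_succ by blast
      have "J a b : $c" unfolding c_def elts_succ[of w] w by simp
      then have "J a b : $(ap N c)" using chain_trace_ge[OF N nice c1] by blast
      moreover have "a : $(ap N c)" using chain_mono[OF N nice c1 zc] z(2) by blast
      then have "$(ap N c) \<inter> $a = $(B a (vset ($(ap N c) \<inter> $omega1)))"
        using nice[OF chain_P[OF N nice c1]] z(3) unfolding nice_def by blast
      ultimately have "b : $(ap N c)" using b jb by auto
      then show "b : $l" unfolding l Q using c1 Ord_trans[OF Ord_omega2 b z(3)] by blast
    qed
  qed (use l Ord_mem[OF Ord_omega2] in blast)
  have "lepoll l omega1" by (rule lepoll_trans[OF lepoll_subset Qk]) (simp add: l)
  then have l2: "l : $omega2" unfolding elts_omega2 using Ol by blast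
  obtain M where M: "good M R" "l : $M" "!!x. $x <= $l ==> ctbl x ==> x : $X \<longleftrightarrow> x : $M"
    using X[OF l2] by blast
  have s0: "stat omega1 (SS l (traces M l))" by (rule good_stat[OF M(1,2) l2])
  define S1 where "S1 = vset {z \<in> $(SS l (traces M l)). z : $omega1 & Limit z & vset ($(ap N z) \<inter> $omega1) = z}"
  have S1: "$S1 = {z \<in> $(SS l (traces M l)). z : $omega1 & Limit z & vset ($(ap N z) \<inter> $omega1) = z}"
    unfolding S1_def by (rule elts_sep) (intro dfb)
  have s1: "stat omega1 S1" unfolding S1_def by (rule chain_points[OF N nice s0])
  let ?R = "%x u. u : $omega1 & x : $(ap N u)"
  have dR: "defb (%e. ?R x (e 0))" for x by (intro dfb)
  have R: "oleast (?R x) : $omega1" "?R x (oleast (?R x))" if x: "x : $l" for x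
  proof -
    obtain u where u: "?R x u" "u : $omega1" using x l Q by blast
    from oleast_mem[OF dR Ord_omega1 u] show "oleast (?R x) : $omega1" "?R x (oleast (?R x))" by auto
  qed
  have dJ: "deft (%e. J l (e 0))" and dl: "deft (%e. oleast (?R (e 0)))" by (intro dfb)+
  \<comment> \<open>Half of the agreement of the two filtrations of \<open>l\<close>: from the
    \<open>J l\<close> value of \<open>x\<close> one reaches a stage of the chain that contains
    \<open>x\<close>. The function \<open>?V\<close> below serves the converse direction.\<close>
  define S2 where "S2 = vset {z \<in> $S1. \<forall>x\<in>$l. J l x : $z --> oleast (?R x) : $z}"
  have S2: "$S2 = {z \<in> $S1. \<forall>x\<in>$l. J l x : $z --> oleast (?R x) : $z}"
    unfolding S2_def by (rule elts_sep) (intro dfb)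
  have s2: "stat omega1 S2" unfolding S2_def by (rule filtration_half[OF s1 dJ J(2)[OF l2] dl R(1)])
  let ?V = "%u b. b : $omega1 & (\<forall>x\<in>$(ap N u). x : $l --> J l x : $b)"
  have dV: "defb (%e. ?V u (e 0))" for u by (intro dfb)
  have V: "oleast (?V u) : $omega1" "?V u (oleast (?V u))" if u: "u : $omega1" for u
  proof -
    define I where "I = vset ($(ap N u) \<inter> $l)"
    have I: "$I = $(ap N u) \<inter> $l" unfolding I_def by simp
    have "ctbl I" by (rule ctbl_subset[OF cN[OF u]]) (simp add: I)
    then obtain b where "b : $omega1" "\<forall>x\<in>$I. J l x : $b"
      using bnd_image[OF bnd_omega1 dJ _ omega_omega1, of I] J(1)[OF l2] I unfolding ctbl_def by blast
    then have b: "?V u b" "b : $omega1" using I by blast+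
    from oleast_mem[OF dV Ord_omega1 b] show "oleast (?V u) : $omega1" "?V u (oleast (?V u))" by auto
  qed
  have dlV: "deft (%e. oleast (?V (e 0)))" by (intro dfb)
  obtain z where z: "z : $S2" "z : $omega1" "closed_pt (%u v. oleast (?V u)) z"
    using stat_closed_pt[OF bnd_omega1 s2 dlV] V(1) by blast
  have Oz: "Ord z" using Ord_mem[OF Ord_omega1 z(2)] .
  have z1: "z : $(SS l (traces M l))" "Limit z" "vset ($(ap N z) \<inter> $omega1) = z" using z(1) S2 S1 by blast+
  have lim: "$(ap N z) = (\<Union>b\<in>$z. $(ap N b))" by (rule chain_lim[OF N nice z(2) z1(2)])
  have "B l z = vset ($(ap N z) \<inter> $omega2)"
  proof (rule vsetI, unfold elts_B elts_Int, intro equalityI subsetI)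
    fix x assume x: "x : {x \<in> $l. J l x : $z}"
    then have o: "oleast (?R x) : $z" using z(1) S2 by blast
    have "x : $(ap N (oleast (?R x)))" using R(2)[of x] x by blast
    then show "x : $(ap N z) \<inter> $omega2" using lim o x l by blast
  next
    fix x assume x: "x : $(ap N z) \<inter> $omega2"
    then obtain u where u: "u : $z" "x : $(ap N u)" using lim by blast
    have u1: "u : $omega1" using Ord_trans[OF Ord_omega1 u(1) z(2)] .
    have xl: "x : $l" using u(2) u1 x unfolding l Q by blast
    have "J l x : $(oleast (?V u))" using V(2)[OF u1] u(2) xl by blast
    moreover have "oleast (?V u) : $z" using z(3) u(1) unfolding closed_pt_def by blast
    ultimately show "x : {x \<in> $l. J l x : $z}" using xl Ord_trans[OF Oz] by blast
  qed
  moreover have "B l z : $M" using z1(1) unfolding elts_SS elts_traces by blast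
  moreover have "$(B l z) <= $l" by auto
  ultimately have "vset ($(ap N z) \<inter> $omega2) : $X" using M(3) ctbl_B[OF l2 z(2)] by metis
  then show False using chain_P[OF N nice z(2)] P by blast
qed

subsection \<open>Decoding a real from three interleaved sets of ordinals\<close>

text \<open>\<open>clock E\<^sub>0 E\<^sub>1 E\<^sub>2 x\<close>: the elements of \<open>E\<^sub>0\<close> from \<open>x\<close> on that are first in
  their block, where the blocks of \<open>E\<^sub>0\<close> are separated by elements of \<open>E\<^sub>1 \<union> E\<^sub>2\<close>.\<close>

definition clock :: "'v \<Rightarrow> 'v \<Rightarrow> 'v \<Rightarrow> 'v \<Rightarrow> 'v" where
  "clock E0 E1 E2 x0 = vset {x \<in> $E0. x \<notin> $x0 &
     (\<forall>y\<in>$E0. y \<notin> $x0 & y : $x --> (\<exists>z. (z : $E1 \<or> z : $E2) & y : $z & z : $x))}"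
text \<open>The position of a clock point, computed as an order type, is the index of a bit. The bit
  is 1 if \<open>E1\<close> answers after that clock point before \<open>E2\<close> does and before
  the next tick. Only the order of the elements matters, so \<open>dec\<close> survives collapsing;
  \<open>x0\<close> cuts off an irrelevant initial part.\<close>

definition dec :: "'v \<Rightarrow> 'v \<Rightarrow> 'v \<Rightarrow> 'v \<Rightarrow> 'v" where
  "dec E0 E1 E2 x0 = vset {n \<in> $omega. \<exists>x\<in>$(clock E0 E1 E2 x0). col (clock E0 E1 E2 x0) x = n &
     (\<exists>z\<in>$E1. x : $z & \<not> (\<exists>y. (y : $(clock E0 E1 E2 x0) \<or> y : $E2) & x : $y & y : $z))}"

lemma elts_clock: "$(clock E0 E1 E2 x0) = {x \<in> $E0. x \<notin> $x0 &
     (\<forall>y\<in>$E0. y \<notin> $x0 & y : $x --> (\<exists>z. (z : $E1 \<or> z : $E2) & y : $z & z : $x))}"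
  unfolding clock_def by (rule elts_sep) (intro dfb)
lemma elts_dec: "$(dec E0 E1 E2 x0) = {n \<in> $omega. \<exists>x\<in>$(clock E0 E1 E2 x0). col (clock E0 E1 E2 x0) x = n &
     (\<exists>z\<in>$E1. x : $z & \<not> (\<exists>y. (y : $(clock E0 E1 E2 x0) \<or> y : $E2) & x : $y & y : $z))}"
  unfolding dec_def by (rule elts_sep) (intro dfb)
lemma deft_clock [dfb]: assumes "deft a" "deft b" "deft c" "deft d" shows "deft (%e. clock (a e) (b e) (c e) (d e))"
  unfolding clock_def
  by (intro dfb assms deft_ren[OF assms(1), of Suc] deft_ren[OF assms(4), of Suc] 
     deft_ren[OF assms(4), of "%n. Suc (Suc n)"] deft_ren[OF assms(2), of "%n. Suc (Suc (Suc n))"]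
     deft_ren[OF assms(3), of "%n. Suc (Suc (Suc n))"])
lemma deft_dec [dfb]: assumes "deft a" "deft b" "deft c" "deft d" shows "deft (%e. dec (a e) (b e) (c e) (d e))"
proof -
  have r: "deft (%e. t (%n. e (f n)))" if "deft t" for t f using deft_ren[OF that] .
  show ?thesis
    unfolding dec_def
    by (intro dfb r[OF assms(1), of Suc] r[OF assms(2), of Suc] r[OF assms(3), of Suc] r[OF assms(4), of Suc]
       r[OF assms(1), of "%n. Suc (Suc n)"] r[OF assms(2), of "%n. Suc (Suc n)"] r[OF assms(3), of "%n. Suc (Suc n)"] r[OF assms(4), of "%n. Suc (Suc n)"]
       r[OF assms(1), of "%n. Suc (Suc (Suc n))"] r[OF assms(2), of "%n. Suc (Suc (Suc n))"] r[OF assms(3), of "%n. Suc (Suc (Suc n))"] r[OF assms(4), of "%n. Suc (Suc (Suc n))"]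
       r[OF assms(1), of "%n. Suc (Suc (Suc (Suc n)))"] r[OF assms(2), of "%n. Suc (Suc (Suc (Suc n)))"] r[OF assms(3), of "%n. Suc (Suc (Suc (Suc n)))"] r[OF assms(4), of "%n. Suc (Suc (Suc (Suc n)))"])
qed

text \<open>From \<open>p zero\<close> on, the three sets consist of blocks starting at
  \<open>p n\<close>, \<open>q n\<close> and \<open>s n\<close> and bounded by the primed ordinals.
  In step \<open>n\<close> the block of \<open>W0\<close> comes first, and the order of the other
  two blocks is the bit. The map \<open>col c\<close> preserves the order of the elements of
  \<open>c\<close>, so the decoding may be done after collapsing.\<close>

lemma decode:
  assumes c: "!!x. x : $c ==> Ord x" and W: "$W0 <= $c" "$W1 <= $c" "$W2 <= $c"
    and d: "deft (%e. p (e 0))"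
    and O: "!!n. n : $omega ==> Ord (p' n) & Ord (q' n) & Ord (s' n)"
    and in0: "!!n. n : $omega ==> p n : $W0 & p n : $(p' n)"
    and in1: "!!n. n : $omega ==> q n : $W1 & q n : $(q' n)"
    and in2: "!!n. n : $omega ==> s n : $W2 & s n : $(s' n)"
    and b0: "!!x. x : $W0 ==> x \<notin> $(p zero) ==> \<exists>n\<in>$omega. x \<notin> $(p n) & x : $(p' n)"
    and b1: "!!x. x : $W1 ==> x \<notin> $(p zero) ==> \<exists>n\<in>$omega. x \<notin> $(q n) & x : $(q' n)"
    and b2: "!!x. x : $W2 ==> x \<notin> $(p zero) ==> \<exists>n\<in>$omega. x \<notin> $(s n) & x : $(s' n)"
    and pq: "!!n. n : $omega ==> $(p' n) <= $(q n) & $(p' n) <= $(s n) &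
       $(q' n) <= $(p (succ n)) & $(s' n) <= $(p (succ n))"
    and rin: "!!n. n : $omega ==> n : $r ==> $(q' n) <= $(s n)"
    and rout: "!!n. n : $omega ==> n \<notin> $r ==> $(s' n) <= $(q n)"
    and r: "$r <= $omega"
  shows "dec (vset (col c ` $W0)) (vset (col c ` $W1)) (vset (col c ` $W2)) (col c (p zero)) = r"
proof -
  let ?t = "col c"
  have dt: "deft (%e. ?t (e 0))" by (intro dfb)
  let ?E0 = "vset (?t ` $W0)" and ?E1 = "vset (?t ` $W1)" and ?E2 = "vset (?t ` $W2)"
  have E: "$?E0 = ?t ` $W0" "$?E1 = ?t ` $W1" "$?E2 = ?t ` $W2"
    by (rule elts_image[OF dt])+
  have OW: "Ord x" if "x : $W0 \<or> x : $W1 \<or> x : $W2" for x using that c W by blast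
  have op: "Ord (p n)" "Ord (q n)" "Ord (s n)" if "n : $omega" for n
    using OW in0[OF that] in1[OF that] in2[OF that] by blast+
  have t: "?t x : $(?t y) \<longleftrightarrow> x : $y" if "x : $W0 \<or> x : $W1 \<or> x : $W2" "y : $W0 \<or> y : $W1 \<or> y : $W2" for x y
    by (rule col_mem_iff) (use that OW W in blast)+
  have nat: "n : $omega ==> Ord n" for n using Ord_mem[OF Ord_omega] .
  have step: "p n : $(p (succ n)) & q n : $(p (succ n)) & s n : $(p (succ n)) & $(p' n) <= $(p (succ n))" if n: "n : $omega" for n
  proof -
    have 1: "q n : $(p (succ n))" "s n : $(p (succ n))" using in1[OF n] in2[OF n] pq[OF n] by blast+
    have "$(p' n) <= $(p (succ n))"
      using pq[OF n] 1(1) Ord_trans[OF op(1)[OF succ_omega[OF n]] _ 1(1)] by blast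
    then show ?thesis using 1 in0[OF n] by blast
  qed
  have mono: "m : $n --> p m : $(p n) & $(p' m) <= $(p n) & $(q' m) <= $(p n) & $(s' m) <= $(p n) & $(p (succ m)) <= $(p n)"
    if n: "n : $omega" for m n
  proof -
    have "\<forall>k\<in>$(succ n). m : $k --> p (succ m) = p k \<or> p (succ m) : $(p k)"
      using n
    proof (induction rule: omega_induct)
      case def show ?case by (intro dfb deft_subst[OF d])
    next
      case zero then show ?case by auto
    next
      case (succ n)
      have "p (succ m) = p (succ n) \<or> p (succ m) : $(p (succ n))" if "m : $(succ n)"
      proof (cases "m = n")
        case False
        then have "m : $n" using that by simp
        then have "p (succ m) = p n \<or> p (succ m) : $(p n)" using succ(2) by auto
        then show ?thesis using step[OF succ(1)] Ord_trans[OF op(1)[OF succ_omega[OF succ(1)]]] by metis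
      qed simp
      then show ?case using succ(2) by auto
    qed
    then have 1: "m : $n --> p (succ m) = p n \<or> p (succ m) : $(p n)" by auto
    show ?thesis
    proof
      assume mn: "m : $n"
      then have m: "m : $omega" using Ord_trans[OF Ord_omega _ n] by blast
      have "p (succ m) = p n \<or> p (succ m) : $(p n)" using 1 mn by blast
      then have "$(p (succ m)) <= $(p n)" 
      proof
        assume "p (succ m) : $(p n)"
        then show ?thesis using Ord_trans[OF op(1)[OF n]] by blast
      qed simp
      then show "p m : $(p n) & $(p' m) <= $(p n) & $(q' m) <= $(p n) & $(s' m) <= $(p n) & $(p (succ m)) <= $(p n)"
        using step[OF m] pq[OF m] by blast
    qed
  qed
  have cases: "m : $n \<or> m = n \<or> n : $m" if "m : $omega" "n : $omega" for m n
    using Ord_linear nat that by blast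
  have notless: "y \<notin> $(p k)" if "y \<notin> $(p n)" "k = n \<or> k : $n" "n : $omega" for y k n
  proof
    assume "y : $(p k)"
    then show False using that mono[OF that(3), of k] Ord_trans[OF op(1)[OF that(3)], of y "p k"] by blast
  qed
  have p0: "p n \<notin> $(p zero)" if n: "n : $omega" for n
  proof (rule notless[OF mem_irrefl _ n])
    show "zero = n \<or> zero : $n" using Ord_linear[OF Ord_zero nat[OF n]] by auto
  qed
  define D where "D = clock ?E0 ?E1 ?E2 (?t (p zero))"
  \<comment> \<open>The clock ticks exactly at the starts \<open>p n\<close>: inside a block of
    \<open>W0\<close> there are no elements of \<open>W1\<close> or \<open>W2\<close>, while
    \<open>q m\<close> separates the block number \<open>m\<close> from later ones.\<close>
  have D: "$D = ?t ` p ` $omega"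
  proof (intro equalityI subsetI)
    fix u assume "u : $D"
    then have u: "u : $?E0" "u \<notin> $(?t (p zero))" 
      "!!y. y : $?E0 ==> y \<notin> $(?t (p zero)) ==> y : $u ==> \<exists>z. (z : $?E1 \<or> z : $?E2) & y : $z & z : $u"
      unfolding D_def elts_clock by blast+
    obtain x where x: "x : $W0" "u = ?t x" using u(1) E by blast
    have "x \<notin> $(p zero)" using u(2) t[of x "p zero"] x in0[OF zero_omega] by blast
    then obtain m where m: "m : $omega" "x \<notin> $(p m)" "x : $(p' m)" using b0[OF x(1)] by blast
    have "x = p m"
    proof (rule ccontr)
      assume "x \<noteq> p m"
      then have pm: "p m : $x" using Ord_linear[of x "p m"] OW x(1) op(1)[OF m(1)] m(2) by blast
      have "?t (p m) \<notin> $(?t (p zero))" using t[of "p m" "p zero"] p0[OF m(1)] in0[OF m(1)] in0[OF zero_omega] by blast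
      moreover have "?t (p m) : $u" using t[of "p m" x] pm x in0[OF m(1)] by blast
      moreover have "?t (p m) : $?E0" using E(1) in0[OF m(1)] by blast
      ultimately obtain z' where "(z' : $?E1 \<or> z' : $?E2) & ?t (p m) : $z' & z' : $u" using u(3) by blast
      then have zz: "z' : $?E1 \<or> z' : $?E2" "?t (p m) : $z'" "z' : $u" by auto
      have "(\<exists>w\<in>$W1. z' = ?t w) \<or> (\<exists>w\<in>$W2. z' = ?t w)" using zz(1) unfolding E by blast
      then obtain z where z0: "z : $W1 \<or> z : $W2" "z' = ?t z" by blast
      have z: "z : $W1 \<or> z : $W2" "?t (p m) : $(?t z)" "?t z : $(?t x)" using z0 zz x(2) by auto
      have z': "p m : $z" "z : $x" using t[of "p m" z] t[of z x] z x(1) in0[OF m(1)] by blast+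
      have zp: "z : $(p' m)" using Ord_trans[OF _ z'(2) m(3)] O[OF m(1)] by blast
      have z0: "z \<notin> $(p zero)"
      proof
        assume "z : $(p zero)"
        then have "p m : $(p zero)" using Ord_trans[OF op(1)[OF zero_omega] z'(1)] by blast
        then show False using p0[OF m(1)] by blast
      qed
      obtain k where k: "k : $omega" "z \<notin> $(q k) & z : $(q' k) \<or> z \<notin> $(s k) & z : $(s' k)"
        using z(1) b1[OF _ z0] b2[OF _ z0] by blast
      show False
      proof (cases "k : $m")
        case True
        then have "z : $(p m)" using k(2) mono[OF m(1), of k] by blast
        then show False using z'(1) mem_asym by blast
      next
        case False
        then have "m = k \<or> m : $k" using cases[OF m(1) k(1)] by blast
        then have "$(p' m) <= $(p' k) \<or> $(p' m) <= $(p k)" using mono[OF k(1), of m] by blast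
        moreover have "$(p k) <= $(p' k)" using Ord_trans[of "p' k" _ "p k"] O[OF k(1)] in0[OF k(1)] by blast
        ultimately have "z : $(p' k)" using zp by blast
        then have "z : $(q k)" "z : $(s k)" using pq[OF k(1)] by blast+
        then show False using k(2) by blast
      qed
    qed
    then show "u : ?t ` p ` $omega" using x(2) m(1) by blast
  next
    fix u assume "u : ?t ` p ` $omega"
    then obtain n where n: "n : $omega" "u = ?t (p n)" by blast
    have "\<exists>z. (z : $?E1 \<or> z : $?E2) & y' : $z & z : $u" if y': "y' : $?E0" "y' \<notin> $(?t (p zero))" "y' : $u" for y'
    proof -
      obtain y where y: "y : $W0" "y' = ?t y" using y'(1) E by blast
      have "y \<notin> $(p zero)" using y'(2) t[of y "p zero"] y in0[OF zero_omega] by blast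
      then obtain m where m: "m : $omega" "y \<notin> $(p m)" "y : $(p' m)" using b0[OF y(1)] by blast
      have yn: "y : $(p n)" using y'(3) t[of y "p n"] y n(2) in0[OF n(1)] by blast
      have "m : $n" using cases[OF m(1) n(1)] notless[OF m(2) _ m(1), of n] yn by blast
      then have "q m : $(p n)" using mono[OF n(1), of m] in1[OF m(1)] by blast
      moreover have "y : $(q m)" using m(3) pq[OF m(1)] by blast
      ultimately have "y' : $(?t (q m))" "?t (q m) : $u"
        using t[of y "q m"] t[of "q m" "p n"] y n(2) in0[OF n(1)] in1[OF m(1)] by blast+
      then show ?thesis using E(2) in1[OF m(1)] by blast
    qed
    moreover have "u : $?E0" using n in0[OF n(1)] E(1) by blast
    moreover have "u \<notin> $(?t (p zero))" using t[of "p n" "p zero"] p0[OF n(1)] n(2) in0[OF n(1)] in0[OF zero_omega] by blast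
    ultimately show "u : $D" unfolding D_def elts_clock by blast
  qed
  have colD: "n : $omega --> col D (?t (p n)) = n" for n
  proof (rule mem_induct[where Q = "%n. n : $omega --> col D (?t (p n)) = n"])
    show "defb (%e. e 0 : $omega --> col D (?t (p (e 0))) = e 0)" by (intro dfb deft_subst[OF d])
    fix n assume IH: "!!m. m : $n ==> m : $omega --> col D (?t (p m)) = m"
    show "n : $omega --> col D (?t (p n)) = n"
    proof (intro impI vsetI)
      assume n: "n : $omega"
      have mo: "m : $omega" if "m : $n" for m using Ord_trans[OF Ord_omega that n] .
      have "$(?t (p n)) \<inter> $D = ?t ` p ` $n"
      proof (intro equalityI subsetI)
        fix u assume "u : $(?t (p n)) \<inter> $D"
        then obtain m where m: "m : $omega" "u = ?t (p m)" "?t (p m) : $(?t (p n))" unfolding D by blast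
        then have "p m : $(p n)" using t[of "p m" "p n"] in0[OF m(1)] in0[OF n] by blast
        then have "m : $n" using cases[OF m(1) n] mono[OF m(1), of n] mem_asym mem_irrefl by metis
        then show "u : ?t ` p ` $n" using m(2) by blast
      next
        fix u assume "u : ?t ` p ` $n"
        then obtain m where m: "m : $n" "u = ?t (p m)" by blast
        have "?t (p m) : $(?t (p n))" using t[of "p m" "p n"] mono[OF n, of m] m(1) in0[OF mo[OF m(1)]] in0[OF n] by blast
        then show "u : $(?t (p n)) \<inter> $D" unfolding D using m mo by blast
      qed
      then have "$(col D (?t (p n))) = (%m. col D (?t (p m))) ` $n" unfolding elts_col by (simp add: image_image)
      also have "\<dots> = (%m. m) ` $n" by (rule image_cong[OF refl]) (use IH mo in blast)
      finally show "$(col D (?t (p n))) = $n" by simp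
    qed
  qed
  \<comment> \<open>For \<open>n\<close> in \<open>r\<close> the witness is \<open>q n\<close>,
    since \<open>s n\<close> comes after the whole block of \<open>W1\<close>. For other
    \<open>n\<close> every candidate in \<open>W1\<close> lies above \<open>s n\<close>, which is an
    obstruction.\<close>
  have bit: "n : $r \<longleftrightarrow> (\<exists>z\<in>$?E1. ?t (p n) : $z & \<not> (\<exists>y. (y : $D \<or> y : $?E2) & ?t (p n) : $y & y : $z))"
    if n: "n : $omega" for n
  proof
    assume nr: "n : $r"
    have pnq: "p n : $(q n)" using in0[OF n] pq[OF n] by blast
    have "\<not> ((y : $D \<or> y : $?E2) & ?t (p n) : $y & y : $(?t (q n)))" for y
    proof
      assume y: "(y : $D \<or> y : $?E2) & ?t (p n) : $y & y : $(?t (q n))"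
      then have "(\<exists>m\<in>$omega. y = ?t (p m)) \<or> (\<exists>w\<in>$W2. y = ?t w)" unfolding D E by blast
      then show False
      proof (elim disjE bexE)
        fix m assume m: "m : $omega" "y = ?t (p m)"
        have "p n : $(p m)" "p m : $(q n)" using y m t[of "p n" "p m"] t[of "p m" "q n"] in0[OF m(1)] in0[OF n] in1[OF n] by blast+
        moreover have "n : $m" using cases[OF m(1) n] mono[OF n, of m] \<open>p n : $(p m)\<close> mem_asym mem_irrefl by metis
        then have "q n : $(p m)" using mono[OF m(1), of n] in1[OF n] by blast
        ultimately show False using mem_asym by blast
      next
        fix w assume w: "w : $W2" "y = ?t w"
        have wn: "p n : $w" "w : $(q n)" using y w t[of "p n" w] t[of w "q n"] in0[OF n] in1[OF n] by blast+
        have "w \<notin> $(p zero)"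
        proof
          assume "w : $(p zero)"
          then show False using Ord_trans[OF op(1)[OF zero_omega] wn(1)] p0[OF n] by blast
        qed
        then obtain k where k: "k : $omega" "w \<notin> $(s k)" "w : $(s' k)" using b2[OF w(1)] by blast
        have "q n : $(s k) \<or> w : $(p n)"
          using cases[OF k(1) n]
        proof (elim disjE)
          assume "k : $n" then show ?thesis using mono[OF n, of k] k(3) by blast
        next
          assume "k = n" then show ?thesis using rin[OF n nr] in1[OF n] by blast
        next
          assume "n : $k"
          then have "q n : $(p k)" using mono[OF k(1), of n] in1[OF n] by blast
          moreover have "$(p k) <= $(s k)" using Ord_trans[of "p' k" _ "p k"] O[OF k(1)] in0[OF k(1)] pq[OF k(1)] by blast
          ultimately show ?thesis by blast
        qed
        then show False
        proof
          assume "q n : $(s k)"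
          then have "w : $(s k)" using Ord_trans[OF op(3)[OF k(1)] wn(2)] by blast
          then show False using k(2) by blast
        qed (use wn(1) mem_asym in blast)
      qed
    qed
    moreover have "?t (p n) : $(?t (q n))" using t[of "p n" "q n"] pnq in0[OF n] in1[OF n] by blast
    moreover have "?t (q n) : $?E1" using E in1[OF n] by blast
    ultimately show "\<exists>z\<in>$?E1. ?t (p n) : $z & \<not> (\<exists>y. (y : $D \<or> y : $?E2) & ?t (p n) : $y & y : $z)" by blast
  next
    assume "\<exists>z\<in>$?E1. ?t (p n) : $z & \<not> (\<exists>y. (y : $D \<or> y : $?E2) & ?t (p n) : $y & y : $z)"
    then obtain z where z: "z : $W1" "?t (p n) : $(?t z)" "!!y. y : $?E2 ==> ?t (p n) : $y ==> y \<notin> $(?t z)"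
      unfolding E by blast
    show "n : $r"
    proof (rule ccontr)
      assume nr: "n \<notin> $r"
      have pz: "p n : $z" using t[of "p n" z] z in0[OF n] by blast
      have "z \<notin> $(p zero)"
      proof
        assume "z : $(p zero)"
        then show False using Ord_trans[OF op(1)[OF zero_omega] pz] p0[OF n] by blast
      qed
      then obtain k where k: "k : $omega" "z \<notin> $(q k)" "z : $(q' k)" using b1[OF z(1)] by blast
      have "s n : $z"
        using cases[OF k(1) n]
      proof (elim disjE)
        assume "k : $n" then have "z : $(p n)" using mono[OF n, of k] k(3) by blast
        then show ?thesis using pz mem_asym by blast
      next
        assume "k = n"
        then have "s n : $(q n)" using rout[OF n nr] in2[OF n] by blast
        then show ?thesis using k(2) \<open>k = n\<close> Ord_not_mem_iff[of z "q n"] OW z(1) op(2)[OF n] by blast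
      next
        assume "n : $k"
        then have "s n : $(p k)" using mono[OF k(1), of n] in2[OF n] by blast
        moreover have "$(p k) <= $(q k)" using Ord_trans[of "p' k" _ "p k"] O[OF k(1)] in0[OF k(1)] pq[OF k(1)] by blast
        ultimately show ?thesis using k(2) Ord_not_mem_iff[of z "q k"] OW z(1) op(2)[OF k(1)] by blast
      qed
      then have "?t (s n) : $(?t z)" using t[of "s n" z] in2[OF n] z(1) by blast
      moreover have "p n : $(s n)" using in0[OF n] pq[OF n] by blast
      then have "?t (p n) : $(?t (s n))" using t[of "p n" "s n"] in0[OF n] in2[OF n] by blast
      moreover have "?t (s n) : $?E2" using E in2[OF n] by blast
      ultimately show False using z(3) by blast
    qed
  qed
  show ?thesis
  proof (rule vsetI)
    have "$(dec ?E0 ?E1 ?E2 (?t (p zero))) = {n \<in> $omega. \<exists>x\<in>$D. col D x = n &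
       (\<exists>z\<in>$?E1. x : $z & \<not> (\<exists>y. (y : $D \<or> y : $?E2) & x : $y & y : $z))}"
      unfolding elts_dec D_def ..
    also have "\<dots> = {n \<in> $omega. \<exists>z\<in>$?E1. ?t (p n) : $z & \<not> (\<exists>y. (y : $D \<or> y : $?E2) & ?t (p n) : $y & y : $z)}"
    proof (intro Collect_cong conj_cong refl)
      fix n assume n: "n : $omega"
      let ?P = "%x. \<exists>z\<in>$?E1. x : $z & \<not> (\<exists>y. (y : $D \<or> y : $?E2) & x : $y & y : $z)"
      have a: "x = ?t (p n)" if x: "x : $D" "col D x = n" for x
      proof -
        obtain m where "m : $omega" "x = ?t (p m)" using x(1) unfolding D by blast
        then show ?thesis using colD x(2) by auto
      qed
      have b: "?t (p n) : $D" unfolding D using n by blast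
      have c: "col D (?t (p n)) = n" using colD n by blast
      have "(\<exists>x\<in>$D. col D x = n & Q x) \<longleftrightarrow> Q (?t (p n))" for Q
      proof
        assume "\<exists>x\<in>$D. col D x = n & Q x"
        then obtain x where x: "x : $D" "col D x = n" "Q x" by blast
        show "Q (?t (p n))" by (rule subst[where P = Q, OF a[OF x(1,2)] x(3)])
      next
        assume "Q (?t (p n))"
        with c have "col D (?t (p n)) = n & Q (?t (p n))" by (rule conjI)
        then show "\<exists>x\<in>$D. col D x = n & Q x" by (rule bexI[OF _ b])
      qed
      then show "(\<exists>x\<in>$D. col D x = n & ?P x) \<longleftrightarrow> ?P (?t (p n))" .
    qed
    also have "\<dots> = $r" using bit r by blast
    finally show "$(dec ?E0 ?E1 ?E2 (?t (p zero))) = $r" .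
  qed
qed

subsection \<open>Traces of sets in a club that avoid the branch\<close>

lemma bnd_two:
  assumes k: "bnd k" and a: "a : $k" "b : $k"
  shows "\<exists>d\<in>$k. $a <= $d & $b <= $d & a : $d & b : $d"
proof -
  have O: "Ord (succ a)" "Ord (succ b)" using a Ord_mem[OF bnd_Ord[OF k]] by auto
  define d where "d = vset ($(succ a) \<union> $(succ b))"
  have d: "$d = $(succ a) \<union> $(succ b)" unfolding d_def by (rule elts_Un)
  have "d : $k" using Un_Ord[OF O] bnd_succ[OF k a(1)] bnd_succ[OF k a(2)] unfolding d_def by metis
  then show ?thesis by (rule bexI[rotated]) (auto simp: d)
qed

lemma ctbl_bounded_omega2: "$c <= $omega2 ==> ctbl c ==> \<exists>b\<in>$omega2. $c <= $b"
  by (rule bounded_omega2[OF _ ctbl_lepoll_omega1])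

text \<open>Points \<open>a\<close> of countable cofinality are stationary in \<open>omega2\<close>,
  and each gets a countable closed set cofinal below it with trace in \<open>T\<close>. The traces
  are countable ordinals, hence regressive, so one trace \<open>h\<close> works for stationarily
  many \<open>a\<close>.\<close>

lemma tops:
  assumes A: "$omega2 <= $A" and g: "deft (%e. g (e 0) (e 1))"
    and gA: "!!x y. x : $A ==> y : $A ==> ctbl (g x y) & $(g x y) <= $A"
    and T: "stat omega1 T"
  shows "\<exists>S Y h. stat omega2 S & h : $T & h : $omega1 & (\<forall>a\<in>$S. a : $omega2 & omega1 : $a &
     ctbl (ap Y a) & $(ap Y a) <= $A & (\<forall>x\<in>$(ap Y a). \<forall>y\<in>$(ap Y a). $(g x y) <= $(ap Y a)) &
     vset ($(ap Y a) \<inter> $omega1) = h & (\<forall>x\<in>$a. \<exists>y\<in>$(ap Y a). y : $a & x : $y))"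
proof -
  have g': "deft t ==> deft s ==> deft (%e. g (t e) (s e))" for t s by (rule deft_subst2[OF g])
  let ?cof = "%a. \<exists>c. ctbl c & $c <= $a & (\<forall>x\<in>$a. \<exists>y\<in>$c. x : $y)"
  define S0 where "S0 = vset {a \<in> $omega2. omega1 : $a & ?cof a}"
  have S0: "$S0 = {a \<in> $omega2. omega1 : $a & ?cof a}" unfolding S0_def by (rule elts_sep) (intro dfb)
  have s0: "stat omega2 S0"
    unfolding stat_def
  proof (intro allI impI)
    fix h assume h: "\<forall>x\<in>$omega2. ap h x : $omega2"
    have d: "deft (%e. ap h (e 0))" by (intro dfb)
    have "\<exists>x\<in>$omega2. omega1 : $x & closed_pt (%u v. ap h u) x & (\<exists>b. (\<forall>i\<in>$omega. ap b i : $x) &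
      (\<forall>y\<in>$x. \<exists>i\<in>$omega. y : $(ap b i)) & (\<forall>i\<in>$omega. \<forall>j\<in>$i. ap b j : $(ap b i)))"
      by (rule closed_pt_approach[OF bnd_omega2 omega_props(1) omega_omega2 d _ omega1_omega2]) (use h in blast)
    then obtain x b where x: "x : $omega2" "omega1 : $x" "closed_pt (%u v. ap h u) x"
      and b: "\<forall>i\<in>$omega. ap b i : $x" "\<forall>y\<in>$x. \<exists>i\<in>$omega. y : $(ap b i)" by blast
    have db: "deft (%e. ap b (e 0))" by (intro dfb)
    define c where "c = vset (ap b ` $omega)"
    have c: "$c = ap b ` $omega" unfolding c_def by (rule elts_image[OF db])
    have "ctbl c" unfolding c_def by (rule ctbl_image[OF db]) (simp add: ctbl_def)
    then have "?cof x" using b c by (intro exI[of _ c]) auto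
    then show "\<exists>x\<in>$S0. x : $omega2 & closed_pt (%u v. ap h u) x" using x S0 by blast
  qed
  let ?Q = "%a Y. ctbl Y & $Y <= $A & (\<forall>x\<in>$Y. \<forall>y\<in>$Y. $(g x y) <= $Y) &
     vset ($Y \<inter> $omega1) : $T & vset ($Y \<inter> $omega1) : $omega1 & (\<forall>x\<in>$a. \<exists>y\<in>$Y. y : $a & x : $y)"
  have "\<exists>Y. func Y S0 (pow A) & (\<forall>a\<in>$S0. ?Q a (ap Y a))"
  proof (rule choice_func[where Q = ?Q])
    show "defb (%e. ?Q (e 0) (e 1))" by (intro dfb g')
    fix a assume "a : $S0"
    then obtain c where c: "ctbl c" "$c <= $a" "\<forall>x\<in>$a. \<exists>y\<in>$c. x : $y" and a: "a : $omega2" using S0 by blast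
    have cA: "$c <= $A" using c(2) a A Ord_trans[OF Ord_omega2] by blast
    have "$omega1 <= $A" using omega1_sub_omega2 A by blast
    from lift_stationary[OF this g gA T c(1) cA] obtain Y where "$Y <= $A" "ctbl Y" "$c <= $Y"
      "\<forall>x\<in>$Y. \<forall>y\<in>$Y. $(g x y) <= $Y" "vset ($Y \<inter> $omega1) : $T" "vset ($Y \<inter> $omega1) : $omega1" by blast
    then have "?Q a Y" using c by blast
    moreover have "Y : $(pow A)" using \<open>$Y <= $A\<close> by simp
    ultimately show "\<exists>Y\<in>$(pow A). ?Q a Y" by blast
  qed
  then obtain Y where Y0: "func Y S0 (pow A) & (\<forall>a\<in>$S0. ?Q a (ap Y a))" by (rule exE)
  have Y: "?Q a (ap Y a)" if "a : $S0" for a by (rule bspec[OF conjunct2[OF Y0] that])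
  have d: "deft (%e. vset ($(ap Y (e 0)) \<inter> $omega1))" by (intro dfb)
  have "\<exists>h\<in>$omega2. stat omega2 (vset {a \<in> $S0. vset ($(ap Y a) \<inter> $omega1) = h})"
  proof (rule Fodor[OF bnd_omega2 s0 d])
    fix a assume a: "a : $S0"
    then have "vset ($(ap Y a) \<inter> $omega1) : $omega1" using Y[OF a] by blast
    moreover have "omega1 : $a" "Ord a" using a S0 Ord_mem[OF Ord_omega2] by auto
    ultimately show "vset ($(ap Y a) \<inter> $omega1) : $a" using Ord_trans by blast
  qed
  then obtain h where h: "stat omega2 (vset {a \<in> $S0. vset ($(ap Y a) \<inter> $omega1) = h})" by blast
  define S where "S = vset {a \<in> $S0. vset ($(ap Y a) \<inter> $omega1) = h}"
  have S: "$S = {a \<in> $S0. vset ($(ap Y a) \<inter> $omega1) = h}" unfolding S_def by (rule elts_sep) (intro dfb)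
  have sS: "stat omega2 S" unfolding S_def by (rule h)
  obtain a0 where a0: "a0 : $S" using stat_unbounded[OF bnd_omega2 sS bnd_zero[OF bnd_omega2]] by blast
  then have "h : $T" "h : $omega1" using S Y[of a0] by auto
  moreover have "a : $omega2 & omega1 : $a &
     ctbl (ap Y a) & $(ap Y a) <= $A & (\<forall>x\<in>$(ap Y a). \<forall>y\<in>$(ap Y a). $(g x y) <= $(ap Y a)) &
     vset ($(ap Y a) \<inter> $omega1) = h & (\<forall>x\<in>$a. \<exists>y\<in>$(ap Y a). y : $a & x : $y)" if a: "a : $S" for a
  proof -
    have a': "a : $S0" "vset ($(ap Y a) \<inter> $omega1) = h" using a S by auto
    show ?thesis using Y[OF a'(1)] a' S0 by blast
  qed
  ultimately show ?thesis using sS by blast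
qed

text \<open>The gap property: above any \<open>b \<in> G\<close> there are end extensions that add only elements
  below a fixed bound \<open>r\<close> before an arbitrarily long gap. Pressing down on points \<open>d\<close> of
  cofinality \<open>\<omega>\<^sub>1\<close> provides the bound, as countable sets are bounded in \<open>d\<close>.\<close>

lemma gaps:
  assumes S: "stat omega2 S" and h: "h : $omega1"
    and Y: "!!a. a : $S ==> a : $omega2 & (\<forall>x\<in>$a. \<exists>y\<in>$(ap Y a). y : $a & x : $y)"
    and YB: "!!a b. a : $S ==> b : $(ap Y a) ==> b : $omega2 ==> $(ap Y a) \<inter> $b = $(B b h)"
  shows "\<exists>G. $G <= $omega2 & (\<forall>d\<in>$omega2. \<exists>b\<in>$G. $d <= $b) &
     (\<forall>b\<in>$G. \<exists>a\<in>$S. b : $(ap Y a)) &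
     (\<forall>b\<in>$G. \<exists>r\<in>$omega2. \<forall>d\<in>$omega2. \<exists>b'\<in>$G. $d <= $b' & b : $(B b' h) & $(B b' h) <= $r)"
proof -
  have O2: "x : $omega2 ==> Ord x" for x using Ord_mem[OF Ord_omega2] .
  \<comment> \<open>\<open>G\<close> collects the \<open>b\<close> that belong to
    \<open>ap Y a\<close> for stationarily many \<open>a\<close>, so that pressing down can be
    repeated above any member of \<open>G\<close>.\<close>
  let ?Sb = "%b. vset {a \<in> $S. b : $a & b : $(ap Y a)}"
  have Sb: "$(?Sb b) = {a \<in> $S. b : $a & b : $(ap Y a)}" for b by (rule elts_sep) (intro dfb)
  define G where "G = vset {b \<in> $omega2. stat omega2 (?Sb b)}"
  have G: "$G = {b \<in> $omega2. stat omega2 (?Sb b)}" unfolding G_def by (rule elts_sep) (intro dfb)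
  have press: "\<exists>b\<in>$G. $d <= $b & (\<exists>a\<in>$S'. b : $(ap Y a) & $(ap Y a) \<inter> $b <= $d)"
    if S': "stat omega2 S'" "$S' <= $S" and d: "d : $omega2" for S' d
  proof -
    \<comment> \<open>The least element of \<open>ap Y a\<close> from \<open>d\<close> on is below
      \<open>a\<close>, because \<open>ap Y a\<close> is cofinal there. Pressing it down to a fixed
      \<open>b\<close> gives a member of \<open>G\<close> below which \<open>ap Y a\<close> has no
      elements from \<open>d\<close> on.\<close>
    let ?R = "%a b. b : $(ap Y a) & b \<notin> $d"
    have dR: "defb (%e. ?R a (e 0))" for a by (intro dfb)
    have dl: "deft (%e. oleast (?R (e 0)))" by (intro dfb)
    have cd: "deft (%e::nat \<Rightarrow> 'v. d)" by (rule deft_const)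
    define S1 where "S1 = vset {a \<in> $S'. a : $omega2 & closed_pt (%u v. d) a}"
    have S1: "$S1 = {a \<in> $S'. a : $omega2 & closed_pt (%u v. d) a}" unfolding S1_def by (rule elts_sep) (intro dfb)
    have s1: "stat omega2 S1" unfolding S1_def by (rule stat_inter[OF bnd_omega2 S'(1) cd d])
    have R: "oleast (?R a) : $a" "?R a (oleast (?R a))" "x : $(oleast (?R a)) ==> \<not> ?R a x" if a: "a : $S1" for a x
    proof -
      have aS: "a : $S" "d : $a" "a : $omega2" using a S1 S'(2) unfolding closed_pt_def by auto
      obtain y where y: "y : $(ap Y a)" "y : $a" "d : $y" using Y[OF aS(1)] aS(2) by blast
      then have "?R a y" using mem_asym by blast
      note o = oleast_mem[OF dR O2[OF aS(3)] this y(2)]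
      show "oleast (?R a) : $a" "?R a (oleast (?R a))" "x : $(oleast (?R a)) ==> \<not> ?R a x" using o by blast+
    qed
    obtain b where b: "b : $omega2" "stat omega2 (vset {a \<in> $S1. oleast (?R a) = b})"
      using Fodor[OF bnd_omega2 s1 dl] R(1) by blast
    have S2: "$(vset {a \<in> $S1. oleast (?R a) = b}) = {a \<in> $S1. oleast (?R a) = b}" by (rule elts_sep) (intro dfb)
    have "stat omega2 (?Sb b)"
      by (rule stat_mono[OF b(2)], unfold S2 Sb) (use R S1 S'(2) in blast)
    then have bG: "b : $G" using b(1) G by blast
    obtain a where a: "a : $S1" "oleast (?R a) = b"
      using stat_unbounded[OF bnd_omega2 b(2) bnd_zero[OF bnd_omega2]] unfolding S2 by blast
    have "?R a b" "!!x. x : $b ==> \<not> ?R a x" using R(2,3)[OF a(1)] a(2) by auto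
    moreover have "$d <= $b" using \<open>?R a b\<close> Ord_not_mem_iff[OF O2[OF b(1)] O2[OF d]] by blast
    moreover have "a : $S'" using a S1 by blast
    ultimately show ?thesis using bG by blast
  qed
  have top: "\<exists>a\<in>$S. b : $(ap Y a)" if "b : $G" for b
    using stat_unbounded[OF bnd_omega2 _ bnd_zero[OF bnd_omega2], of "?Sb b"] that Sb[of b] unfolding G by auto
  have gap: "\<exists>r\<in>$omega2. \<forall>d\<in>$omega2. \<exists>b'\<in>$G. $d <= $b' & b : $(B b' h) & $(B b' h) <= $r"
    if b: "b : $G" for b
  proof -
    have b2: "b : $omega2" and sb: "stat omega2 (?Sb b)" using b G by auto
    define D where "D = vset {d \<in> $omega2. b : $d & (\<forall>c. ctbl c & $c <= $d --> (\<exists>y\<in>$d. $c <= $y))}"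
    have D: "$D = {d \<in> $omega2. b : $d & (\<forall>c. ctbl c & $c <= $d --> (\<exists>y\<in>$d. $c <= $y))}"
      unfolding D_def by (rule elts_sep) (intro dfb)
    have sD: "stat omega2 D"
      unfolding stat_def
    proof (intro allI impI)
      fix k assume k: "\<forall>x\<in>$omega2. ap k x : $omega2"
      have dk: "deft (%e. ap k (e 0))" by (intro dfb)
      have L1: "Limit omega1" using bnd_omega1 unfolding bnd_def by blast
      have "\<exists>x\<in>$omega2. b : $x & closed_pt (%u v. ap k u) x & (\<exists>f. (\<forall>i\<in>$omega1. ap f i : $x) &
        (\<forall>y\<in>$x. \<exists>i\<in>$omega1. y : $(ap f i)) & (\<forall>i\<in>$omega1. \<forall>j\<in>$i. ap f j : $(ap f i)))"
        by (rule closed_pt_approach[OF bnd_omega2 L1 omega1_omega2 dk _ b2]) (use k in blast)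
      then obtain x f where x: "x : $omega2" "b : $x" "closed_pt (%u v. ap k u) x"
        and f: "!!i. i : $omega1 ==> ap f i : $x" "!!y. y : $x ==> \<exists>i\<in>$omega1. y : $(ap f i)"
          "!!i j. i : $omega1 ==> j : $i ==> ap f j : $(ap f i)" by blast
      have "\<exists>y\<in>$x. $c <= $y" if c: "ctbl c" "$c <= $x" for c
      proof -
        let ?i = "%y i. y : $(ap f i)"
        have di: "defb (%e. ?i y (e 0))" for y by (intro dfb)
        have i: "oleast (?i y) : $omega1" "y : $(ap f (oleast (?i y)))" if y: "y : $c" for y
        proof -
          obtain u where u: "?i y u" "u : $omega1" using f(2) y c(2) by blast
          from oleast_mem[OF di Ord_omega1 u] show "oleast (?i y) : $omega1" "y : $(ap f (oleast (?i y)))" by auto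
        qed
        have dl: "deft (%e. oleast (?i (e 0)))" by (intro dfb)
        obtain m where m: "m : $omega1" "\<forall>y\<in>$c. oleast (?i y) : $m"
          using bnd_image[OF bnd_omega1 dl c(1)[unfolded ctbl_def] omega_omega1] i(1) by blast
        have Om: "Ord (ap f m)" using Ord_mem[OF O2[OF x(1)] f(1)[OF m(1)]] .
        have "$c <= $(ap f m)"
        proof
          fix y assume y: "y : $c"
          show "y : $(ap f m)" using Ord_trans[OF Om i(2)[OF y]] f(3)[OF m(1)] m(2) y by blast
        qed
        then show ?thesis using f(1)[OF m(1)] by blast
      qed
      then show "\<exists>x\<in>$D. x : $omega2 & closed_pt (%u v. ap k u) x" using x D by blast
    qed
    \<comment> \<open>For \<open>d\<close> in \<open>D\<close> the piece \<open>B b' h\<close> is a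
      countable subset of \<open>d\<close>, so it has a bound \<open>r\<close> below
      \<open>d\<close>. One bound then serves stationarily many, hence arbitrarily large
      \<open>d\<close>.\<close>
    let ?R = "%d r. \<exists>b'\<in>$G. $d <= $b' & b : $(B b' h) & $(B b' h) <= $r"
    have dR: "defb (%e. ?R d (e 0))" for d by (intro dfb)
    have dl: "deft (%e. oleast (?R (e 0)))" by (intro dfb)
    have R: "oleast (?R d) : $d" "?R d (oleast (?R d))" if d: "d : $D" for d
    proof -
      have d': "d : $omega2" "b : $d" "!!c. ctbl c ==> $c <= $d ==> \<exists>y\<in>$d. $c <= $y"
        using d unfolding D by blast+
      obtain b' a where b': "b' : $G" "$d <= $b'" "a : $(?Sb b)" "b' : $(ap Y a)" "$(ap Y a) \<inter> $b' <= $d"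
        using press[OF sb _ d'(1)] unfolding Sb by blast
      have b'2: "b' : $omega2" using b'(1) G by blast
      have aS: "a : $S" "b : $(ap Y a)" using b'(3) unfolding Sb by auto
      have e: "$(ap Y a) \<inter> $b' = $(B b' h)" by (rule YB[OF aS(1) b'(4) b'2])
      obtain y where y: "y : $d" "$(B b' h) <= $y" using d'(3)[OF ctbl_B[OF b'2 h]] e b'(5) by auto
      have "?R d y" using b' aS(2) d'(2) e y(2) by blast
      from oleast_mem[OF dR O2[OF d'(1)] this y(1)] show "oleast (?R d) : $d" "?R d (oleast (?R d))" by auto
    qed
    obtain r where r: "r : $omega2" "stat omega2 (vset {d \<in> $D. oleast (?R d) = r})"
      using Fodor[OF bnd_omega2 sD dl] R(1) by blast
    have D2: "$(vset {d \<in> $D. oleast (?R d) = r}) = {d \<in> $D. oleast (?R d) = r}" by (rule elts_sep) (intro dfb)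
    have "?R d r" if d: "d : $omega2" for d
    proof -
      obtain d' where d': "d' : $D" "oleast (?R d') = r" "d : $d'" "d' : $omega2"
        using stat_unbounded[OF bnd_omega2 r(2) d] unfolding D2 by blast
      have "$d <= $d'" using Ord_trans[OF O2[OF d'(4)] _ d'(3)] by blast
      then show ?thesis using R(2)[OF d'(1)] unfolding d'(2) by blast
    qed
    then show ?thesis using r(1) by blast
  qed
  have "\<exists>b\<in>$G. $d <= $b" if "d : $omega2" for d using press[OF S _ that] by blast
  moreover have "$G <= $omega2" using G by blast
  ultimately show ?thesis using top gap by blast
qed

text \<open>Three interleaved sequences in \<open>G\<close> are chosen so that the order in which the second and
  the third one move in step \<open>n\<close> tells whether \<open>n \<in> r\<close>.\<close>

lemma interleave:
  assumes G: "$G <= $omega2" "!!d. d : $omega2 ==> \<exists>b\<in>$G. $d <= $b"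
    "!!b. b : $G ==> \<exists>r\<in>$omega2. \<forall>d\<in>$omega2. \<exists>b'\<in>$G. $d <= $b' & b : $(B b' h) & $(B b' h) <= $r"
    and h: "h : $omega1" and dE: "defb (%e. E (e 0))"
    and cl: "!!b. b : $omega2 ==> \<exists>e\<in>$omega2. b : $e & E e"
    and coh: "!!b b'. b : $G ==> b' : $G ==> b : $(B b' h) ==> $(B b' h) \<inter> $b = $(B b h)"
    and run: "!!p. deft (%e. p (e 0)) ==> (!!n. n : $omega ==> p n : $G) ==>
       (!!n. n : $omega ==> p n : $(B (p (succ n)) h)) ==>
       (!!n. n : $omega ==> \<exists>e. Ord e & E e & p n : $e & $e <= $(p (succ n))) ==>
       $omega1 <= $(p zero) ==> vset (\<Union>n\<in>$omega. $(B (p n) h)) : $X"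
    and X: "!!a. a : $omega2 ==> \<exists>N. good N R & a : $N & (\<forall>x. $x <= $a & ctbl x --> (x : $X \<longleftrightarrow> x : $N))"
    and R: "!!E0 E1 E2 x. E0 : $R ==> E1 : $R ==> E2 : $R ==> x : $omega1 ==> dec E0 E1 E2 x : $R"
    and r: "$r <= $omega"
  shows "r : $R"
proof -
  have O2: "x : $omega2 ==> Ord x" for x using Ord_mem[OF Ord_omega2] .
  have G2: "b : $G ==> b : $omega2" for b using G(1) by blast
  have E': "deft t ==> defb (%e. E (t e))" for t by (rule defb_subst[OF dE])
  \<comment> \<open>\<open>rh b\<close> is the least bound for the new elements in extensions of
    \<open>b\<close> with arbitrarily long gaps, and \<open>nu b d\<close> the least extension whose
    gap reaches up to \<open>d\<close>.\<close>
  let ?r = "%b r. \<forall>d\<in>$omega2. \<exists>b'\<in>$G. $d <= $b' & b : $(B b' h) & $(B b' h) <= $r"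
  define rh where "rh b = oleast (?r b)" for b
  have drh: "deft (%e. rh (e 0))" unfolding rh_def by (intro dfb)
  note drh' = deft_subst[OF drh]
  have rh: "rh b : $omega2" "?r b (rh b)" if b: "b : $G" for b
  proof -
    obtain r where r: "?r b r" "r : $omega2" using G(3)[OF b] by blast
    have d: "defb (%e. ?r b (e 0))" by (intro dfb)
    show "rh b : $omega2" "?r b (rh b)" unfolding rh_def using oleast_mem[OF d Ord_omega2 r] by blast+
  qed
  let ?n = "%b d b'. b' : $G & $d <= $b' & b : $(B b' h) & $(B b' h) <= $(rh b)"
  define nu where "nu b d = oleast (?n b d)" for b d
  have "deft (%e. nu (e 0) (e 1))" unfolding nu_def by (intro dfb drh')
  note dnu = deft_subst2[OF this]
  have nu: "?n b d (nu b d)" if b: "b : $G" "d : $omega2" for b d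
  proof -
    obtain b' where b': "?n b d b'" "b' : $omega2" using rh(2)[OF b(1)] b(2) G2 by blast
    have d: "defb (%e. ?n b d (e 0))" by (intro dfb drh')
    show ?thesis unfolding nu_def by (rule oleast_mem(2)[OF d Ord_omega2 b'])
  qed
  \<comment> \<open>\<open>mu b\<close> lies above all elements that extensions of \<open>b\<close>
    add before their gap, and also above a closure point \<open>e\<close> beyond \<open>b\<close>.
    The next member of the sequence is taken from \<open>mu b\<close> on, so that \<open>run\<close>
    applies.\<close>
  let ?m = "%b m. $(rh b) <= $m & b : $m & (\<exists>e. Ord e & E e & b : $e & $e <= $m)"
  define mu where "mu b = oleast (?m b)" for b
  have "deft (%e. mu (e 0))" unfolding mu_def by (intro dfb drh' E')
  note dmu = deft_subst[OF this]
  have mu: "mu b : $omega2" "?m b (mu b)" if b: "b : $G" for b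
  proof -
    obtain e where e: "e : $omega2" "b : $e" "E e" using cl[OF G2[OF b]] by blast
    obtain m where m: "m : $omega2" "$e <= $m" "$(rh b) <= $m" using bnd_two[OF bnd_omega2 e(1) rh(1)[OF b]] by blast
    have "?m b m" using m e O2[OF e(1)] by blast
    have d: "defb (%e. ?m b (e 0))" by (intro dfb drh' E')
    show "mu b : $omega2" "?m b (mu b)" unfolding mu_def using oleast_mem[OF d Ord_omega2 \<open>?m b m\<close> m(1)] by blast+
  qed
  have rm: "$(rh b) <= $(mu b)" "b : $(mu b)" if "b : $G" for b
    using mu(2)[OF that, THEN conjunct1] mu(2)[OF that, THEN conjunct2, THEN conjunct1] by auto
  define un where "un a b = vset ($a \<union> $b)" for a b
  have un: "$(un a b) = $a \<union> $b" for a b unfolding un_def by (rule elts_Un)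
  have un2: "un a b : $omega2" if "a : $omega2" "b : $omega2" for a b
    using Un_Ord[OF O2[OF that(1)] O2[OF that(2)]] that unfolding un_def by metis
  have dun: "deft t ==> deft u ==> deft (%e. un (t e) (u e))" for t u unfolding un_def by (intro dfb)
  \<comment> \<open>All three sequences start at the same \<open>b0\<close>; their members separate
    from the first step on. The recursion handles the three together as a nested pair.\<close>
  obtain b0 where b0: "b0 : $G" "$omega1 <= $b0" using G(2)[OF omega1_omega2] by blast
  let ?p = "%s. fstp s" and ?q = "%s. fstp (sndp s)" and ?t = "%s. sndp (sndp s)"
  define p' where "p' s = nu (?p s) (un (mu (?p s)) (un (mu (?q s)) (mu (?t s))))" for s
  define d1 where "d1 s = un (un (mu (?p s)) (un (mu (?q s)) (mu (?t s)))) (mu (p' s))" for s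
  \<comment> \<open>If \<open>n\<close> is in \<open>r\<close>, the second sequence moves first and
    the third one jumps over its block; otherwise the roles are exchanged. In both cases the clock
    has moved before.\<close>
  define q' where "q' n s = (if n : $r then nu (?q s) (d1 s) else nu (?q s) (un (d1 s) (mu (nu (?t s) (d1 s)))))" for n s
  define t' where "t' n s = (if n : $r then nu (?t s) (un (d1 s) (mu (nu (?q s) (d1 s)))) else nu (?t s) (d1 s))" for n s
  have "deft (%e. p' (e 0))" unfolding p'_def by (intro dfb dnu dun dmu)
  note dp' = deft_subst[OF this]
  have "deft (%e. d1 (e 0))" unfolding d1_def by (intro dfb dun dmu dp')
  note dd1 = deft_subst[OF this]
  have "deft (%e. q' (e 0) (e 1))" unfolding q'_def by (intro dfb dnu dun dmu dd1)
  note dq' = deft_subst2[OF this]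
  have "deft (%e. t' (e 0) (e 1))" unfolding t'_def by (intro dfb dnu dun dmu dd1)
  note dt' = deft_subst2[OF this]
  define F where "F n g = (if n = zero then pair b0 (pair b0 b0) else
     pair (p' (ap g (union n))) (pair (q' (union n) (ap g (union n))) (t' (union n) (ap g (union n)))))" for n g
  have dF: "deft (%e. F (e (Suc 0)) (e 0))" unfolding F_def by (intro dfb dp' dq' dt')
  define st where "st = rec F"
  have "deft (%e. st (e 0))" unfolding st_def by (intro deft_rec'[OF dF] dfb)
  note dst = deft_subst[OF this]
  have st0: "st zero = pair b0 (pair b0 b0)"
    unfolding st_def by (subst rec_eq[OF dF]) (simp only: F_def if_True simp_thms)
  have sts: "st (succ n) = pair (p' (st n)) (pair (q' n (st n)) (t' n (st n)))" if n: "n : $omega" for n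
  proof -
    have u: "union (succ n) = n" using Ord_mem[OF Ord_omega n] unfolding Ord_def transitive_def by (intro vsetI[symmetric] trans[OF vset_elts[symmetric]] elts_inject[THEN iffD1]) auto
    have z: "succ n \<noteq> zero"
    proof
      assume "succ n = zero"
      then have "$(succ n) = $zero" by (rule arg_cong)
      then show False by simp
    qed
    have "deft (%e. rec F (e 0))" by (intro deft_rec'[OF dF] dfb)
    then have l: "ap (lam (succ n) (rec F)) n = rec F n" by (rule ap_lam) simp
    show ?thesis unfolding st_def by (subst rec_eq[OF dF]) (simp only: F_def u l z if_False)
  qed
  define P where "P n = ?p (st n)" for n
  define Q where "Q n = ?q (st n)" for n
  define S where "S n = ?t (st n)" for n
  have z0: "P zero = b0" "Q zero = b0" "S zero = b0" unfolding P_def Q_def S_def st0 by simp_all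
  have PS: "P (succ n) = p' (st n)" "Q (succ n) = q' n (st n)" "S (succ n) = t' n (st n)" if "n : $omega" for n
    unfolding P_def Q_def S_def sts[OF that] by simp_all
  have dP: "deft (%e. P (e 0))" "deft (%e. Q (e 0))" "deft (%e. S (e 0))" unfolding P_def Q_def S_def by (intro dfb dst)+
  have step: "?n (P n) zero (P (succ n)) & ?n (Q n) zero (Q (succ n)) & ?n (S n) zero (S (succ n)) &
     $(mu (P n)) <= $(P (succ n)) & $(mu (Q n)) <= $(P (succ n)) & $(mu (S n)) <= $(P (succ n)) &
     $(mu (Q n)) <= $(Q (succ n)) & $(mu (S n)) <= $(S (succ n)) &
     $(mu (P (succ n))) <= $(Q (succ n)) & $(mu (P (succ n))) <= $(S (succ n)) &
     (n : $r --> $(mu (Q (succ n))) <= $(S (succ n))) & (n \<notin> $r --> $(mu (S (succ n))) <= $(Q (succ n)))"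
    if n: "n : $omega" and g: "P n : $G" "Q n : $G" "S n : $G" for n
  proof -
    define d0 where "d0 = un (mu (P n)) (un (mu (Q n)) (mu (S n)))"
    have d0: "d0 : $omega2" unfolding d0_def by (intro un2 mu(1) g)
    have e0: "$d0 = $(mu (P n)) \<union> $(mu (Q n)) \<union> $(mu (S n))" unfolding d0_def un by blast
    have p: "P (succ n) = nu (P n) d0" by (simp only: PS[OF n] p'_def d0_def P_def[of n] Q_def[of n] S_def[of n])
    note np = nu[OF g(1) d0, folded p]
    define d where "d = un d0 (mu (P (succ n)))"
    have d: "d : $omega2" unfolding d_def using np by (intro un2 d0 mu(1)) blast
    have e1: "$d = $d0 \<union> $(mu (P (succ n)))" unfolding d_def un ..
    have dd: "d1 (st n) = d" by (simp only: d1_def d_def d0_def PS(1)[OF n] P_def[of n] Q_def[of n] S_def[of n])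
    define x where "x = nu (Q n) d"
    define y where "y = nu (S n) d"
    note nx = nu[OF g(2) d, folded x_def] and ny = nu[OF g(3) d, folded y_def]
    have d2: "un d (mu x) : $omega2" "un d (mu y) : $omega2" using nx ny by (intro un2 d mu(1); blast)+
    note nq = nu[OF g(2) d2(2)] and ns = nu[OF g(3) d2(1)]
    have q: "Q (succ n) = (if n : $r then x else nu (Q n) (un d (mu y)))" 
      by (simp only: PS(2)[OF n] q'_def dd x_def y_def Q_def[of n] S_def[of n])
    have s: "S (succ n) = (if n : $r then nu (S n) (un d (mu x)) else y)" 
      by (simp only: PS(3)[OF n] t'_def dd x_def y_def Q_def[of n] S_def[of n])
    show ?thesis
    proof (cases "n : $r")
      case True
      then have "Q (succ n) = x" "S (succ n) = nu (S n) (un d (mu x))" using q s by auto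
      then show ?thesis using np nx ns True e0 e1 un[of d "mu x"] elts_zero by auto
    next
      case False
      then have "S (succ n) = y" "Q (succ n) = nu (Q n) (un d (mu y))" using q s by auto
      then show ?thesis using np ny nq False e0 e1 un[of d "mu y"] elts_zero by auto
    qed
  qed
  have inG: "P n : $G & Q n : $G & S n : $G" if "n : $omega" for n
    using that
  proof (induction rule: omega_induct)
    case def show ?case by (intro dfb dP)
  next
    case zero show ?case unfolding z0 using b0 by blast
  next
    case (succ n) then show ?case using step[OF succ(1)] by blast
  qed
  note step' = step[OF _ inG[THEN conjunct1] inG[THEN conjunct2, THEN conjunct1] inG[THEN conjunct2, THEN conjunct2]]
  have component: "vset (\<Union>n\<in>$omega. $(B (Z n) h)) : $X & ctbl (vset (\<Union>n\<in>$omega. $(B (Z n) h))) &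
      (\<forall>n\<in>$omega. Z n : $(vset (\<Union>n\<in>$omega. $(B (Z n) h)))) &
      $(vset (\<Union>n\<in>$omega. $(B (Z n) h))) <= $omega2 &
      (\<forall>x\<in>$(vset (\<Union>n\<in>$omega. $(B (Z n) h))). x \<notin> $(P (succ zero)) --> (\<exists>n\<in>$omega. x \<notin> $(Z (succ n)) & x : $(mu (Z (succ n)))))"
    if dZ: "deft (%e. Z (e 0))" and Z0: "Z zero = b0" "$(mu (Z zero)) <= $(P (succ zero))"
      and Zn: "!!n. n : $omega ==> ?n (Z n) zero (Z (succ n)) & $(mu (Z n)) <= $(Z (succ n))" for Z
  proof -
    have dB: "deft (%e. B (Z (e 0)) h)" by (intro dfb dZ)
    define W where "W = vset (\<Union>n\<in>$omega. $(B (Z n) h))"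
    have W: "$W = (\<Union>n\<in>$omega. $(B (Z n) h))" unfolding W_def by (rule elts_UN[OF dB])
    have ZG: "Z n : $G" if n: "n : $omega" for n
      using n
    proof (induction rule: omega_induct)
      case def show ?case by (intro dfb dZ)
    next
      case zero show ?case unfolding Z0 by (rule b0)
    next
      case (succ n) then show ?case using Zn[OF succ(1)] by blast
    qed
    have "W : $X" unfolding W_def
    proof (rule run[OF dZ ZG])
      fix n assume n: "n : $omega"
      show "Z n : $(B (Z (succ n)) h)" using Zn[OF n] by blast
      show "\<exists>e. Ord e & E e & Z n : $e & $e <= $(Z (succ n))" 
      proof (rule exE[OF mu(2)[OF ZG[OF n], THEN conjunct2, THEN conjunct2]])
        fix e assume "Ord e & E e & Z n : $e & $e <= $(mu (Z n))"
        then show ?thesis using Zn[OF n] by (intro exI[of _ e]) auto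
      qed
    qed (auto simp: Z0 b0)
    moreover have "ctbl W" unfolding W_def by (rule ctbl_UN[OF dB]) (auto simp: ctbl_def[of omega] intro: ctbl_B[OF G2[OF ZG] h])
    moreover have "Z n : $W" if n: "n : $omega" for n unfolding W using Zn[OF n] succ_omega[OF n] by blast
    moreover have W2: "$W <= $omega2" unfolding W using Ord_trans[OF Ord_omega2 _ G2[OF ZG]] by auto
    moreover have "\<exists>n\<in>$omega. x \<notin> $(Z (succ n)) & x : $(mu (Z (succ n)))" if x: "x : $W" "x \<notin> $(P (succ zero))" for x
    proof -
      \<comment> \<open>The first stage \<open>k\<close> at which \<open>x\<close> appears is a
        successor of some \<open>i\<close>. By coherence \<open>x\<close> is then not below
        \<open>Z i\<close>, and being new it lies below the bound \<open>rh (Z i)\<close>, hence in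
        the block of \<open>Z i\<close>.\<close>
      let ?k = "%k. x : $(B (Z k) h)"
      have dk: "defb (%e. ?k (e 0))" by (intro dfb dZ)
      obtain k where k: "k : $omega" "?k k" "!!i. i : $k ==> i : $omega ==> \<not> ?k i"
        using x(1) defb_min[OF dk] unfolding W by blast
      have "k = zero \<or> (\<exists>i\<in>$omega. k = succ i)" using k(1)
      proof (induction rule: omega_induct)
        case def show ?case by (intro dfb)
      qed auto
      moreover have "k \<noteq> zero"
      proof
        assume "k = zero"
        then have "x : $(Z zero)" using k(2) by simp
        from Ord_trans[OF O2[OF mu(1)] this rm(2)] ZG[OF zero_omega] Z0(2) x(2) show False by blast
      qed
      ultimately obtain i where i: "i : $omega" "k = succ i" by blast
      have xm: "x : $(mu (Z i))" using k(2) i Zn[OF i(1)] rm[OF ZG[OF i(1)]] by blast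
      have "i = zero \<or> (\<exists>j\<in>$omega. i = succ j)" using i(1)
      proof (induction rule: omega_induct)
        case def show ?case by (intro dfb)
      qed auto
      then obtain j where j: "j : $omega" "i = succ j" using xm Z0(2) x(2) by blast
      have "x \<notin> $(Z i)"
      proof
        assume "x : $(Z i)"
        then have "?k i" using coh[OF ZG[OF i(1)] ZG[OF k(1)]] k(2) Zn[OF i(1)] i(2) by blast
        then show False using k(3)[of i] i by simp
      qed
      then show ?thesis using xm j by blast
    qed
    ultimately show ?thesis unfolding W_def by blast
  qed
  define WP where "WP = vset (\<Union>n\<in>$omega. $(B (P n) h))"
  define WQ where "WQ = vset (\<Union>n\<in>$omega. $(B (Q n) h))"
  define WS where "WS = vset (\<Union>n\<in>$omega. $(B (S n) h))"
  have sP: "?n (P n) zero (P (succ n)) & $(mu (P n)) <= $(P (succ n))"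
    and sQ: "?n (Q n) zero (Q (succ n)) & $(mu (Q n)) <= $(Q (succ n))"
    and sS: "?n (S n) zero (S (succ n)) & $(mu (S n)) <= $(S (succ n))" if n: "n : $omega" for n
    using step'[OF n n n n] by blast+
  have s0: "$(mu (P zero)) <= $(P (succ zero))" "$(mu (Q zero)) <= $(P (succ zero))" "$(mu (S zero)) <= $(P (succ zero))"
    using step'[OF zero_omega zero_omega zero_omega zero_omega] by blast+
  note cP = component[of P, OF dP(1) z0(1) s0(1) sP, folded WP_def] and cQ = component[of Q, OF dP(2) z0(2) s0(2) sQ, folded WQ_def]
    and cS = component[of S, OF dP(3) z0(3) s0(3) sS, folded WS_def]
  have cP: "WP : $X" "ctbl WP" "!!n. n : $omega ==> P n : $WP" "$WP <= $omega2"
    "!!x. x : $WP ==> x \<notin> $(P (succ zero)) ==> \<exists>n\<in>$omega. x \<notin> $(P (succ n)) & x : $(mu (P (succ n)))"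
    using cP by blast+
  have cQ: "WQ : $X" "ctbl WQ" "!!n. n : $omega ==> Q n : $WQ" "$WQ <= $omega2"
    "!!x. x : $WQ ==> x \<notin> $(P (succ zero)) ==> \<exists>n\<in>$omega. x \<notin> $(Q (succ n)) & x : $(mu (Q (succ n)))"
    using cQ by blast+
  have cS: "WS : $X" "ctbl WS" "!!n. n : $omega ==> S n : $WS" "$WS <= $omega2"
    "!!x. x : $WS ==> x \<notin> $(P (succ zero)) ==> \<exists>n\<in>$omega. x \<notin> $(S (succ n)) & x : $(mu (S (succ n)))"
    using cS by blast+
  \<comment> \<open>A good set containing a bound \<open>a\<close> of the three countable sets
    contains all three and also a countable piece \<open>c\<close> covering them. The clause of
    \<open>good\<close> about covers puts the three collapses into \<open>R\<close>.\<close>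
  define V where "V = un WP (un WQ WS)"
  have V: "$V = $WP \<union> $WQ \<union> $WS" unfolding V_def un by blast
  have cV: "ctbl V" unfolding V_def un_def by (intro ctbl_Un cP cQ cS)
  obtain a where a: "a : $omega2" "$V <= $a" using ctbl_bounded_omega2[OF _ cV] V cP(4) cQ(4) cS(4) by blast
  obtain N where N: "good N R" "a : $N" "!!x. $x <= $a ==> ctbl x ==> x : $X \<longleftrightarrow> x : $N" using X[OF a(1)] by blast
  have WN: "WP : $N" "WQ : $N" "WS : $N" using N(3) a(2) V cP(1,2) cQ(1,2) cS(1,2) by blast+
  obtain b where b: "b : $omega1" "!!z. Ord z ==> b : $z ==> $V <= $(B a z)" using ctbl_sub_B[OF a(1) cV a(2)] by blast
  obtain z where z: "z : $(SS a (traces N a))" "z : $omega1" "b : $z"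
    using stat_unbounded[OF bnd_omega1 good_stat[OF N(1,2) a(1)] b(1)] by blast
  define c where "c = B a z"
  have c: "c : $N" "ctbl c" "$V <= $c" "!!y. y : $c ==> Ord y"
    unfolding c_def using z b(2) ctbl_B[OF a(1) z(2)] Ord_mem[OF Ord_omega1 z(2)] Ord_mem[OF O2[OF a(1)]] by (auto simp: elts_SS elts_traces simp del: elts_B)
  have cR: "vset (col c ` $A) : $R" if "A : $N" "$A <= $V" for A
    using N(1) c that unfolding good_def by blast
  \<comment> \<open>Step \<open>n\<close> of the decoding uses the members with index
    \<open>succ n\<close>, since the members with index \<open>zero\<close> coincide. The cut-off is
    accordingly the first proper clock point \<open>P (succ zero)\<close>.\<close>
  have D: "dec (vset (col c ` $WP)) (vset (col c ` $WQ)) (vset (col c ` $WS)) (col c (P (succ zero))) = r"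
  proof (rule decode[where p = "%n. P (succ n)" and q = "%n. Q (succ n)" and s = "%n. S (succ n)" and
      p' = "%n. mu (P (succ n))" and q' = "%n. mu (Q (succ n))" and s' = "%n. mu (S (succ n))", OF c(4)])
    show "deft (%e. P (succ (e 0)))" by (rule deft_subst[OF dP(1)]) (intro dfb)
    show "$WP <= $c" "$WQ <= $c" "$WS <= $c" using V c(3) by blast+
    show "$r <= $omega" by (rule r)
    fix n assume n: "n : $omega"
    note g = inG[OF succ_omega[OF n]]
    show "Ord (mu (P (succ n))) & Ord (mu (Q (succ n))) & Ord (mu (S (succ n)))" using O2 mu(1) g by blast
    show "P (succ n) : $WP & P (succ n) : $(mu (P (succ n)))" using cP(3)[OF succ_omega[OF n]] rm(2) g by blast
    show "Q (succ n) : $WQ & Q (succ n) : $(mu (Q (succ n)))" using cQ(3)[OF succ_omega[OF n]] rm(2) g by blast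
    show "S (succ n) : $WS & S (succ n) : $(mu (S (succ n)))" using cS(3)[OF succ_omega[OF n]] rm(2) g by blast
    show "$(mu (P (succ n))) <= $(Q (succ n)) & $(mu (P (succ n))) <= $(S (succ n)) &
       $(mu (Q (succ n))) <= $(P (succ (succ n))) & $(mu (S (succ n))) <= $(P (succ (succ n)))"
    proof -
      have "$(mu (Q (succ n))) <= $(P (succ (succ n)))" "$(mu (S (succ n))) <= $(P (succ (succ n)))"
        using step'[OF succ_omega succ_omega succ_omega succ_omega, OF n n n n] by blast+
      then show ?thesis using step'[OF n n n n] by blast
    qed
    show "n : $r ==> $(mu (Q (succ n))) <= $(S (succ n))" "n \<notin> $r ==> $(mu (S (succ n))) <= $(Q (succ n))"
      using step'[OF n n n n] by blast+
  next
    fix x show "x : $WP ==> x \<notin> $(P (succ zero)) ==> \<exists>n\<in>$omega. x \<notin> $(P (succ n)) & x : $(mu (P (succ n)))"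
      "x : $WQ ==> x \<notin> $(P (succ zero)) ==> \<exists>n\<in>$omega. x \<notin> $(Q (succ n)) & x : $(mu (Q (succ n)))"
      "x : $WS ==> x \<notin> $(P (succ zero)) ==> \<exists>n\<in>$omega. x \<notin> $(S (succ n)) & x : $(mu (S (succ n)))"
      by (fact cP(5) cQ(5) cS(5))+
  qed
  have "P (succ zero) : $omega2" using inG[OF succ_omega[OF zero_omega]] G2 by blast
  then have x0: "col c (P (succ zero)) : $omega1" by (rule col_omega1[OF c(2) O2])
  have "dec (vset (col c ` $WP)) (vset (col c ` $WQ)) (vset (col c ` $WS)) (col c (P (succ zero))) : $R"
    by (intro R cR WN x0) (use V in auto)
  then show ?thesis unfolding D .
qed

text \<open>Inside a hull \<open>A\<close> of size \<open>omega2\<close>, with an injection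
  \<open>j\<close> into \<open>omega2\<close>, a countable set closed under \<open>j\<close> and its
  inverse is recovered from its ordinals. Unions along suitable sequences in \<open>G\<close> are
  therefore traces of new closed sets, not only of the sets found by \<open>tops\<close>; these are
  in the club with trace \<open>h\<close> in \<open>T\<close>, so \<open>X\<close> contains enough
  traces for \<open>interleave\<close>.\<close>

lemma avoid_branch:
  assumes T: "stat omega1 T" and C: "club C (H omega2)"
    and CX: "!!Y. Y : $C ==> ctbl Y ==> $Y <= $(H omega2) ==> nice Y ==>
      vset ($Y \<inter> $omega1) : $T ==> vset ($Y \<inter> $omega2) : $X"
    and X: "!!a. a : $omega2 ==> \<exists>N. good N R & a : $N & (\<forall>x. $x <= $a & ctbl x --> (x : $X \<longleftrightarrow> x : $N))"
    and R: "!!E0 E1 E2 x. E0 : $R ==> E1 : $R ==> E2 : $R ==> x : $omega1 ==> dec E0 E1 E2 x : $R"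
    and r: "$r <= $omega"
  shows "r : $R"
proof -
  let ?X = "H omega2"
  have O2: "x : $omega2 ==> Ord x" for x using Ord_mem[OF Ord_omega2] .
  obtain F where F: "!!z. z : $?X ==> ctbl (ap F z) & $(ap F z) <= $?X" and
    FC: "!!Y. $Y <= $?X ==> ctbl Y ==> $Y \<noteq> {} ==> (\<forall>z\<in>$Y. $(ap F z) <= $Y) ==>
      (\<forall>x\<in>$Y. \<forall>y\<in>$Y. vset {x, y} : $Y) ==> Y : $C"
  proof -
    show ?thesis using club_contains_closed[OF C transitive_H[OF Ord_omega2]] by (elim exE) (rule that, blast+)
  qed
  define g1 where "g1 x y = vset ($(g0 x y) \<union> $(ap F x))" for x y
  have g1: "$(g1 x y) = $(g0 x y) \<union> $(ap F x)" for x y unfolding g1_def by simp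
  have dg1: "deft (%e. g1 (e 0) (e 1))" unfolding g1_def by (intro dfb)
  have g1X: "ctbl (g1 x y)" "$(g1 x y) <= $?X" if "x : $?X" "y : $?X" for x y
    unfolding g1 using ctbl_Un[OF ctbl_g0] F g0_H2 that by (auto simp: g1_def simp del: elts_vset)
  have "lepoll (g1 x y) omega2 & $(g1 x y) <= $?X" if "x : $?X" "y : $?X" for x y
    using g1X[OF that] lepoll_trans[OF ctbl_lepoll_omega1 omega1_lepoll_omega2] by blast
  from closure_exists[OF idem_omega2 dg1 lepoll_refl omega2_sub_H2 this]
  obtain A where A: "$omega2 <= $A" "$A <= $?X" "lepoll A omega2"
    and A1: "!!x y. x : $A ==> y : $A ==> $(g1 x y) <= $A" by blast
  obtain j where j: "!!x. x : $A ==> ap j x : $omega2" "inj_on (ap j) ($A)"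
    using A(3) unfolding lepoll_iff by blast
  have dj: "deft (%e. ap j (e 0))" by (intro dfb)
  let ?fib = "%x. vset {x' \<in> $A. ap j x' : $(vset {x})}"
  have fib: "$(?fib x) = {x' \<in> $A. ap j x' : $(vset {x})}" for x by (rule elts_sep) (intro dfb)
  have s1: "ctbl (vset {u})" for u using ctbl_upair[of u u] by simp
  \<comment> \<open>Besides the values of \<open>g1\<close>, closed sets get \<open>j\<close> and
    its inverse. This is what makes them determined by their ordinals, see
    \<open>Yj\<close>.\<close>
  define g2 where "g2 x y = vset ($(g1 x y) \<union> $(vset ($(vset {ap j x}) \<union> $(?fib x))))" for x y
  have g2: "$(g2 x y) = $(g1 x y) \<union> {ap j x} \<union> {x' \<in> $A. ap j x' = x}" for x y
  proof -
    have "$(g2 x y) = $(g1 x y) \<union> ($(vset {ap j x}) \<union> $(?fib x))"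
      unfolding g2_def by (subst elts_Un, subst elts_Un, rule refl)
    then show ?thesis unfolding fib by auto
  qed
  have dg2: "deft (%e. g2 (e 0) (e 1))" unfolding g2_def g1_def by (intro dfb)
  have g2A: "ctbl (g2 x y) & $(g2 x y) <= $A" if xy: "x : $A" "y : $A" for x y
  proof
    have "ctbl (?fib x)" by (rule ctbl_fibre[OF dj j(2) s1])
    moreover have "ctbl (g1 x y)" using g1X xy A(2) by blast
    ultimately show "ctbl (g2 x y)" unfolding g2_def by (intro ctbl_Un s1)
    show "$(g2 x y) <= $A" unfolding g2 using A1[OF xy] j(1)[OF xy(1)] A(1) by blast
  qed
  from tops[OF A(1) dg2 g2A T] obtain S Y h where sS: "stat omega2 S" and h: "h : $T" "h : $omega1"
    and SY: "\<forall>a\<in>$S. a : $omega2 & omega1 : $a &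
     ctbl (ap Y a) & $(ap Y a) <= $A & (\<forall>x\<in>$(ap Y a). \<forall>y\<in>$(ap Y a). $(g2 x y) <= $(ap Y a)) &
     vset ($(ap Y a) \<inter> $omega1) = h & (\<forall>x\<in>$a. \<exists>y\<in>$(ap Y a). y : $a & x : $y)" by blast
  have Ya: "ctbl (ap Y a)" "$(ap Y a) <= $A" "!!x y. x : $(ap Y a) ==> y : $(ap Y a) ==> $(g2 x y) <= $(ap Y a)"
    "vset ($(ap Y a) \<inter> $omega1) = h" if "a : $S" for a using bspec[OF SY that] by blast+
  have Yh: "$(ap Y a) \<inter> $omega1 = $h" if "a : $S" for a using Ya(4)[OF that] elts_Int by metis
  have YB: "$(ap Y a) \<inter> $b = $(B b h)" if a: "a : $S" "b : $(ap Y a)" "b : $omega2" for a b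
  proof -
    have "\<forall>x\<in>$(ap Y a). \<forall>y\<in>$(ap Y a). $(g0 x y) <= $(ap Y a)" using Ya(3)[OF a(1)] g2 g1 by blast
    from nice_closed(1)[OF Ya(1)[OF a(1)] this] show ?thesis using a(2,3) Ya(4)[OF a(1)] unfolding nice_def by metis
  qed
  have Yj: "ap j x : $(ap Y a) \<longleftrightarrow> x : $(ap Y a)" if a: "a : $S" "x : $A" for a x
  proof
    assume "ap j x : $(ap Y a)"
    moreover have "x : $(g2 (ap j x) (ap j x))" unfolding g2 using a(2) by blast
    ultimately show "x : $(ap Y a)" using Ya(3)[OF a(1)] by blast
  next
    assume "x : $(ap Y a)"
    moreover have "ap j x : $(g2 x x)" unfolding g2 by blast
    ultimately show "ap j x : $(ap Y a)" using Ya(3)[OF a(1)] by blast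
  qed
  have "\<exists>G. $G <= $omega2 & (\<forall>d\<in>$omega2. \<exists>b\<in>$G. $d <= $b) &
     (\<forall>b\<in>$G. \<exists>a\<in>$S. b : $(ap Y a)) &
     (\<forall>b\<in>$G. \<exists>r\<in>$omega2. \<forall>d\<in>$omega2. \<exists>b'\<in>$G. $d <= $b' & b : $(B b' h) & $(B b' h) <= $r)"
    by (rule gaps[OF sS h(2) _ YB]) (use SY in blast)
  then obtain G where G0: "$G <= $omega2 & (\<forall>d\<in>$omega2. \<exists>b\<in>$G. $d <= $b) &
     (\<forall>b\<in>$G. \<exists>a\<in>$S. b : $(ap Y a)) &
     (\<forall>b\<in>$G. \<exists>r\<in>$omega2. \<forall>d\<in>$omega2. \<exists>b'\<in>$G. $d <= $b' & b : $(B b' h) & $(B b' h) <= $r)"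
    by (rule exE)
  note G = G0[THEN conjunct1] bspec[OF G0[THEN conjunct2, THEN conjunct1]]
    bspec[OF G0[THEN conjunct2, THEN conjunct2, THEN conjunct1]] bspec[OF G0[THEN conjunct2, THEN conjunct2, THEN conjunct2]]
  \<comment> \<open>\<open>e\<close> is a closure point if \<open>j\<close> maps a \<open>g1\<close>-closed subset of \<open>A\<close> with trace \<open>e\<close> onto \<open>e\<close>.\<close>
  let ?cl = "%e. (\<forall>x\<in>$A. \<forall>y\<in>$A. ap j x : $e & ap j y : $e --> (\<forall>w\<in>$(g1 x y). ap j w : $e)) &
     (\<forall>w\<in>$omega2. ap j w : $e \<longleftrightarrow> w : $e)"
  have g1': "deft t ==> deft s ==> deft (%e. g1 (t e) (s e))" for t s by (rule deft_subst2[OF dg1])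
  have cl: "\<exists>e\<in>$omega2. b : $e & ?cl e" if b: "b : $omega2" for b
  proof -
    \<comment> \<open>Ordinals \<open>u\<close> and \<open>v\<close> are read through
      \<open>j\<close> as codes of elements of \<open>A\<close>. Their closure points below
      \<open>omega2\<close> bound the codes of the values of \<open>g1\<close> and make
      \<open>j\<close> and the identity agree on ordinals.\<close>
    let ?K = "%u v c. ap j u : $c & (\<forall>x\<in>$A. \<forall>y\<in>$A. ap j x = u & ap j y = v --> (\<forall>w\<in>$(g1 x y). ap j w : $c) & (x : $omega2 --> x : $c))"
    have dK: "defb (%e. ?K u v (e 0))" for u v by (intro dfb g1')
    have dl: "deft (%e. oleast (?K (e 0) (e 1)))" by (intro dfb g1')
    have K: "oleast (?K u v) : $omega2" "?K u v (oleast (?K u v))" if u: "u : $omega2" "v : $omega2" for u v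
    proof -
      have ju: "ap j u : $omega2" using j(1) A(1) u by blast
      have "\<exists>c\<in>$omega2. ?K u v c"
      proof (cases "\<exists>x\<in>$A. \<exists>y\<in>$A. ap j x = u & ap j y = v")
        case True
        then obtain x y where xy: "x : $A" "y : $A" "ap j x = u" "ap j y = v" by blast
        have uq: "x' = x & y' = y" if "x' : $A" "y' : $A" "ap j x' = u" "ap j y' = v" for x' y'
          using j(2) that xy unfolding inj_on_def by blast
        have "ctbl (g1 x y)" using g1X xy A(2) by blast
        then have "\<exists>c\<in>$omega2. \<forall>w\<in>$(g1 x y). ap j w : $c"
          by (intro bnd_image[OF bnd_omega2 dj _ omega_omega2]) (use j(1) A1[OF xy(1,2)] in \<open>auto simp: ctbl_def\<close>)
        then obtain c where c: "c : $omega2" "\<forall>w\<in>$(g1 x y). ap j w : $c" by blast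
        define x1 where "x1 = (if x : $omega2 then x else zero)"
        have x1: "x1 : $omega2" unfolding x1_def using bnd_zero[OF bnd_omega2] by simp
        obtain c1 where c1: "c1 : $omega2" "$c <= $c1" "x1 : $c1" using bnd_two[OF bnd_omega2 c(1) x1] by blast
        obtain c2 where c2: "c2 : $omega2" "$c1 <= $c2" "ap j u : $c2" using bnd_two[OF bnd_omega2 c1(1) ju] by blast
        have "x : $omega2 --> x : $c2" using c1(3) c2(2) unfolding x1_def by auto
        then have "?K u v c2" using uq c(2) c1(2) c2 by blast
        then show ?thesis using c2(1) by blast
      next
        case False
        then have "?K u v (succ (ap j u))" by auto
        then show ?thesis using bnd_succ[OF bnd_omega2 ju] by blast
      qed
      then obtain c where c: "?K u v c" "c : $omega2" by blast
      from oleast_mem[OF dK Ord_omega2 c] show "oleast (?K u v) : $omega2" "?K u v (oleast (?K u v))" by auto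
    qed
    from closed_pt_approach[OF bnd_omega2 omega_props(1) omega_omega2 dl K(1) b]
    obtain e where e: "e : $omega2" "b : $e" "closed_pt (%u v. oleast (?K u v)) e" by blast
    have eK: "?K u v (oleast (?K u v))" "oleast (?K u v) : $e" if "u : $e" "v : $e" for u v
      using K(2) Ord_trans[OF Ord_omega2 _ e(1)] e(3) that unfolding closed_pt_def by blast+
    have tr: "x : $e" if "u : $e" "v : $e" "x : $(oleast (?K u v))" for u v x
      using Ord_trans[OF O2[OF e(1)] that(3) eK(2)[OF that(1,2)]] .
    have "?cl e"
    proof (intro conjI ballI impI iffI)
      fix x y w assume x: "x : $A" and y: "y : $A" and xy: "ap j x : $e & ap j y : $e" and w: "w : $(g1 x y)"
      have "ap j w : $(oleast (?K (ap j x) (ap j y)))" using eK(1)[OF conjunct1[OF xy] conjunct2[OF xy]] x y w by blast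
      then show "ap j w : $e" by (rule tr[OF conjunct1[OF xy] conjunct2[OF xy]])
    next
      fix w assume w: "w : $omega2" "ap j w : $e"
      have wA: "w : $A" using w(1) A(1) by blast
      have "w : $(oleast (?K (ap j w) (ap j w)))" using eK(1)[OF w(2) w(2)] wA w(1) by blast
      then show "w : $e" by (rule tr[OF w(2) w(2)])
    next
      fix w assume w: "w : $e"
      have "ap j w : $(oleast (?K w w))" using eK(1)[OF w w] by blast
      then show "ap j w : $e" by (rule tr[OF w w])
    qed
    then show ?thesis using e by blast
  qed
  have coh: "$(B b' h) \<inter> $b = $(B b h)" "b : $b'" if b: "b : $G" "b' : $G" "b : $(B b' h)" for b b'
  proof -
    obtain a where a: "a : $S" "b' : $(ap Y a)" using G(3)[OF b(2)] by blast
    have b2: "b : $omega2" "b' : $omega2" using b G(1) by blast+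
    have e: "$(ap Y a) \<inter> $b' = $(B b' h)" by (rule YB[OF a b2(2)])
    have "b : $(ap Y a)" using e b(3) by blast
    then have "$(ap Y a) \<inter> $b = $(B b h)" by (rule YB[OF a(1) _ b2(1)])
    moreover show bb: "b : $b'" using b(3) by simp
    ultimately show "$(B b' h) \<inter> $b = $(B b h)" using e Ord_trans[OF O2[OF b2(2)] _ bb] by blast
  qed
  have mono: "$(B b h) <= $(B b' h)" if b: "b : $G" "b' : $G" "b : $(B b' h)" for b b'
    using coh(1)[OF that] by blast
  \<comment> \<open>The set \<open>Z\<close> of all \<open>x\<close> in \<open>A\<close> with code
    in the union \<open>W\<close> is shown to be a closed countable set with \<open>W\<close> as its
    trace on \<open>omega2\<close>. Membership of \<open>W\<close> in \<open>X\<close> is then the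
    assumption on the club.\<close>
  have run: "vset (\<Union>n\<in>$omega. $(B (p n) h)) : $X"
    if dp: "deft (%e. p (e 0))" and pG: "!!n. n : $omega ==> p n : $G"
      and pB: "!!n. n : $omega ==> p n : $(B (p (succ n)) h)"
      and pe: "!!n. n : $omega ==> \<exists>e. Ord e & ?cl e & p n : $e & $e <= $(p (succ n))"
      and p0: "$omega1 <= $(p zero)" for p
  proof -
    have dB: "deft (%e. B (p (e 0)) h)" by (intro dfb dp)
    define W where "W = vset (\<Union>n\<in>$omega. $(B (p n) h))"
    have W: "$W = (\<Union>n\<in>$omega. $(B (p n) h))" unfolding W_def by (rule elts_UN[OF dB])
    have p2: "p n : $omega2" if "n : $omega" for n using pG[OF that] G(1) by blast
    have inc: "$(B (p n) h) <= $(B (p (succ n)) h)" if "n : $omega" for n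
      by (rule mono[OF pG pG pB]) (use that in auto)
    have inc2: "m : $n --> $(B (p m) h) <= $(B (p n) h)" if n: "n : $omega" for m n
      using n
    proof (induction rule: omega_induct)
      case def show ?case by (intro dfb dp)
    next
      case zero then show ?case by simp
    next
      case (succ n) then show ?case using inc[OF succ(1)] by auto
    qed
    have omp: "$omega1 <= $(p n)" if n: "n : $omega" for n
      using n
    proof (induction rule: omega_induct)
      case def show ?case by (intro dfb dp)
    next
      case zero then show ?case by (rule p0)
    next
      case (succ n)
      have "p n : $(p (succ n))" by (rule coh(2)[OF pG pG pB]) (use succ in auto)
      then show ?case using succ(2) Ord_trans[OF O2[OF p2[OF succ_omega[OF succ(1)]]]] by blast
    qed
    have two: "\<exists>k\<in>$omega. u : $(B (p k) h) & v : $(B (p k) h)" if u: "u : $W" "v : $W" for u v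
    proof -
      obtain m n where mn: "m : $omega" "u : $(B (p m) h)" "n : $omega" "v : $(B (p n) h)" using u W by blast
      have "m : $n \<or> m = n \<or> n : $m" using Ord_linear Ord_mem[OF Ord_omega] mn by blast
      then show ?thesis using inc2[OF mn(1), of n] inc2[OF mn(3), of m] mn by blast
    qed
    have W2: "$W <= $omega2" unfolding W using Ord_trans[OF Ord_omega2 _ p2] by auto
    define Z where "Z = vset {x \<in> $A. ap j x : $W}"
    have Z: "$Z = {x \<in> $A. ap j x : $W}" unfolding Z_def by (rule elts_sep) (intro dfb)
    have cW: "ctbl W" unfolding W_def by (rule ctbl_UN[OF dB]) (auto simp: ctbl_def[of omega] intro: ctbl_B[OF p2 h(2)])
    have cZ: "ctbl Z" unfolding Z_def by (rule ctbl_fibre[OF dj j(2) cW])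
    have get: "\<exists>a\<in>$S. $(ap Y a) \<inter> $(p (succ k)) = $(B (p (succ k)) h)" if k: "k : $omega" for k
    proof -
      obtain a where a: "a : $S" "p (succ k) : $(ap Y a)" using G(3)[OF pG[OF succ_omega[OF k]]] by blast
      then show ?thesis using YB[OF a p2[OF succ_omega[OF k]]] by blast
    qed
    \<comment> \<open>Arguments with codes below \<open>p k\<close> have a value with code below the
      closure point \<open>e\<close>, hence below \<open>p (succ k)\<close>. They belong to a closed
      set \<open>ap Y a\<close> with \<open>p (succ k)\<close> in it, so the code of the value lies
      in the piece at \<open>p (succ k)\<close>.\<close>
    have closed: "$(g1 x y) <= $Z" if x: "x : $Z" "y : $Z" for x y
    proof
      fix w assume w: "w : $(g1 x y)"
      have xA: "x : $A" "y : $A" "ap j x : $W" "ap j y : $W" using x Z by auto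
      have wA: "w : $A" using A1[OF xA(1,2)] w by blast
      obtain k where k: "k : $omega" "ap j x : $(B (p k) h)" "ap j y : $(B (p k) h)" using two[OF xA(3,4)] by blast
      obtain e where eo: "Ord e" and e: "?cl e" "p k : $e" "$e <= $(p (succ k))" using pe[OF k(1)] by blast
      have "$(p k) <= $e" using Ord_trans[OF eo _ e(2)] by blast
      then have je: "ap j x : $e" "ap j y : $e" using k by auto
      have jw: "ap j w : $e" using e(1) je xA(1,2) w by blast
      obtain a where a: "a : $S" "$(ap Y a) \<inter> $(p (succ k)) = $(B (p (succ k)) h)" using get[OF k(1)] by blast
      have "ap j x : $(ap Y a)" "ap j y : $(ap Y a)" using a(2) inc[OF k(1)] k(2,3) by blast+
      then have "x : $(ap Y a)" "y : $(ap Y a)" using Yj[OF a(1)] xA by blast+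
      then have "w : $(ap Y a)" using Ya(3)[OF a(1)] w g2 by blast
      then have "ap j w : $(ap Y a)" using Yj[OF a(1) wA] by blast
      then have "ap j w : $(B (p (succ k)) h)" using a(2) jw e(3) by blast
      then show "w : $Z" unfolding Z W using wA succ_omega[OF k(1)] by blast
    qed
    have Zw: "$Z \<inter> $omega2 = $W"
    proof (intro equalityI subsetI)
      fix x assume x: "x : $Z \<inter> $omega2"
      then have xA: "x : $A" "ap j x : $W" using Z by auto
      obtain k where k: "k : $omega" "ap j x : $(B (p k) h)" using xA(2) W by blast
      obtain e where eo: "Ord e" and e: "?cl e" "p k : $e" "$e <= $(p (succ k))" using pe[OF k(1)] by blast
      have "$(p k) <= $e" using Ord_trans[OF eo _ e(2)] by blast
      then have "ap j x : $e" using k by auto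
      then have xe: "x : $e" using e(1) x by blast
      obtain a where a: "a : $S" "$(ap Y a) \<inter> $(p (succ k)) = $(B (p (succ k)) h)" using get[OF k(1)] by blast
      have "ap j x : $(ap Y a)" using a(2) inc[OF k(1)] k(2) by blast
      then have "x : $(ap Y a)" using Yj[OF a(1) xA(1)] by blast
      then show "x : $W" unfolding W using a(2) xe e(3) succ_omega[OF k(1)] by blast
    next
      fix x assume x: "x : $W"
      then obtain k where k: "k : $omega" "x : $(B (p k) h)" using W by blast
      obtain e where eo: "Ord e" and e: "?cl e" "p k : $e" "$e <= $(p (succ k))" using pe[OF k(1)] by blast
      have "$(p k) <= $e" using Ord_trans[OF eo _ e(2)] by blast
      then have "x : $e" using k by auto
      then have je: "ap j x : $e" using e(1) x W2 by blast
      have xA: "x : $A" using x W2 A(1) by blast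
      obtain a where a: "a : $S" "$(ap Y a) \<inter> $(p (succ k)) = $(B (p (succ k)) h)" using get[OF k(1)] by blast
      have "x : $(ap Y a)" using a(2) inc[OF k(1)] k(2) by blast
      then have "ap j x : $(ap Y a)" using Yj[OF a(1) xA] by blast
      then have "ap j x : $W" unfolding W using a(2) je e(3) succ_omega[OF k(1)] by blast
      then show "x : $Z \<inter> $omega2" using Z xA x W2 by blast
    qed
    have Zh: "$Z \<inter> $omega1 = $h"
    proof -
      have "$(B (p n) h) \<inter> $omega1 = $h" if n: "n : $omega" for n
      proof -
        obtain a where a: "a : $S" "p n : $(ap Y a)" using G(3)[OF pG[OF n]] by blast
        show ?thesis using YB[OF a p2[OF n]] Yh[OF a(1)] omp[OF n] by blast
      qed
      then have "$W \<inter> $omega1 = $h" unfolding W using zero_omega by blast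
      then show ?thesis using Zw omega1_sub_omega2 by blast
    qed
    have ZX: "$Z <= $?X" using Z A(2) by blast
    have g0Z: "\<forall>x\<in>$Z. \<forall>y\<in>$Z. $(g0 x y) <= $Z" and FZ: "\<forall>x\<in>$Z. $(ap F x) <= $Z"
      using closed g1 by blast+
    have "p zero : $W" unfolding W using pB[OF zero_omega] succ_omega[OF zero_omega] by blast
    then have ne: "$Z \<noteq> {}" using Zw by blast
    note nc = nice_closed[OF cZ g0Z]
    have "Z : $C" by (rule FC[OF ZX cZ ne FZ nc(2)])
    then have "vset ($Z \<inter> $omega2) : $X" by (rule CX[OF _ cZ ZX nc(1)]) (simp add: Zh h(1))
    then show ?thesis unfolding Zw by (simp add: W_def)
  qed
  have dE: "defb (%e. ?cl (e 0))" by (intro dfb g1')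
  show ?thesis
    by (rule interleave[OF G(1,2,4) h(2) dE cl coh(1) run X R r])
qed

definition dec_closed :: "'v \<Rightarrow> bool" where
  "dec_closed R \<longleftrightarrow> (\<forall>E0\<in>$R. \<forall>E1\<in>$R. \<forall>E2\<in>$R. \<forall>x\<in>$omega1. dec E0 E1 E2 x : $R)"

text \<open>If every ordinal below \<open>omega2\<close> occurred in a good set over
  \<open>R\<close>, the coherent branch would decode each real inside \<open>R\<close>, including
  the missing \<open>r\<close>.\<close>

theorem not_all_good:
  assumes SRP: "SRP_omega2" and TP: "tree_property omega2" and R: "dec_closed R" and r: "$r <= $omega" "r \<notin> $R"
  shows "\<exists>a\<in>$omega2. \<forall>N. good N R --> a \<notin> $N"
proof (rule ccontr)
  assume "\<not> ?thesis"
  then have g: "!!a. a : $omega2 ==> \<exists>N. good N R & a : $N" by blast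
  from coherent_branch[OF SRP TP g] obtain X where
    X: "\<forall>a\<in>$omega2. \<exists>N. good N R & a : $N & (\<forall>x. $x <= $a & ctbl x --> (x : $X \<longleftrightarrow> x : $N))" by (rule exE)
  from branch_contradiction[OF SRP bspec[OF X]] obtain T C where TC: "stat omega1 T" "club C (H omega2)" and
    C: "\<forall>Y\<in>$C. ctbl Y & $Y <= $(H omega2) & nice Y & vset ($Y \<inter> $omega1) : $T --> vset ($Y \<inter> $omega2) : $X" by blast
  have "r : $R"
    by (rule avoid_branch[OF TC _ bspec[OF X] _ r(1)]) (use C R in \<open>auto simp: dec_closed_def\<close>)
  then show False using r(2) by blast
qed

lemma deft_triple [dfb]: "deft t ==> deft s ==> deft u ==> deft (%e. triple (t e) (s e) (u e))"
  unfolding triple_def by (intro dfb)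

section \<open>Ranks, as a measure for names\<close>

definition rank :: "'v \<Rightarrow> 'v" where
  "rank = rec (%x g. vset (\<Union>y\<in>$x. $(succ (ap g y))))"
lemma elts_rank: "$(rank x) = (\<Union>y\<in>$x. $(succ (rank y)))"
proof -
  let ?F = "%x g. vset (\<Union>y\<in>$x. $(succ (ap g y)))"
  have F: "deft (%e. ?F (e (Suc 0)) (e 0))" by (intro dfb)
  have d: "deft (%e. rank (e 0))" unfolding rank_def by (intro deft_rec'[OF F] dfb)
  have l: "ap (lam x rank) y = rank y" if "y : $x" for y by (rule ap_lam[OF d that])
  have ds: "deft (%e. succ (ap (lam x rank) (e 0)))" by (intro dfb d)
  have "rank x = ?F x (lam x rank)" unfolding rank_def by (rule rec_eq[OF F])
  then have "$(rank x) = $(?F x (lam x rank))" by (rule arg_cong)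
  also have "\<dots> = (\<Union>y\<in>$x. $(succ (ap (lam x rank) y)))" by (rule elts_UN[OF ds])
  also have "\<dots> = (\<Union>y\<in>$x. $(succ (rank y)))" by (rule SUP_cong[OF refl]) (simp only: l)
  finally show ?thesis .
qed
lemma deft_rank [dfb]: "deft t ==> deft (%e. rank (t e))"
  unfolding rank_def by (rule deft_rec') (intro dfb)
lemma rank_mem: "x : $y ==> rank x : $(rank y)"
  unfolding elts_rank[of y] by auto
lemma Ord_rank: "Ord (rank x)"
proof (rule mem_induct[where Q = "%x. Ord (rank x)"])
  show "defb (%e. Ord (rank (e 0)))" by (intro dfb)
  fix x assume IH: "!!y. y : $x ==> Ord (rank y)"
  have "Ord (succ (rank y))" if "y : $x" for y by (rule Ord_succ[OF IH[OF that]])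
  then show "Ord (rank x)" unfolding Ord_def transitive_def elts_rank[of x] by blast
qed
lemma rank_pair: "pair x p : $y ==> rank x : $(rank y)"
proof -
  assume "pair x p : $y"
  moreover have "x : $(vset {x})" "vset {x} : $(pair x p)" unfolding pair_def by auto
  ultimately show ?thesis by (meson rank_mem Ord_trans Ord_rank)
qed

end

subsection \<open>Forcing tables\<close>

locale forcing = zfc mem for mem :: "'v \<Rightarrow> 'v \<Rightarrow> bool" +
  fixes P le :: 'v
  assumes le_refl: "p : $P ==> pair p p : $le"
    and le_trans: "pair p q : $le ==> pair q r : $le ==> pair p r : $le"
    and le_P: "pair p q : $le ==> p : $P & q : $P"
begin

abbreviation leq (infix "\<preceq>" 50) where "q \<preceq> p \<equiv> pair q p : $le"

lemma below_iff: "q : below P le p \<longleftrightarrow> q \<preceq> p"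
  unfolding below_def using le_P by blast

text \<open>The clause for forced membership, relative to a candidate \<open>E\<close> for forced
  equality.\<close>

definition Rel :: "'v \<Rightarrow> 'v \<Rightarrow> 'v \<Rightarrow> 'v \<Rightarrow> bool" where
  "Rel E p \<rho> \<tau> \<longleftrightarrow> (\<forall>q. q \<preceq> p --> (\<exists>r \<rho>' s. r \<preceq> q & pair \<rho>' s : $\<tau> & r \<preceq> s & triple r \<rho> \<rho>' : $E))"
definition Phi :: "'v \<Rightarrow> 'v \<Rightarrow> 'v \<Rightarrow> 'v \<Rightarrow> bool" where
  "Phi E p \<sigma> \<tau> \<longleftrightarrow> (\<forall>\<rho> s q. pair \<rho> s : $\<sigma> & q \<preceq> p & q \<preceq> s --> Rel E q \<rho> \<tau>) &
     (\<forall>\<rho> s q. pair \<rho> s : $\<tau> & q \<preceq> p & q \<preceq> s --> Rel E q \<rho> \<sigma>)"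
definition post :: "'v \<Rightarrow> 'v \<Rightarrow> bool" where
  "post N E \<longleftrightarrow> $E <= $(prod P (prod N N)) & (\<forall>p \<sigma> \<tau>. triple p \<sigma> \<tau> : $E --> Phi E p \<sigma> \<tau>)"
text \<open>The union of all \<open>E\<close> with \<open>post N E\<close>, that is, the greatest
  relation consistent with the clause \<open>Phi\<close>. Forced equality is thus obtained by
  coinduction instead of a simultaneous recursion on pairs of names, and its properties are proved
  by exhibiting bisimulations.\<close>

definition Eq :: "'v \<Rightarrow> 'v" where
  "Eq N = vset {w \<in> $(prod P (prod N N)). \<exists>E. post N E & w : $E}"

lemma Rel_mono: "Rel E p \<rho> \<tau> ==> (!!p \<sigma> \<tau>. triple p \<sigma> \<tau> : $E ==> triple p \<sigma> \<tau> : $E') ==> Rel E' p \<rho> \<tau>"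
  unfolding Rel_def by meson
lemma Phi_mono: "Phi E p \<rho> \<tau> ==> (!!p \<sigma> \<tau>. triple p \<sigma> \<tau> : $E ==> triple p \<sigma> \<tau> : $E') ==> Phi E' p \<rho> \<tau>"
  unfolding Phi_def using Rel_mono[of E _ _ _ E'] by meson
lemma RelI: "(!!q. q \<preceq> p ==> \<exists>r \<rho>' s. r \<preceq> q & pair \<rho>' s : $\<tau> & r \<preceq> s & triple r \<rho> \<rho>' : $E) ==> Rel E p \<rho> \<tau>"
  unfolding Rel_def by blast
lemma RelD: "Rel E p \<rho> \<tau> ==> q \<preceq> p ==> \<exists>r \<rho>' s. r \<preceq> q & pair \<rho>' s : $\<tau> & r \<preceq> s & triple r \<rho> \<rho>' : $E"
  unfolding Rel_def by blast
lemma Rel_down: "Rel E p \<rho> \<tau> ==> q \<preceq> p ==> Rel E q \<rho> \<tau>"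
  unfolding Rel_def using le_trans by blast

lemma name_closedD: "name_closed P N ==> \<tau> : $N ==> pair \<sigma> p : $\<tau> ==> \<sigma> : $N & p : $P"
  unfolding name_closed_def using pair_inject by metis

lemma elts_Eq: "$(Eq N) = {w \<in> $(prod P (prod N N)). \<exists>E. post N E & w : $E}"
  unfolding Eq_def by (rule elts_sep) (unfold post_def Phi_def Rel_def, intro dfb)

lemma triple_prod: "triple p \<sigma> \<tau> : $(prod P (prod N N)) \<longleftrightarrow> p : $P & \<sigma> : $N & \<tau> : $N"
  unfolding triple_def by simp

lemma Eq_Phi: "triple p \<sigma> \<tau> : $(Eq N) ==> Phi (Eq N) p \<sigma> \<tau>"
proof -
  assume "triple p \<sigma> \<tau> : $(Eq N)"
  then obtain E where E: "post N E" "triple p \<sigma> \<tau> : $E" unfolding elts_Eq by blast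
  have "Phi E p \<sigma> \<tau>" using E unfolding post_def by blast
  then show ?thesis by (rule Phi_mono) (use E(1) in \<open>auto simp: elts_Eq post_def\<close>)
qed

lemma Eq_coind:
  assumes d: "defb (%e. Q (e 0) (e 1) (e 2))" and Q: "Q p \<sigma> \<tau>"
    and N: "!!p \<sigma> \<tau>. Q p \<sigma> \<tau> ==> p : $P & \<sigma> : $N & \<tau> : $N"
    and step: "!!E p \<sigma> \<tau>. (!!p \<sigma> \<tau>. triple p \<sigma> \<tau> : $E \<longleftrightarrow> Q p \<sigma> \<tau>) ==> Q p \<sigma> \<tau> ==> Phi E p \<sigma> \<tau>"
  shows "triple p \<sigma> \<tau> : $(Eq N)"
proof -
  define E where "E = vset {w \<in> $(prod P (prod N N)). Q (fstp w) (fstp (sndp w)) (sndp (sndp w))}"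
  have "$E = {w \<in> $(prod P (prod N N)). Q (fstp w) (fstp (sndp w)) (sndp (sndp w))}"
    unfolding E_def by (rule elts_sep) (intro defb_subst3[OF d] dfb)
  then have E: "triple p \<sigma> \<tau> : $E \<longleftrightarrow> Q p \<sigma> \<tau>" "$E <= $(prod P (prod N N))" for p \<sigma> \<tau>
    using N by (auto simp: triple_def)
  have "post N E" unfolding post_def using E(2) step[OF E(1)] unfolding E(1) by blast
  then show ?thesis unfolding elts_Eq using Q E by blast
qed

lemma Eq_refl: assumes N: "name_closed P N" and "p : $P" "\<sigma> : $N" shows "triple p \<sigma> \<sigma> : $(Eq N)"
proof (rule Eq_coind[where Q = "%p \<sigma> \<tau>. p : $P & \<sigma> : $N & \<sigma> = \<tau>"])
  fix E p \<sigma> \<tau> assume E: "!!p \<sigma> \<tau>. triple p \<sigma> \<tau> : $E \<longleftrightarrow> p : $P & \<sigma> : $N & \<sigma> = \<tau>"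
    and a: "p : $P & \<sigma> : $N & \<sigma> = \<tau>"
  have "Rel E q \<rho> \<sigma>" if r: "pair \<rho> s : $\<sigma>" "q \<preceq> s" for \<rho> s q
  proof (rule RelI)
    fix q' assume q': "q' \<preceq> q"
    then have "q' \<preceq> q'" "q' \<preceq> s" "triple q' \<rho> \<rho> : $E"
      using le_refl le_P le_trans[OF _ r(2)] name_closedD[OF N _ r(1)] a unfolding E by blast+
    then show "\<exists>r \<rho>' s. r \<preceq> q' & pair \<rho>' s : $\<sigma> & r \<preceq> s & triple r \<rho> \<rho>' : $E" using r(1) by blast
  qed
  then show "Phi E p \<sigma> \<tau>" using a unfolding Phi_def by blast
qed (intro dfb | use assms in auto)+

lemma EqD: "triple p \<sigma> \<tau> : $(Eq N) ==> p : $P & \<sigma> : $N & \<tau> : $N"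
  unfolding elts_Eq by (simp add: triple_prod)

lemma Eq_sym: assumes "triple p \<sigma> \<tau> : $(Eq N)" shows "triple p \<tau> \<sigma> : $(Eq N)"
proof (rule Eq_coind[where Q = "%p \<sigma> \<tau>. triple p \<sigma> \<tau> : $(Eq N) \<or> triple p \<tau> \<sigma> : $(Eq N)"])
  fix E p \<sigma> \<tau> assume E: "!!p \<sigma> \<tau>. triple p \<sigma> \<tau> : $E \<longleftrightarrow> triple p \<sigma> \<tau> : $(Eq N) \<or> triple p \<tau> \<sigma> : $(Eq N)"
    and a: "triple p \<sigma> \<tau> : $(Eq N) \<or> triple p \<tau> \<sigma> : $(Eq N)"
  have "Phi (Eq N) p \<sigma> \<tau>" using a Eq_Phi[of p \<sigma> \<tau> N] Eq_Phi[of p \<tau> \<sigma> N] unfolding Phi_def by blast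
  then show "Phi E p \<sigma> \<tau>" by (rule Phi_mono) (simp add: E)
next
  show "defb (%e. triple (e 0) (e 1) (e 2) : $(Eq N) \<or> triple (e 0) (e 2) (e 1) : $(Eq N))" by (intro dfb)
qed (use assms EqD in blast)+

lemma Eq_down: assumes "triple p \<sigma> \<tau> : $(Eq N)" "q \<preceq> p" shows "triple q \<sigma> \<tau> : $(Eq N)"
proof (rule Eq_coind[where Q = "%q \<sigma> \<tau>. q : $P & (\<exists>p. q \<preceq> p & triple p \<sigma> \<tau> : $(Eq N))"])
  fix E q \<sigma> \<tau> assume E: "!!q \<sigma> \<tau>. triple q \<sigma> \<tau> : $E \<longleftrightarrow> q : $P & (\<exists>p. q \<preceq> p & triple p \<sigma> \<tau> : $(Eq N))"
    and "q : $P & (\<exists>p. q \<preceq> p & triple p \<sigma> \<tau> : $(Eq N))"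
  then obtain p where p: "q \<preceq> p" "triple p \<sigma> \<tau> : $(Eq N)" by blast
  have "Phi (Eq N) q \<sigma> \<tau>" using Eq_Phi[OF p(2)] le_trans[OF _ p(1)] unfolding Phi_def by blast
  then show "Phi E q \<sigma> \<tau>" by (rule Phi_mono) (use E EqD le_refl in blast)
next
  show "defb (%e. e 0 : $P & (\<exists>p. e 0 \<preceq> p & triple p (e 1) (e 2) : $(Eq N)))" by (intro dfb)
qed (use assms EqD le_P in blast)+

text \<open>The composition of \<open>Eq N\<close> with itself is consistent: a witness in the
  middle name is first found below \<open>q'\<close> and then extended to a witness in the last
  name.\<close>

lemma Eq_trans:
  assumes N: "name_closed P N" and "triple p \<sigma> \<tau> : $(Eq N)" "triple p \<tau> \<upsilon> : $(Eq N)"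
  shows "triple p \<sigma> \<upsilon> : $(Eq N)"
proof (rule Eq_coind[where Q = "%p \<sigma> \<tau>. \<exists>\<upsilon>. triple p \<sigma> \<upsilon> : $(Eq N) & triple p \<upsilon> \<tau> : $(Eq N)"])
  fix E p \<sigma> \<tau> assume E: "!!p \<sigma> \<tau>. triple p \<sigma> \<tau> : $E \<longleftrightarrow> (\<exists>\<upsilon>. triple p \<sigma> \<upsilon> : $(Eq N) & triple p \<upsilon> \<tau> : $(Eq N))"
    and "\<exists>\<upsilon>. triple p \<sigma> \<upsilon> : $(Eq N) & triple p \<upsilon> \<tau> : $(Eq N)"
  then obtain \<upsilon> where u: "triple p \<sigma> \<upsilon> : $(Eq N)" "triple p \<upsilon> \<tau> : $(Eq N)" by blast
  have half: "Rel E q \<rho> \<tau>'"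
    if h: "triple p \<sigma>' \<upsilon> : $(Eq N)" "triple p \<upsilon> \<tau>' : $(Eq N)" "pair \<rho> s : $\<sigma>'" "q \<preceq> p" "q \<preceq> s" for \<sigma>' \<tau>' \<rho> s q
  proof (rule RelI)
    fix q' assume q': "q' \<preceq> q"
    have "Rel (Eq N) q \<rho> \<upsilon>" using Eq_Phi[OF h(1)] h(3-5) unfolding Phi_def by blast
    from RelD[OF this q'] obtain r \<rho>' s' where r: "r \<preceq> q'" "pair \<rho>' s' : $\<upsilon>" "r \<preceq> s'" "triple r \<rho> \<rho>' : $(Eq N)" by blast
    have rp: "r \<preceq> p" using le_trans[OF le_trans[OF r(1) q'] h(4)] .
    have "Rel (Eq N) r \<rho>' \<tau>'" using Eq_Phi[OF h(2)] r(2,3) rp unfolding Phi_def by blast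
    from RelD[OF this le_refl] le_P[OF r(1)] obtain t \<rho>'' s'' where t: "t \<preceq> r" "pair \<rho>'' s'' : $\<tau>'" "t \<preceq> s''" "triple t \<rho>' \<rho>'' : $(Eq N)" by blast
    have "triple t \<rho> \<rho>'' : $E" unfolding E using Eq_down[OF r(4) t(1)] t(4) by blast
    then show "\<exists>r \<rho>' s. r \<preceq> q' & pair \<rho>' s : $\<tau>' & r \<preceq> s & triple r \<rho> \<rho>' : $E" using t(2,3) le_trans[OF t(1) r(1)] by blast
  qed
  show "Phi E p \<sigma> \<tau>" unfolding Phi_def using half[OF u] half[OF Eq_sym[OF u(2)] Eq_sym[OF u(1)]] by blast
next
  show "defb (%e. \<exists>\<upsilon>. triple (e 0) (e 1) \<upsilon> : $(Eq N) & triple (e 0) \<upsilon> (e 2) : $(Eq N))" by (intro dfb)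
qed (use assms EqD in blast)+

lemma Rel_left:
  assumes "name_closed P N" "triple p \<sigma> \<sigma>' : $(Eq N)" "Rel (Eq N) p \<sigma> \<tau>" shows "Rel (Eq N) p \<sigma>' \<tau>"
proof (rule RelI)
  fix q assume q: "q \<preceq> p"
  obtain r \<rho>' s where r: "r \<preceq> q" "pair \<rho>' s : $\<tau>" "r \<preceq> s" "triple r \<sigma> \<rho>' : $(Eq N)" using RelD[OF assms(3) q] by blast
  have "triple r \<sigma>' \<rho>' : $(Eq N)" by (rule Eq_trans[OF assms(1) Eq_sym[OF Eq_down[OF assms(2) le_trans[OF r(1) q]]] r(4)])
  then show "\<exists>r \<rho>' s. r \<preceq> q & pair \<rho>' s : $\<tau> & r \<preceq> s & triple r \<sigma>' \<rho>' : $(Eq N)" using r by blast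
qed
lemma Rel_right:
  assumes N: "name_closed P N" and e: "triple p \<tau> \<tau>' : $(Eq N)" and "Rel (Eq N) p \<sigma> \<tau>" shows "Rel (Eq N) p \<sigma> \<tau>'"
proof (rule RelI)
  fix q assume q: "q \<preceq> p"
  obtain r \<rho>' s where r: "r \<preceq> q" "pair \<rho>' s : $\<tau>" "r \<preceq> s" "triple r \<sigma> \<rho>' : $(Eq N)" using RelD[OF assms(3) q] by blast
  have "Rel (Eq N) r \<rho>' \<tau>'" using Eq_Phi[OF e] r(2,3) le_trans[OF r(1) q] unfolding Phi_def by blast
  from Rel_left[OF N Eq_sym[OF r(4)] this] have "Rel (Eq N) r \<sigma> \<tau>'" .
  from RelD[OF this le_refl] le_P[OF r(1)] obtain t \<rho>'' s'' where t: "t \<preceq> r" "pair \<rho>'' s'' : $\<tau>'" "t \<preceq> s''" "triple t \<sigma> \<rho>'' : $(Eq N)" by blast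
  then show "\<exists>r \<rho>' s. r \<preceq> q & pair \<rho>' s : $\<tau>' & r \<preceq> s & triple r \<sigma> \<rho>' : $(Eq N)" using le_trans[OF t(1) r(1)] by blast
qed
lemma Rel_member:
  assumes N: "name_closed P N" and "\<tau> : $N" "pair \<rho> s : $\<tau>" "p \<preceq> s" shows "Rel (Eq N) p \<rho> \<tau>"
proof (rule RelI)
  fix q assume q: "q \<preceq> p"
  then have "q \<preceq> q" "q \<preceq> s" "triple q \<rho> \<rho> : $(Eq N)"
    using le_refl le_P[OF q] le_trans[OF q assms(4)] Eq_refl[OF N _ conjunct1[OF name_closedD[OF N assms(2,3)]]] by blast+
  then show "\<exists>r \<rho>' s. r \<preceq> q & pair \<rho>' s : $\<tau> & r \<preceq> s & triple r \<rho> \<rho>' : $(Eq N)" using assms(3) by blast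
qed

text \<open>The greatest consistent relation is a fixed point, since adding one triple that
  satisfies the clause keeps it consistent.\<close>

lemma Phi_Eq:
  assumes N: "name_closed P N" and x: "p : $P" "\<sigma> : $N" "\<tau> : $N" and f: "Phi (Eq N) p \<sigma> \<tau>"
  shows "triple p \<sigma> \<tau> : $(Eq N)"
proof (rule Eq_coind[where Q = "%p' \<sigma>' \<tau>'. triple p' \<sigma>' \<tau>' : $(Eq N) \<or> p' = p & \<sigma>' = \<sigma> & \<tau>' = \<tau>"])
  fix E p' \<sigma>' \<tau>' assume E: "!!p' \<sigma>' \<tau>'. triple p' \<sigma>' \<tau>' : $E \<longleftrightarrow> triple p' \<sigma>' \<tau>' : $(Eq N) \<or> p' = p & \<sigma>' = \<sigma> & \<tau>' = \<tau>"
    and a: "triple p' \<sigma>' \<tau>' : $(Eq N) \<or> p' = p & \<sigma>' = \<sigma> & \<tau>' = \<tau>"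
  have "Phi (Eq N) p' \<sigma>' \<tau>'" using a f Eq_Phi by blast
  then show "Phi E p' \<sigma>' \<tau>'" by (rule Phi_mono) (simp add: E)
next
  show "defb (%e. triple (e 0) (e 1) (e 2) : $(Eq N) \<or> e 0 = p & e 1 = \<sigma> & e 2 = \<tau>)" by (intro dfb)
qed (use x EqD in blast)+

definition Mm :: "'v \<Rightarrow> 'v" where
  "Mm N = vset {w \<in> $(prod P (prod N N)). Rel (Eq N) (fstp w) (fstp (sndp w)) (sndp (sndp w))}"
lemma triple_Mm: "triple p \<sigma> \<tau> : $(Mm N) \<longleftrightarrow> p : $P & \<sigma> : $N & \<tau> : $N & Rel (Eq N) p \<sigma> \<tau>"
proof -
  have "$(Mm N) = {w \<in> $(prod P (prod N N)). Rel (Eq N) (fstp w) (fstp (sndp w)) (sndp (sndp w))}"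
    unfolding Mm_def by (rule elts_sep) (unfold Rel_def, intro dfb)
  then show ?thesis by (simp add: triple_def)
qed

lemma forcing_table_iff:
  "forcing_table P le N E R \<longleftrightarrow> (\<forall>p\<in>$P. \<forall>\<sigma>\<in>$N. \<forall>\<tau>\<in>$N.
     (triple p \<sigma> \<tau> : $E \<longleftrightarrow> (\<forall>\<rho> s q. (pair \<rho> s : $\<sigma> \<or> pair \<rho> s : $\<tau>) & q \<preceq> p --> (triple q \<rho> \<sigma> : $R \<longleftrightarrow> triple q \<rho> \<tau> : $R))) &
     (triple p \<sigma> \<tau> : $R \<longleftrightarrow> Rel E p \<sigma> \<tau>))"
proof -
  have 1: "(\<forall>\<rho>\<in>dom \<sigma> \<union> dom \<tau>. \<forall>q\<in>below P le p. Q q \<rho>) \<longleftrightarrow> (\<forall>\<rho> s q. (pair \<rho> s : $\<sigma> \<or> pair \<rho> s : $\<tau>) & q \<preceq> p --> Q q \<rho>)" for \<sigma> \<tau> p Q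
    unfolding dom_def Ball_def below_iff by blast
  have 2: "(\<forall>q\<in>below P le p. \<exists>r\<in>below P le q. \<exists>\<rho> s. pair \<rho> s : $\<tau> & pair r s : $le & triple r \<sigma> \<rho> : $E) \<longleftrightarrow> Rel E p \<sigma> \<tau>" for p \<sigma> \<tau>
    unfolding Rel_def Ball_def Bex_def below_iff by blast
  show ?thesis unfolding forcing_table_def 1 2 ..
qed

text \<open>\<open>forcing_table\<close> compares two names by their forced members,
  \<open>Phi\<close> by mutual containment. Congruence of \<open>Rel\<close> gives one direction;
  for the other, \<open>Rel_member\<close> says that a member of a name is forced to belong to
  it.\<close>

lemma table_exists: assumes N: "name_closed P N" shows "forcing_table P le N (Eq N) (Mm N)"
  unfolding forcing_table_iff
proof (rule ballI, rule ballI, rule ballI, rule conjI[rotated])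
  fix p \<sigma> \<tau> assume p: "p : $P" "\<sigma> : $N" "\<tau> : $N"
  show "triple p \<sigma> \<tau> : $(Mm N) \<longleftrightarrow> Rel (Eq N) p \<sigma> \<tau>" using p by (simp add: triple_Mm)
  show "triple p \<sigma> \<tau> : $(Eq N) \<longleftrightarrow> (\<forall>\<rho> s q. (pair \<rho> s : $\<sigma> \<or> pair \<rho> s : $\<tau>) & q \<preceq> p --> (triple q \<rho> \<sigma> : $(Mm N) \<longleftrightarrow> triple q \<rho> \<tau> : $(Mm N)))"
  proof (rule iffI, intro allI impI)
    fix \<rho> s q assume e: "triple p \<sigma> \<tau> : $(Eq N)" and q: "(pair \<rho> s : $\<sigma> \<or> pair \<rho> s : $\<tau>) & q \<preceq> p"
    have e': "triple q \<sigma> \<tau> : $(Eq N)" by (rule Eq_down[OF e]) (use q in blast)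
    show "triple q \<rho> \<sigma> : $(Mm N) \<longleftrightarrow> triple q \<rho> \<tau> : $(Mm N)"
      unfolding triple_Mm using Rel_right[OF N e'] Rel_right[OF N Eq_sym[OF e']] p by blast
  next
    assume r: "\<forall>\<rho> s q. (pair \<rho> s : $\<sigma> \<or> pair \<rho> s : $\<tau>) & q \<preceq> p --> (triple q \<rho> \<sigma> : $(Mm N) \<longleftrightarrow> triple q \<rho> \<tau> : $(Mm N))"
    have "Phi (Eq N) p \<sigma> \<tau>"
      unfolding Phi_def
    proof (intro conjI allI impI)
      fix \<rho> s q assume q: "pair \<rho> s : $\<sigma> & q \<preceq> p & q \<preceq> s"
      then have "triple q \<rho> \<sigma> : $(Mm N)" 
        unfolding triple_Mm using Rel_member[OF N p(2)] name_closedD[OF N p(2)] le_P p(2) by blast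
      then have "triple q \<rho> \<tau> : $(Mm N)" using r q by blast
      then show "Rel (Eq N) q \<rho> \<tau>" unfolding triple_Mm by blast
    next
      fix \<rho> s q assume q: "pair \<rho> s : $\<tau> & q \<preceq> p & q \<preceq> s"
      then have "triple q \<rho> \<tau> : $(Mm N)" 
        unfolding triple_Mm using Rel_member[OF N p(3)] name_closedD[OF N p(3)] le_P p(3) by blast
      then have "triple q \<rho> \<sigma> : $(Mm N)" using r q by blast
      then show "Rel (Eq N) q \<rho> \<sigma>" unfolding triple_Mm by blast
    qed
    then show "triple p \<sigma> \<tau> : $(Eq N)" by (rule Phi_Eq[OF N p])
  qed
qed

text \<open>Induction on a bound for the ranks of both names. Membership of \<open>\<rho>\<close> in
  \<open>\<tau>\<close> refers to equality of \<open>\<rho>\<close> with members of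
  \<open>\<tau>\<close>, whose ranks are smaller than that of \<open>\<tau>\<close>; hence the
  asymmetric rank conditions in the claim \<open>R\<close>.\<close>

lemma table_unique:
  assumes N: "name_closed P N" and N': "name_closed P N'" and t: "forcing_table P le N E R" and t': "forcing_table P le N' E' R'"
    and p: "p : $P" and s: "\<sigma> : $N" "\<sigma> : $N'" "\<tau> : $N" "\<tau> : $N'"
  shows "triple p \<sigma> \<tau> : $E \<longleftrightarrow> triple p \<sigma> \<tau> : $E'" "triple p \<sigma> \<tau> : $R \<longleftrightarrow> triple p \<sigma> \<tau> : $R'"
proof -
  let ?C = "%a. \<forall>p\<in>$P. \<forall>\<sigma>\<in>$N. \<forall>\<tau>\<in>$N. \<sigma> : $N' & \<tau> : $N' & rank \<sigma> : $a & rank \<tau> : $a -->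
     (triple p \<sigma> \<tau> : $E \<longleftrightarrow> triple p \<sigma> \<tau> : $E')"
  have R: "triple p \<rho> \<tau> : $R \<longleftrightarrow> triple p \<rho> \<tau> : $R'"
    if c: "?C a" and a: "rank \<rho> : $a" "$(rank \<tau>) <= $a" and x: "p : $P" "\<rho> : $N" "\<rho> : $N'" "\<tau> : $N" "\<tau> : $N'" for a p \<rho> \<tau>
  proof -
    have "triple q \<rho> \<rho>' : $E \<longleftrightarrow> triple q \<rho> \<rho>' : $E'" if q: "q : $P" "pair \<rho>' s : $\<tau>" for q \<rho>' s
      using c q(1) name_closedD[OF N x(4) q(2)] name_closedD[OF N' x(5) q(2)] rank_pair[OF q(2)] a x by blast
    then have "Rel E p \<rho> \<tau> \<longleftrightarrow> Rel E' p \<rho> \<tau>" unfolding Rel_def using le_P by meson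
    then show ?thesis using t t' x unfolding forcing_table_iff by blast
  qed
  have C: "?C a" if "Ord a" for a
    using that
  proof (induction rule: Ord_induct)
    case def show ?case by (intro dfb)
  next
    case (less a)
    show ?case
    proof (intro ballI impI)
      fix p \<sigma> \<tau> assume p: "p : $P" and s: "\<sigma> : $N" and u: "\<tau> : $N"
        and h: "\<sigma> : $N' & \<tau> : $N' & rank \<sigma> : $a & rank \<tau> : $a"
      define m where "m = vset ($(rank \<sigma>) \<union> $(rank \<tau>))"
      have m: "$m = $(rank \<sigma>) \<union> $(rank \<tau>)" unfolding m_def by (rule elts_Un)
      have "m : $a" using Un_Ord[OF Ord_rank Ord_rank, of \<sigma> \<tau>] h unfolding m_def by metis
      then have c: "?C m" by (rule less(2))
      have "(triple q \<rho> \<sigma> : $R \<longleftrightarrow> triple q \<rho> \<sigma> : $R') & (triple q \<rho> \<tau> : $R \<longleftrightarrow> triple q \<rho> \<tau> : $R')"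
        if q: "q \<preceq> p" "pair \<rho> s' : $\<sigma> \<or> pair \<rho> s' : $\<tau>" for q \<rho> s'
      proof -
        have "rank \<rho> : $m" using q(2) rank_pair m by blast
        moreover have "\<rho> : $N" "\<rho> : $N'" using q(2) name_closedD[OF N s] name_closedD[OF N u] name_closedD[OF N'] h by blast+
        ultimately show ?thesis using R[OF c] m le_P[OF q(1)] s u h by blast
      qed
      then show "triple p \<sigma> \<tau> : $E \<longleftrightarrow> triple p \<sigma> \<tau> : $E'"
        using bspec[OF bspec[OF bspec[OF t[unfolded forcing_table_iff] p] s] u, THEN conjunct1] 
          bspec[OF bspec[OF bspec[OF t'[unfolded forcing_table_iff] p] conjunct1[OF h]] conjunct1[OF conjunct2[OF h]], THEN conjunct1] by blast
    qed
  qed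
  define a where "a = vset ($(succ (rank \<sigma>)) \<union> $(succ (rank \<tau>)))"
  have a: "$a = $(succ (rank \<sigma>)) \<union> $(succ (rank \<tau>))" unfolding a_def by (rule elts_Un)
  have "Ord a" using Un_Ord[OF Ord_succ[OF Ord_rank] Ord_succ[OF Ord_rank], of \<sigma> \<tau>] Ord_succ[OF Ord_rank] unfolding a_def by metis
  note c = C[OF this]
  show "triple p \<sigma> \<tau> : $E \<longleftrightarrow> triple p \<sigma> \<tau> : $E'" using c p s a by auto
  show "triple p \<sigma> \<tau> : $R \<longleftrightarrow> triple p \<sigma> \<tau> : $R'" by (rule R[OF c]) (use p s a in auto)
qed

subsection \<open>The forcing relation\<close>

abbreviation EQ where "EQ \<equiv> forces_eql P le"
abbreviation ME where "ME \<equiv> forces_mem P le"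
abbreviation nm where "nm \<tau> \<equiv> is_name P \<tau>"

lemma EQ_iff: assumes N: "name_closed P N" and x: "\<sigma> : $N" "\<tau> : $N" "p : $P" shows "EQ p \<sigma> \<tau> \<longleftrightarrow> triple p \<sigma> \<tau> : $(Eq N)"
  unfolding forces_eql_def using table_unique(1)[OF _ N _ table_exists[OF N] x(3) _ x(1) _ x(2)] table_exists[OF N] N x by blast
lemma ME_iff: assumes N: "name_closed P N" and x: "\<sigma> : $N" "\<tau> : $N" "p : $P" shows "ME p \<sigma> \<tau> \<longleftrightarrow> Rel (Eq N) p \<sigma> \<tau>"
proof -
  have "ME p \<sigma> \<tau> \<longleftrightarrow> triple p \<sigma> \<tau> : $(Mm N)"
    unfolding forces_mem_def using table_unique(2)[OF _ N _ table_exists[OF N] x(3) _ x(1) _ x(2)] table_exists[OF N] N x by blast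
  then show ?thesis using x triple_Mm by blast
qed

lemma name_closed_Un: "name_closed P N ==> name_closed P N' ==> name_closed P (vset ($N \<union> $N'))"
  unfolding name_closed_def elts_Un by blast
lemma names3: assumes "nm \<sigma>" "nm \<tau>" "nm \<upsilon>" shows "\<exists>N. name_closed P N & \<sigma> : $N & \<tau> : $N & \<upsilon> : $N"
proof -
  obtain A B C where a: "name_closed P A" "\<sigma> : $A" "name_closed P B" "\<tau> : $B" "name_closed P C" "\<upsilon> : $C"
    using assms unfolding is_name_def by blast
  show ?thesis using name_closed_Un[OF a(1) name_closed_Un[OF a(3,5)]] a by (intro exI[of _ "vset ($A \<union> $(vset ($B \<union> $C)))"]) simp
qed
lemma nm_dom: "nm \<tau> ==> pair \<rho> s : $\<tau> ==> nm \<rho> & s : $P"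
  unfolding is_name_def using name_closedD by blast

lemma EQ_refl: "nm \<sigma> ==> p : $P ==> EQ p \<sigma> \<sigma>"
  using names3[of \<sigma> \<sigma> \<sigma>] EQ_iff Eq_refl by blast
lemma EQ_sym: "EQ p \<sigma> \<tau> ==> nm \<sigma> ==> nm \<tau> ==> p : $P ==> EQ p \<tau> \<sigma>"
  using names3[of \<sigma> \<tau> \<tau>] EQ_iff Eq_sym by blast
lemma EQ_trans: "EQ p \<sigma> \<tau> ==> EQ p \<tau> \<upsilon> ==> nm \<sigma> ==> nm \<tau> ==> nm \<upsilon> ==> p : $P ==> EQ p \<sigma> \<upsilon>"
  using names3[of \<sigma> \<tau> \<upsilon>] EQ_iff Eq_trans by blast
lemma EQ_down: "EQ p \<sigma> \<tau> ==> q \<preceq> p ==> nm \<sigma> ==> nm \<tau> ==> EQ q \<sigma> \<tau>"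
  using names3[of \<sigma> \<tau> \<tau>] EQ_iff Eq_down le_P by blast
lemma ME_char: assumes "nm \<sigma>" "nm \<tau>" "p : $P"
  shows "ME p \<sigma> \<tau> \<longleftrightarrow> (\<forall>q. q \<preceq> p --> (\<exists>r \<rho> s. r \<preceq> q & pair \<rho> s : $\<tau> & r \<preceq> s & EQ r \<sigma> \<rho>))"
proof -
  obtain N where N: "name_closed P N" "\<sigma> : $N" "\<tau> : $N" using names3[of \<sigma> \<tau> \<tau>] assms by blast
  have "EQ r \<sigma> \<rho> \<longleftrightarrow> triple r \<sigma> \<rho> : $(Eq N)" if "pair \<rho> s : $\<tau>" "r \<preceq> s" for r \<rho> s
    by (rule EQ_iff[OF N(1,2)]) (use that N name_closedD le_P in blast)+
  then show ?thesis unfolding ME_iff[OF N assms(3)] Rel_def by blast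
qed
lemma ME_left: "EQ p \<sigma> \<sigma>' ==> ME p \<sigma> \<tau> ==> nm \<sigma> ==> nm \<sigma>' ==> nm \<tau> ==> p : $P ==> ME p \<sigma>' \<tau>"
proof -
  assume a: "EQ p \<sigma> \<sigma>'" "ME p \<sigma> \<tau>" "nm \<sigma>" "nm \<sigma>'" "nm \<tau>" and p: "p : $P"
  obtain N where N: "name_closed P N" "\<sigma> : $N" "\<sigma>' : $N" "\<tau> : $N" using names3 a by blast
  show ?thesis using Rel_left[OF N(1)] a(1,2) unfolding EQ_iff[OF N(1-3) p] ME_iff[OF N(1,2,4) p] ME_iff[OF N(1,3,4) p] by blast
qed
lemma ME_right: "EQ p \<tau> \<tau>' ==> ME p \<sigma> \<tau> ==> nm \<tau> ==> nm \<tau>' ==> nm \<sigma> ==> p : $P ==> ME p \<sigma> \<tau>'"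
proof -
  assume a: "EQ p \<tau> \<tau>'" "ME p \<sigma> \<tau>" "nm \<tau>" "nm \<tau>'" "nm \<sigma>" and p: "p : $P"
  obtain N where N: "name_closed P N" "\<tau> : $N" "\<tau>' : $N" "\<sigma> : $N" using names3 a by blast
  show ?thesis using Rel_right[OF N(1)] a(1,2) unfolding EQ_iff[OF N(1-3) p] ME_iff[OF N(1,4,2) p] ME_iff[OF N(1,4,3) p] by blast
qed
lemma ME_down: "ME p \<sigma> \<tau> ==> q \<preceq> p ==> nm \<sigma> ==> nm \<tau> ==> ME q \<sigma> \<tau>"
  using names3[of \<sigma> \<tau> \<tau>] ME_iff Rel_down le_P by blast
lemma ME_I: "nm \<tau> ==> pair \<rho> s : $\<tau> ==> p \<preceq> s ==> ME p \<rho> \<tau>"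
  using names3[of \<tau> \<tau> \<tau>] ME_iff Rel_member le_P name_closedD by blast
lemma ME_dense: 
  assumes d: "!!q. q \<preceq> p ==> \<exists>r. r \<preceq> q & ME r \<sigma> \<tau>" and n: "nm \<sigma>" "nm \<tau>" "p : $P" shows "ME p \<sigma> \<tau>"
  unfolding ME_char[OF n]
proof (intro allI impI)
  fix q assume "q \<preceq> p"
  then obtain r where r: "r \<preceq> q" "ME r \<sigma> \<tau>" using d by blast
  then obtain t \<rho> s where "t \<preceq> r" "pair \<rho> s : $\<tau>" "t \<preceq> s" "EQ t \<sigma> \<rho>" using ME_char[OF n(1,2)] le_P le_refl by meson
  then show "\<exists>r \<rho> s. r \<preceq> q & pair \<rho> s : $\<tau> & r \<preceq> s & EQ r \<sigma> \<rho>" using le_trans[OF _ r(1)] by blast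
qed
lemma EQ_I: 
  assumes n: "nm \<sigma>" "nm \<tau>" "p : $P" and l: "!!\<rho> s q. pair \<rho> s : $\<sigma> ==> q \<preceq> p ==> q \<preceq> s ==> ME q \<rho> \<tau>"
    and r: "!!\<rho> s q. pair \<rho> s : $\<tau> ==> q \<preceq> p ==> q \<preceq> s ==> ME q \<rho> \<sigma>"
  shows "EQ p \<sigma> \<tau>"
proof -
  obtain N where N: "name_closed P N" "\<sigma> : $N" "\<tau> : $N" using names3[of \<sigma> \<tau> \<tau>] n by blast
  have "Phi (Eq N) p \<sigma> \<tau>" unfolding Phi_def
  proof (intro conjI allI impI)
    fix \<rho> s q assume a: "pair \<rho> s : $\<sigma> & q \<preceq> p & q \<preceq> s"
    then have "\<rho> : $N" "q : $P" using name_closedD[OF N(1,2)] le_P by blast+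
    then show "Rel (Eq N) q \<rho> \<tau>" using ME_iff[OF N(1) _ N(3)] l a by blast
  next
    fix \<rho> s q assume a: "pair \<rho> s : $\<tau> & q \<preceq> p & q \<preceq> s"
    then have "\<rho> : $N" "q : $P" using name_closedD[OF N(1,3)] le_P by blast+
    then show "Rel (Eq N) q \<rho> \<sigma>" using ME_iff[OF N(1) _ N(2)] r a by blast
  qed
  then show ?thesis using Phi_Eq[OF N(1) n(3) N(2,3)] EQ_iff[OF N n(3)] by blast
qed
lemma EQ_ext: assumes n: "nm \<sigma>" "nm \<tau>" "p : $P"
  shows "EQ p \<sigma> \<tau> \<longleftrightarrow> (\<forall>\<rho>. nm \<rho> --> (\<forall>q. q \<preceq> p --> (ME q \<rho> \<sigma> \<longleftrightarrow> ME q \<rho> \<tau>)))"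
proof (intro iffI allI impI)
  fix \<rho> q assume e: "EQ p \<sigma> \<tau>" and r: "nm \<rho>" and q: "q \<preceq> p"
  have e': "EQ q \<sigma> \<tau>" by (rule EQ_down[OF e q n(1,2)])
  have qP: "q : $P" using le_P[OF q] ..
  show "ME q \<rho> \<tau>" if "ME q \<rho> \<sigma>" by (rule ME_right[OF e' that n(1,2) r qP])
  show "ME q \<rho> \<sigma>" if "ME q \<rho> \<tau>" by (rule ME_right[OF EQ_sym[OF e' n(1,2) qP] that n(2,1) r qP])
next
  assume a: "\<forall>\<rho>. nm \<rho> --> (\<forall>q. q \<preceq> p --> (ME q \<rho> \<sigma> \<longleftrightarrow> ME q \<rho> \<tau>))"
  show "EQ p \<sigma> \<tau>" by (rule EQ_I[OF n]) (use a ME_I n nm_dom in blast)+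
qed
lemma EQ_dense: 
  assumes d: "!!q. q \<preceq> p ==> \<exists>r. r \<preceq> q & EQ r \<sigma> \<tau>" and n: "nm \<sigma>" "nm \<tau>" "p : $P" shows "EQ p \<sigma> \<tau>"
proof (rule EQ_I[OF n])
  fix \<rho> s q assume r: "pair \<rho> s : $\<sigma>" "q \<preceq> p" "q \<preceq> s"
  show "ME q \<rho> \<tau>"
  proof (rule ME_dense)
    fix q' assume q': "q' \<preceq> q"
    obtain t where t: "t \<preceq> q'" "EQ t \<sigma> \<tau>" using d[OF le_trans[OF q' r(2)]] by blast
    have "ME t \<rho> \<sigma>" by (rule ME_I[OF n(1) r(1)]) (rule le_trans[OF le_trans[OF t(1) q'] r(3)])
    then have "ME t \<rho> \<tau>" by (rule ME_right[OF t(2)]) (use n nm_dom r(1) le_P[OF t(1)] in auto)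
    then show "\<exists>r. r \<preceq> q' & ME r \<rho> \<tau>" using t(1) by blast
  qed (use n nm_dom r(1) le_P[OF r(2)] in auto)
next
  fix \<rho> s q assume r: "pair \<rho> s : $\<tau>" "q \<preceq> p" "q \<preceq> s"
  show "ME q \<rho> \<sigma>"
  proof (rule ME_dense)
    fix q' assume q': "q' \<preceq> q"
    obtain t where t: "t \<preceq> q'" "EQ t \<sigma> \<tau>" using d[OF le_trans[OF q' r(2)]] by blast
    have "ME t \<rho> \<tau>" by (rule ME_I[OF n(2) r(1)]) (rule le_trans[OF le_trans[OF t(1) q'] r(3)])
    then have "ME t \<rho> \<sigma>" using EQ_sym[OF t(2)] le_P[OF t(1)] ME_right n nm_dom[OF n(2) r(1)] by blast
    then show "\<exists>r. r \<preceq> q' & ME r \<rho> \<sigma>" using t(1) by blast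
  qed (use n nm_dom r(1) le_P[OF r(2)] in auto)
qed

abbreviation fo where "fo \<equiv> forces P le"

lemma nm_upd: "(!!n. nm (e n)) ==> nm \<tau> ==> nm ((e(k := \<tau>)) n)"
  by simp

lemma fo_Neg: "fo p (Neg \<phi>) e \<longleftrightarrow> (\<forall>q. q \<preceq> p --> \<not> fo q \<phi> e)"
  by (simp add: Ball_def below_iff)
lemma fo_down: "(!!n. nm (e n)) ==> fo p \<phi> e ==> q \<preceq> p ==> fo q \<phi> e"
proof (induction \<phi> arbitrary: e p q)
  case (Neg \<phi>) then show ?case unfolding fo_Neg using le_trans by blast
qed (auto intro: ME_down EQ_down simp: nm_upd)
text \<open>What is forced densely below a condition is forced by it. The atomic cases carry the
  content; this replaces reasoning about generic filters.\<close>

lemma fo_dense: 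
  assumes "!!n. nm (e n)" "!!q. q \<preceq> p ==> \<exists>r. r \<preceq> q & fo r \<phi> e" "p : $P" shows "fo p \<phi> e"
  using assms
proof (induction \<phi> arbitrary: e p)
  case (Mem i j) then show ?case using ME_dense by simp
next
  case (Eql i j) then show ?case using EQ_dense by simp
next
  case (Neg \<phi>)
  show ?case unfolding fo_Neg
  proof (intro allI impI notI)
    fix q assume q: "q \<preceq> p" "fo q \<phi> e"
    obtain r where r: "r \<preceq> q" "fo r (Neg \<phi>) e" using Neg.prems(2)[OF q(1)] by blast
    have "fo r \<phi> e" by (rule fo_down[OF Neg.prems(1) q(2) r(1)])
    then show False using r(2) le_refl le_P[OF r(1)] unfolding fo_Neg by blast
  qed
next
  case (Conj \<phi> \<psi>)
  have "fo p \<phi> e" by (rule Conj.IH(1)[OF Conj.prems(1) _ Conj.prems(3)]) (use Conj.prems(2) in auto)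
  moreover have "fo p \<psi> e" by (rule Conj.IH(2)[OF Conj.prems(1) _ Conj.prems(3)]) (use Conj.prems(2) in auto)
  ultimately show ?case by simp
next
  case (All n \<phi>)
  have "fo p \<phi> (e(n := \<tau>))" if "nm \<tau>" for \<tau>
  proof (rule All.IH[OF nm_upd[OF All.prems(1) that] _ All.prems(3)])
    fix q assume "q \<preceq> p"
    from All.prems(2)[OF this] show "\<exists>r. r \<preceq> q & fo r \<phi> (e(n := \<tau>))" using that by auto
  qed
  then show ?case by simp
qed
lemma fo_cong:
  assumes "!!n. nm (e n)" "!!n. nm (e' n)" "!!n. EQ p (e n) (e' n)" "p : $P" "fo p \<phi> e" shows "fo p \<phi> e'"
  using assms
proof (induction \<phi> arbitrary: p e e')
  case (Mem i j)
  have "ME p (e i) (e j)" using Mem by simp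
  then have "ME p (e' i) (e j)" using ME_left Mem by blast
  then have "ME p (e' i) (e' j)" using ME_right Mem by blast
  then show ?case by simp
next
  case (Eql i j)
  have "EQ p (e' i) (e i)" "EQ p (e i) (e j)" "EQ p (e j) (e' j)" using Eql EQ_sym by simp_all
  then have "EQ p (e' i) (e' j)" using EQ_trans Eql(1,2,4) by blast
  then show ?case by simp
next
  case (Neg \<phi>)
  show ?case unfolding fo_Neg
  proof (intro allI impI notI)
    fix q assume q: "q \<preceq> p" "fo q \<phi> e'"
    have "fo q \<phi> e"
    proof (rule Neg.IH[OF Neg.prems(2,1) _ _ q(2)])
      show "q : $P" using le_P[OF q(1)] ..
      then show "EQ q (e' n) (e n)" for n using EQ_sym[OF EQ_down[OF Neg.prems(3) q(1)]] Neg.prems by blast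
    qed
    then show False using Neg.prems(5) q(1) unfolding fo_Neg by blast
  qed
next
  case (Conj \<phi> \<psi>)
  then show ?case by (metis forces.simps(4))
next
  case (All n \<phi>)
  have "fo p \<phi> (e'(n := \<tau>))" if "nm \<tau>" for \<tau>
  proof (rule All.IH[OF nm_upd[OF All.prems(1) that] nm_upd[OF All.prems(2) that] _ All.prems(4)])
    show "EQ p ((e(n := \<tau>)) k) ((e'(n := \<tau>)) k)" for k using All.prems(3) EQ_refl[OF that All.prems(4)] by simp
    show "fo p \<phi> (e(n := \<tau>))" using All.prems(5) that unfolding forces.simps(5) by blast
  qed
  then show ?case by simp
qed

text \<open>Implication is coded by negations, so a density argument is needed to remove the
  resulting double negation.\<close>

lemma fo_Imp: assumes e: "!!n. nm (e n)" shows "fo p (Imp a b) e \<longleftrightarrow> (\<forall>q. q \<preceq> p --> fo q a e --> fo q b e)"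
proof
  assume f: "fo p (Imp a b) e"
  show "\<forall>q. q \<preceq> p --> fo q a e --> fo q b e"
  proof (intro allI impI)
    fix q assume q: "q \<preceq> p" "fo q a e"
    show "fo q b e"
    proof (rule fo_dense[OF e])
      fix r assume r: "r \<preceq> q"
      have "fo r a e" by (rule fo_down[OF e q(2) r])
      then show "\<exists>t. t \<preceq> r & fo t b e" using f le_trans[OF r q(1)] unfolding Imp_def fo_Neg forces.simps(4) by blast
    qed (use le_P[OF q(1)] in blast)
  qed
next
  assume "\<forall>q. q \<preceq> p --> fo q a e --> fo q b e"
  then show "fo p (Imp a b) e" unfolding Imp_def fo_Neg forces.simps(4) using le_refl le_P by meson
qed
lemma fo_Disj: "fo p (Disj a b) e \<longleftrightarrow> (\<forall>q. q \<preceq> p --> (\<exists>r. r \<preceq> q & (fo r a e \<or> fo r b e)))"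
  unfolding Disj_def fo_Neg forces.simps(4) by blast
lemma fo_Ex: "fo p (Ex n a) e \<longleftrightarrow> (\<forall>q. q \<preceq> p --> (\<exists>r \<tau>. r \<preceq> q & nm \<tau> & fo r a (e(n := \<tau>))))"
  unfolding Ex_def fo_Neg forces.simps(5) by blast
lemma fo_BEx: "fo p (BEx n i a) e \<longleftrightarrow> (\<forall>q. q \<preceq> p --> (\<exists>r \<tau>. r \<preceq> q & nm \<tau> & ME r \<tau> ((e(n := \<tau>)) i) & fo r a (e(n := \<tau>))))"
  unfolding BEx_def fo_Ex by simp
lemma fo_ExI: assumes e: "!!n. nm (e n)" and "nm \<tau>" "fo p a (e(n := \<tau>))" shows "fo p (Ex n a) e"
  unfolding fo_Ex
proof (intro allI impI)
  fix q assume "q \<preceq> p"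
  then have "q \<preceq> q & fo q a (e(n := \<tau>))" using fo_down[OF nm_upd[OF e assms(2)] assms(3)] le_refl le_P by blast
  then show "\<exists>r \<tau>. r \<preceq> q & nm \<tau> & fo r a (e(n := \<tau>))" using assms(2) by blast
qed
lemma fo_BExI: assumes "!!n. nm (e n)" "nm \<tau>" "ME p \<tau> (e i)" "i \<noteq> n" "fo p a (e(n := \<tau>))" shows "fo p (BEx n i a) e"
  unfolding BEx_def by (rule fo_ExI[OF assms(1,2)]) (use assms in simp)
text \<open>A name forced to be a member is densely equal to one of the names listed in the bounding
  name, and \<open>fo_cong\<close> transfers the formula to it.\<close>

lemma fo_BAllI:
  assumes e: "!!n. nm (e n)" and i: "i \<noteq> n" and a: "!!\<rho> s q. pair \<rho> s : $(e i) ==> q \<preceq> p ==> q \<preceq> s ==> fo q a (e(n := \<rho>))"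
  shows "fo p (BAll n i a) e"
  unfolding BAll_def forces.simps(5)
proof (intro allI impI)
  fix \<tau> assume t: "nm \<tau>"
  note et = nm_upd[of e \<tau> n, OF e t]
  show "fo p (Imp (Mem n i) a) (e(n := \<tau>))"
    unfolding fo_Imp[OF et]
  proof (intro allI impI)
    fix q assume q: "q \<preceq> p" and m: "fo q (Mem n i) (e(n := \<tau>))"
    have qP: "q : $P" using le_P[OF q] ..
    show "fo q a (e(n := \<tau>))"
    proof (rule fo_dense[OF et _ qP])
      fix q' assume q': "q' \<preceq> q"
      have "ME q \<tau> (e i)" using m i by simp
      then obtain r \<rho> s where r: "r \<preceq> q'" "pair \<rho> s : $(e i)" "r \<preceq> s" "EQ r \<tau> \<rho>" using ME_char[OF t e qP] q' by blast
      have n: "nm \<rho>" "r : $P" using nm_dom[OF e r(2)] le_P[OF r(1)] by auto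
      have "fo r a (e(n := \<rho>))" by (rule a[OF r(2) le_trans[OF le_trans[OF r(1) q'] q] r(3)])
      then have "fo r a (e(n := \<tau>))"
        by (rule fo_cong[OF nm_upd[OF e n(1)] et _ n(2), rotated]) (use EQ_sym[OF r(4) t n] EQ_refl[OF e n(2)] in simp)
      then show "\<exists>r. r \<preceq> q' & fo r a (e(n := \<tau>))" using r(1) by blast
    qed
  qed
qed

subsection \<open>Names for pairs and check names\<close>

text \<open>A name for an unordered pair; all conditions are attached because there may be no
  largest one. \<open>op\<close> is the corresponding Kuratowski pair.\<close>

definition up :: "'v \<Rightarrow> 'v \<Rightarrow> 'v" where "up a b = prod (vset {a, b}) P"
definition op :: "'v \<Rightarrow> 'v \<Rightarrow> 'v" where "op a b = up (up a a) (up a b)"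

lemma pair_up: "pair \<rho> s : $(up a b) \<longleftrightarrow> (\<rho> = a \<or> \<rho> = b) & s : $P"
  unfolding up_def by simp
lemma nm_I: 
  assumes "!!z. z : $\<tau> ==> \<exists>\<sigma> p. z = pair \<sigma> p & \<sigma> : $N & p : $P" "name_closed P N" shows "nm \<tau>"
proof -
  have "name_closed P (vset ($N \<union> $(vset {\<tau>})))"
    unfolding name_closed_def elts_Un
  proof (intro ballI)
    fix \<tau>' z assume "\<tau>' : $N \<union> $(vset {\<tau>})" "z : $\<tau>'"
    then have "z : $\<tau> \<or> (\<exists>\<sigma>\<in>$N. \<exists>p\<in>$P. z = pair \<sigma> p)" using assms(2) unfolding name_closed_def by auto
    then have "\<exists>\<sigma> p. z = pair \<sigma> p & \<sigma> : $N & p : $P" using assms(1) by blast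
    then show "\<exists>\<sigma>\<in>$N \<union> $(vset {\<tau>}). \<exists>p\<in>$P. z = pair \<sigma> p" by blast
  qed
  then show ?thesis unfolding is_name_def by (intro exI[of _ "vset ($N \<union> $(vset {\<tau>}))"]) simp
qed
lemma nm_up: "nm a ==> nm b ==> nm (up a b)"
proof -
  assume "nm a" "nm b"
  then obtain N where N: "name_closed P N" "a : $N" "b : $N" using names3 by blast
  show ?thesis by (rule nm_I[OF _ N(1)]) (use N in \<open>auto simp: up_def elts_prod\<close>)
qed
lemma nm_op: "nm a ==> nm b ==> nm (op a b)"
  unfolding op_def by (intro nm_up)

lemma ME_up: assumes n: "nm \<tau>" "nm a" "nm b" "p : $P"
  shows "ME p \<tau> (up a b) \<longleftrightarrow> (\<forall>q. q \<preceq> p --> (\<exists>r. r \<preceq> q & (EQ r \<tau> a \<or> EQ r \<tau> b)))"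
proof -
  have "(\<exists>r \<rho> s. r \<preceq> q & ((\<rho> = a \<or> \<rho> = b) & s : $P) & r \<preceq> s & EQ r \<tau> \<rho>) \<longleftrightarrow> (\<exists>r. r \<preceq> q & (EQ r \<tau> a \<or> EQ r \<tau> b))" for q
    using le_P le_refl by fast
  then show ?thesis unfolding ME_char[OF n(1) nm_up[OF n(2,3)] n(4)] pair_up by simp
qed
lemma ME_up_I: "nm a ==> nm b ==> p : $P ==> ME p a (up a b) & ME p b (up a b)"
  using ME_up le_refl EQ_refl le_P by meson
lemma up_cong:
  assumes e: "EQ p a a'" "EQ p b b'" and n: "nm a" "nm b" "nm a'" "nm b'" "p : $P" shows "EQ p (up a b) (up a' b')"
proof (rule EQ_I)
  fix \<rho> s q assume r: "pair \<rho> s : $(up a b)" and q: "q \<preceq> p"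
  have qP: "q : $P" using le_P[OF q] ..
  have "EQ q a' a" "EQ q b' b" using EQ_down[OF _ q] EQ_sym e n by blast+
  then show "ME q \<rho> (up a' b')" using ME_up_I[OF n(3,4) qP] r ME_left n nm_up qP unfolding pair_up by blast
next
  fix \<rho> s q assume r: "pair \<rho> s : $(up a' b')" and q: "q \<preceq> p"
  have qP: "q : $P" using le_P[OF q] ..
  have "EQ q a a'" "EQ q b b'" using EQ_down[OF _ q] e n by blast+
  then show "ME q \<rho> (up a b)" using ME_up_I[OF n(1,2) qP] r ME_left n nm_up qP unfolding pair_up by blast
qed (use n nm_up in auto)
lemma up_single:
  assumes e: "EQ p (up x x) (up a b)" and n: "nm x" "nm a" "nm b" "p : $P" shows "EQ p a x" "EQ p b x"
proof -
  have m: "ME p a (up x x)" "ME p b (up x x)"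
    using ME_right[OF EQ_sym[OF e]] ME_up_I[OF n(2,3,4)] nm_up n by blast+
  show "EQ p a x" by (rule EQ_dense) (use m(1) ME_up n in blast)+
  show "EQ p b x" by (rule EQ_dense) (use m(2) ME_up n in blast)+
qed
text \<open>The usual injectivity of Kuratowski pairs. The case distinctions cannot be decided by
  one condition, so each of them is made densely below \<open>p\<close>.\<close>

lemma op_inject:
  assumes e: "EQ p (op x y) (op x' y')" and n: "nm x" "nm y" "nm x'" "nm y'" "p : $P" shows "EQ p x x' & EQ p y y'"
proof -
  have nu: "nm (up x x)" "nm (up x y)" "nm (up x' x')" "nm (up x' y')" "nm (op x y)" "nm (op x' y')" using n nm_up nm_op by auto
  have x: "EQ p x x'"
  proof (rule EQ_dense[OF _ n(1,3,5)])
    fix q assume q: "q \<preceq> p"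
    have "ME p (up x x) (op x' y')" using ME_right[OF e] ME_up_I[OF nu(1,2) n(5)] nu n unfolding op_def by blast
    then obtain r where r: "r \<preceq> q" "EQ r (up x x) (up x' x') \<or> EQ r (up x x) (up x' y')"
      unfolding op_def ME_up[OF nu(1,3,4) n(5)] using q by blast
    have "EQ r x' x" using r(2) up_single(1) n le_P[OF r(1)] by blast
    then show "\<exists>r. r \<preceq> q & EQ r x x'" using r(1) EQ_sym n le_P by blast
  qed
  \<comment> \<open>Used twice with the roles exchanged: \<open>y\<close> equals \<open>x'\<close>
    or \<open>y'\<close>, and \<open>y'\<close> equals \<open>x\<close> or \<open>y\<close>.
    Together with equality of the first components this leaves only equality of the second
    ones.\<close>
  have half: "\<exists>r. r \<preceq> q & (EQ r y x' \<or> EQ r y y')"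
    if q: "q \<preceq> p" and e: "EQ p (op x y) (op x' y')" and n: "nm x" "nm y" "nm x'" "nm y'" for q x y x' y'
  proof -
    have nu: "nm (up x x)" "nm (up x y)" "nm (up x' x')" "nm (up x' y')" "nm (op x y)" "nm (op x' y')" using n nm_up nm_op by auto
    have pP: "p : $P" using le_P[OF q] ..
    have "ME p (up x y) (op x' y')" using ME_right[OF e] ME_up_I[OF nu(1,2) pP] nu pP unfolding op_def by blast
    then obtain r where r: "r \<preceq> q" "EQ r (up x y) (up x' x') \<or> EQ r (up x y) (up x' y')"
      unfolding op_def ME_up[OF nu(2,3,4) pP] using q by blast
    have rP: "r : $P" using le_P[OF r(1)] ..
    show ?thesis
      using r(2)
    proof
      assume "EQ r (up x y) (up x' x')"
      then have "EQ r y x'" using up_single(2)[OF EQ_sym] nu n rP by blast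
      then show ?thesis using r(1) by blast
    next
      assume "EQ r (up x y) (up x' y')"
      then have "ME r y (up x' y')" using ME_right ME_up_I[OF n(1,2) rP] nu n rP by blast
      then show ?thesis using ME_up[OF n(2,3,4) rP] le_refl[OF rP] le_trans[OF _ r(1)] by meson
    qed
  qed
  have "EQ p y y'"
  proof (rule EQ_dense[OF _ n(2,4,5)])
    fix q assume q: "q \<preceq> p"
    obtain r where r: "r \<preceq> q" "EQ r y x' \<or> EQ r y y'" using half[OF q e n(1-4)] by blast
    obtain t where t: "t \<preceq> r" "EQ t y' x \<or> EQ t y' y" using half[OF le_trans[OF r(1) q] EQ_sym[OF e nu(5,6) n(5)] n(3,4,1,2)] by blast
    have tP: "t : $P" using le_P[OF t(1)] ..
    have "EQ t x x'" by (rule EQ_down[OF x le_trans[OF t(1) le_trans[OF r(1) q]] n(1,3)])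
    moreover have "EQ t y x' \<or> EQ t y y'" using r(2) EQ_down[OF _ t(1)] n by blast
    ultimately have "EQ t y y'" using t(2) EQ_sym EQ_trans n tP by meson
    then show "\<exists>r. r \<preceq> q & EQ r y y'" using le_trans[OF t(1) r(1)] by blast
  qed
  then show ?thesis using x by blast
qed

lemma fo_UPair:
  assumes e: "!!n. nm (e n)" and p: "p : $P" and v: "w \<noteq> 20" "x \<noteq> 20" "y \<noteq> 20"
  shows "fo p (UPair_fm w x y) e \<longleftrightarrow> EQ p (e w) (up (e x) (e y))"
proof -
  have 1: "fo p (Iff (Mem 20 w) (Disj (Eql 20 x) (Eql 20 y))) (e(20 := \<tau>)) \<longleftrightarrow> (\<forall>q. q \<preceq> p --> (ME q \<tau> (e w) \<longleftrightarrow> ME q \<tau> (up (e x) (e y))))"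
    if t: "nm \<tau>" for \<tau>
  proof -
    note et = nm_upd[of e \<tau> 20, OF e t]
    have "ME q \<tau> (up (e x) (e y)) \<longleftrightarrow> fo q (Disj (Eql 20 x) (Eql 20 y)) (e(20 := \<tau>))" if "q \<preceq> p" for q
      unfolding ME_up[OF t e e conjunct1[OF le_P[OF that]]] fo_Disj using v by simp
    moreover have "fo q (Mem 20 w) (e(20 := \<tau>)) \<longleftrightarrow> ME q \<tau> (e w)" for q using v by simp
    ultimately show ?thesis unfolding Iff_def forces.simps(4) fo_Imp[of "e(20 := \<tau>)", OF et] by blast
  qed
  show ?thesis unfolding EQ_ext[OF e nm_up[OF e e] p] UPair_fm_def forces.simps(5) using 1 by blast
qed
lemma fo_Pair:
  assumes e: "!!n. nm (e n)" and p: "p : $P" and v: "z \<notin> {20, 21, 22}" "x \<notin> {20, 21, 22}" "y \<notin> {20, 21, 22}"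
  shows "fo p (Pair_fm z x y) e \<longleftrightarrow> EQ p (e z) (op (e x) (e y))"
proof -
  let ?b = "Conj (UPair_fm 21 x x) (Conj (UPair_fm 22 x y) (UPair_fm z 21 22))"
  have b: "fo q ?b (e(21 := a, 22 := b)) \<longleftrightarrow> EQ q a (up (e x) (e x)) & EQ q b (up (e x) (e y)) & EQ q (e z) (up a b)"
    if n: "nm a" "nm b" "q : $P" for q a b
  proof -
    note et = nm_upd[of "e(21 := a)" b 22, OF nm_upd[of e a 21, OF e n(1)] n(2)]
    show ?thesis using fo_UPair[of "e(21 := a, 22 := b)" q, OF et n(3)] v by simp
  qed
  have n: "nm (up (e x) (e x))" "nm (up (e x) (e y))" using nm_up e by auto
  show ?thesis
  proof
    assume f: "fo p (Pair_fm z x y) e"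
    show "EQ p (e z) (op (e x) (e y))"
    proof (rule EQ_dense[OF _ e nm_op[OF e e] p])
      fix q assume q: "q \<preceq> p"
      obtain r a where r: "r \<preceq> q" "nm a" "fo r (Ex 22 ?b) (e(21 := a))" using f q unfolding Pair_fm_def fo_Ex[where n = 21] by blast
      then obtain t b' where t: "t \<preceq> r" "nm b'" "fo t ?b (e(21 := a, 22 := b'))" unfolding fo_Ex using le_refl le_P by meson
      have tP: "t : $P" using le_P[OF t(1)] ..
      have ab: "EQ t a (up (e x) (e x))" "EQ t b' (up (e x) (e y))" "EQ t (e z) (up a b')" using b[OF r(2) t(2) tP] t(3) by blast+
      have "EQ t (up a b') (op (e x) (e y))" unfolding op_def by (rule up_cong[OF ab(1,2) r(2) t(2) n tP])
      then have "EQ t (e z) (op (e x) (e y))" using EQ_trans[OF ab(3)] e nm_up r(2) t(2) nm_op tP by blast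
      then show "\<exists>r. r \<preceq> q & EQ r (e z) (op (e x) (e y))" using le_trans[OF t(1) r(1)] by blast
    qed
  next
    assume "EQ p (e z) (op (e x) (e y))"
    then have "fo p ?b (e(21 := up (e x) (e x), 22 := up (e x) (e y)))" unfolding b[OF n p] op_def using EQ_refl n p by blast
    then show "fo p (Pair_fm z x y) e" unfolding Pair_fm_def by (rule fo_ExI[OF e n(1) fo_ExI[OF nm_upd[OF e n(1)] n(2)]])
  qed
qed
lemma fo_App:
  assumes e: "!!n. nm (e n)" and p: "p : $P" and v: "f \<notin> {20, 21, 22, 23}" "x \<notin> {20, 21, 22, 23}" "y \<notin> {20, 21, 22, 23}"
  shows "fo p (App_fm f x y) e \<longleftrightarrow> ME p (op (e x) (e y)) (e f)"
proof -
  have b: "fo q (Pair_fm 23 x y) (e(23 := \<tau>)) \<longleftrightarrow> EQ q \<tau> (op (e x) (e y))" if "nm \<tau>" "q : $P" for q \<tau>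
    using fo_Pair[of "e(23 := \<tau>)" q 23 x y, OF nm_upd[of e \<tau> 23, OF e that(1)] that(2)] v by simp
  show ?thesis
  proof
    assume f: "fo p (App_fm f x y) e"
    show "ME p (op (e x) (e y)) (e f)"
    proof (rule ME_dense[OF _ nm_op[OF e e] e p])
      fix q assume q: "q \<preceq> p"
      obtain r \<tau> where r: "r \<preceq> q" "nm \<tau>" "ME r \<tau> (e f)" "fo r (Pair_fm 23 x y) (e(23 := \<tau>))" using f q v unfolding App_fm_def fo_BEx by auto
      have rP: "r : $P" using le_P[OF r(1)] ..
      have "EQ r \<tau> (op (e x) (e y))" using r(4) b[OF r(2) rP] by blast
      then have "ME r (op (e x) (e y)) (e f)" using ME_left r(2,3) rP e nm_op by blast
      then show "\<exists>r. r \<preceq> q & ME r (op (e x) (e y)) (e f)" using r(1) by blast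
    qed
  next
    assume "ME p (op (e x) (e y)) (e f)"
    then show "fo p (App_fm f x y) e"
      unfolding App_fm_def by (rule fo_BExI[OF e nm_op[OF e e]]) (use v b[OF nm_op[OF e e] p] EQ_refl[OF nm_op[OF e e] p] in auto)
  qed
qed

definition ck :: "'v \<Rightarrow> 'v" where
  "ck = rec (%x g. prod (vset (ap g ` $x)) P)"
lemma deft_ck [dfb]: "deft t ==> deft (%e. ck (t e))"
  unfolding ck_def by (rule deft_rec') (intro dfb)
lemma ck_eq: "ck x = prod (vset (ck ` $x)) P"
proof -
  have F: "deft (%e. prod (vset (ap (e 0) ` $(e (Suc 0)))) P)" by (intro dfb)
  have d: "deft (%e. ck (e 0))" by (intro dfb)
  have "ck x = prod (vset (ap (lam x ck) ` $x)) P" unfolding ck_def by (rule rec_eq[OF F])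
  also have "ap (lam x ck) ` $x = ck ` $x" by (rule image_cong[OF refl ap_lam[OF d]])
  finally show ?thesis .
qed
lemma elts_ck: "$(ck x) = {pair (ck z) p | z p. z : $x & p : $P}"
proof -
  have d: "deft (%e. ck (e 0))" by (intro dfb)
  show ?thesis unfolding ck_eq[of x] elts_prod elts_image[OF d] by blast
qed
lemma check_name: "check_name P x = ck x"
proof -
  have d: "deft (%e. ck (e 0))" by (intro dfb)
  have "is_check_name P x (ck x)"
  proof -
    obtain T where T: "transitive T" "$(vset {x}) <= $T" using transitive_superset by blast
    have l: "app (lam T ck) y = ck y" if "y : $T" for y by (rule app_lam[OF d that])
    have Tz: "z : $T" if "y : $T" "z : $y" for y z using T(1) that unfolding transitive_def by blast
    have "$(app (lam T ck) y) = {pair (app (lam T ck) z) p | z p. z : $y & p : $P}" if y: "y : $T" for y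
      unfolding l[OF y] elts_ck using l Tz[OF y] by (intro Collect_cong) metis
    moreover have "x : $T" using T(2) by simp
    ultimately show ?thesis unfolding is_check_name_def using T(1) function_on_lam[OF d] app_lam[OF d] by (intro exI[of _ T] exI[of _ "lam T ck"]) auto
  qed
  moreover have "c = ck x" if c: "is_check_name P x c" for c
  proof -
    obtain T f where T: "transitive T" "x : $T" "function_on f T"
      "\<forall>y\<in>$T. $(app f y) = {pair (app f z) p | z p. z : $y & p : $P}" "c = app f x" using c unfolding is_check_name_def by blast
    obtain b where f: "func f T b" using T(3) unfolding function_on_def by blast
    have "y : $T --> ap f y = ck y" for y
    proof (rule mem_induct[where Q = "%y. y : $T --> ap f y = ck y"])
      show "defb (%e. e 0 : $T --> ap f (e 0) = ck (e 0))" by (intro dfb)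
      fix y assume IH: "!!z. z : $y ==> z : $T --> ap f z = ck z"
      show "y : $T --> ap f y = ck y"
      proof (intro impI vsetI)
        assume y: "y : $T"
        have "app f z = ck z" if z: "z : $y" for z
        proof -
          have zT: "z : $T" using T(1) y z unfolding transitive_def by blast
          show ?thesis using IH[OF z] zT func_ap[OF f zT] by simp
        qed
        moreover have "$(ap f y) = {pair (app f z) p | z p. z : $y & p : $P}" using bspec[OF T(4) y] func_ap[OF f y] by simp
        ultimately show "$(ap f y) = $(ck y)" unfolding elts_ck by (simp, intro Collect_cong) metis
      qed
    qed
    then show ?thesis using T(2,5) func_ap[OF f] by simp
  qed
  ultimately show ?thesis unfolding check_name_def by (rule the_equality)
qed
lemma nm_ck: "nm (ck x)"
proof -
  have d: "deft (%e. ck (e 0))" by (intro dfb)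
  obtain T where T: "transitive T" "$(vset {x}) <= $T" using transitive_superset by blast
  have "name_closed P (vset (ck ` $T))"
    unfolding name_closed_def elts_image[OF d] using T(1) unfolding transitive_def by (auto simp: elts_ck)
  then show ?thesis unfolding is_name_def using T(2) by (intro exI[of _ "vset (ck ` $T)"]) (simp add: elts_image[OF d])
qed
lemma pair_ck: "pair \<rho> s : $(ck x) \<longleftrightarrow> s : $P & (\<exists>z\<in>$x. \<rho> = ck z)"
  unfolding elts_ck by (auto simp: pair_inject)
lemma ME_ck: "z : $x ==> p : $P ==> ME p (ck z) (ck x)"
  by (rule ME_I[OF nm_ck _ le_refl]) (auto simp: pair_ck)
lemma ck_inject: assumes "EQ p (ck x) (ck y)" "p : $P" shows "x = y"
proof -
  obtain T where T: "transitive T" "$(vset {x, y}) <= $T" using transitive_superset by blast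
  have Tt: "z : $T" if "z : $w" "w : $T" for z w using T(1) that unfolding transitive_def by blast
  have d: "deft (%e. ck (e 0))" by (intro dfb)
  define N where "N = vset (ck ` $T)"
  have N: "name_closed P N"
    unfolding name_closed_def N_def elts_image[OF d] using T(1) unfolding transitive_def by (auto simp: elts_ck)
  have EN: "EQ p (ck x) (ck y) \<longleftrightarrow> triple p (ck x) (ck y) : $(Eq N)" if "x : $T" "y : $T" "p : $P" for x y p
    by (rule EQ_iff[OF N]) (use that in \<open>auto simp: N_def elts_image[OF d]\<close>)
  \<comment> \<open>The induction needs a definable predicate, so forced equality is replaced by
    membership in the single table \<open>Eq N\<close> for the check names of elements of
    \<open>T\<close>.\<close>
  let ?Q = "%x. x : $T --> (\<forall>y\<in>$T. \<forall>p\<in>$P. triple p (ck x) (ck y) : $(Eq N) --> x = y)"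
  have "?Q x"
  proof (rule mem_induct[where Q = ?Q])
    show "defb (%e. ?Q (e 0))" by (intro dfb)
    fix x assume IH: "!!z. z : $x ==> ?Q z"
    show "?Q x"
    proof (intro impI ballI vsetI)
      fix y p assume x: "x : $T" and y: "y : $T" and p: "p : $P" and t: "triple p (ck x) (ck y) : $(Eq N)"
      have e: "EQ p (ck x) (ck y)" using EN[OF x y p] t by blast
      have mem: "\<exists>r w. r : $P & w : $b & EQ r (ck z) (ck w)" if m: "ME p (ck z) (ck b)" for z b
        using ME_char[OF nm_ck nm_ck p, THEN iffD1, OF m, rule_format, OF le_refl[OF p]] le_P unfolding pair_ck by blast
      have IH': "z = w" if "z : $x" "w : $T" "r : $P" "EQ r (ck z) (ck w)" for z w r
      proof -
        have zT: "z : $T" by (rule Tt[OF that(1) x])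
        have "triple r (ck z) (ck w) : $(Eq N)" by (rule EN[OF zT that(2,3), THEN iffD1, OF that(4)])
        then show ?thesis by (rule IH[OF that(1), THEN mp, OF zT, THEN bspec, OF that(2), THEN bspec, OF that(3), THEN mp])
      qed
      show "$x = $y"
      proof (intro equalityI subsetI)
        fix z assume z: "z : $x"
        have "ME p (ck z) (ck y)" by (rule ME_right[OF e ME_ck[OF z p]]) (simp_all add: nm_ck p)
        then obtain r w where "r : $P" "w : $y" "EQ r (ck z) (ck w)" using mem by blast
        then show "z : $y" using IH'[OF z] Tt[OF _ y] by blast
      next
        fix z assume z: "z : $y"
        have "ME p (ck z) (ck x)" by (rule ME_right[OF EQ_sym[OF e] ME_ck[OF z p]]) (simp_all add: nm_ck p)
        then obtain r w where "r : $P" "w : $x" "EQ r (ck z) (ck w)" using mem by blast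
        then show "z : $x" using IH'[of w z r] Tt[OF z y] EQ_sym nm_ck by blast
      qed
    qed
  qed
  moreover have xy: "x : $T" "y : $T" using T(2) by simp_all
  moreover have "triple p (ck x) (ck y) : $(Eq N)" by (rule EN[OF xy assms(2), THEN iffD1, OF assms(1)])
  ultimately show ?thesis using assms(2) by blast
qed

text \<open>The name collects the pairs \<open>(i, l)\<close> with \<open>p \<in> D i l\<close>; it is forced to be a cofinal
  function from \<open>a\<close> to \<open>\<delta>\<close>.\<close>

theorem not_forced_regular:
  assumes p: "p : $P" and a: "a : $\<delta>"
    and D: "!!i l q. pair (pair i l) q : $D ==> i : $a & l : $\<delta> & q : $P" "!!z. z : $D ==> \<exists>i l q. z = pair (pair i l) q"
    and down: "!!i l q r. pair (pair i l) q : $D ==> r \<preceq> q ==> pair (pair i l) r : $D"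
    and disj: "!!i l l' q. pair (pair i l) q : $D ==> pair (pair i l') q : $D ==> l = l'"
    and tot: "!!i q. i : $a ==> q : $P ==> \<exists>r l. r \<preceq> q & pair (pair i l) r : $D"
    and dense: "!!m q. m : $\<delta> ==> q : $P ==> \<exists>r i l. r \<preceq> q & $m <= $l & pair (pair i l) r : $D"
  shows "\<not> fo p regular_fm (%_. ck \<delta>)"
proof
  assume f: "fo p regular_fm (%_. ck \<delta>)"
  let ?F = "%w. pair (op (ck (fstp (fstp w))) (ck (sndp (fstp w)))) (sndp w)"
  have dF: "deft (%e. ?F (e 0))" unfolding op_def up_def by (intro dfb)
  define f where "f = vset (?F ` $D)"
  have ef: "$f = ?F ` $D" unfolding f_def by (rule elts_image[OF dF])
  have pf: "pair \<rho> s : $f \<longleftrightarrow> (\<exists>i l. \<rho> = op (ck i) (ck l) & pair (pair i l) s : $D)" for \<rho> s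
  proof
    assume "pair \<rho> s : $f"
    then obtain w where w: "w : $D" "pair \<rho> s = ?F w" unfolding ef by blast
    obtain i l q where "w = pair (pair i l) q" using D(2)[OF w(1)] by blast
    then show "\<exists>i l. \<rho> = op (ck i) (ck l) & pair (pair i l) s : $D" using w by (auto simp: pair_inject)
  next
    assume "\<exists>i l. \<rho> = op (ck i) (ck l) & pair (pair i l) s : $D"
    then obtain i l where "\<rho> = op (ck i) (ck l)" "pair (pair i l) s : $D" by blast
    then show "pair \<rho> s : $f" unfolding ef by (intro image_eqI[of _ _ "pair (pair i l) s"]) simp_all
  qed
  \<comment> \<open>A closed set of names around \<open>f\<close> has to contain the check names,
    the unordered pairs of check names and the ordered pairs built from these.\<close>
  have nf: "nm f"
  proof -
    have dN: "deft (%e. ck (e 0))" by (intro dfb)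
    obtain T where T: "transitive T" "$(vset {a, \<delta>}) <= $T" using transitive_superset by blast
    have dC: "name_closed P (vset (ck ` $T))"
      unfolding name_closed_def elts_image[OF dN] using T(1) unfolding transitive_def by (auto simp: elts_ck)
    let ?u = "%z. up (ck (fstp z)) (ck (sndp z))"
    have du: "deft (%e. ?u (e 0))" "deft (%e. op (ck (fstp (e 0))) (ck (sndp (e 0))))" unfolding op_def up_def by (intro dfb)+
    let ?A = "vset (ck ` $T)" and ?B = "vset (?u ` $(prod T T))" and ?C = "vset ((%z. op (ck (fstp z)) (ck (sndp z))) ` $(prod T T))"
    have A: "name_closed P ?A" by (rule dC)
    have BC: "\<tau> : $?B \<longleftrightarrow> (\<exists>x\<in>$T. \<exists>y\<in>$T. \<tau> = up (ck x) (ck y))"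
      "\<tau> : $?C \<longleftrightarrow> (\<exists>x\<in>$T. \<exists>y\<in>$T. \<tau> = op (ck x) (ck y))" for \<tau>
      by (subst elts_image[OF du(1)], force simp: elts_prod) (subst elts_image[OF du(2)], force simp: elts_prod)
    define N where "N = vset ($?A \<union> $(vset ($?B \<union> $?C)))"
    have N: "$N = $?A \<union> $?B \<union> $?C" unfolding N_def by (subst elts_Un, subst elts_Un, blast)
    have upN: "up (ck x) (ck y) : $N" "op (ck x) (ck y) : $N" "ck x : $N" if "x : $T" "y : $T" for x y
      using BC that unfolding N by (blast, blast, simp add: elts_image[OF dN])
    have "name_closed P N" unfolding name_closed_def
    proof (intro ballI)
      fix \<tau> z assume t: "\<tau> : $N" "z : $\<tau>"
      then consider "\<tau> : $?A" | x y where "x : $T" "y : $T" "\<tau> = up (ck x) (ck y)" | x y where "x : $T" "y : $T" "\<tau> = op (ck x) (ck y)"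
        using BC unfolding N by blast
      then show "\<exists>\<sigma>\<in>$N. \<exists>p\<in>$P. z = pair \<sigma> p"
      proof cases
        case 1 then show ?thesis using A t(2) unfolding name_closed_def N by blast
      next
        case 2 then show ?thesis using upN(3) t(2) by (auto simp: up_def elts_prod)
      next
        case 3 then show ?thesis using upN(1) t(2) unfolding op_def by (auto simp: up_def[of "up _ _"] elts_prod)
      qed
    qed
    moreover have "\<exists>\<sigma> p. z = pair \<sigma> p & \<sigma> : $N & p : $P" if z: "z : $f" for z
    proof -
      obtain w where w: "w : $D" "z = ?F w" using z unfolding ef by blast
      obtain i l q where e: "w = pair (pair i l) q" using D(2)[OF w(1)] by blast
      have m: "i : $a" "l : $\<delta>" "q : $P" using D(1) w(1) e by blast+
      have "i : $T" "l : $T" using m(1,2) T unfolding transitive_def by auto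
      then show ?thesis using upN(2) w(2) e m(3) by auto
    qed
    ultimately show ?thesis using nm_I by blast
  qed
  define e where "e = (%_::nat. ck \<delta>)(1 := ck a, 2 := f)"
  have e: "nm (e n)" for n unfolding e_def using nm_ck nf by simp
  have ev: "e 0 = ck \<delta>" "e 1 = ck a" "e (Suc 0) = ck a" "e 2 = f" unfolding e_def by simp_all
  have memf: "ME r (op (ck i) (ck l)) f" if "pair (pair i l) r : $D" for i l r
    by (rule ME_I[OF nf, of _ r]) (use that pf D(1) le_refl in blast)+
  have Func: "fo p (Func_fm 2 1 0) e"
    unfolding Func_fm_def forces.simps(4)
  proof
    show "fo p (BAll 10 2 (BEx 11 1 (BEx 12 0 (Pair_fm 10 11 12)))) e"
    proof (rule fo_BAllI[OF e])
      fix \<rho> s q assume r: "pair \<rho> s : $(e 2)" and q: "q \<preceq> p"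
      obtain i l where il: "\<rho> = op (ck i) (ck l)" "pair (pair i l) s : $D" using r pf ev by auto
      have m: "i : $a" "l : $\<delta>" "q : $P" using D(1)[OF il(2)] le_P[OF q] by auto
      note e1 = nm_upd[of e \<rho> 10, OF e conjunct1[OF nm_dom[OF e r]]]
      note e2 = nm_upd[of "e(10 := \<rho>)" "ck i" 11, OF e1 nm_ck]
      note e3 = nm_upd[of "e(10 := \<rho>, 11 := ck i)" "ck l" 12, OF e2 nm_ck]
      show "fo q (BEx 11 1 (BEx 12 0 (Pair_fm 10 11 12))) (e(10 := \<rho>))"
      proof (rule fo_BExI[OF e1 nm_ck _ _ fo_BExI[OF e2 nm_ck]])
        have "EQ q \<rho> \<rho>" by (rule EQ_refl[OF conjunct1[OF nm_dom[OF e r]] m(3)])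
        then show "fo q (Pair_fm 10 11 12) (e(10 := \<rho>, 11 := ck i, 12 := ck l))"
          using fo_Pair[of "e(10 := \<rho>, 11 := ck i, 12 := ck l)" q 10 11 12, OF e3 m(3)] il(1) by simp
      qed (use ME_ck m ev in simp_all)
    qed simp
    show "fo p (BAll 11 1 (Ex 12 (Conj (App_fm 2 11 12) (All 13 (Imp (App_fm 2 11 13) (Eql 13 12)))))) e"
    proof (rule fo_BAllI[OF e])
      fix \<rho> s q assume r: "pair \<rho> s : $(e 1)" and q: "q \<preceq> p"
      obtain z where z: "z : $a" "\<rho> = ck z" using r pair_ck ev by auto
      have qP: "q : $P" using le_P[OF q] ..
      let ?b = "Conj (App_fm 2 11 12) (All 13 (Imp (App_fm 2 11 13) (Eql 13 12)))"
      note e1 = nm_upd[of e "ck z" 11, OF e nm_ck]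
      show "fo q (Ex 12 ?b) (e(11 := \<rho>))"
        unfolding z(2) fo_Ex
      proof (intro allI impI)
        fix q' assume q': "q' \<preceq> q"
        obtain r l where rl: "r \<preceq> q'" "pair (pair z l) r : $D" using tot[OF z(1)] le_P[OF q'] by blast
        have rP: "r : $P" using le_P[OF rl(1)] ..
        note e2 = nm_upd[of "e(11 := ck z)" "ck l" 12, OF e1 nm_ck]
        have 1: "fo r (App_fm 2 11 12) (e(11 := ck z, 12 := ck l))"
          using fo_App[of "e(11 := ck z, 12 := ck l)" r 2 11 12, OF e2 rP] memf[OF rl(2)] ev by simp
        have 2: "fo r (Imp (App_fm 2 11 13) (Eql 13 12)) (e(11 := ck z, 12 := ck l, 13 := \<tau>))" if t: "nm \<tau>" for \<tau>
        proof -
          note e3 = nm_upd[of "e(11 := ck z, 12 := ck l)" \<tau> 13, OF e2 t]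
          have "EQ u \<tau> (ck l)" if u: "u \<preceq> r" "fo u (App_fm 2 11 13) (e(11 := ck z, 12 := ck l, 13 := \<tau>))" for u
          proof -
            have uP: "u : $P" using le_P[OF u(1)] ..
            have m: "ME u (op (ck z) \<tau>) f"
              using fo_App[of "e(11 := ck z, 12 := ck l, 13 := \<tau>)" u 2 11 13, OF e3 uP] u(2) ev by simp
            show ?thesis
            proof (rule EQ_dense[OF _ t nm_ck uP])
              fix v assume "v \<preceq> u"
              then obtain w \<rho>' s' where w: "w \<preceq> v" "pair \<rho>' s' : $f" "w \<preceq> s'" "EQ w (op (ck z) \<tau>) \<rho>'"
                using m unfolding ME_char[OF nm_op[OF nm_ck t] nf uP] by blast
              obtain i l' where il: "\<rho>' = op (ck i) (ck l')" "pair (pair i l') s' : $D" using w(2) pf by blast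
              have wP: "w : $P" using le_P[OF w(1)] ..
              have eq: "EQ w (ck z) (ck i)" "EQ w \<tau> (ck l')"
                using op_inject[OF w(4)[unfolded il(1)] nm_ck t nm_ck nm_ck wP] by blast+
              \<comment> \<open>One condition forces the two check names equal, so the arguments are
                the same element. Then \<open>down\<close> moves both entries of \<open>D\<close> to
                \<open>w\<close>, where \<open>disj\<close> identifies the values.\<close>
              have "z = i" by (rule ck_inject[OF eq(1) wP])
              then have "pair (pair z l') w : $D" using down[OF il(2) w(3)] by simp
              moreover have "pair (pair z l) w : $D" by (rule down[OF rl(2) le_trans[OF w(1) le_trans[OF \<open>v \<preceq> u\<close> u(1)]]])
              ultimately have "l = l'" using disj by blast
              then show "\<exists>r. r \<preceq> v & EQ r \<tau> (ck l)" using eq(2) w(1) by blast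
            qed
          qed
          then show ?thesis unfolding fo_Imp[of "e(11 := ck z, 12 := ck l, 13 := \<tau>)", OF e3] by simp
        qed
        have "fo r ?b (e(11 := ck z, 12 := ck l))" using 1 2 by simp
        then show "\<exists>r \<tau>. r \<preceq> q' & nm \<tau> & fo r ?b (e(11 := ck z, 12 := \<tau>))" using rl(1) nm_ck by blast
      qed
    qed simp
  qed
  let ?c = "BEx 4 1 (BEx 5 0 (Conj (App_fm 2 4 5) (Sub_fm 3 5)))"
  have cof: "fo p (BAll 3 0 ?c) e"
  proof (rule fo_BAllI[OF e])
    fix \<rho> s q assume r: "pair \<rho> s : $(e 0)" and q: "q \<preceq> p"
    obtain m where m: "m : $\<delta>" "\<rho> = ck m" using r pair_ck ev by auto
    have qP: "q : $P" using le_P[OF q] ..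
    note e1 = nm_upd[of e "ck m" 3, OF e nm_ck]
    show "fo q ?c (e(3 := \<rho>))"
      unfolding m(2)
    proof (rule fo_dense[OF e1 _ qP])
      fix q' assume q': "q' \<preceq> q"
      obtain r i l where rl: "r \<preceq> q'" "$m <= $l" "pair (pair i l) r : $D" using dense[OF m(1)] le_P[OF q'] by blast
      have x: "i : $a" "l : $\<delta>" "r : $P" using D(1)[OF rl(3)] by auto
      note e2 = nm_upd[of "e(3 := ck m)" "ck i" 4, OF e1 nm_ck]
      note e3 = nm_upd[of "e(3 := ck m, 4 := ck i)" "ck l" 5, OF e2 nm_ck]
      have 1: "fo r (App_fm 2 4 5) (e(3 := ck m, 4 := ck i, 5 := ck l))"
        using fo_App[of "e(3 := ck m, 4 := ck i, 5 := ck l)" r 2 4 5, OF e3 x(3)] memf[OF rl(3)] ev by simp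
      have 2: "fo r (Sub_fm 3 5) (e(3 := ck m, 4 := ck i, 5 := ck l))"
        unfolding Sub_fm_def
        by (rule fo_BAllI[of "e(3 := ck m, 4 := ck i, 5 := ck l)", OF e3]) (use rl(2) ME_ck le_P in \<open>auto simp: pair_ck\<close>)
      have "fo r ?c (e(3 := ck m))"
        by (rule fo_BExI[of "e(3 := ck m)", OF e1 nm_ck _ _ fo_BExI[of "e(3 := ck m, 4 := ck i)", OF e2 nm_ck]]) (use 1 2 x ME_ck ev in simp_all)
      then show "\<exists>r. r \<preceq> q' & fo r ?c (e(3 := ck m))" using rl(1) by blast
    qed
  qed simp
  have "fo p (Ex 2 (Conj (Func_fm 2 1 0) (BAll 3 0 ?c))) ((%_. ck \<delta>)(1 := ck a))"
    by (rule fo_ExI[OF _ nf]) (use Func cof nm_ck in \<open>auto simp only: e_def forces.simps(4) fun_upd_apply split: if_splits\<close>)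
  then have "fo p (BEx 1 0 (Ex 2 (Conj (Func_fm 2 1 0) (BAll 3 0 ?c)))) (%_. ck \<delta>)"
    by (intro fo_BExI[where \<tau> = "ck a"]) (use nm_ck ME_ck[OF a p] in simp_all)
  moreover have "fo p (Neg (BEx 1 0 (Ex 2 (Conj (Func_fm 2 1 0) (BAll 3 0 ?c))))) (%_. ck \<delta>)"
    using f unfolding regular_fm_def forces.simps(4) by blast
  ultimately show False unfolding fo_Neg using le_refl[OF p] by blast
qed

end

context zfc begin

subsection \<open>Transitive collapses of guessing internally stationary sets are good\<close>

text \<open>Chosen once like \<open>J\<close>: injections of the countable ordinals into
  \<open>omega\<close>, by which bounded subsets of \<open>omega1\<close> are coded as
  reals.\<close>

definition phi :: "'v \<Rightarrow> 'v \<Rightarrow> 'v" where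
  "phi b x = ap (ap (SOME p. \<forall>b\<in>$omega1. (\<forall>x\<in>$b. ap (ap p b) x : $omega) & inj_on (ap (ap p b)) ($b)) b) x"
lemma deft_phi [dfb]: "deft b ==> deft x ==> deft (%e. phi (b e) (x e))"
  unfolding phi_def by (intro dfb)
lemma phi: "b : $omega1 ==> x : $b ==> phi b x : $omega" "b : $omega1 ==> inj_on (phi b) ($b)"
proof -
  let ?Q = "%b f. (\<forall>x\<in>$b. ap f x : $omega) & inj_on (ap f) ($b)"
  have "\<exists>p. func p omega1 (pow (prod omega1 omega)) & (\<forall>b\<in>$omega1. ?Q b (ap p b))"
  proof (rule choice_func[where Q = ?Q])
    show "defb (%e. ?Q (e 0) (e 1))" by (intro dfb)
    fix b assume b: "b : $omega1"
    then have "lepoll b omega" using elts_omega1 unfolding ctbl_def by blast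
    then obtain f where f: "func f b omega" "inj_on (app f) ($b)" unfolding lepoll_def injection_def by blast
    have "inj_on (ap f) ($b)" using f func_ap[OF f(1)] unfolding inj_on_def by metis
    moreover have "f : $(pow (prod omega1 omega))"
    proof -
      have "$f <= $(prod omega1 omega)"
        using f(1) Ord_trans[OF Ord_omega1 _ b] unfolding func_def elts_prod by (intro subsetI CollectI) blast
      then show ?thesis by simp
    qed
    ultimately show "\<exists>f\<in>$(pow (prod omega1 omega)). ?Q b f" using func_ap_in[OF f(1)] by blast
  qed
  then have "\<exists>p. \<forall>b\<in>$omega1. ?Q b (ap p b)" by blast
  from someI_ex[OF this] show "b : $omega1 ==> x : $b ==> phi b x : $omega" "b : $omega1 ==> inj_on (phi b) ($b)"
    unfolding phi_def by blast+
qed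

text \<open>The closure properties needed to compute with traces inside \<open>M\<close>. They are
  obtained for almost all \<open>M\<close> from fineness and normality, see \<open>ae_rich\<close>,
  without evaluating formula codes.\<close>

definition rich :: "'v \<Rightarrow> bool" where
  "rich M \<longleftrightarrow> omega1 : $M & (\<forall>x\<in>$M. \<forall>y\<in>$M. vset ($x \<inter> $y) : $M) &
     (\<forall>c\<in>$M. \<forall>a\<in>$M. $a <= $c & ctbl c & $(vset (col c ` $a)) <= $omega1 --> vset (col c ` $a) : $M) &
     (\<forall>c\<in>$M. \<forall>b\<in>$M. vset {y \<in> $c. col c y : $b} : $M) &
     (\<forall>b\<in>$M. \<forall>r\<in>$M. vset {x \<in> $b. phi b x : $r} : $M) &
     (\<forall>x\<in>$M. \<forall>y\<in>$M. \<forall>z\<in>$M. \<forall>w\<in>$M. dec x y z w : $M)"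
text \<open>The parameter over which the collapse of \<open>M\<close> is good. Subsets of
  \<open>omega\<close> suffice to detect that something is missing, but covers have countable order
  types, hence all countable subsets of \<open>omega1\<close> are recorded.\<close>

definition reals :: "'v \<Rightarrow> 'v" where
  "reals M = vset {x \<in> $M. $x <= $omega1 & ctbl x}"
lemma elts_reals: "$(reals M) = {x \<in> $M. $x <= $omega1 & ctbl x}"
  unfolding reals_def by (rule elts_sep) (intro dfb)
lemma deft_reals [dfb]: "deft t ==> deft (%e. reals (t e))"
  by (rule deft_subst[where F = reals]) (unfold reals_def, intro dfb)

definition collapse :: "'v \<Rightarrow> 'v" where
  "collapse M = vset (col M ` $M)"
lemma elts_collapse: "$(collapse M) = col M ` $M"
proof -
  have d: "deft (%e. col M (e 0))" by (intro dfb)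
  show ?thesis unfolding collapse_def by (rule elts_image[OF d])
qed

lemma is_collapse_col:
  assumes N: "is_collapse M N"
  shows "inj_on (col M) ($M)" "N = collapse M" "x : $M ==> y : $M ==> col M x : $(col M y) \<longleftrightarrow> x : $y"
proof -
  obtain f where t: "transitive N" and f: "func f M N" and b: "bij_betw (app f) ($M) ($N)"
    and i: "!!x y. x : $M ==> y : $M ==> x : $y \<longleftrightarrow> app f x : $(app f y)"
    using N unfolding is_collapse_def bijection_def by blast
  have a: "app f x = ap f x" if "x : $M" for x by (rule func_ap[OF f that])
  have "x : $M --> ap f x = col M x" for x
  proof (rule mem_induct[where Q = "%x. x : $M --> ap f x = col M x"])
    show "defb (%e. e 0 : $M --> ap f (e 0) = col M (e 0))" by (intro dfb)
    fix x assume IH: "!!y. y : $x ==> y : $M --> ap f y = col M y"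
    show "x : $M --> ap f x = col M x"
    proof (intro impI vsetI equalityI subsetI)
      fix w assume x: "x : $M" and w: "w : $(ap f x)"
      have "w : $N" using t func_ap_in[OF f x] w unfolding transitive_def by blast
      then obtain y where y: "y : $M" "w = ap f y" using b a unfolding bij_betw_def by auto
      then have "y : $x" using i[OF y(1) x] w a[OF x] a[OF y(1)] by simp
      then show "w : $(col M x)" using IH y unfolding elts_col by auto
    next
      fix w assume x: "x : $M" and w: "w : $(col M x)"
      then obtain y where y: "y : $x" "y : $M" "w = col M y" unfolding elts_col by blast
      then show "w : $(ap f x)" using IH[OF y(1)] i[OF y(2) x] a[OF x] a[OF y(2)] by simp
    qed
  qed
  then have c: "app f x = col M x" if "x : $M" for x using a that by simp
  show "inj_on (col M) ($M)" using b c unfolding bij_betw_def inj_on_def by simp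
  show "N = collapse M" using b c unfolding bij_betw_def by (intro vsetI) (auto simp: elts_collapse)
  show "x : $M ==> y : $M ==> col M x : $(col M y) \<longleftrightarrow> x : $y" using i c by simp
qed

text \<open>The bijection \<open>g\<close> filters \<open>M\<close> by countable sets. The pieces at
  closure points of a given function \<open>h\<close> form a club in the countable subsets of
  \<open>M\<close>, and internal stationarity puts one of them into \<open>M\<close>.\<close>

lemma IS_stat:
  assumes S: "stationary (vset ($M \<inter> $(ctbl_subsets M))) M" and g: "inj_on (ap g) ($M)" "ap g ` $M = $omega1"
  shows "stat omega1 (vset {z \<in> $omega1. vset {y \<in> $M. ap g y : $z} : $M})"
  unfolding stat_def
proof (intro allI impI)
  fix h assume h: "\<forall>x\<in>$omega1. ap h x : $omega1"
  have dg: "deft (%e. ap g (e 0))" and dh: "deft (%e. ap h (e 0))" by (intro dfb)+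
  let ?M = "%z. vset {y \<in> $M. ap g y : $z}"
  let ?cl = "closed_pt (%u v. ap h u)"
  have eM: "$(?M z) = {y \<in> $M. ap g y : $z}" for z by (rule elts_sep) (intro dfb)
  have cM: "ctbl (?M z)" if "z : $omega1" for z by (rule ctbl_fibre[OF dg g(1) ctbl_omega1_mem[OF that]])
  define C where "C = vset {Y \<in> $(ctbl_subsets M). \<exists>z\<in>$omega1. ?cl z & Y = ?M z}"
  have C: "$C = {Y \<in> $(ctbl_subsets M). \<exists>z\<in>$omega1. ?cl z & Y = ?M z}" unfolding C_def by (rule elts_sep) (intro dfb)
  have "club C M" unfolding club_def
  proof (intro conjI ballI allI impI)
    show "$C <= $(ctbl_subsets M)" using C by blast
    fix Y assume "Y : $(ctbl_subsets M)"
    then have Y: "$Y <= $M" "ctbl Y" unfolding elts_ctbl_subsets by auto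
    obtain b where b: "b : $omega1" "\<forall>y\<in>$Y. ap g y : $b"
      using bnd_image[OF bnd_omega1 dg Y(2)[unfolded ctbl_def] omega_omega1] g(2) Y(1) by blast
    have "\<exists>x\<in>$omega1. b : $x & closed_pt (%u v. ap h u) x & (\<exists>b. (\<forall>i\<in>$omega. ap b i : $x) &
      (\<forall>y\<in>$x. \<exists>i\<in>$omega. y : $(ap b i)) & (\<forall>i\<in>$omega. \<forall>j\<in>$i. ap b j : $(ap b i)))"
      by (rule closed_pt_approach[OF bnd_omega1 omega_props(1) omega_omega1 dh _ b(1)]) (use h in blast)
    then obtain z where z: "z : $omega1" "b : $z" "?cl z" by blast
    have "$Y <= $(?M z)" unfolding eM using b(2) Y(1) Ord_trans[OF Ord_mem[OF Ord_omega1 z(1)] _ z(2)] by blast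
    moreover have "?M z : $C" unfolding C elts_ctbl_subsets using z cM[OF z(1)] eM[of z] by blast
    ultimately show "\<exists>Z\<in>$C. $Y <= $Z" by blast
  next
    fix D assume D: "$D <= $C & $D \<noteq> {} & ctbl D & (\<forall>Y\<in>$D. \<forall>Z\<in>$D. $Y <= $Z \<or> $Z <= $Y)"
    let ?z = "%Y. vset (ap g ` $Y)"
    have ez: "$(?z Y) = ap g ` $Y" for Y by (rule elts_image[OF dg])
    have dz: "deft (%e. ?z (e 0))" by (intro dfb)
    have Dz: "?z Y : $omega1 & ?cl (?z Y) & Y = ?M (?z Y)" if Y: "Y : $D" for Y
    proof -
      have "Y : $C" using D Y by blast
      then obtain z where z: "z : $omega1" "?cl z" "Y = ?M z" unfolding C by blast
      have "$z <= $omega1" using Ord_trans[OF Ord_omega1 _ z(1)] by blast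
      then have "$z <= ap g ` $M" unfolding g(2) .
      then have "ap g ` {y \<in> $M. ap g y : $z} = $z" by fast
      moreover have "$Y = {y \<in> $M. ap g y : $z}" unfolding z(3) by (rule eM)
      ultimately have "$(?z Y) = $z" using ez[of Y] by simp
      then have "?z Y = z" by (rule vsetI)
      then show ?thesis using z by simp
    qed
    define u where "u = vset (\<Union>Y\<in>$D. $(?z Y))"
    have u: "$u = (\<Union>Y\<in>$D. $(?z Y))" unfolding u_def by (rule elts_UN[OF dz])
    have "Ord (?z Y)" if "Y : $D" for Y using Dz[OF that] Ord_mem[OF Ord_omega1] by blast
    then have "Ord u" unfolding Ord_def transitive_def u by blast
    moreover have "ctbl u" unfolding u_def by (rule ctbl_UN[OF dz]) (use D Dz ctbl_omega1_mem in blast)+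
    ultimately have u1: "u : $omega1" using elts_omega1 by blast
    have cu: "?cl u" unfolding closed_pt_def
    proof (intro conjI ballI)
      obtain Y where "Y : $D" using D by blast
      then show "zero : $u" using Dz[of Y] unfolding closed_pt_def u by blast
    next
      fix x y assume "x : $u"
      then obtain Y where Y: "Y : $D" "x : $(?z Y)" unfolding u by blast
      then have "ap h x : $(?z Y)" using Dz[OF Y(1)] unfolding closed_pt_def by blast
      then show "ap h x : $u" using Y(1) u by blast
    qed
    have Du: "$Y = {y \<in> $M. ap g y : $(?z Y)}" if "Y : $D" for Y
      by (rule trans[OF arg_cong[where f = elts] eM]) (use Dz[OF that] in blast)
    have "union D = ?M u"
    proof (rule vsetI, unfold elts_union eM)
      show "(\<Union>x\<in>$D. $x) = {y \<in> $M. ap g y : $u}" unfolding u using Du by blast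
    qed
    moreover have "?M u : $(ctbl_subsets M)" unfolding elts_ctbl_subsets using cM[OF u1] eM[of u] by blast
    ultimately show "union D : $C" unfolding C using u1 cu by auto
  qed
  then have "$(vset ($M \<inter> $(ctbl_subsets M))) \<inter> $C \<noteq> {}" using S unfolding stationary_def by blast
  then obtain Y where Y: "Y : $M" "Y : $C" by auto
  then obtain z where z: "z : $omega1" "?cl z" "Y = ?M z" unfolding C by blast
  have "z : $(vset {z \<in> $omega1. ?M z : $M})" by (subst elts_sep, intro dfb) (use z Y in blast)
  then show "\<exists>x\<in>$(vset {z \<in> $omega1. ?M z : $M}). x : $omega1 & ?cl x" using z by blast
qed

text \<open>Internal stationarity makes the collapse good, while guessing is responsible for the
  missing real.\<close>

theorem rich_GIS:
  assumes r: "rich M" and G: "GIS_omega1 M"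
  shows "good (collapse M) (reals M)" "dec_closed (reals M)" "\<exists>x. $x <= $omega & x \<notin> $(reals M)"
    "!!l. l : $M ==> Ord l ==> col M l : $omega2 & col M l : $(collapse M)"
proof -
  obtain N where N: "is_collapse M N" and ap1: "omega1_approximation N" using G unfolding GIS_omega1_def G_omega1_def guessing_def by blast
  have IS: "stationary (vset ($M \<inter> $(ctbl_subsets M))) M" and w1: "$omega1 <= $M" and eq: "eqpoll M omega1"
    using G unfolding GIS_omega1_def IS_omega1_def by blast+
  have inj: "x : $M ==> y : $M ==> col M x = col M y ==> x = y" for x y using is_collapse_col(1)[OF N] unfolding inj_on_def by blast
  note iso = is_collapse_col(3)[OF N]
  have NM: "N = collapse M" by (rule is_collapse_col(2)[OF N])
  have eN: "$N = col M ` $M" unfolding NM by (rule elts_collapse)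
  have tN: "transitive N" using N unfolding is_collapse_def by blast
  have dc: "deft (%e. col c (e 0))" for c by (intro dfb)
  have cap: "x : $M ==> y : $M ==> vset ($x \<inter> $y) : $M" for x y using r unfolding rich_def by blast
  have r2: "c : $M ==> a : $M ==> $a <= $c ==> ctbl c ==> $(vset (col c ` $a)) <= $omega1 ==> vset (col c ` $a) : $M"
    and r3: "c : $M ==> b : $M ==> vset {y \<in> $c. col c y : $b} : $M"
    and r5: "b : $M ==> a : $M ==> vset {x \<in> $b. phi b x : $a} : $M"
    and r4: "x : $M ==> y : $M ==> z : $M ==> w : $M ==> dec x y z w : $M" for a b c x y z w
    using r unfolding rich_def by blast+
  obtain g where g0: "func g M omega1" "bij_betw (app g) ($M) ($omega1)" using eq unfolding eqpoll_def bijection_def by blast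
  have ga: "app g x = ap g x" if "x : $M" for x by (rule func_ap[OF g0(1) that])
  have g: "inj_on (ap g) ($M)" "ap g ` $M = $omega1"
    using g0(2) ga unfolding bij_betw_def by (auto simp: inj_on_def)
  have dg: "deft (%e. ap g (e 0))" by (intro dfb)
  let ?M = "%z. vset {y \<in> $M. ap g y : $z}"
  have eM: "$(?M z) = {y \<in> $M. ap g y : $z}" for z by (rule elts_sep) (intro dfb)
  define S where "S = vset {z \<in> $omega1. ?M z : $M}"
  have eS: "$S = {z \<in> $omega1. ?M z : $M}" unfolding S_def by (rule elts_sep) (intro dfb)
  have st: "stat omega1 S" unfolding S_def by (rule IS_stat[OF IS g])
  have sub: "$z <= $omega1" if "z : $omega1" for z using Ord_trans[OF Ord_omega1 _ that] by blast
  \<comment> \<open>Since \<open>omega1\<close> is included in \<open>M\<close>, the collapse fixes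
    countable ordinals, and then also subsets of \<open>omega1\<close>.\<close>
  have fix1: "z : $omega1 --> col M z = z" for z
  proof (rule mem_induct[where Q = "%z. z : $omega1 --> col M z = z"])
    show "defb (%e. e 0 : $omega1 --> col M (e 0) = e 0)" by (intro dfb)
    fix z assume IH: "!!y. y : $z ==> y : $omega1 --> col M y = y"
    show "z : $omega1 --> col M z = z"
    proof (intro impI vsetI)
      assume z: "z : $omega1"
      have "$z \<inter> $M = $z" using sub[OF z] w1 by blast
      moreover have "col M ` $z = (%y. y) ` $z" by (rule image_cong[OF refl]) (use IH sub[OF z] in blast)
      ultimately show "$(col M z) = $z" unfolding elts_col by simp
    qed
  qed
  have fix2: "col M x = x" if x: "$x <= $omega1" for x
  proof (rule vsetI)
    have "$x \<inter> $M = $x" using x w1 by blast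
    moreover have "col M ` $x = (%y. y) ` $x" by (rule image_cong[OF refl]) (use fix1 x in blast)
    ultimately show "$(col M x) = $x" unfolding elts_col by simp
  qed
  \<comment> \<open>A preimage \<open>x'\<close> of a countable subset of \<open>omega1\<close> may
    be cut down to a countable bound \<open>b\<close> without changing its collapse. By injectivity
    it is already included in \<open>b\<close>, so it equals its collapse.\<close>
  have RN: "x : $N \<longleftrightarrow> x : $M" if x: "$x <= $omega1" "ctbl x" for x
  proof
    assume "x : $M" then show "x : $N" unfolding eN using fix2[OF x(1)] by (metis imageI)
  next
    assume "x : $N"
    then obtain x' where x': "x' : $M" "x = col M x'" unfolding eN by blast
    obtain b where b: "b : $omega1" "$x <= $b" using ctbl_bounded_omega1[OF x] by blast
    have bM: "b : $M" using b(1) w1 by blast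
    have eb: "$(vset ($x' \<inter> $b)) = $x' \<inter> $b" by simp
    have "col M (vset ($x' \<inter> $b)) = col M x'"
    proof (rule vsetI, unfold elts_col eb, intro equalityI subsetI)
      fix w assume "w : col M ` ($x' \<inter> $M)"
      then obtain y where y: "y : $x'" "y : $M" "w = col M y" by blast
      have "w : $x" unfolding x'(2) elts_col using y by blast
      then have wb: "w : $b" using b(2) by blast
      then have "w : $omega1" using sub[OF b(1)] by blast
      then have "col M w = col M y" "w : $M" using fix1 y(3) w1 by auto
      then have "y = w" using inj y(2) by metis
      then show "w : col M ` ($x' \<inter> $b \<inter> $M)" using y wb by blast
    qed blast
    then have "vset ($x' \<inter> $b) = x'" using inj cap[OF x'(1) bM] x'(1) by blast
    then have "$x' <= $b" using eb by auto
    then have "col M x' = x'" using sub[OF b(1)] by (intro fix2) blast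
    then show "x : $M" using x' by simp
  qed
  \<comment> \<open>The inverse of the collapse, written as a union to be definable.\<close>
  define iv where "iv w = vset {u. \<exists>x\<in>$M. col M x = w & u : $x}" for w
  have iv: "iv (col M x) = x" if "x : $M" for x
  proof -
    have "{u. \<exists>y\<in>$M. col M y = col M x & u : $y} = $x" using inj that by blast
    then show ?thesis unfolding iv_def by simp
  qed
  have d: "deft (%e. ap g (iv (e 0)))" unfolding iv_def by (intro dfb)
  have lN: "lepoll N omega1"
  proof (rule lepollI[OF d])
    fix x assume "x : $N"
    then obtain a where a: "a : $M" "x = col M a" unfolding eN by blast
    then show "ap g (iv x) : $omega1" using iv[OF a(1)] g(2) by auto
    fix y assume "y : $N" and eq: "ap g (iv x) = ap g (iv y)"
    then obtain b where b: "b : $M" "y = col M b" unfolding eN by blast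
    have "ap g a = ap g b" using eq iv[OF a(1)] iv[OF b(1)] a(2) b(2) by simp
    then have "a = b" by (rule inj_onD[OF g(1) _ a(1) b(1)])
    then show "x = y" using a(2) b(2) by simp
  qed
  show "good (collapse M) (reals M)"
    unfolding NM[symmetric] good_def
  proof (intro conjI ballI impI allI)
    show "transitive N" by (rule tN)
    show "\<exists>f. (\<forall>x\<in>$N. ap f x : $omega1) & inj_on (ap f) ($N) & stat omega1 (vset {z \<in> $omega1. vset {x \<in> $N. ap f x : $z} : $N})"
    proof -
      define f where "f = lam N (%w. ap g (iv w))"
      have f: "ap f (col M x) = ap g x" if x: "x : $M" for x
      proof -
        have "ap f (col M x) = ap g (iv (col M x))" unfolding f_def by (rule ap_lam[OF d]) (use x eN in blast)
        then show ?thesis using iv[OF x] by simp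
      qed
      have S': "$S <= $(vset {z \<in> $omega1. vset {x \<in> $N. ap f x : $z} : $N})"
      proof
        fix z assume "z : $S"
        then have z: "z : $omega1" "?M z : $M" using eS by auto
        have "vset {x \<in> $N. ap f x : $z} = col M (?M z)"
        proof (rule vsetI)
          have "$(vset {x \<in> $N. ap f x : $z}) = {x \<in> $N. ap f x : $z}" by (rule elts_sep) (intro dfb)
          also have "\<dots> = col M ` ($(?M z) \<inter> $M)" unfolding eM eN using f by auto
          finally show "$(vset {x \<in> $N. ap f x : $z}) = $(col M (?M z))" unfolding elts_col .
        qed
        then have "vset {x \<in> $N. ap f x : $z} : $N" using z(2) eN by simp
        then show "z : $(vset {z \<in> $omega1. vset {x \<in> $N. ap f x : $z} : $N})"
          by (subst elts_sep, intro dfb) (use z in blast)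
      qed
      have "stat omega1 (vset {z \<in> $omega1. vset {x \<in> $N. ap f x : $z} : $N})" by (rule stat_mono[OF st S'])
      moreover have "ap f x : $omega1" if "x : $N" for x using that f g(2) eN by auto
      moreover have "inj_on (ap f) ($N)" unfolding eN using f g(1) by (auto simp: inj_on_def)
      ultimately show ?thesis by blast
    qed
  next
    fix x y assume "x : $N" "y : $N"
    then obtain a b where ab: "a : $M" "x = col M a" "b : $M" "y = col M b" unfolding eN by blast
    have "vset ($x \<inter> $y) = col M (vset ($a \<inter> $b))"
      by (rule vsetI, unfold elts_Int, unfold ab(2,4) elts_col elts_Int) (use inj in blast)
    then show "vset ($x \<inter> $y) : $N" using cap[OF ab(1,3)] eN by simp
  next
    fix c A assume cN: "c : $N" and c: "ctbl c & (\<forall>y\<in>$c. Ord y)" and A: "$A <= $c"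
    obtain c1 where c1: "c1 : $M" "c = col M c1" using cN eN by blast
    have "ctbl (vset ($c1 \<inter> $M))"
    proof -
      have "lepoll (vset ($c1 \<inter> $M)) c"
        by (rule lepollI[OF dc[of M]]) (use inj in \<open>auto simp: c1(2) elts_col\<close>)
      then show ?thesis using c lepoll_trans unfolding ctbl_def by blast
    qed
    then have "\<exists>b\<in>$omega1. \<forall>i\<in>$(vset ($c1 \<inter> $M)). ap g i : $b"
      unfolding ctbl_def by (rule bnd_image[OF bnd_omega1 dg _ omega_omega1]) (use g(2) in auto)
    then obtain b where b: "b : $omega1" "\<forall>i\<in>$c1 \<inter> $M. ap g i : $b" by auto
    \<comment> \<open>The preimage \<open>c1\<close> of the cover may have elements outside
      \<open>M\<close>. Intersecting it with a piece that belongs to \<open>M\<close> and covers its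
      part in \<open>M\<close> gives \<open>c'\<close>, which is countable, included in
      \<open>M\<close> and still mapped onto \<open>c\<close>.\<close>
    obtain z where z: "z : $S" "b : $z" using stat_unbounded[OF bnd_omega1 st b(1)] by blast
    have z': "z : $omega1" "?M z : $M" using z(1) eS by auto
    define c' where "c' = vset ($(?M z) \<inter> $c1)"
    have ec': "$c' = $(?M z) \<inter> $c1" unfolding c'_def by (rule elts_Int)
    have c'M: "c' : $M" "$c' <= $M" using cap[OF z'(2) c1(1)] c'_def ec' eM by auto
    have "$c' \<inter> $M = $c1 \<inter> $M"
      unfolding ec' eM using b(2) Ord_trans[OF Ord_mem[OF Ord_omega1 z'(1)] _ z(2)] by blast
    then have ec: "$c = col M ` $c'" unfolding c1(2) elts_col using c'M(2) by blast
    have cc': "ctbl c'" by (rule ctbl_subset[OF ctbl_fibre[OF dg g(1) ctbl_omega1_mem[OF z'(1)]]]) (use ec' in blast)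
    \<comment> \<open>Collapsing along \<open>c\<close> after collapsing \<open>M\<close> is the
      same as collapsing along \<open>c'\<close>. Hence the subsets of \<open>c\<close> correspond
      to subsets of \<open>c'\<close> with the same image in \<open>omega1\<close>.\<close>
    have tt: "x : $M --> col c (col M x) = col c' x" for x
    proof (rule mem_induct[where Q = "%x. x : $M --> col c (col M x) = col c' x"])
      show "defb (%e. e 0 : $M --> col c (col M (e 0)) = col c' (e 0))" by (intro dfb)
      fix x assume IH: "!!y. y : $x ==> y : $M --> col c (col M y) = col c' y"
      show "x : $M --> col c (col M x) = col c' x"
      proof (intro impI vsetI)
        assume x: "x : $M"
        have "$(col M x) \<inter> $c = col M ` ($x \<inter> $c')" unfolding elts_col[of M] ec using inj c'M(2) by blast
        then have "$(col c (col M x)) = (%y. col c (col M y)) ` ($x \<inter> $c')" unfolding elts_col[of c] by (simp add: image_image)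
        also have "\<dots> = col c' ` ($x \<inter> $c')" by (rule image_cong[OF refl]) (use IH c'M(2) in blast)
        finally show "$(col c (col M x)) = $(col c' x)" unfolding elts_col[of c'] .
      qed
    qed
    show "A : $N \<longleftrightarrow> vset (col c ` $A) : $(reals M)"
    proof
      assume "A : $N"
      then obtain a1 where a1: "a1 : $M" "A = col M a1" using eN by blast
      define a where "a = vset ($a1 \<inter> $c')"
      have ea: "$a = $a1 \<inter> $c'" unfolding a_def by (rule elts_Int)
      have aM: "a : $M" unfolding a_def by (rule cap[OF a1(1) c'M(1)])
      have eA: "$A = col M ` $a"
      proof
        show "$A <= col M ` $a"
        proof
          fix w assume w: "w : $A"
          then obtain y where y: "y : $a1" "y : $M" "w = col M y" unfolding a1(2) elts_col by blast
          obtain y' where y': "y' : $c'" "w = col M y'" using w A ec by blast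
          have "y = y'" by (rule inj[OF y(2) subsetD[OF c'M(2) y'(1)]]) (use y(3) y'(2) in simp)
          then show "w : col M ` $a" unfolding ea using y y'(1) by blast
        qed
        show "col M ` $a <= $A" unfolding a1(2) elts_col ea using c'M(2) by blast
      qed
      have im: "col c ` $A = col c' ` $a"
      proof -
        have "col c ` $A = (%y. col c (col M y)) ` $a" unfolding eA by (simp add: image_image)
        also have "\<dots> = col c' ` $a" by (rule image_cong[OF refl]) (use tt ea c'M(2) in blast)
        finally show ?thesis .
      qed
      have eB: "$(vset (col c' ` $a)) = col c' ` $a" by (rule elts_image[OF dc])
      have "col c ` $A <= $omega1" by (rule image_subsetI, rule col_omega1) (use c A in blast)+
      then have B1: "$(vset (col c' ` $a)) <= $omega1" by (simp only: eB im)
      have "ctbl (vset (col c' ` $a))" by (rule ctbl_image[OF dc ctbl_subset[OF cc']]) (use ea in blast)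
      moreover have "$a <= $c'" using ea by blast
      then have "vset (col c' ` $a) : $M" by (rule r2[OF c'M(1) aM _ cc' B1])
      ultimately show "vset (col c ` $A) : $(reals M)" unfolding im elts_reals using B1 by blast
    next
      assume B: "vset (col c ` $A) : $(reals M)"
      let ?B = "vset (col c ` $A)"
      have eB: "$?B = col c ` $A" by (rule elts_image[OF dc])
      have BM: "?B : $M" using B elts_reals by blast
      define a where "a = vset {y \<in> $c'. col c' y : $?B}"
      have "$a = {y \<in> $c'. col c' y : $?B}" unfolding a_def by (rule elts_sep) (intro dfb)
      then have ea: "$a = {y \<in> $c'. col c' y : col c ` $A}" unfolding eB .
      have aM: "a : $M" unfolding a_def by (rule r3[OF c'M(1) BM])
      have "A = col M a"
      proof (rule vsetI, unfold elts_col, intro equalityI subsetI)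
        fix w assume w: "w : $A"
        then obtain y where y: "y : $c'" "w = col M y" using A ec by blast
        then have "col c' y = col c w" using tt c'M(2) by auto
        then show "w : col M ` ($a \<inter> $M)" using y w ea c'M(2) by blast
      next
        fix w assume "w : col M ` ($a \<inter> $M)"
        then obtain y where y: "y : $c'" "col c' y : col c ` $A" "w = col M y" using ea by blast
        then obtain v where v: "v : $A" "col c w = col c v" using tt c'M(2) by auto
        have wc: "w : $c" "v : $c" using y ec v A by blast+
        have "w = v" by (rule col_inj[OF _ _ wc v(2)]) (use c wc in blast)+
        then show "w : $A" using v by simp
      qed
      then show "A : $N" using aM eN by simp
    qed
  qed
  have om: "$x <= $omega1 & ctbl x" if "$x <= $omega" for x
    using that sub[OF omega_omega1] ctbl_subset[of omega x] by (auto simp: ctbl_def)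
  show "dec_closed (reals M)"
    unfolding dec_closed_def
  proof (intro ballI)
    fix x y z w assume "x : $(reals M)" "y : $(reals M)" "z : $(reals M)" "w : $omega1"
    then have "dec x y z w : $M" by (intro r4) (use w1 elts_reals in blast)+
    moreover have "$(dec x y z w) <= $omega" using elts_dec by blast
    ultimately show "dec x y z w : $(reals M)" using om unfolding elts_reals by blast
  qed
  show "col M l : $omega2 & col M l : $(collapse M)" if l: "l : $M" "Ord l" for l
  proof -
    have n: "col M l : $N" using l eN by blast
    then have "$(col M l) <= $N" using tN unfolding transitive_def by blast
    then have "lepoll (col M l) omega1" using lepoll_trans[OF lepoll_subset lN] by blast
    then show ?thesis using n NM Ord_col[OF l(2)] elts_omega2 by simp
  qed
  show "\<exists>x. $x <= $omega & x \<notin> $(reals M)"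
  proof (rule ccontr)
    assume "\<not> ?thesis"
    \<comment> \<open>If all reals were in \<open>M\<close>, coding by \<open>phi\<close> would put
      all bounded subsets of \<open>omega1\<close> into the collapse, and the approximation property
      then all its subsets. But the collapse has size \<open>omega1\<close>, so a diagonal set
      refutes this.\<close>
    then have all: "x : $M" if "$x <= $omega" for x using that elts_reals by blast
    have bd: "x : $N" if x: "$x <= $omega1" "ctbl x" for x
    proof -
      obtain b where b: "b : $omega1" "$x <= $b" using ctbl_bounded_omega1[OF x] by blast
      have d: "deft (%e. phi b (e 0))" by (intro dfb)
      let ?r = "vset (phi b ` $x)"
      have er: "$?r = phi b ` $x" by (rule elts_image[OF d])
      have rM: "?r : $M" by (rule all, unfold er, rule image_subsetI, rule phi(1)[OF b(1)]) (use b(2) in blast)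
      have bM: "b : $M" using b(1) w1 by blast
      have "vset {v \<in> $b. phi b v : $?r} = x"
      proof (rule vsetI)
        have "$(vset {v \<in> $b. phi b v : $?r}) = {v \<in> $b. phi b v : $?r}" by (rule elts_sep) (intro dfb)
        also have "\<dots> = $x" unfolding er using inj_on_image_mem_iff[OF phi(2)[OF b(1)] _ b(2)] b(2) by blast
        finally show "$(vset {v \<in> $b. phi b v : $?r}) = $x" .
      qed
      moreover have "vset {v \<in> $b. phi b v : $?r} : $M" by (rule r5[OF bM rM])
      ultimately show ?thesis using RN[OF x] by simp
    qed
    have AN: "A : $N" if A: "$A <= $omega1" for A
    proof -
      have "vset ($z \<inter> $A) : $N" if "injection f z omega" for z f
        by (rule bd) (use A that ctbl_subset[of z "vset ($z \<inter> $A)"] in \<open>auto simp: ctbl_def lepoll_def\<close>)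
      moreover have "\<forall>A. $A <= $omega1 & (\<forall>z\<in>$N. (\<exists>f\<in>$N. injection f z omega) --> vset ($z \<inter> $A) : $N) --> A : $N"
        using ap1 unfolding omega1_approximation_def by blast
      ultimately show ?thesis using A by blast
    qed
    obtain f where f: "!!x. x : $N ==> ap f x : $omega1" "inj_on (ap f) ($N)" using lN unfolding lepoll_iff by blast
    define A where "A = vset {z \<in> $omega1. \<exists>x\<in>$N. ap f x = z & z \<notin> $x}"
    have A: "$A = {z \<in> $omega1. \<exists>x\<in>$N. ap f x = z & z \<notin> $x}" unfolding A_def by (rule elts_sep) (intro dfb)
    have "A : $N" by (rule AN) (use A in blast)
    then have "(\<exists>x\<in>$N. ap f x = ap f A & ap f A \<notin> $x) \<longleftrightarrow> ap f A \<notin> $A" using inj_onD[OF f(2)] by blast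
    moreover have "ap f A : $A \<longleftrightarrow> ap f A : $omega1 & (\<exists>x\<in>$N. ap f x = ap f A & ap f A \<notin> $x)" unfolding A by simp
    ultimately show False using f(1)[OF \<open>A : $N\<close>] by blast
  qed
qed

subsection \<open>Almost all members of a normal ideal's underlying set\<close>

definition ae :: "'v \<Rightarrow> 'v \<Rightarrow> ('v \<Rightarrow> bool) \<Rightarrow> bool" where
  "ae Z I Q \<longleftrightarrow> vset {M \<in> $Z. \<not> Q M} : $I"

context
  fixes Z I assumes ideal: "ideal Z I"
begin

lemma ideal_mono: "A : $I ==> $A' <= $A ==> A' : $I"
  using ideal unfolding ideal_def by blast
lemma ideal_union: "$X <= $I ==> ctbl X ==> union X : $I"
  using ideal unfolding ideal_def by blast
lemma positive_nonempty: "S \<notin> $I ==> $S \<noteq> {}"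
proof
  assume S: "S \<notin> $I" "$S = {}"
  have "union zero : $I" by (rule ideal_union) (auto simp: ctbl_def intro: lepoll_subset)
  then show False using ideal_mono[of "union zero" S] S by simp
qed
lemma elts_ae: "defb (%e. Q (e 0)) ==> $(vset {M \<in> $Z. \<not> Q M}) = {M \<in> $Z. \<not> Q M}"
  by (rule elts_sep) (intro dfb)
lemma ae_mono:
  assumes "defb (%e. Q (e 0))" "defb (%e. Q' (e 0))" "ae Z I Q" "!!M. M : $Z ==> Q M ==> Q' M" shows "ae Z I Q'"
  unfolding ae_def
  by (rule ideal_mono[OF assms(3)[unfolded ae_def]]) (unfold elts_ae[OF assms(1)] elts_ae[OF assms(2)], use assms(4) in blast)
lemma ae_conj:
  assumes d: "defb (%e. Q (e 0))" "defb (%e. Q' (e 0))" and a: "ae Z I Q" "ae Z I Q'" shows "ae Z I (%M. Q M & Q' M)"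
proof -
  let ?A = "vset {M \<in> $Z. \<not> Q M}" and ?B = "vset {M \<in> $Z. \<not> Q' M}"
  have d2: "defb (%e. Q (e 0) & Q' (e 0))" by (intro dfb d)
  have "union (vset {?A, ?B}) : $I" by (rule ideal_union[OF _ ctbl_upair]) (use a in \<open>simp add: ae_def\<close>)
  then show ?thesis unfolding ae_def
    by (rule ideal_mono) (unfold elts_ae[OF d2] elts_union elts_upair, use elts_ae[OF d(1)] elts_ae[OF d(2)] in auto)
qed
lemma ae_positive:
  assumes d: "defb (%e. Q (e 0))" and a: "ae Z I Q" and S: "$S <= $Z" "S \<notin> $I" shows "vset {M \<in> $S. Q M} \<notin> $I"
proof
  let ?A = "vset {M \<in> $S. Q M}" and ?B = "vset {M \<in> $Z. \<not> Q M}"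
  have A: "$?A = {M \<in> $S. Q M}" by (rule elts_sep[OF d])
  assume "?A : $I"
  then have "union (vset {?A, ?B}) : $I" by (intro ideal_union[OF _ ctbl_upair]) (use a in \<open>simp add: ae_def\<close>)
  then have "S : $I" by (rule ideal_mono) (unfold elts_union elts_upair, use A elts_ae[OF d] S(1) in auto)
  then show False using S(2) by blast
qed
lemma ae_fine: "b : $(union Z) ==> ae Z I (%M. b : $M)"
  unfolding ae_def using ideal unfolding ideal_def by blast
lemma press:
  assumes S: "$S <= $Z" "S \<notin> $I" and g: "func g S X" "!!M. M : $S ==> ap g M : $M"
  shows "\<exists>S' c. $S' <= $S & S' \<notin> $I & (\<forall>M\<in>$S'. ap g M = c)"
proof -
  have a: "app g M = ap g M" if "M : $S" for M by (rule func_ap[OF g(1) that])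
  have f: "function_on g S" using g(1) unfolding function_on_def by blast
  have n: "\<forall>S g. $S <= $Z & S \<notin> $I & function_on g S & (\<forall>M\<in>$S. app g M : $M) -->
        (\<exists>S'. $S' <= $S & S' \<notin> $I & (\<exists>c. \<forall>M\<in>$S'. app g M = c))"
    using ideal unfolding ideal_def by (elim conjE)
  have "\<forall>M\<in>$S. app g M : $M" using g(2) a by simp
  then obtain S' c where s: "$S' <= $S" "S' \<notin> $I" "\<forall>M\<in>$S'. app g M = c"
    using n[rule_format, of S g] S f by blast
  have "\<forall>M\<in>$S'. ap g M = c"
  proof
    fix M assume M: "M : $S'"
    show "ap g M = c" using a[OF subsetD[OF s(1) M]] bspec[OF s(3) M] by (rule trans[OF sym])
  qed
  then show ?thesis using s by blast
qed
text \<open>Diagonal intersections: if the exceptional set were positive, choosing a counterexample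
  in each \<open>M\<close> would be regressive, and a single counterexample would be bad for a
  positive set.\<close>

lemma ae_diag:
  assumes d: "defb (%e. Q (e 0) (e 1))" and a: "!!x. x : $(union Z) ==> ae Z I (%M. Q M x)"
  shows "ae Z I (%M. \<forall>x\<in>$M. Q M x)"
proof (rule ccontr)
  have d': "deft t ==> deft s ==> defb (%e. Q (t e) (s e))" for t s by (rule defb_subst2[OF d])
  let ?S = "vset {M \<in> $Z. \<not> (\<forall>x\<in>$M. Q M x)}"
  have S: "$?S = {M \<in> $Z. \<not> (\<forall>x\<in>$M. Q M x)}" by (rule elts_sep) (intro dfb d')
  assume "\<not> ?thesis"
  then have pos: "?S \<notin> $I" unfolding ae_def .
  have "\<exists>g. func g ?S (union Z) & (\<forall>M\<in>$?S. ap g M : $M & \<not> Q M (ap g M))"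
  proof (rule choice_func[where Q = "%M x. x : $M & \<not> Q M x"])
    show "defb (%e. e 1 : $(e 0) & \<not> Q (e 0) (e 1))" by (intro dfb d')
  qed (use S in auto)
  then obtain g where g: "func g ?S (union Z)" "!!M. M : $?S ==> ap g M : $M & \<not> Q M (ap g M)" by blast
  have "\<exists>S' c. $S' <= $?S & S' \<notin> $I & (\<forall>M\<in>$S'. ap g M = c)"
    by (rule press[OF _ pos g(1)]) (use g(2) S in auto)
  then obtain S' c where S': "$S' <= $?S" "S' \<notin> $I" "\<forall>M\<in>$S'. ap g M = c" by blast
  obtain M where M: "M : $S'" using positive_nonempty[OF S'(2)] by blast
  have MS: "M : $?S" using M S'(1) by blast
  have "ap g M = c" using S'(3) M by blast
  then have "c : $M" "M : $Z" using g(2)[OF MS] MS[unfolded S] by auto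
  then have "ae Z I (%M. Q M c)" by (intro a) auto
  moreover have e: "$(vset {M \<in> $Z. \<not> Q M c}) = {M \<in> $Z. \<not> Q M c}" by (rule elts_sep) (intro dfb d')
  moreover have "$S' <= {M \<in> $Z. \<not> Q M c}"
  proof
    fix M assume M: "M : $S'"
    have MS: "M : $?S" using M S'(1) by blast
    have "ap g M = c" using S'(3) M by blast
    then show "M : {M \<in> $Z. \<not> Q M c}" using g(2)[OF MS] MS[unfolded S] by auto
  qed
  ultimately show False using ideal_mono S'(2) unfolding ae_def by metis
qed

text \<open>By fineness each value lies in almost all \<open>M\<close>; four diagonal intersections
  make this uniform in the arguments. The arity is that of \<open>dec\<close>, and operations with
  fewer arguments are padded.\<close>

lemma ae_closed:
  assumes d: "!!x y z. deft (%e. F x y z (e 0))" "!!x y. deft (%e. F x y (e (Suc 0)) (e 0))"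
    "!!x. deft (%e. F x (e (Suc (Suc 0))) (e (Suc 0)) (e 0))" "deft (%e. F (e (Suc (Suc (Suc 0)))) (e (Suc (Suc 0))) (e (Suc 0)) (e 0))"
    and F: "!!x y z w. x : $(union Z) ==> y : $(union Z) ==> z : $(union Z) ==> w : $(union Z) ==> F x y z w : $(union Z)"
  shows "ae Z I (%M. \<forall>x\<in>$M. \<forall>y\<in>$M. \<forall>z\<in>$M. \<forall>w\<in>$M. F x y z w : $M)"
proof -
  have d1: "deft t ==> deft (%e. F x y z (t e))" for x y z t by (rule deft_subst[OF d(1)])
  have d2: "deft t ==> deft s ==> deft (%e. F x y (s e) (t e))" for x y t s 
    by (rule deft_subst2[where F = "%w z. F x y z w"]) (use d(2) in simp)
  show ?thesis
  proof (rule ae_diag)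
    show "defb (%e. \<forall>y\<in>$(e 0). \<forall>z\<in>$(e 0). \<forall>w\<in>$(e 0). F (e 1) y z w : $(e 0))"
      by (intro dfb) (use deft_ren[OF d(4), of "%n. if n = Suc (Suc (Suc 0)) then Suc (Suc (Suc (Suc 0))) else n"] in simp)
    fix x assume x: "x : $(union Z)"
    show "ae Z I (%M. \<forall>y\<in>$M. \<forall>z\<in>$M. \<forall>w\<in>$M. F x y z w : $M)"
    proof (rule ae_diag)
      show "defb (%e. \<forall>z\<in>$(e 0). \<forall>w\<in>$(e 0). F x (e 1) z w : $(e 0))"
        by (intro dfb) (use deft_ren[OF d(3), of x "%n. if n = Suc (Suc 0) then Suc (Suc (Suc 0)) else n"] in simp)
      fix y assume y: "y : $(union Z)"
      show "ae Z I (%M. \<forall>z\<in>$M. \<forall>w\<in>$M. F x y z w : $M)"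
      proof (rule ae_diag)
        show "defb (%e. \<forall>w\<in>$(e 0). F x y (e 1) w : $(e 0))" by (intro dfb d2)
        fix z assume z: "z : $(union Z)"
        show "ae Z I (%M. \<forall>w\<in>$M. F x y z w : $M)"
        proof (rule ae_diag)
          show "defb (%e. F x y z (e 1) : $(e 0))" by (intro dfb d1)
          show "ae Z I (%M. F x y z w : $M)" if "w : $(union Z)" for w by (rule ae_fine[OF F[OF x y z that]])
        qed
      qed
    qed
  qed
qed

end

lemma defb_rich [dfb]: assumes "deft t" shows "defb (%e. rich (t e))"
  by (rule defb_subst[where Q = rich, OF _ assms]) (unfold rich_def, intro dfb)

lemma ae_rich:
  assumes i: "ideal Z I" and Z: "$(union Z) = $(H l)" and l: "Ord l" "omega1 : $l" shows "ae Z I rich"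
proof -
  have sub: "y : $(union Z)" if "x : $(union Z)" "$y <= $x" for x y using H_subset'[OF l(1)] that unfolding Z by blast
  have w: "omega1 : $(union Z)" unfolding Z by (rule Ord_in_H[OF l])
  have w0: "$x <= $omega1 ==> x : $(union Z)" for x by (rule sub[OF w])
  have om: "$omega <= $omega1" using Ord_trans[OF Ord_omega1 _ omega_omega1] by blast
  have dc: "deft (%e. col c (e 0))" for c by (intro dfb)
  \<comment> \<open>The default \<open>zero\<close> keeps the values inside \<open>H l\<close> when
    the collapsed set is not a subset of \<open>omega1\<close>.\<close>
  let ?F2 = "%c a. if $(vset (col c ` $a)) <= $omega1 then vset (col c ` $a) else zero"
  let ?F3 = "%c b. vset {y \<in> $c. col c y : $b}"
  let ?F5 = "%b r. vset {x \<in> $b. phi b x : $r}"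
  have e3: "$(?F3 c b) = {y \<in> $c. col c y : $b}" for c b by (rule elts_sep) (intro dfb)
  have e5: "$(?F5 b r) = {x \<in> $b. phi b x : $r}" for b r by (rule elts_sep) (intro dfb)
  let ?A = "%F M. \<forall>x\<in>$M. \<forall>y\<in>$M. \<forall>z\<in>$M. \<forall>w\<in>$M. F x y z w : $M"
  have a1: "ae Z I (?A (%x y z w. vset ($x \<inter> $y)))"
    by (rule ae_closed[OF i]; (intro dfb)?) (use sub in auto)
  have a2: "ae Z I (?A (%c a z w. ?F2 c a))"
    by (rule ae_closed[OF i]; (intro dfb)?) (use w0 in \<open>auto simp: w0\<close>)
  have a3: "ae Z I (?A (%c b z w. ?F3 c b))"
    by (rule ae_closed[OF i]; (intro dfb)?) (rule sub, assumption, use e3 in blast)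
  have a5: "ae Z I (?A (%b r z w. ?F5 b r))"
    by (rule ae_closed[OF i]; (intro dfb)?) (rule sub, assumption, use e5 in blast)
  have a4: "ae Z I (?A dec)"
    by (rule ae_closed[OF i]; (intro dfb)?) (rule w0, use elts_dec om in blast)
  let ?Q = "%M. omega1 : $M & ?A (%x y z w. vset ($x \<inter> $y)) M & ?A (%c a z w. ?F2 c a) M & ?A (%c b z w. ?F3 c b) M &
    ?A (%b r z w. ?F5 b r) M & ?A dec M"
  have q: "ae Z I ?Q" by (intro ae_conj[OF i] ae_fine[OF i] a1 a2 a3 a4 a5 w dfb)
  show ?thesis
  proof (rule ae_mono[OF i _ _ q])
    show "defb (%e. ?Q (e 0))" by (intro dfb)
    show "defb (%e. rich (e 0))" by (intro dfb)
    fix M assume q: "?Q M"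
    have 1: "omega1 : $M" using q by blast
    have 2: "vset (col c ` $a) : $M" if "c : $M" "a : $M" "$(vset (col c ` $a)) <= $omega1" for c a
    proof -
      have "?F2 c a : $M" using q that(1,2) by blast
      then show ?thesis using that(3) by simp
    qed
    have 3: "?F3 c b : $M" if "c : $M" "b : $M" for c b using q that by blast
    have 5: "?F5 c b : $M" if "c : $M" "b : $M" for c b using q that by blast
    have 6: "vset ($c \<inter> $b) : $M" if "c : $M" "b : $M" for c b using q that by blast
    have 4: "dec x y z w : $M" if "x : $M" "y : $M" "z : $M" "w : $M" for x y z w using q that by blast
    show "rich M" unfolding rich_def
      by (intro conjI ballI impI 1 3 4 5 6; (rule 2)?) blast+
  qed
qed

subsection \<open>Towers of ideals\<close>

lemma elts_Zset: "$(Zset k l) = {M. $M <= $(H l) & card_less M k}"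
  unfolding Zset_def
proof (rule elts_vset[OF isset_bounded])
  show "defb (%e. $(e 0) <= $(H l) & card_less (e 0) k)" by (intro dfb)
  show "$x <= $(H l) & card_less x k ==> x : $(pow (H l))" for x by simp
qed
lemma deft_H [dfb]: "deft t ==> deft (%e. H (t e))"
  by (rule deft_subst[where F = H]) (unfold H_def, intro dfb)
lemma deft_Zset [dfb]: assumes "deft k" "deft l" shows "deft (%e. Zset (k e) (l e))"
  by (rule deft_subst2[where F = Zset, OF _ assms]) (unfold Zset_def, intro dfb)
lemma H_mono: "Ord l' ==> l : $l' \<or> l = l' ==> $(H l) <= $(H l')"
proof -
  assume l: "Ord l'" "l : $l' \<or> l = l'"
  have "$l <= $l'" using l Ord_trans by blast
  moreover have "Ord l" using l Ord_mem by blast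
  ultimately show ?thesis unfolding elts_H[OF l(1)] elts_H[OF \<open>Ord l\<close>] card_less_def by blast
qed
lemma union_Zset:
  assumes k: "regular k" and l: "Ord l" shows "$(union (Zset k l)) = $(H l)"
proof
  show "$(union (Zset k l)) <= $(H l)" by (auto simp: elts_Zset)
  show "$(H l) <= $(union (Zset k l))"
  proof
    fix x assume x: "x : $(H l)"
    have L: "Limit k" "Ord k" using k unfolding regular_def Limit_def by auto
    then obtain z where "z : $k" unfolding Limit_def by blast
    then have "zero : $k" using Ord_linear[OF Ord_zero L(2)] by auto
    then have s: "succ zero : $k" using Limit_succ[OF L(1)] by blast
    have "lepoll (vset {x}) (succ zero)" by (rule lepollI[where F = "%_. zero"], intro dfb) simp_all
    then have "vset {x} : $(Zset k l)" unfolding elts_Zset card_less_def using s x by auto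
    then show "x : $(union (Zset k l))" by (auto intro!: bexI[of _ "vset {x}"])
  qed
qed

text \<open>The bound \<open>g(R)\<close> of the overview. The ordinals below \<open>omega2\<close>
  occurring in good sets over \<open>R\<close> form an initial segment, so this set is itself the
  bound.\<close>

definition gbound :: "'v \<Rightarrow> 'v" where
  "gbound R = vset {a \<in> $omega2. \<exists>N. good N R & a : $N}"
lemma elts_gbound: "$(gbound R) = {a \<in> $omega2. \<exists>N. good N R & a : $N}"
  unfolding gbound_def by (rule elts_sep) (intro dfb)
lemma deft_gbound [dfb]: "deft t ==> deft (%e. gbound (t e))"
  by (rule deft_subst[where F = gbound]) (unfold gbound_def, intro dfb)
lemma gbound_omega2:
  assumes "SRP_omega2" "tree_property omega2" "dec_closed R" "$r <= $omega" "r \<notin> $R" shows "gbound R : $omega2"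
proof -
  obtain a where a: "a : $omega2" "\<forall>N. good N R --> a \<notin> $N" using not_all_good[OF assms] by blast
  have O2: "x : $omega2 ==> Ord x" for x using Ord_mem[OF Ord_omega2] .
  have tr: "y : $(gbound R)" if "x : $(gbound R)" "y : $x" for x y
    using that Ord_trans[OF Ord_omega2] unfolding elts_gbound good_def transitive_def by blast
  have "transitive x" if "x : $(gbound R)" for x using O2 that unfolding elts_gbound Ord_def by blast
  then have O: "Ord (gbound R)" using tr unfolding Ord_def transitive_def by blast
  have "a \<notin> $(gbound R)" using a unfolding elts_gbound by blast
  then have "$(gbound R) <= $a" using Ord_not_mem_iff[OF O2[OF a(1)] O] by blast
  then have "gbound R : $a \<or> gbound R = a" using Ord_subset_iff[OF O O2[OF a(1)]] by blast
  then show ?thesis using a(1) Ord_trans[OF Ord_omega2] by blast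
qed

text \<open>The countable ordinal that names \<open>l\<close> in \<open>M\<close>. It depends on
  \<open>M\<close> only through \<open>reals M\<close> and the order type of the part of
  \<open>M\<close> below \<open>l\<close>.\<close>

definition code :: "'v \<Rightarrow> 'v \<Rightarrow> 'v" where
  "code M l = J (gbound (reals M)) (col M l)"
lemma deft_code [dfb]: "deft t ==> deft s ==> deft (%e. code (t e) (s e))"
  unfolding code_def by (intro dfb)

context
  fixes \<delta> \<kappa> U I
  assumes SRP: "SRP_omega2" and TP: "tree_property omega2" and tower: "tower \<delta> \<kappa> U I"
    and conc: "tower_concentrates \<kappa> U I GIS_omega1" and reg: "regular \<delta>"
begin

abbreviation Z where "Z \<equiv> Zset \<kappa>"

lemma tower_props:
  "Ord \<delta>" "$U <= $\<delta>" "a : $\<delta> ==> \<exists>l\<in>$U. $a <= $l" "regular \<kappa>" "l : $U ==> $\<kappa> <= $l"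
  "l : $U ==> ideal (Z l) (ap I l)" "l : $U ==> Ord l" "l : $U ==> app I l = ap I l"
  "l : $U ==> l' : $U ==> $l <= $l' ==> projection (Z l) (ap I l) (Z l') (ap I l')"
proof -
  obtain b where b: "func I U b" using tower unfolding tower_def function_on_def by blast
  have a: "app I l = ap I l" if "l : $U" for l by (rule func_ap[OF b that])
  show "Ord \<delta>" "$U <= $\<delta>" "a : $\<delta> ==> \<exists>l\<in>$U. $a <= $l" "regular \<kappa>" "l : $U ==> $\<kappa> <= $l"
    using tower unfolding tower_def by blast+
  then show "l : $U ==> Ord l" using Ord_mem by blast
  show "l : $U ==> app I l = ap I l" by (rule a)
  show "l : $U ==> ideal (Z l) (ap I l)" using tower a unfolding tower_def by fastforce
  have "\<forall>l\<in>$U. \<forall>l'\<in>$U. $l <= $l' --> projection (Z l) (app I l) (Z l') (app I l')"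
    using tower unfolding tower_def by (elim conjE)
  then show "l : $U ==> l' : $U ==> $l <= $l' ==> projection (Z l) (ap I l) (Z l') (ap I l')"
    using a by metis
qed
lemmas U_Ord = tower_props(7) and U_ideal = tower_props(6)

lemma union_Z: "l : $U ==> $(union (Z l)) = $(H l)"
  by (rule union_Zset[OF tower_props(4) U_Ord])

text \<open>Some \<open>M\<close> in \<open>Z l\<close> is in \<open>GIS_omega1\<close>, since the
  ideal is proper. It includes \<open>omega1\<close> and has size less than
  \<open>\<kappa>\<close>.\<close>

lemma omega1_kappa: "omega1 : $\<kappa>"
proof -
  have "Limit \<delta>" using reg unfolding regular_def by blast
  then obtain l where l: "l : $U" using tower_props(3) unfolding Limit_def by blast
  obtain A where A: "$A <= $(Z l)" "vset ($(Z l) - $A) : $(ap I l)" "\<forall>M\<in>$A. GIS_omega1 M"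
    using conc l tower_props(8)[OF l] unfolding tower_concentrates_def concentrates_def by auto
  have "$A \<noteq> {}"
  proof
    assume "$A = {}"
    then have "Z l : $(ap I l)" using A(2) by simp
    then show False using U_ideal[OF l] unfolding ideal_def by blast
  qed
  then obtain M where M: "M : $(Z l)" "GIS_omega1 M" using A by blast
  obtain b where b: "b : $\<kappa>" "lepoll M b" using M(1) unfolding elts_Zset card_less_def by blast
  have "$omega1 <= $M" using M(2) unfolding GIS_omega1_def IS_omega1_def by blast
  then have w: "lepoll omega1 b" using lepoll_trans[OF lepoll_subset b(2)] by blast
  have Ok: "Ord \<kappa>" using tower_props(4) unfolding regular_def Limit_def by blast
  have Ob: "Ord b" by (rule Ord_mem[OF Ok b(1)])
  have "b \<notin> $omega1"
  proof
    assume "b : $omega1"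
    then have "ctbl omega1" using w lepoll_trans unfolding elts_omega1 ctbl_def by blast
    then show False using not_ctbl_omega1 by blast
  qed
  then have "omega1 : $b \<or> omega1 = b" using Ord_linear[OF Ob Ord_omega1] by blast
  then show ?thesis using b(1) Ord_trans[OF Ok] by blast
qed
lemma omega1_U: "l : $U ==> omega1 : $l" using omega1_kappa tower_props(5) by blast

definition typical :: "'v \<Rightarrow> bool" where
  "typical M \<longleftrightarrow> $omega1 <= $M & gbound (reals M) : $omega2 &
     (\<forall>l\<in>$M. Ord l --> col M l : $(gbound (reals M)))"
lemma defb_typical [dfb]: "deft t ==> defb (%e. typical (t e))"
  by (rule defb_subst[where Q = typical]) (unfold typical_def, intro dfb)

lemma ae_typical: assumes l: "l : $U" shows "ae (Z l) (ap I l) typical"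
proof -
  obtain A where A: "$A <= $(Z l)" "vset ($(Z l) - $A) : $(ap I l)" "\<forall>M\<in>$A. GIS_omega1 M"
    using conc l tower_props(8)[OF l] unfolding tower_concentrates_def concentrates_def by auto
  have e: "$(vset {M \<in> $(Z l). M \<notin> $A}) = {M \<in> $(Z l). M \<notin> $A}" by (rule elts_sep) (intro dfb)
  have "{M \<in> $(Z l). M \<notin> $A} = $(Z l) - $A" by blast
  then have a: "ae (Z l) (ap I l) (%M. M : $A)" unfolding ae_def using A(2) by simp
  have r: "ae (Z l) (ap I l) rich" by (rule ae_rich[OF U_ideal[OF l] union_Z[OF l] U_Ord[OF l] omega1_U[OF l]])
  have d: "defb (%e. e 0 : $A)" "defb (%e. rich (e 0))" by (intro dfb)+
  show ?thesis
  proof (rule ae_mono[OF U_ideal[OF l] _ _ ae_conj[OF U_ideal[OF l] d a r]])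
    fix M assume "M : $A & rich M"
    then have M: "rich M" "GIS_omega1 M" using A(3) by auto
    obtain r where r: "$r <= $omega" "r \<notin> $(reals M)" using rich_GIS(3)[OF M] by blast
    have "gbound (reals M) : $omega2" by (rule gbound_omega2[OF SRP TP rich_GIS(2)[OF M] r])
    moreover have "col M l : $(gbound (reals M))" if "l : $M" "Ord l" for l
      using rich_GIS(1)[OF M] rich_GIS(4)[OF M that] unfolding elts_gbound by blast
    moreover have "$omega1 <= $M" using M(2) unfolding GIS_omega1_def IS_omega1_def by blast
    ultimately show "typical M" unfolding typical_def by blast
  qed (intro dfb)+
qed

abbreviation P where "P \<equiv> tower_conditions \<kappa> U I"
abbreviation le where "le \<equiv> tower_order \<kappa> U I"

lemma elts_P: "pair l S : $P \<longleftrightarrow> l : $U & $S <= $(Z l) & S \<notin> $(ap I l)"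
  "p : $P ==> \<exists>l S. p = pair l S"
proof -
  let ?Q = "%p. \<exists>l S. p = pair l S & l : $U & $S <= $(Z l) & S \<notin> $(ap I l)"
  have Q: "{pair l S | l S. l : $U & S : positive (Z l) (app I l)} = {p. ?Q p}"
  proof (rule Collect_cong, intro iff_exI conj_cong refl)
    fix l S assume "l : $U"
    then show "S : positive (Z l) (app I l) \<longleftrightarrow> $S <= $(Z l) & S \<notin> $(ap I l)" using tower_props(8) unfolding positive_def by simp
  qed
  have dZ: "deft (%e. pow (Z (e 0)))" by (intro dfb)
  have "$P = {p. ?Q p}"
    unfolding tower_conditions_def Q
  proof (rule elts_vset[OF isset_bounded])
    show "defb (%e. ?Q (e 0))" by (intro dfb)
    show "p : $(prod U (vset (\<Union>l\<in>$U. $(pow (Z l)))))" if "?Q p" for p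
      using that elts_UN[OF dZ, of U] by auto
  qed
  then show "pair l S : $P \<longleftrightarrow> l : $U & $S <= $(Z l) & S \<notin> $(ap I l)" "p : $P ==> \<exists>l S. p = pair l S"
    by (auto simp: pair_inject)
qed
lemma pair_le: "pair (pair l' S') (pair l S) : $le \<longleftrightarrow> pair l' S' : $P & pair l S : $P & $l <= $l' &
    (\<forall>M\<in>$S'. vset ($M \<inter> $(H l)) : $S)"
  "z : $le ==> \<exists>l' S' l S. z = pair (pair l' S') (pair l S)"
proof -
  let ?Q = "%z. \<exists>l' S' l S. z = pair (pair l' S') (pair l S) & pair l' S' : $P & pair l S : $P & $l <= $l' &
    (\<forall>M\<in>$S'. vset ($M \<inter> $(H l)) : $S)"
  have Q: "{pair (pair l' S') (pair l S) | l' S' l S. pair l' S' : $P & pair l S : $P &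
        $l <= $l' & $S' <= {M' \<in> $(Z l'). vset ($M' \<inter> $(H l)) : $S}} = {z. ?Q z}"
    using elts_P(1) by blast
  have "$le = {z. ?Q z}"
    unfolding tower_order_def Q
  proof (rule elts_vset[OF isset_bounded])
    show "defb (%e. ?Q (e 0))" by (intro dfb)
    show "z : $(prod P P)" if "?Q z" for z using that by auto
  qed
  then show "pair (pair l' S') (pair l S) : $le \<longleftrightarrow> pair l' S' : $P & pair l S : $P & $l <= $l' &
    (\<forall>M\<in>$S'. vset ($M \<inter> $(H l)) : $S)" "z : $le ==> \<exists>l' S' l S. z = pair (pair l' S') (pair l S)"
    by (simp_all add: pair_inject) blast
qed

lemma Int_Int_H:
  assumes "$l <= $l'" "l : $U" "l' : $U"
  shows "vset ($(vset ($M \<inter> $(H l'))) \<inter> $(H l)) = vset ($M \<inter> $(H l))"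
proof -
  have "$(H l) <= $(H l')" using H_mono[OF U_Ord, of l' l] Ord_subset_iff[OF U_Ord U_Ord, of l l'] assms by blast
  then have "$M \<inter> $(H l') \<inter> $(H l) = $M \<inter> $(H l)" by blast
  then show ?thesis by simp
qed

lemma tower_forcing: "forcing mem P le"
proof (unfold_locales)
  fix p assume p: "p : $P"
  then obtain l S where lS: "p = pair l S" using elts_P(2) by blast
  have "vset ($M \<inter> $(H l)) : $S" if M: "M : $S" for M
  proof -
    have "$M \<inter> $(H l) = $M" using M p lS elts_P(1) elts_Zset by blast
    then show ?thesis using M by simp
  qed
  then show "pair p p : $le" using p unfolding lS pair_le(1) by blast
next
  fix p q assume "pair p q : $le"
  then show "p : $P & q : $P" using pair_le pair_inject by metis
next
  fix p q r assume a: "pair p q : $le" and b: "pair q r : $le"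
  obtain l S l' S' where 1: "p = pair l S" "q = pair l' S'" using pair_le(2)[OF a] pair_inject by metis
  obtain l'' S'' where 2: "r = pair l'' S''" using pair_le(2)[OF b] pair_inject by metis
  have a': "pair l S : $P" "pair l' S' : $P" "$l' <= $l" "\<forall>M\<in>$S. vset ($M \<inter> $(H l')) : $S'"
    using a unfolding 1 pair_le(1) by blast+
  have b': "pair l'' S'' : $P" "$l'' <= $l'" "\<forall>M\<in>$S'. vset ($M \<inter> $(H l'')) : $S''"
    using b unfolding 1 2 pair_le(1) by blast+
  have U: "l'' : $U" "l' : $U" using a'(2) b'(1) elts_P(1) by blast+
  have "vset ($M \<inter> $(H l'')) : $S''" if "M : $S" for M
    using b'(3) a'(4) that Int_Int_H[OF b'(2) U, of M] by metis
  then show "pair p r : $le" unfolding 1 2 pair_le(1) using a'(1,3) b'(1,2) by blast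
qed

text \<open>\<open>H l\<close> contains all subsets of \<open>omega1\<close> and all ordinals below
  \<open>l\<close>, so intersecting \<open>M\<close> with it changes neither \<open>reals M\<close>
  nor the collapse of \<open>a\<close>.\<close>

lemma code_trace:
  assumes l: "l : $U" and a: "a : $l" shows "code (vset ($M \<inter> $(H l))) a = code M a"
proof -
  have e: "$(vset ($M \<inter> $(H l))) = $M \<inter> $(H l)" by (rule elts_Int)
  have w: "omega1 : $(H l)" by (rule Ord_in_H[OF U_Ord[OF l] omega1_U[OF l]])
  have "$(reals (vset ($M \<inter> $(H l)))) = $(reals M)"
    unfolding elts_reals e using H_subset'[OF U_Ord[OF l] w] by blast
  then have "reals (vset ($M \<inter> $(H l))) = reals M" by (rule vsetI)
  moreover have "col (vset ($M \<inter> $(H l))) a = col M a"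
  proof (rule col_cong[where t = l])
    show "transitive l" using U_Ord[OF l] unfolding Ord_def by blast
    show "$l \<inter> $(vset ($M \<inter> $(H l))) = $l \<inter> $M" unfolding e using Ord_in_H[OF U_Ord[OF l]] by blast
  qed (use a in blast)
  ultimately show ?thesis unfolding code_def by simp
qed

text \<open>The condition makes the generic partial function take the value \<open>l\<close> at the
  countable ordinal \<open>i\<close>. Requiring \<open>l\<close> to be below the height
  \<open>l'\<close> makes the decision visible in traces, so extensions inherit it.\<close>

definition decides :: "'v \<Rightarrow> 'v \<Rightarrow> 'v \<Rightarrow> bool" where
  "decides i l q \<longleftrightarrow> (\<exists>l' S. q = pair l' S & l : $l' & (\<forall>M\<in>$S. l : $M & code M l = i))"

lemma decides_down: assumes "decides i l q" "pair r q : $le" shows "decides i l r"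
proof -
  obtain l2 S2 l1 S1 where e: "r = pair l2 S2" "q = pair l1 S1" using pair_le(2)[OF assms(2)] pair_inject by metis
  have d: "l : $l1" "!!M. M : $S1 ==> l : $M & code M l = i" using assms(1) unfolding decides_def e pair_inject by blast+
  have u: "pair l1 S1 : $P" "$l1 <= $l2" "!!M. M : $S2 ==> vset ($M \<inter> $(H l1)) : $S1"
    using assms(2) unfolding e pair_le(1) by blast+
  have l1: "l1 : $U" using u(1) elts_P(1) by blast
  have "l : $M & code M l = i" if M: "M : $S2" for M
    using d(2)[OF u(3)[OF M]] code_trace[OF l1 d(1), of M] by simp
  then show ?thesis unfolding decides_def e using d(1) u(2) by blast
qed

text \<open>A positive set has a typical member \<open>M\<close>. For it both \<open>J\<close> at
  the bound and the collapse on the ordinals of \<open>M\<close> are injective, so equal codes come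
  from equal ordinals.\<close>

lemma decides_unique: assumes "decides i l q" "decides i l' q" and q: "q : $P" shows "l = l'"
proof -
  obtain l1 S where e: "q = pair l1 S" using elts_P(2)[OF q] by blast
  have d: "l : $l1" "l' : $l1" "!!M. M : $S ==> l : $M & l' : $M & code M l = i & code M l' = i"
    using assms(1,2) unfolding decides_def e pair_inject by blast+
  have l1: "l1 : $U" and S: "$S <= $(Z l1)" "S \<notin> $(ap I l1)" using q unfolding e elts_P(1) by blast+
  have dt: "defb (%e. typical (e 0))" by (intro dfb)
  have "vset {M \<in> $S. typical M} \<notin> $(ap I l1)" by (rule ae_positive[OF U_ideal[OF l1] dt ae_typical[OF l1] S])
  from positive_nonempty[OF U_ideal[OF l1] this] obtain M where M: "M : $S" "typical M" unfolding elts_sep[OF dt] by blast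
  have O: "Ord l" "Ord l'" using d(1,2) Ord_mem[OF U_Ord[OF l1]] by blast+
  have c: "col M l : $(gbound (reals M))" "col M l' : $(gbound (reals M))" "gbound (reals M) : $omega2"
    using M(2) d(3)[OF M(1)] O unfolding typical_def by blast+
  have "J (gbound (reals M)) (col M l) = J (gbound (reals M)) (col M l')" using d(3)[OF M(1)] unfolding code_def by simp
  from inj_onD[OF J(2)[OF c(3)] this c(1,2)] have "col M l = col M l'" .
  then show ?thesis using col_inj[OF O] d(3)[OF M(1)] by blast
qed

text \<open>After lifting the condition to a height above \<open>m\<close>, the code of
  \<open>m\<close> is a countable ordinal and hence an element of typical \<open>M\<close>;
  normality makes it constant on a positive set.\<close>

lemma decides_dense: assumes m: "m : $\<delta>" and q: "q : $P" shows "\<exists>r i. pair r q : $le & i : $omega1 & decides i m r"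
proof -
  obtain l1 S1 where e: "q = pair l1 S1" using elts_P(2)[OF q] by blast
  have l1: "l1 : $U" and S1: "$S1 <= $(Z l1)" "S1 \<notin> $(ap I l1)" using q unfolding e elts_P(1) by blast+
  have L: "Limit \<delta>" using reg unfolding regular_def by blast
  have O: "Ord (succ m)" "Ord l1" using Ord_succ[OF Ord_mem[OF tower_props(1) m]] U_Ord[OF l1] by auto
  \<comment> \<open>The maximum of \<open>succ m\<close> and \<open>l1\<close>, so that an index
    beyond it lies strictly above \<open>m\<close> and not below the height of
    \<open>q\<close>.\<close>
  define d where "d = vset ($(succ m) \<union> $l1)"
  have ed: "$d = $(succ m) \<union> $l1" unfolding d_def by (rule elts_Un)
  have "d = succ m \<or> d = l1" using Un_Ord[OF O] unfolding d_def .
  then have "d : $\<delta>" using Limit_succ[OF L m] l1 tower_props(2) by blast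
  then obtain l2 where l2: "l2 : $U" "$d <= $l2" using tower_props(3) by blast
  have m2: "m : $l2" "$l1 <= $l2" using l2(2) ed by auto
  note id = U_ideal[OF l2(1)]
  let ?S2 = "vset {M \<in> $(Z l2). vset ($M \<inter> $(H l1)) : $S1}"
  have S2: "$?S2 = {M \<in> $(Z l2). vset ($M \<inter> $(H l1)) : $S1}" by (rule elts_sep) (intro dfb)
  \<comment> \<open>Positivity of the lifted set is the projection property of the tower.\<close>
  have p2: "?S2 \<notin> $(ap I l2)"
    using tower_props(9)[OF l1 l2(1) m2(2)] S1 unfolding projection_def union_Z[OF l1] by blast
  let ?T = "%M. m : $M & typical M"
  have dt: "defb (%e. m : $(e 0))" "defb (%e. typical (e 0))" "defb (%e. ?T (e 0))" by (intro dfb)+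
  have "m : $(union (Z l2))" unfolding union_Z[OF l2(1)] by (rule Ord_in_H[OF U_Ord[OF l2(1)] m2(1)])
  note a = ae_conj[OF id dt(1,2) ae_fine[OF id this] ae_typical[OF l2(1)]]
  let ?S3 = "vset {M \<in> $?S2. ?T M}"
  have S3: "$?S3 = {M \<in> $?S2. ?T M}" by (rule elts_sep[OF dt(3)])
  have p3: "?S3 \<notin> $(ap I l2)" by (rule ae_positive[OF id dt(3) a _ p2]) (use S2 in blast)
  have dc: "deft (%e. code (e 0) m)" by (intro dfb)
  have c1: "code M m : $omega1" "code M m : $M" if M: "M : $?S3" for M
  proof -
    have t: "typical M" "m : $M" using M S3 by auto
    have "gbound (reals M) : $omega2" "col M m : $(gbound (reals M))"
      using t Ord_mem[OF tower_props(1) m] unfolding typical_def by blast+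
    then show "code M m : $omega1" unfolding code_def by (rule J(1))
    then show "code M m : $M" using t(1) unfolding typical_def by blast
  qed
  define g where "g = lam ?S3 (%M. code M m)"
  have g: "ap g M = code M m" if "M : $?S3" for M unfolding g_def by (rule ap_lam[OF dc that])
  have "func g ?S3 omega1" unfolding g_def by (rule func_lam[OF dc c1(1)])
  moreover have "$?S3 <= $(Z l2)" using S3 S2 by blast
  ultimately have "\<exists>S' c. $S' <= $?S3 & S' \<notin> $(ap I l2) & (\<forall>M\<in>$S'. ap g M = c)"
    by (intro press[OF id _ p3]) (use g c1 in auto)
  then obtain S' c where S': "$S' <= $?S3" "S' \<notin> $(ap I l2)" "\<forall>M\<in>$S'. ap g M = c" by blast
  have c: "code M m = c" if "M : $S'" for M using g[OF subsetD[OF S'(1) that]] bspec[OF S'(3) that] by simp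
  obtain M where M: "M : $S'" using positive_nonempty[OF id S'(2)] by blast
  have cw: "c : $omega1" using c1(1)[OF subsetD[OF S'(1) M]] c[OF M] by simp
  have "pair l2 S' : $P" unfolding elts_P(1) using l2(1) S'(2) subset_trans[OF S'(1) \<open>$?S3 <= $(Z l2)\<close>] by blast
  moreover have "vset ($M \<inter> $(H l1)) : $S1" if M: "M : $S'" for M
  proof -
    have "M : $?S3" using S'(1) M by blast
    then have "M : $?S2" unfolding S3 by blast
    then show ?thesis unfolding S2 by blast
  qed
  ultimately have "pair (pair l2 S') q : $le" unfolding e pair_le(1) using q m2(2) e by blast
  moreover have "m : $M" if "M : $S'" for M using subsetD[OF S'(1) that] unfolding S3 by blast
  then have "decides c m (pair l2 S')" unfolding decides_def using c m2(1) by blast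
  ultimately show ?thesis using cw by blast
qed

theorem tower_not_presaturated: "\<not> presaturated \<delta> \<kappa> U I"
proof
  assume ps: "presaturated \<delta> \<kappa> U I"
  interpret F: forcing mem P le by (rule tower_forcing)
  have L: "Limit \<delta>" using reg unfolding regular_def by blast
  then obtain l where l: "l : $U" using tower_props(3) unfolding Limit_def by blast
  have l\<delta>: "l : $\<delta>" using l tower_props(2) by blast
  have w\<delta>: "omega1 : $\<delta>" by (rule Ord_trans[OF tower_props(1) omega1_U[OF l] l\<delta>])
  have z\<delta>: "zero : $\<delta>" using Ord_trans[OF tower_props(1) _ w\<delta>] bnd_zero[OF bnd_omega1] by blast
  have "Z l \<notin> $(ap I l)" using U_ideal[OF l] unfolding ideal_def by blast
  then have p: "pair l (Z l) : $P" unfolding elts_P(1) using l by blast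
  \<comment> \<open>Countable ordinals that name nothing in any extension of \<open>q\<close>
    receive the default value \<open>zero\<close>. This makes the named function total on
    \<open>omega1\<close>, while the actual decisions make it cofinal in
    \<open>\<delta>\<close>.\<close>
  let ?def = "%i q. \<forall>r. pair r q : $le --> (\<forall>l\<in>$\<delta>. \<not> decides i l r)"
  define D where "D = vset {z \<in> $(prod (prod omega1 \<delta>) P). \<exists>i l q. z = pair (pair i l) q & (decides i l q \<or> l = zero & ?def i q)}"
  have eD: "$D = {z \<in> $(prod (prod omega1 \<delta>) P). \<exists>i l q. z = pair (pair i l) q & (decides i l q \<or> l = zero & ?def i q)}"
    unfolding D_def by (rule elts_sep) (unfold decides_def, intro dfb)
  have D: "pair (pair i l) q : $D \<longleftrightarrow> i : $omega1 & l : $\<delta> & q : $P & (decides i l q \<or> l = zero & ?def i q)" for i l q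
    unfolding eD by (auto simp: pair_inject)
  have "\<not> forces P le (pair l (Z l)) regular_fm (%_. F.ck \<delta>)"
  proof (rule F.not_forced_regular[OF p w\<delta>, of D])
    show "pair (pair i l) q : $D ==> i : $omega1 & l : $\<delta> & q : $P" for i l q unfolding D by blast
    show "z : $D ==> \<exists>i l q. z = pair (pair i l) q" for z unfolding eD by blast
    show "pair (pair i l) r : $D" if h: "pair (pair i l) q : $D" "pair r q : $le" for i l q r
      using h(1) F.le_P[OF h(2)] decides_down[OF _ h(2)] F.le_trans[OF _ h(2)] unfolding D by blast
    show "l = l'" if h: "pair (pair i l) q : $D" "pair (pair i l') q : $D" for i l l' q
      using h decides_unique F.le_refl unfolding D by blast
    show "\<exists>r l. pair r q : $le & pair (pair i l) r : $D" if h: "i : $omega1" "q : $P" for i q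
    proof (cases "?def i q")
      case True then show ?thesis using h z\<delta> F.le_refl unfolding D by blast
    next
      case False then show ?thesis using h F.le_P unfolding D by blast
    qed
    show "\<exists>r i l. pair r q : $le & $m <= $l & pair (pair i l) r : $D" if h: "m : $\<delta>" "q : $P" for m q
    proof -
      obtain r i where r: "pair r q : $le" "i : $omega1" "decides i m r" using decides_dense[OF h] by blast
      have "pair (pair i m) r : $D" unfolding D using r h(1) F.le_P[OF r(1)] by blast
      then show ?thesis using r(1) by blast
    qed
  qed
  then show False using ps p unfolding presaturated_def F.check_name by blast
qed

end
end

theorem theorem3:
  fixes mem :: "'v \<Rightarrow> 'v \<Rightarrow> bool"
    and \<delta> \<kappa> U I :: 'v
  assumes "zfc mem"
    and "membership.SRP_omega2 mem"
    and "membership.tree_property mem (membership.omega2 mem)"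
    and "membership.tower mem \<delta> \<kappa> U I"
    and "membership.tower_concentrates mem \<kappa> U I (membership.GIS_omega1 mem)"
  shows "\<not> membership.presaturated mem \<delta> \<kappa> U I"
proof
  interpret zfc mem by fact
  assume ps: "membership.presaturated mem \<delta> \<kappa> U I"
  then have "regular \<delta>" unfolding presaturated_def by blast
  from tower_not_presaturated[OF assms(2-5) this] ps show False by blast
qed

end
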